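(* Let $\rho\in\,]0,\rho_0]$ be fixed. There exists $h_0>0$ such that for any $h\in\,]0,h_0]$ one has $$\sup_{x\in M}\|s^k_{h,\rho}(x,dy)-\mu\|_{TV}\le Ce^{-kg_{h,\rho}}$$ for any $k\in\mathbb{N}$, where $C>0$ is a universal constant (independent of $h$ and $k$).
   Context: Setting. $(M,g)$ is a connected closed smooth Riemannian manifold of dimension $n$, with Riemannian distance $d_g$, given with an atlas $\{(U_\alpha,\varphi_\alpha)\}_\alpha$. $A:C^\infty(M)\to C^\infty(M)$ is a second-order differential operator whose local expressions $A_\alpha f=A(f\circ\varphi_\alpha)\circ\varphi_\alpha^{-1}$ have the form $A_\alpha=-\sum_{i,j}a^{(\alpha)}_{ij}\partial_i\partial_j+\sum_kb^{(\alpha)}_k\partial_k+d^{(\alpha)}$ with smooth coefficients. Standing assumptions: $A$ is subelliptic of order $\varepsilon\in(0,1)$, i.e. for some $c,C>0$, $\|Au\|_0+C\|u\|_0\ge c\|u\|_{2\varepsilon}$ for all $u\in C^\infty(M)$ ($\|\cdot\|_s$ the Sobolev norm of order $s$ on $M$); the coefficients are real and $(a^{(\alpha)}_{ij})_{i,j}$ is symmetric positive semidefinite at each point; $A$ is formally self-adjoint; no $a^{(\alpha)}_{ij}$ vanishes identically on a nonempty open set. A Lipschitz curve $\gamma:[0,1]\to M$ is subunit for $\sigma^2A$ if for a.e. $t$, $|\xi(\dot\gamma(t))|^2\le\sigma^2a_2(\gamma(t),\xi)$ for all $\xi\in T^*_{\gamma(t)}M$, where $a_2$ is the principal symbol, locally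 $\sum a_{ij}\xi_i\xi_j$; $B_A(x,s)$ is the set of $x'$ with $d_A(x,x')<s$, where $d_A(x,x')$ is the infimum of $\sigma>0$ such that a subunit curve for $\sigma^2A$ joins $x$ to $x'$. The same definitions apply to local expressions on open subsets of $\mathbb{R}^n$. Subunit cubes. $M$ is covered by finitely many geodesic balls $V_\ell$, with normal-coordinate charts $\varphi_\ell$ defined near $\overline{V_\ell}$; $A_\ell$ is the local expression of $A$ in $\varphi_\ell$. The number $\rho_0>0$ is fixed so small that for all $\rho\in\,]0,\rho_0]$ and $x\in M$ the following data exist (and are fixed): an index $\ell$ with $x\in V_\ell$; a block $Q_\rho=\prod_{j=1}^n]-c_j\rho^{\kappa_j},c_j\rho^{\kappa_j}[$ with constants $c_1=1$, $c_j>0$, $1=\kappa_1\le\dots\le\kappa_n=1/\varepsilon$; its dilation $Q_\rho^\ast=Q_{c^\ast\rho}$, $c^\ast>1$ fixed; and a diffeomorphism $\Phi_x$ of $Q^\ast_\rho$ onto an open subset of $\varphi_\ell(V_\ell)$, with derivatives bounded uniformly in $x$, $\Phi_x(0)=\varphi_\ell(x)$ and $\Phi_x(Q^\ast_\rho)\subseteq B_{A_\ell}(\varphi_\ell(x),C\rho)$, $C>0$ universal. Put $\Psi_x=\Phi_x^{-1}\circ\varphi_\ell$, $Q_A(x,\rho)=\Psi_x^{-1}(Q_\rho)$, $Q_A^\ast(x,\rho)=\Psi_x^{-1}(Q_\rho^\ast)$. By compactness fix $x_1,\dots,x_N\in M$, $N=N(\rho)$, such that the sets $Q_i:=Q_A(x_i,\rho)$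 cover $M$; write $Q_i^\ast:=Q^\ast_A(x_i,\rho)$, $\Psi_i:=\Psi_{x_i}$, with coordinates $w^{(i)}$ on $Q_\rho^\ast=\Psi_i(Q_i^\ast)$ and block constants $c^{(i)}_j,\kappa^{(i)}_j$. Measure and vector fields. Let $\{\psi_k\}_{k=1}^N$ be a smooth partition of unity subordinate to $\{Q_k^\ast\}$ and $d\mu=\sum_{k=1}^N\psi_k\,\Psi_k^*|dw^{(k)}|$, multiplied by a constant so that $\mu(M)=1$. On $Q_\rho^\ast=\Psi_i(Q_i^\ast)$, $d\mu$ reads $\tilde\gamma_i|dw^{(i)}|$ with $\tilde\gamma_i>0$ smooth. Set $\tilde X_{i,j}=\frac{c^{(i)}_j\rho^{\kappa^{(i)}_j}}{\tilde\gamma_i}\frac{\partial}{\partial w^{(i)}_j}$ (up to a fixed positive rescaling of the $c_j^{(i)}$) and $X_{i,j}=(\Psi_i^{-1})_*\tilde X_{i,j}$, a vector field on $Q_i^\ast$; $e^{tX_{i,j}}$ is its flow. $(\cdot,\cdot)_0$ and $\|\cdot\|_0$ are the inner product and norm of $L^2(M,d\mu)$. Markov operator. $h_0$ is always small enough that $e^{tX_{i,j}}x\in Q_i^\ast$ is defined for $x\in Q_i$, $|t|<h_0$. For $h\in\,]0,h_0]$ let $\chi_{i,j,h,\rho}(t,x)=1$ if $|t|<h$, $x\in Q_i$ and $e^{tX_{i,j}}x\in Q_i$, and $=0$ otherwise. Define $$S_{i,j,h,\rho}f(x)=\Bigl(1-\frac1{2h}\int_{-h}^h\chi_{i,j,h,\rho}(t,x)dt\Bigr)f(x)+\frac1{2h}\int_{-h}^h\chi_{i,j,h,\rho}(t,x)f(e^{tX_{i,j}}x)dt,$$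 (the second integrand being $0$ where $\chi_{i,j,h,\rho}=0$) and $S_{h,\rho}=\frac1{nN}\sum_{i=1}^N\sum_{j=1}^nS_{i,j,h,\rho}$ on bounded measurable functions and on $L^2(M,d\mu)$. $s^k_{h,\rho}(x,dy)$ is the Markov kernel of the $k$-th iterate: $S^k_{h,\rho}f(x)=\int_Mf(y)s^k_{h,\rho}(x,dy)$. The spectral gap $g_{h,\rho}$ of $I-S_{h,\rho}$ is the best (largest) constant $g$ such that $\|u\|_0^2-|(u,1)_0|^2\le\frac1g((I-S_{h,\rho})u,u)_0$ for all $u\in L^2(M,d\mu)$. The total variation distance of two measures $\mu_1,\mu_2$ on a measurable space $(X,\mathscr F)$ is $\|\mu_1-\mu_2\|_{TV}=\sup_{B\in\mathscr F}|\mu_1(B)-\mu_2(B)|$. *)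

theory Defs
  imports "HOL-Analysis.Analysis"
begin

section \<open>Smooth functions on open subsets of Euclidean space\<close>

primrec Ck_on :: "nat \<Rightarrow> 'a::real_normed_vector set \<Rightarrow> ('a \<Rightarrow> 'b::real_normed_vector) \<Rightarrow> bool" where
  "Ck_on 0 S f \<longleftrightarrow> continuous_on S f"
| "Ck_on (Suc k) S f \<longleftrightarrow>
     (\<forall>x\<in>S. f differentiable (at x)) \<and> (\<forall>v. Ck_on k S (\<lambda>x. frechet_derivative f (at x) v))"

text \<open>Only used for open \<open>S\<close>.\<close>
definition smooth_on :: "'a::real_normed_vector set \<Rightarrow> ('a \<Rightarrow> 'b::real_normed_vector) \<Rightarrow> bool" where
  "smooth_on S f \<longleftrightarrow> (\<forall>k. Ck_on k S f)"

definition pd :: "'n \<Rightarrow> (real^'n::finite \<Rightarrow> 'b::real_normed_vector) \<Rightarrow> real^'n \<Rightarrow> 'b" where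
  "pd j f x = frechet_derivative f (at x) (axis j 1)"


section \<open>Smooth manifolds\<close>

text \<open>The manifold is the whole type \<open>'m\<close> and its dimension is \<open>CARD('n)\<close>. A chart is a pair of its
  domain and a total function whose values outside of the domain are irrelevant.\<close>

type_synonym ('m, 'n) chart = "'m set \<times> ('m \<Rightarrow> real^'n)"

definition chart_inv :: "('m, 'n::finite) chart \<Rightarrow> real^'n \<Rightarrow> 'm" where
  "chart_inv c = inv_into (fst c) (snd c)"

definition chart_img :: "('m, 'n::finite) chart \<Rightarrow> (real^'n) set" where
  "chart_img c = snd c ` fst c"

definition is_chart :: "('m::topological_space, 'n::finite) chart \<Rightarrow> bool" where
  "is_chart c \<longleftrightarrow> open (fst c) \<and> open (chart_img c) \<and>
     homeomorphism (fst c) (chart_img c) (snd c) (chart_inv c)"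

definition compatible :: "('m, 'n::finite) chart \<Rightarrow> ('m, 'n) chart \<Rightarrow> bool" where
  "compatible c c' \<longleftrightarrow>
     smooth_on (snd c ` (fst c \<inter> fst c')) (snd c' \<circ> chart_inv c) \<and>
     smooth_on (snd c' ` (fst c \<inter> fst c')) (snd c \<circ> chart_inv c')"

definition smooth_atlas :: "('m::topological_space, 'n::finite) chart set \<Rightarrow> bool" where
  "smooth_atlas atl \<longleftrightarrow> (\<forall>c\<in>atl. is_chart c) \<and> (\<forall>c\<in>atl. \<forall>c'\<in>atl. compatible c c') \<and>
     (\<Union>c\<in>atl. fst c) = UNIV"

definition max_atlas :: "('m::topological_space, 'n::finite) chart set \<Rightarrow> ('m, 'n) chart set" where
  "max_atlas atl = {c. is_chart c \<and> (\<forall>c'\<in>atl. compatible c c')}"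

definition smooth_fun ::
    "('m::topological_space, 'n::finite) chart set \<Rightarrow> ('m \<Rightarrow> 'b::real_normed_vector) \<Rightarrow> bool" where
  "smooth_fun atl u \<longleftrightarrow> (\<forall>c\<in>atl. smooth_on (chart_img c) (u \<circ> chart_inv c))"

definition partition_of_unity :: "('m::topological_space, 'n::finite) chart set \<Rightarrow> nat \<Rightarrow>
    (nat \<Rightarrow> 'm set) \<Rightarrow> (nat \<Rightarrow> 'm \<Rightarrow> real) \<Rightarrow> bool" where
  "partition_of_unity atl N W \<theta> \<longleftrightarrow>
     (\<forall>k<N. smooth_fun atl (\<theta> k) \<and> (\<forall>x. 0 \<le> \<theta> k x) \<and> closure {x. \<theta> k x \<noteq> 0} \<subseteq> W k) \<and>
     (\<forall>x. (\<Sum>k<N. \<theta> k x) = 1)"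


section \<open>Riemannian metrics\<close>

text \<open>A metric is given by its coefficient matrix in every chart \<open>c\<close> of the smooth structure, as a
  function on the image of \<open>c\<close>.\<close>

type_synonym 'n matrix_field = "real^'n \<Rightarrow> real^'n^'n"

type_synonym ('m, 'n) metric_tensor = "('m, 'n) chart \<Rightarrow> 'n matrix_field"

definition riemannian_metric ::
    "('m::topological_space, 'n::finite) chart set \<Rightarrow> ('m, 'n) metric_tensor \<Rightarrow> bool" where
  "riemannian_metric atl g \<longleftrightarrow>
     (\<forall>c\<in>max_atlas atl. smooth_on (chart_img c) (g c) \<and>
        (\<forall>x\<in>chart_img c. transpose (g c x) = g c x \<and> (\<forall>v. v \<noteq> 0 \<longrightarrow> 0 < v \<bullet> (g c x *v v)))) \<and>
     (\<forall>c\<in>max_atlas atl. \<forall>c'\<in>max_atlas atl. \<forall>p\<in>fst c \<inter> fst c'.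
        let J = matrix (frechet_derivative (snd c' \<circ> chart_inv c) (at (snd c p)))
        in g c (snd c p) = transpose J ** g c' (snd c' p) ** J)"

definition closed_connected_riemannian_manifold ::
    "('m::{t2_space, second_countable_topology}, 'n::finite) chart set \<Rightarrow> ('m, 'n) metric_tensor \<Rightarrow> bool" where
  "closed_connected_riemannian_manifold atl g \<longleftrightarrow>
     compact (UNIV :: 'm set) \<and> connected (UNIV :: 'm set) \<and> smooth_atlas atl \<and> riemannian_metric atl g"

text \<open>The Riemannian volume: in local coordinates it is \<open>sqrt (det g) dx\<close>.\<close>
definition riem_volume ::
    "('m::topological_space, 'n::finite) chart set \<Rightarrow> ('m, 'n) metric_tensor \<Rightarrow> 'm measure" where
  "riem_volume atl g = (THE \<nu>. sets \<nu> = sets borel \<and>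
     (\<forall>c\<in>max_atlas atl. \<forall>B\<in>sets borel. B \<subseteq> fst c \<longrightarrow>
        emeasure \<nu> B = (\<integral>\<^sup>+ x \<in> snd c ` B. ennreal (sqrt (det (g c x))) \<partial>lborel)))"

definition pw_C1_curve :: "('m::topological_space, 'n::finite) chart set \<Rightarrow> (real \<Rightarrow> 'm) \<Rightarrow> bool" where
  "pw_C1_curve atl \<gamma> \<longleftrightarrow> continuous_on {0..1} \<gamma> \<and>
     (\<exists>D. finite D \<and> {0, 1} \<subseteq> D \<and>
        (\<forall>c\<in>atl. (snd c \<circ> \<gamma>) C1_differentiable_on ({t\<in>{0..1}. \<gamma> t \<in> fst c} - D)))"

text \<open>The value does not depend on the chart selected.\<close>
definition riem_speed :: "('m::topological_space, 'n::finite) chart set \<Rightarrow> ('m, 'n) metric_tensor \<Rightarrow>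
    (real \<Rightarrow> 'm) \<Rightarrow> real \<Rightarrow> real" where
  "riem_speed atl g \<gamma> t =
     (let c = (SOME c. c \<in> atl \<and> \<gamma> t \<in> fst c); v = vector_derivative (snd c \<circ> \<gamma>) (at t)
      in sqrt (v \<bullet> (g c (snd c (\<gamma> t)) *v v)))"

definition riem_dist :: "('m::topological_space, 'n::finite) chart set \<Rightarrow> ('m, 'n) metric_tensor \<Rightarrow>
    'm \<Rightarrow> 'm \<Rightarrow> ennreal" where
  "riem_dist atl g p q = (INF \<gamma>\<in>{\<gamma>. pw_C1_curve atl \<gamma> \<and> \<gamma> 0 = p \<and> \<gamma> 1 = q}.
     \<integral>\<^sup>+ t \<in> {0..1}. ennreal (riem_speed atl g \<gamma> t) \<partial>lborel)"

definition riem_ball :: "('m::topological_space, 'n::finite) chart set \<Rightarrow> ('m, 'n) metric_tensor \<Rightarrow>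
    'm \<Rightarrow> real \<Rightarrow> 'm set" where
  "riem_ball atl g p r = {q. riem_dist atl g p q < ennreal r}"

definition christoffel :: "('m, 'n::finite) metric_tensor \<Rightarrow> ('m, 'n) chart \<Rightarrow> 'n \<Rightarrow> 'n \<Rightarrow> 'n \<Rightarrow> real^'n \<Rightarrow> real" where
  "christoffel g c k i j x = (1 / 2) * (\<Sum>l\<in>UNIV. matrix_inv (g c x) $ k $ l *
     (pd i (\<lambda>y. g c y $ j $ l) x + pd j (\<lambda>y. g c y $ i $ l) x - pd l (\<lambda>y. g c y $ i $ j) x))"

text \<open>\<open>x\<close> is the coordinate expression, in the chart \<open>c\<close>, of a geodesic defined on the interval \<open>I\<close>.\<close>
definition geodesic_in :: "('m, 'n::finite) metric_tensor \<Rightarrow> ('m, 'n) chart \<Rightarrow> (real \<Rightarrow> real^'n) \<Rightarrow> real set \<Rightarrow> bool" where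
  "geodesic_in g c x I \<longleftrightarrow> (\<exists>x' x''. \<forall>t\<in>I. x t \<in> chart_img c \<and>
     (x has_vector_derivative x' t) (at t within I) \<and>
     (x' has_vector_derivative x'' t) (at t within I) \<and>
     (\<forall>k. x'' t $ k + (\<Sum>i\<in>UNIV. \<Sum>j\<in>UNIV. christoffel g c k i j (x t) * x' t $ i * x' t $ j) = 0))"

text \<open>Normal coordinates at \<open>p\<close>: the coordinate frame at \<open>p\<close> is orthonormal and \<open>chart_inv c v\<close> is the
  endpoint of the geodesic issued from \<open>p\<close> with initial velocity \<open>v\<close>, i.e. \<open>chart_inv c\<close> is the
  exponential map on a star-shaped neighbourhood of \<open>0\<close>.\<close>
definition normal_chart :: "('m::topological_space, 'n::finite) chart set \<Rightarrow> ('m, 'n) metric_tensor \<Rightarrow>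
    'm \<Rightarrow> ('m, 'n) chart \<Rightarrow> bool" where
  "normal_chart atl g p c \<longleftrightarrow> c \<in> max_atlas atl \<and> p \<in> fst c \<and> snd c p = 0 \<and> g c 0 = mat 1 \<and>
     (\<forall>v\<in>chart_img c. geodesic_in g c (\<lambda>t. t *\<^sub>R v) {0..1})"

text \<open>The whole manifold is covered by the geodesic balls \<open>riem_ball atl g (p l) (r l)\<close>, \<open>l < L\<close>, and
  \<open>nc l\<close> is a normal chart centred at \<open>p l\<close> and defined near the closure of the \<open>l\<close>-th ball.\<close>
definition geodesic_ball_cover :: "('m::topological_space, 'n::finite) chart set \<Rightarrow> ('m, 'n) metric_tensor \<Rightarrow>
    nat \<Rightarrow> (nat \<Rightarrow> 'm) \<Rightarrow> (nat \<Rightarrow> real) \<Rightarrow> (nat \<Rightarrow> ('m, 'n) chart) \<Rightarrow> bool" where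
  "geodesic_ball_cover atl g L p r nc \<longleftrightarrow>
     (\<forall>l<L. 0 < r l \<and> normal_chart atl g (p l) (nc l) \<and> closure (riem_ball atl g (p l) (r l)) \<subseteq> fst (nc l)) \<and>
     (\<Union>l<L. riem_ball atl g (p l) (r l)) = UNIV"


section \<open>Sobolev norms\<close>

definition fourier :: "(real^'n::finite \<Rightarrow> complex) \<Rightarrow> real^'n \<Rightarrow> complex" where
  "fourier v \<xi> = (LINT x|lborel. exp (- (\<i> * complex_of_real (x \<bullet> \<xi>))) * v x)"

definition Hs_norm :: "real \<Rightarrow> (real^'n::finite \<Rightarrow> complex) \<Rightarrow> real" where
  "Hs_norm s v = sqrt ((1 / (2 * pi) ^ CARD('n)) *
     (LINT \<xi>|lborel. (1 + (norm \<xi>)\<^sup>2) powr s * (cmod (fourier v \<xi>))\<^sup>2))"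

text \<open>The Sobolev norm of order \<open>s\<close> on the manifold, relative to charts \<open>ch k\<close> and a partition of
  unity \<open>\<theta> k\<close>, \<open>k < K\<close>; another choice gives an equivalent norm.\<close>
definition sobolev_norm :: "nat \<Rightarrow> (nat \<Rightarrow> ('m, 'n::finite) chart) \<Rightarrow> (nat \<Rightarrow> 'm \<Rightarrow> real) \<Rightarrow>
    real \<Rightarrow> ('m \<Rightarrow> complex) \<Rightarrow> real" where
  "sobolev_norm K ch \<theta> s u = sqrt (\<Sum>k<K.
     (Hs_norm s (\<lambda>x. if x \<in> chart_img (ch k)
        then \<theta> k (chart_inv (ch k) x) *\<^sub>R u (chart_inv (ch k) x) else 0))\<^sup>2)"


section \<open>The operator\<close>

text \<open>\<open>C\<^sup>\<infinity>(M)\<close> consists of the smooth complex-valued functions.\<close>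

definition subelliptic :: "('m::topological_space, 'n::finite) chart set \<Rightarrow> (('m \<Rightarrow> complex) \<Rightarrow> ('m \<Rightarrow> complex)) \<Rightarrow>
    real \<Rightarrow> bool" where
  "subelliptic atl A \<epsilon> \<longleftrightarrow> (\<exists>K ch \<theta>.
     (\<forall>k<K. ch k \<in> atl) \<and> partition_of_unity atl K (\<lambda>k. fst (ch k)) \<theta> \<and>
     (\<exists>c>0. \<exists>C>0. \<forall>u. smooth_fun atl u \<longrightarrow>
        sobolev_norm K ch \<theta> 0 (A u) + C * sobolev_norm K ch \<theta> 0 u \<ge> c * sobolev_norm K ch \<theta> (2 * \<epsilon>) u))"

text \<open>\<open>A\<close> has in the chart \<open>c\<close> a local expression with the real smooth coefficients \<open>a\<close>, \<open>b\<close>, \<open>d\<close>, where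
  \<open>a\<close> is symmetric and positive semidefinite at each point.\<close>
definition local_expression :: "('m::topological_space, 'n::finite) chart set \<Rightarrow> (('m \<Rightarrow> complex) \<Rightarrow> ('m \<Rightarrow> complex)) \<Rightarrow>
    ('m, 'n) chart \<Rightarrow> 'n matrix_field \<Rightarrow> (real^'n \<Rightarrow> real^'n) \<Rightarrow> (real^'n \<Rightarrow> real) \<Rightarrow> bool" where
  "local_expression atl A c a b d \<longleftrightarrow>
     smooth_on (chart_img c) a \<and> smooth_on (chart_img c) b \<and> smooth_on (chart_img c) d \<and>
     (\<forall>x\<in>chart_img c. transpose (a x) = a x \<and> (\<forall>\<xi>. 0 \<le> \<xi> \<bullet> (a x *v \<xi>))) \<and>
     (\<forall>u. smooth_fun atl u \<longrightarrow> (\<forall>x\<in>chart_img c.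
        A u (chart_inv c x) =
          - (\<Sum>i\<in>UNIV. \<Sum>j\<in>UNIV. a x $ i $ j *\<^sub>R pd i (pd j (u \<circ> chart_inv c)) x)
          + (\<Sum>k\<in>UNIV. b x $ k *\<^sub>R pd k (u \<circ> chart_inv c) x)
          + d x *\<^sub>R u (chart_inv c x)))"

definition formally_self_adjoint :: "('m::topological_space, 'n::finite) chart set \<Rightarrow> ('m, 'n) metric_tensor \<Rightarrow>
    (('m \<Rightarrow> complex) \<Rightarrow> ('m \<Rightarrow> complex)) \<Rightarrow> bool" where
  "formally_self_adjoint atl g A \<longleftrightarrow> (\<forall>u v. smooth_fun atl u \<and> smooth_fun atl v \<longrightarrow>
     (LINT x|riem_volume atl g. A u x * cnj (v x)) = (LINT x|riem_volume atl g. u x * cnj (A v x)))"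

definition standing_assumptions :: "('m::topological_space, 'n::finite) chart set \<Rightarrow> ('m, 'n) metric_tensor \<Rightarrow>
    (('m \<Rightarrow> complex) \<Rightarrow> ('m \<Rightarrow> complex)) \<Rightarrow> real \<Rightarrow> bool" where
  "standing_assumptions atl g A \<epsilon> \<longleftrightarrow>
     0 < \<epsilon> \<and> \<epsilon> < 1 \<and>
     (\<forall>u. smooth_fun atl u \<longrightarrow> smooth_fun atl (A u)) \<and>
     (\<forall>c\<in>atl. \<exists>a b d. local_expression atl A c a b d \<and>
        (\<forall>i j W. open W \<and> W \<noteq> {} \<and> W \<subseteq> chart_img c \<longrightarrow> (\<exists>x\<in>W. a x $ i $ j \<noteq> 0))) \<and>
     subelliptic atl A \<epsilon> \<and> formally_self_adjoint atl g A"


section \<open>Subunit balls in open subsets of Euclidean space\<close>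

definition subunit_curve :: "(real^'n::finite) set \<Rightarrow> 'n matrix_field \<Rightarrow> real \<Rightarrow> (real \<Rightarrow> real^'n) \<Rightarrow> bool" where
  "subunit_curve \<Omega> a \<sigma> \<gamma> \<longleftrightarrow> \<gamma> ` {0..1} \<subseteq> \<Omega> \<and> (\<exists>K. K-lipschitz_on {0..1} \<gamma>) \<and>
     (AE t in lborel. t \<in> {0..1} \<longrightarrow> (\<exists>v. (\<gamma> has_vector_derivative v) (at t within {0..1}) \<and>
        (\<forall>\<xi>. \<bar>\<xi> \<bullet> v\<bar>\<^sup>2 \<le> \<sigma>\<^sup>2 * (\<Sum>i\<in>UNIV. \<Sum>j\<in>UNIV. a (\<gamma> t) $ i $ j * \<xi> $ i * \<xi> $ j))))"

text \<open>The distance is \<open>\<infinity>\<close> if there is no subunit curve at all.\<close>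
definition subunit_dist :: "(real^'n::finite) set \<Rightarrow> 'n matrix_field \<Rightarrow> real^'n \<Rightarrow> real^'n \<Rightarrow> ereal" where
  "subunit_dist \<Omega> a x x' =
     (INF \<sigma>\<in>{\<sigma>. 0 < \<sigma> \<and> (\<exists>\<gamma>. subunit_curve \<Omega> a \<sigma> \<gamma> \<and> \<gamma> 0 = x \<and> \<gamma> 1 = x')}. ereal \<sigma>)"

definition subunit_ball :: "(real^'n::finite) set \<Rightarrow> 'n matrix_field \<Rightarrow> real^'n \<Rightarrow> real \<Rightarrow> (real^'n) set" where
  "subunit_ball \<Omega> a x s = {x' \<in> \<Omega>. subunit_dist \<Omega> a x x' < ereal s}"


section \<open>Subunit cubes\<close>

text \<open>The data attached to a point \<open>x\<close> and a radius \<open>\<rho>\<close>: the index of a geodesic ball containing \<open>x\<close>,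
  the constants and exponents of the block, and the diffeomorphism \<open>\<Phi>\<^sub>x\<close>. The coordinates \<open>1, \<dots>, n\<close>
  are the elements of the linearly ordered finite type \<open>'n\<close>.\<close>

datatype ('n::finite) cube = Cube
  (cube_idx: nat)
  (cube_const: "'n \<Rightarrow> real")
  (cube_exp: "'n \<Rightarrow> real")
  (cube_map: "real^'n \<Rightarrow> real^'n")

definition block :: "'n::finite cube \<Rightarrow> real \<Rightarrow> (real^'n) set" where
  "block q \<rho> = {w. \<forall>j. - (cube_const q j * \<rho> powr cube_exp q j) < w $ j \<and>
                        w $ j < cube_const q j * \<rho> powr cube_exp q j}"

text \<open>\<open>\<Psi>\<^sub>x\<^sup>-\<^sup>1 = \<phi>\<^sub>l\<^sup>-\<^sup>1 \<circ> \<Phi>\<^sub>x\<close>, defined on the dilated block.\<close>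
definition cube_param :: "(nat \<Rightarrow> ('m, 'n::finite) chart) \<Rightarrow> 'n cube \<Rightarrow> real^'n \<Rightarrow> 'm" where
  "cube_param nc q = chart_inv (nc (cube_idx q)) \<circ> cube_map q"

text \<open>The cube is \<open>subunit_cube nc q \<rho>\<close>, its dilation is \<open>subunit_cube nc q (cs * \<rho>)\<close>.\<close>
definition subunit_cube :: "(nat \<Rightarrow> ('m, 'n::finite) chart) \<Rightarrow> 'n cube \<Rightarrow> real \<Rightarrow> 'm set" where
  "subunit_cube nc q \<rho> = cube_param nc q ` block q \<rho>"

text \<open>\<open>a l\<close> is the matrix of second-order coefficients in the normal chart \<open>nc l\<close>.\<close>
definition is_cube_at :: "('m::topological_space, 'n::{finite, linorder}) chart set \<Rightarrow> ('m, 'n) metric_tensor \<Rightarrow> real \<Rightarrow>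
    nat \<Rightarrow> (nat \<Rightarrow> 'm) \<Rightarrow> (nat \<Rightarrow> real) \<Rightarrow> (nat \<Rightarrow> ('m, 'n) chart) \<Rightarrow> (nat \<Rightarrow> 'n matrix_field) \<Rightarrow>
    real \<Rightarrow> real \<Rightarrow> real \<Rightarrow> 'm \<Rightarrow> 'n cube \<Rightarrow> bool" where
  "is_cube_at atl g \<epsilon> L p r nc a cs K \<rho> x q \<longleftrightarrow>
     (let l = cube_idx q; \<Phi> = cube_map q; Qs = block q (cs * \<rho>) in
       l < L \<and> x \<in> riem_ball atl g (p l) (r l) \<and>
       cube_const q (Min UNIV) = 1 \<and> (\<forall>j. 0 < cube_const q j) \<and>
       cube_exp q (Min UNIV) = 1 \<and> mono (cube_exp q) \<and> cube_exp q (Max UNIV) = 1 / \<epsilon> \<and>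
       smooth_on Qs \<Phi> \<and> inj_on \<Phi> Qs \<and> open (\<Phi> ` Qs) \<and> smooth_on (\<Phi> ` Qs) (inv_into Qs \<Phi>) \<and>
       \<Phi> ` Qs \<subseteq> snd (nc l) ` riem_ball atl g (p l) (r l) \<and>
       \<Phi> 0 = snd (nc l) x \<and>
       \<Phi> ` Qs \<subseteq> subunit_ball (chart_img (nc l)) (a l) (snd (nc l) x) (K * \<rho>))"

text \<open>The data fixed for all radii \<open>\<rho> \<le> \<rho>0\<close> and all points; the derivatives of the diffeomorphisms are
  bounded uniformly in the point.\<close>
definition cube_family :: "('m::topological_space, 'n::{finite, linorder}) chart set \<Rightarrow> ('m, 'n) metric_tensor \<Rightarrow> real \<Rightarrow>
    nat \<Rightarrow> (nat \<Rightarrow> 'm) \<Rightarrow> (nat \<Rightarrow> real) \<Rightarrow> (nat \<Rightarrow> ('m, 'n) chart) \<Rightarrow> (nat \<Rightarrow> 'n matrix_field) \<Rightarrow>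
    real \<Rightarrow> real \<Rightarrow> real \<Rightarrow> (real \<Rightarrow> 'm \<Rightarrow> 'n cube) \<Rightarrow> bool" where
  "cube_family atl g \<epsilon> L p r nc a cs K \<rho>0 cube \<longleftrightarrow>
     1 < cs \<and> 0 < K \<and> 0 < \<rho>0 \<and>
     (\<forall>\<rho>\<in>{0<..\<rho>0}.
        (\<forall>x. is_cube_at atl g \<epsilon> L p r nc a cs K \<rho> x (cube \<rho> x)) \<and>
        (\<forall>js. js \<noteq> [] \<longrightarrow> (\<exists>B. \<forall>x. \<forall>w\<in>block (cube \<rho> x) (cs * \<rho>).
           norm (foldr pd js (cube_map (cube \<rho> x)) w) \<le> B)))"


section \<open>The measure\<close>

text \<open>In the following sections \<open>q i\<close>, \<open>i < N\<close>, are the cube data of the chosen centres.\<close>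

text \<open>The sum of the densities \<open>\<psi>\<^sub>k \<Psi>\<^sub>k\<^sup>* |dw\<^sup>(\<^sup>k\<^sup>)|\<close>, each extended by zero.\<close>
definition unnormalized_mu :: "(nat \<Rightarrow> ('m::topological_space, 'n::finite) chart) \<Rightarrow> real \<Rightarrow> real \<Rightarrow> nat \<Rightarrow>
    (nat \<Rightarrow> 'n cube) \<Rightarrow> (nat \<Rightarrow> 'm \<Rightarrow> real) \<Rightarrow> 'm measure" where
  "unnormalized_mu nc cs \<rho> N q \<psi> = measure_of UNIV (sets borel) (\<lambda>B. \<Sum>k<N.
     \<integral>\<^sup>+ w \<in> block (q k) (cs * \<rho>).
       ennreal (\<psi> k (cube_param nc (q k) w)) * indicator B (cube_param nc (q k) w) \<partial>lborel)"

definition mu :: "(nat \<Rightarrow> ('m::topological_space, 'n::finite) chart) \<Rightarrow> real \<Rightarrow> real \<Rightarrow> nat \<Rightarrow>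
    (nat \<Rightarrow> 'n cube) \<Rightarrow> (nat \<Rightarrow> 'm \<Rightarrow> real) \<Rightarrow> 'm measure" where
  "mu nc cs \<rho> N q \<psi> = scale_measure (1 / emeasure (unnormalized_mu nc cs \<rho> N q \<psi>) UNIV)
     (unnormalized_mu nc cs \<rho> N q \<psi>)"

text \<open>\<open>\<nu>\<close> reads \<open>dens i |dw|\<close> in the coordinates of the \<open>i\<close>-th dilated cube, where \<open>dens i\<close> is smooth and
  positive (this determines \<open>dens i\<close> there).\<close>
definition cube_densities :: "(nat \<Rightarrow> ('m::topological_space, 'n::finite) chart) \<Rightarrow> real \<Rightarrow> real \<Rightarrow> nat \<Rightarrow>
    (nat \<Rightarrow> 'n cube) \<Rightarrow> 'm measure \<Rightarrow> (nat \<Rightarrow> real^'n \<Rightarrow> real) \<Rightarrow> bool" where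
  "cube_densities nc cs \<rho> N q \<nu> dens \<longleftrightarrow> (\<forall>i<N.
     smooth_on (block (q i) (cs * \<rho>)) (dens i) \<and> (\<forall>w\<in>block (q i) (cs * \<rho>). 0 < dens i w) \<and>
     (\<forall>B\<in>sets borel. B \<subseteq> block (q i) (cs * \<rho>) \<longrightarrow>
        emeasure \<nu> (cube_param nc (q i) ` B) = (\<integral>\<^sup>+ w \<in> B. ennreal (dens i w) \<partial>lborel)))"


section \<open>Vector fields and flows\<close>

text \<open>The vector field \<open>X\<^sub>i\<^sub>,\<^sub>j\<close> in the coordinates of the \<open>i\<close>-th dilated cube; \<open>\<tau> i j\<close> is the fixed positive
  rescaling of the constant \<open>c\<^sub>j\<close>.\<close>
definition X_coord :: "real \<Rightarrow> (nat \<Rightarrow> 'n::finite cube) \<Rightarrow> (nat \<Rightarrow> real^'n \<Rightarrow> real) \<Rightarrow> (nat \<Rightarrow> 'n \<Rightarrow> real) \<Rightarrow>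
    nat \<Rightarrow> 'n \<Rightarrow> real^'n \<Rightarrow> real^'n" where
  "X_coord \<rho> q dens \<tau> i j w =
     (\<tau> i j * cube_const (q i) j * \<rho> powr cube_exp (q i) j / dens i w) *\<^sub>R axis j 1"

text \<open>\<open>y = e\<^sup>t\<^sup>X x\<close>, where \<open>X\<close> is the push-forward under \<open>par\<close> of the vector field \<open>Y\<close> on the open set \<open>W\<close>.\<close>
definition flows_to :: "(real^'n::finite \<Rightarrow> 'm) \<Rightarrow> (real^'n) set \<Rightarrow> (real^'n \<Rightarrow> real^'n) \<Rightarrow> real \<Rightarrow> 'm \<Rightarrow> 'm \<Rightarrow> bool" where
  "flows_to par W Y t x y \<longleftrightarrow> (\<exists>w. par (w 0) = x \<and> par (w t) = y \<and>
     (\<forall>s\<in>closed_segment 0 t. w s \<in> W \<and>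
        (w has_vector_derivative Y (w s)) (at s within closed_segment 0 t)))"

definition flow_rel :: "(nat \<Rightarrow> ('m, 'n::finite) chart) \<Rightarrow> real \<Rightarrow> real \<Rightarrow> (nat \<Rightarrow> 'n cube) \<Rightarrow>
    (nat \<Rightarrow> real^'n \<Rightarrow> real) \<Rightarrow> (nat \<Rightarrow> 'n \<Rightarrow> real) \<Rightarrow> nat \<Rightarrow> 'n \<Rightarrow> real \<Rightarrow> 'm \<Rightarrow> 'm \<Rightarrow> bool" where
  "flow_rel nc cs \<rho> q dens \<tau> i j =
     flows_to (cube_param nc (q i)) (block (q i) (cs * \<rho>)) (X_coord \<rho> q dens \<tau> i j)"

definition flow :: "(nat \<Rightarrow> ('m, 'n::finite) chart) \<Rightarrow> real \<Rightarrow> real \<Rightarrow> (nat \<Rightarrow> 'n cube) \<Rightarrow>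
    (nat \<Rightarrow> real^'n \<Rightarrow> real) \<Rightarrow> (nat \<Rightarrow> 'n \<Rightarrow> real) \<Rightarrow> nat \<Rightarrow> 'n \<Rightarrow> real \<Rightarrow> 'm \<Rightarrow> 'm" where
  "flow nc cs \<rho> q dens \<tau> i j t x = (THE y. flow_rel nc cs \<rho> q dens \<tau> i j t x y)"

text \<open>For \<open>x\<close> in the \<open>i\<close>-th cube and \<open>\<bar>t\<bar> < h\<close> the point \<open>e\<^sup>t\<^sup>X x\<close> is defined.\<close>
definition flows_defined :: "(nat \<Rightarrow> ('m, 'n::finite) chart) \<Rightarrow> real \<Rightarrow> real \<Rightarrow> nat \<Rightarrow> (nat \<Rightarrow> 'n cube) \<Rightarrow>
    (nat \<Rightarrow> real^'n \<Rightarrow> real) \<Rightarrow> (nat \<Rightarrow> 'n \<Rightarrow> real) \<Rightarrow> real \<Rightarrow> bool" where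
  "flows_defined nc cs \<rho> N q dens \<tau> h \<longleftrightarrow> (\<forall>i<N. \<forall>j. \<forall>x\<in>subunit_cube nc (q i) \<rho>. \<forall>t. \<bar>t\<bar> < h \<longrightarrow>
     (\<exists>!y. flow_rel nc cs \<rho> q dens \<tau> i j t x y))"


section \<open>The Markov operator, its kernel and its spectral gap\<close>

text \<open>Here \<open>Q\<close> is a cube and \<open>F t x\<close> is the flow of one of the vector fields on it.\<close>

definition chi :: "'m set \<Rightarrow> (real \<Rightarrow> 'm \<Rightarrow> 'm) \<Rightarrow> real \<Rightarrow> real \<Rightarrow> 'm \<Rightarrow> real" where
  "chi Q F h t x = (if \<bar>t\<bar> < h \<and> x \<in> Q \<and> F t x \<in> Q then 1 else 0)"

definition S_field :: "'m set \<Rightarrow> (real \<Rightarrow> 'm \<Rightarrow> 'm) \<Rightarrow> real \<Rightarrow>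
    ('m \<Rightarrow> 'b::{banach, second_countable_topology}) \<Rightarrow> 'm \<Rightarrow> 'b" where
  "S_field Q F h f x =
     (1 - 1 / (2 * h) * (LINT t:{-h..h}|lborel. chi Q F h t x)) *\<^sub>R f x
     + (1 / (2 * h)) *\<^sub>R (LINT t:{-h..h}|lborel. chi Q F h t x *\<^sub>R f (F t x))"

definition S_op :: "(nat \<Rightarrow> ('m, 'n::finite) chart) \<Rightarrow> real \<Rightarrow> real \<Rightarrow> nat \<Rightarrow> (nat \<Rightarrow> 'n cube) \<Rightarrow>
    (nat \<Rightarrow> real^'n \<Rightarrow> real) \<Rightarrow> (nat \<Rightarrow> 'n \<Rightarrow> real) \<Rightarrow> real \<Rightarrow>
    ('m \<Rightarrow> 'b::{banach, second_countable_topology}) \<Rightarrow> 'm \<Rightarrow> 'b" where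
  "S_op nc cs \<rho> N q dens \<tau> h f x = (1 / (real CARD('n) * real N)) *\<^sub>R
     (\<Sum>i<N. \<Sum>j\<in>UNIV. S_field (subunit_cube nc (q i) \<rho>) (flow nc cs \<rho> q dens \<tau> i j) h f x)"

text \<open>The kernel \<open>s(x, dy)\<close> of a Markov operator \<open>T\<close>, i.e. \<open>T f x = \<integral> f(y) s(x, dy)\<close>, read off from
  indicator functions.\<close>
definition markov_kernel :: "(('m::topological_space \<Rightarrow> real) \<Rightarrow> 'm \<Rightarrow> real) \<Rightarrow> 'm \<Rightarrow> 'm measure" where
  "markov_kernel T x = measure_of UNIV (sets borel) (\<lambda>B. ennreal (T (indicat_real B) x))"

definition L2 :: "'m measure \<Rightarrow> ('m \<Rightarrow> complex) set" where
  "L2 M = {u. u \<in> borel_measurable M \<and> integrable M (\<lambda>x. (cmod (u x))\<^sup>2)}"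

definition L2_inner :: "'m measure \<Rightarrow> ('m \<Rightarrow> complex) \<Rightarrow> ('m \<Rightarrow> complex) \<Rightarrow> complex" where
  "L2_inner M u v = (LINT x|M. u x * cnj (v x))"

definition L2_norm :: "'m measure \<Rightarrow> ('m \<Rightarrow> complex) \<Rightarrow> real" where
  "L2_norm M u = sqrt (LINT x|M. (cmod (u x))\<^sup>2)"

text \<open>The spectral gap of \<open>I - T\<close>, for self-adjoint \<open>T\<close> (so that the inner product on the right is real).\<close>
definition spectral_gap :: "'m measure \<Rightarrow> (('m \<Rightarrow> complex) \<Rightarrow> ('m \<Rightarrow> complex)) \<Rightarrow> real" where
  "spectral_gap M T = Sup {g. 0 < g \<and> (\<forall>u\<in>L2 M.
     (L2_norm M u)\<^sup>2 - (cmod (L2_inner M u (\<lambda>_. 1)))\<^sup>2 \<le> 1 / g * Re (L2_inner M (\<lambda>x. u x - T u x) u))}"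

definition tv_dist :: "'a measure \<Rightarrow> 'a measure \<Rightarrow> real" where
  "tv_dist M1 M2 = (SUP B\<in>sets M1. \<bar>measure M1 B - measure M2 B\<bar>)"

end

theory Submission
  imports Defs "HOL-Probability.Probability"
begin

text \<open>In the coordinates of a cube, \<open>X\<^sub>i\<^sub>,\<^sub>j\<close> is a positive multiple of \<open>\<partial>\<^sub>j\<close> divided by the density of \<open>\<mu>\<close>, so its flow
  preserves \<open>\<mu>\<close>, \<open>S\<close> is reversible, and the form \<open>((I - S) u, u)\<close> is comparable to the mean of
  \<open>\<bar>u(w + s e\<^sub>j) - u(w)\<bar>\<^sup>2\<close> over \<open>\<bar>s\<bar> \<lesssim> h\<close>, over all cubes and all \<open>j\<close>. At a fixed \<open>\<rho>\<close> the subelliptic geometry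
  therefore plays no further role. Four uniform facts follow for small \<open>h\<close>: the spectrum stays away
  from \<open>-1\<close>; a Nash inequality holds at all scales between \<open>h\<close> and \<open>1\<close>; one jump along each of the \<open>n\<close>
  axes shows that \<open>S\<^sup>n\<close> dominates an operator \<open>U\<close> of mass at least \<open>\<delta>\<close> whose kernel is bounded by \<open>C h\<^bsup>-2n\<^esup>\<close>; and
  the gap is at most \<open>C h\<^sup>2\<close>, as a Lipschitz test function shows. It is positive because \<open>M\<close> is connected.

  For \<open>k \<lesssim> h\<^bsup>-2\<^esup>\<close> the bound on the gap makes the claim trivial. For larger \<open>k\<close> the Nash inequality bounds the
  norm of \<open>S\<^sup>k\<close> from \<open>L\<^sup>1\<close> to \<open>L\<^sup>2\<close>, the gap gives the exponential decay in \<open>L\<^sup>2\<close>, and the splitting \<open>S\<^sup>n = U + V\<close> with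
  \<open>V 1 \<le> 1 - \<delta>\<close> turns \<open>L\<^sup>2\<close> bounds into uniform ones.\<close>

section \<open>Submarkov operators on bounded functions\<close>

text \<open>The obstacle is that no power of \<open>S\<close> need have a bounded kernel: atoms and
  pieces on coordinate lines may persist. The part \<open>V\<close> of the splitting is controlled
  in the sup norm only, by (1 - \<delta>)^L after L rounds; but L of order h^-2 makes this smaller
  than every power of h. Hence crude powers suffice, h^(-2n) instead of h^(-n) and y^(-n) instead of
  y^(-n/2), and all exponents stay natural numbers. The rate e^(-kg) survives because a block of m ~
  h^-2 steps changes it by a bounded factor only: m g \<le> G with G free of h, a second use of the
  upper bound for the gap. No spectral calculus enters: estimates of t^2 on the spectrum are
  replaced by form inequalities \<open>P\<^sup>2 \<le> c P\<close>, tested on bounded functions.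
  Functions are bounded at every point rather than almost everywhere, since total variation is
  estimated at every x and the kernel at x may charge \<mu>-null sets.\<close>

definition bm :: "'a measure \<Rightarrow> ('a \<Rightarrow> real) \<Rightarrow> bool" where
  "bm M f \<longleftrightarrow> f \<in> borel_measurable M \<and> (\<exists>B. \<forall>x. \<bar>f x\<bar> \<le> B)"

lemma bm_measurable[measurable_dest]: "bm M f \<Longrightarrow> f \<in> borel_measurable M"
  by (simp add: bm_def)

lemma bm_bound: "bm M f \<Longrightarrow> \<exists>B\<ge>0. \<forall>x. \<bar>f x\<bar> \<le> B"
  unfolding bm_def by (meson abs_ge_zero order_trans)

lemma bmI: "f \<in> borel_measurable M \<Longrightarrow> (\<And>x. \<bar>f x\<bar> \<le> B) \<Longrightarrow> bm M f"
  by (auto simp: bm_def)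

lemma bm_const[simp]: "bm M (\<lambda>_. c)"
  by (auto simp: bm_def)

lemma bm_add: assumes "bm M f" "bm M g" shows "bm M (\<lambda>x. f x + g x)"
proof -
  obtain B C where "\<forall>x. \<bar>f x\<bar> \<le> B" "\<forall>x. \<bar>g x\<bar> \<le> C" using assms by (auto simp: bm_def)
  then have "\<bar>f x + g x\<bar> \<le> B + C" for x by (simp add: abs_triangle_ineq[THEN order_trans] add_mono)
  then show ?thesis using assms by (intro bmI) auto
qed

lemma bm_mult: assumes "bm M f" "bm M g" shows "bm M (\<lambda>x. f x * g x)"
proof -
  obtain B C where B: "B \<ge> 0" "\<forall>x. \<bar>f x\<bar> \<le> B" "\<forall>x. \<bar>g x\<bar> \<le> C"
    using assms bm_bound by (metis bm_def)
  then have "\<bar>f x * g x\<bar> \<le> B * C" for x by (simp add: abs_mult mult_mono)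
  then show ?thesis using assms by (intro bmI) auto
qed

lemma bm_cmult: "bm M f \<Longrightarrow> bm M (\<lambda>x. c * f x)"
  by (rule bm_mult[OF bm_const])

lemma bm_minus: "bm M f \<Longrightarrow> bm M (\<lambda>x. - f x)"
  using bm_cmult[of M f "-1"] by simp

lemma bm_diff: assumes "bm M f" "bm M g" shows "bm M (\<lambda>x. f x - g x)"
  using bm_add[OF assms(1) bm_minus[OF assms(2)]] by simp

lemma bm_abs: "bm M f \<Longrightarrow> bm M (\<lambda>x. \<bar>f x\<bar>)"
  by (auto simp: bm_def)

lemma bm_power2: "bm M f \<Longrightarrow> bm M (\<lambda>x. (f x)\<^sup>2)"
  using bm_mult[of M f f] by (simp add: power2_eq_square)

lemma bm_indicator: "B \<in> sets M \<Longrightarrow> bm M (indicat_real B)"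
  by (intro bmI[where B=1]) (auto simp: indicator_def)

lemmas bm_intros = bm_const bm_add bm_mult bm_cmult bm_minus bm_diff bm_abs bm_power2

lemma bm_sum: assumes "\<And>i. i \<in> I \<Longrightarrow> bm M (f i)" shows "bm M (\<lambda>x. \<Sum>i\<in>I. f i x)"
  using assms
proof (induction I rule: infinite_finite_induct)
  case (insert i F)
  then have "bm M (\<lambda>x. f i x + (\<Sum>i\<in>F. f i x))" by (intro bm_add) simp_all
  then show ?case using insert by simp
qed auto

lemma (in finite_measure) integrable_bm: assumes "bm M f" shows "integrable M f"
proof -
  obtain B where "\<forall>x. \<bar>f x\<bar> \<le> B" using assms by (auto simp: bm_def)
  then show ?thesis using assms by (intro integrable_const_bound[where B=B]) auto
qed

context finite_measure
begin

lemma integral_bm_add: "bm M f \<Longrightarrow> bm M g \<Longrightarrow> (LINT x|M. f x + g x) = (LINT x|M. f x) + (LINT x|M. g x)"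
  by (intro Bochner_Integration.integral_add integrable_bm)

lemma integral_bm_diff: "bm M f \<Longrightarrow> bm M g \<Longrightarrow> (LINT x|M. f x - g x) = (LINT x|M. f x) - (LINT x|M. g x)"
  by (intro Bochner_Integration.integral_diff integrable_bm)

lemma integral_bm_cmult: "bm M f \<Longrightarrow> (LINT x|M. c * f x) = c * (LINT x|M. f x)" for c :: real
  by simp

lemmas integral_bm = integral_bm_add integral_bm_diff integral_bm_cmult

end


text \<open>Continuity along bounded pointwise convergent sequences replaces countable additivity of a kernel.\<close>

definition submarkov :: "'a measure \<Rightarrow> (('a \<Rightarrow> real) \<Rightarrow> 'a \<Rightarrow> real) \<Rightarrow> bool" where
  "submarkov M T \<longleftrightarrow>
     (\<forall>f. bm M f \<longrightarrow> bm M (T f)) \<and>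
     (\<forall>f g. bm M f \<longrightarrow> bm M g \<longrightarrow> T (\<lambda>x. f x + g x) = (\<lambda>x. T f x + T g x)) \<and>
     (\<forall>f c. bm M f \<longrightarrow> T (\<lambda>x. c * f x) = (\<lambda>x. c * T f x)) \<and>
     (\<forall>f. bm M f \<longrightarrow> (\<forall>x. 0 \<le> f x) \<longrightarrow> (\<forall>x. 0 \<le> T f x)) \<and>
     (\<forall>x. T (\<lambda>_. 1) x \<le> 1) \<and>
     (\<forall>F f B. (\<forall>k. bm M (F k)) \<longrightarrow> bm M f \<longrightarrow> (\<forall>k x. \<bar>F k x\<bar> \<le> B) \<longrightarrow>
        (\<forall>x. (\<lambda>k. F k x) \<longlonglongrightarrow> f x) \<longrightarrow> (\<forall>x. (\<lambda>k. T (F k) x) \<longlonglongrightarrow> T f x))"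

context
  fixes M :: "'a measure" and T :: "('a \<Rightarrow> real) \<Rightarrow> 'a \<Rightarrow> real"
  assumes T: "submarkov M T"
begin

lemma submarkov_bm: "bm M f \<Longrightarrow> bm M (T f)"
  using T[unfolded submarkov_def, THEN conjunct1] by simp

lemma submarkov_add: "bm M f \<Longrightarrow> bm M g \<Longrightarrow> T (\<lambda>x. f x + g x) = (\<lambda>x. T f x + T g x)"
  using T[unfolded submarkov_def, THEN conjunct2, THEN conjunct1] by simp

lemma submarkov_cmult: "bm M f \<Longrightarrow> T (\<lambda>x. c * f x) = (\<lambda>x. c * T f x)"
  using T[unfolded submarkov_def, THEN conjunct2, THEN conjunct2, THEN conjunct1] by simp

lemma submarkov_nonneg: "bm M f \<Longrightarrow> (\<And>x. 0 \<le> f x) \<Longrightarrow> 0 \<le> T f x"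
  using T[unfolded submarkov_def, THEN conjunct2, THEN conjunct2, THEN conjunct2, THEN conjunct1] by simp

lemma submarkov_one: "T (\<lambda>_. 1) x \<le> 1"
  using T[unfolded submarkov_def, THEN conjunct2, THEN conjunct2, THEN conjunct2, THEN conjunct2, THEN conjunct1] by simp

lemma submarkov_lim: "(\<And>k. bm M (F k)) \<Longrightarrow> bm M f \<Longrightarrow> (\<And>k x. \<bar>F k x\<bar> \<le> B) \<Longrightarrow>
    (\<And>x. (\<lambda>k. F k x) \<longlonglongrightarrow> f x) \<Longrightarrow> (\<lambda>k. T (F k) x) \<longlonglongrightarrow> T f x"
  using T[unfolded submarkov_def, THEN conjunct2, THEN conjunct2, THEN conjunct2, THEN conjunct2, THEN conjunct2] by (simp (no_asm_use)) metis

lemma submarkov_diff: assumes "bm M f" "bm M g" shows "T (\<lambda>x. f x - g x) = (\<lambda>x. T f x - T g x)"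
  using submarkov_add[OF assms(1) bm_minus[OF assms(2)]] submarkov_cmult[OF assms(2), of "-1"] by simp

lemma submarkov_mono:
  assumes "bm M f" "bm M g" "\<And>x. f x \<le> g x" shows "T f x \<le> T g x"
  using submarkov_nonneg[of "\<lambda>x. g x - f x" x] assms by (simp add: submarkov_diff bm_diff)

lemma submarkov_const: "T (\<lambda>_. c) = (\<lambda>x. c * T (\<lambda>_. 1) x)"
  using submarkov_cmult[of "\<lambda>_. 1" c] by simp

lemma submarkov_sup_bound:
  assumes "bm M f" "\<And>x. \<bar>f x\<bar> \<le> B" shows "\<bar>T f x\<bar> \<le> B * T (\<lambda>_. 1) x"
proof -
  have "T f x \<le> T (\<lambda>_. B) x" using assms by (intro submarkov_mono) (simp_all add: abs_le_iff)
  moreover have "T (\<lambda>_. - B) x \<le> T f x" using assms by (intro submarkov_mono) (simp_all add: abs_le_iff minus_le_iff)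
  ultimately show ?thesis unfolding submarkov_const[of B] submarkov_const[of "-B"] by simp
qed

lemma submarkov_abs_bound:
  assumes "bm M f" "\<And>x. \<bar>f x\<bar> \<le> B" shows "\<bar>T f x\<bar> \<le> B"
proof -
  have "B \<ge> 0" using assms(2)[of x] by simp
  then show ?thesis
    using submarkov_sup_bound[OF assms] submarkov_one[of x] mult_left_le[of "T (\<lambda>_. 1) x" B]
    by (meson order_trans)
qed

lemma submarkov_abs:
  assumes "bm M f" shows "\<bar>T f x\<bar> \<le> T (\<lambda>x. \<bar>f x\<bar>) x"
proof -
  have "T f x \<le> T (\<lambda>x. \<bar>f x\<bar>) x" using assms by (intro submarkov_mono bm_cmult bm_abs) auto
  moreover have "T (\<lambda>x. -1 * f x) x \<le> T (\<lambda>x. \<bar>f x\<bar>) x" using assms by (intro submarkov_mono bm_cmult bm_abs) auto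
  ultimately show ?thesis unfolding submarkov_cmult[OF assms] by simp
qed

end

lemma submarkov_id: "submarkov M (\<lambda>f. f)"
  by (auto simp: submarkov_def)

lemma submarkov_comp:
  fixes M :: "'a measure"
  assumes S: "submarkov M S" and T: "submarkov M T" shows "submarkov M (\<lambda>f. S (T f))"
  unfolding submarkov_def
proof (safe)
  fix f assume f: "bm M f"
  show "bm M (S (T f))" using S T f by (simp add: submarkov_bm)
  fix g assume g: "bm M g"
  show "S (T (\<lambda>x. f x + g x)) = (\<lambda>x. S (T f) x + S (T g) x)"
    using f g by (simp add: submarkov_add[OF T] submarkov_add[OF S] submarkov_bm[OF T])
next
  fix f c assume f: "bm M f"
  show "S (T (\<lambda>x. c * f x)) = (\<lambda>x. c * S (T f) x)"
    using f by (simp add: submarkov_cmult[OF T] submarkov_cmult[OF S] submarkov_bm[OF T])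
next
  fix f x assume f: "bm M f" "\<forall>x. 0 \<le> f x"
  show "0 \<le> S (T f) x"
    using f by (intro submarkov_nonneg[OF S] submarkov_nonneg[OF T] submarkov_bm[OF T]) auto
next
  fix x
  have "0 \<le> T (\<lambda>_. 1) y" for y by (rule submarkov_nonneg[OF T]) auto
  then have "\<bar>T (\<lambda>_. 1) y\<bar> \<le> 1" for y using submarkov_one[OF T, of y] by simp
  then show "S (T (\<lambda>_. 1)) x \<le> 1"
    using submarkov_abs_bound[OF S, of "T (\<lambda>_. 1)" 1 x] submarkov_bm[OF T] by force
next
  fix F :: "nat \<Rightarrow> 'a \<Rightarrow> real" and f B x
  assume F: "\<forall>k. bm M (F k)" "bm M f" "\<forall>k x. \<bar>F k x\<bar> \<le> B" "\<forall>x. (\<lambda>k. F k x) \<longlonglongrightarrow> f x"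
  show "(\<lambda>k. S (T (F k)) x) \<longlonglongrightarrow> S (T f) x"
    using F by (intro submarkov_lim[OF S, where B=B] submarkov_bm[OF T] submarkov_abs_bound[OF T]
        submarkov_lim[OF T, where B=B]) auto
qed

lemma submarkov_funpow: "submarkov M S \<Longrightarrow> submarkov M (S ^^ k)"
proof (induction k)
  case 0 then show ?case using submarkov_id[of M] by (simp add: id_def)
next
  case (Suc k)
  then show ?case using submarkov_comp[OF Suc.prems Suc.IH] by (simp add: comp_def)
qed

lemma submarkov_average:
  fixes M :: "'a measure"
  assumes I: "finite I" "I \<noteq> {}" and T: "\<And>i. i \<in> I \<Longrightarrow> submarkov M (T i)"
  shows "submarkov M (\<lambda>f x. 1 / real (card I) * (\<Sum>i\<in>I. T i f x))"
  unfolding submarkov_def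
proof (safe)
  fix f assume f: "bm M f"
  show "bm M (\<lambda>x. 1 / real (card I) * (\<Sum>i\<in>I. T i f x))"
    using T f by (intro bm_cmult bm_sum) (simp add: submarkov_bm)
  fix g assume g: "bm M g"
  show "(\<lambda>x. 1 / real (card I) * (\<Sum>i\<in>I. T i (\<lambda>x. f x + g x) x)) =
       (\<lambda>x. 1 / real (card I) * (\<Sum>i\<in>I. T i f x) + 1 / real (card I) * (\<Sum>i\<in>I. T i g x))"
    using f g by (simp add: submarkov_add[OF T] sum.distrib distrib_left add_divide_distrib cong: sum.cong)
next
  fix f c assume f: "bm M f"
  show "(\<lambda>x. 1 / real (card I) * (\<Sum>i\<in>I. T i (\<lambda>x. c * f x) x)) =
       (\<lambda>x. c * (1 / real (card I) * (\<Sum>i\<in>I. T i f x)))"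
    using f by (simp add: submarkov_cmult[OF T] sum_distrib_left cong: sum.cong)
next
  fix f x assume f: "bm M f" "\<forall>x. 0 \<le> f x"
  show "0 \<le> 1 / real (card I) * (\<Sum>i\<in>I. T i f x)"
    using f by (intro mult_nonneg_nonneg sum_nonneg submarkov_nonneg[OF T]) auto
next
  fix x
  have "(\<Sum>i\<in>I. T i (\<lambda>_. 1) x) \<le> (\<Sum>i\<in>I. 1)"
    by (intro sum_mono submarkov_one[OF T])
  moreover have "card I > 0" using I by (simp add: card_gt_0_iff)
  ultimately show "1 / real (card I) * (\<Sum>i\<in>I. T i (\<lambda>_. 1) x) \<le> 1" by (simp add: field_simps)
next
  fix F :: "nat \<Rightarrow> 'a \<Rightarrow> real" and f B x
  assume F: "\<forall>k. bm M (F k)" "bm M f" "\<forall>k x. \<bar>F k x\<bar> \<le> B" "\<forall>x. (\<lambda>k. F k x) \<longlonglongrightarrow> f x"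
  show "(\<lambda>k. 1 / real (card I) * (\<Sum>i\<in>I. T i (F k) x)) \<longlonglongrightarrow> 1 / real (card I) * (\<Sum>i\<in>I. T i f x)"
    using F by (intro tendsto_mult tendsto_const tendsto_sum submarkov_lim[OF T, where B=B]) auto
qed

lemma submarkov_scale:
  fixes M :: "'a measure"
  assumes "submarkov M T" "0 \<le> c" "c \<le> 1" shows "submarkov M (\<lambda>f x. c * T f x)"
  unfolding submarkov_def
proof (safe)
  note T = assms(1)
  fix f assume f: "bm M f"
  show "bm M (\<lambda>x. c * T f x)" using f by (intro bm_cmult submarkov_bm[OF T])
  fix g assume g: "bm M g"
  show "(\<lambda>x. c * T (\<lambda>x. f x + g x) x) = (\<lambda>x. c * T f x + c * T g x)"
    using f g by (simp add: submarkov_add[OF T] distrib_left)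
next
  note T = assms(1)
  fix f d assume f: "bm M f"
  show "(\<lambda>x. c * T (\<lambda>x. d * f x) x) = (\<lambda>x. d * (c * T f x))"
    using f by (simp add: submarkov_cmult[OF T] mult.left_commute)
next
  note T = assms(1)
  fix f x assume f: "bm M f" "\<forall>x. 0 \<le> f x"
  show "0 \<le> c * T f x" using f assms by (simp add: submarkov_nonneg[OF T])
next
  note T = assms(1)
  fix x
  have "0 \<le> T (\<lambda>_. 1) x" by (rule submarkov_nonneg[OF T]) auto
  then show "c * T (\<lambda>_. 1) x \<le> 1" using submarkov_one[OF T, of x] assms by (simp add: mult_le_one)
next
  note T = assms(1)
  fix F :: "nat \<Rightarrow> 'a \<Rightarrow> real" and f B x
  assume F: "\<forall>k. bm M (F k)" "bm M f" "\<forall>k x. \<bar>F k x\<bar> \<le> B" "\<forall>x. (\<lambda>k. F k x) \<longlonglongrightarrow> f x"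
  show "(\<lambda>k. c * T (F k) x) \<longlonglongrightarrow> c * T f x"
    using F by (intro tendsto_mult tendsto_const submarkov_lim[OF T, where B=B]) auto
qed

text \<open>Countable additivity is the continuity clause of \<open>submarkov\<close>, applied to
  the indicators of the finite partial unions.\<close>

lemma submarkov_measure:
  fixes x :: 'a
  assumes T: "submarkov M T" and M: "space M = UNIV"
  defines "N \<equiv> measure_of UNIV (sets M) (\<lambda>B. ennreal (T (indicat_real B) x))"
  shows "sets N = sets M" "B \<in> sets M \<Longrightarrow> emeasure N B = ennreal (T (indicat_real B) x)"
proof -
  interpret sigma_algebra UNIV "sets M" using sets.sigma_algebra_axioms[of M] by (simp add: M)
  show "sets N = sets M" unfolding N_def by (simp add: sigma_sets_eq)
  assume B: "B \<in> sets M"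
  show "emeasure N B = ennreal (T (indicat_real B) x)"
    unfolding N_def
  proof (rule emeasure_measure_of_sigma)
    show "sigma_algebra UNIV (sets M)" ..
    have e: "indicat_real {} = (\<lambda>_. 0)" by (simp add: fun_eq_iff)
    have "T (\<lambda>_. 0) x = 0"
      using fun_cong[OF submarkov_cmult[OF T, of "\<lambda>_. 0" 0], of x] by simp
    then have "T (indicat_real {}) x = 0" unfolding e .
    then show "positive (sets M) (\<lambda>B. ennreal (T (indicat_real B) x))"
      by (simp add: positive_def)
    show "countably_additive (sets M) (\<lambda>B. ennreal (T (indicat_real B) x))"
    proof (rule countably_additiveI)
      fix A :: "nat \<Rightarrow> 'a set"
      assume A: "range A \<subseteq> sets M" "disjoint_family A" "(\<Union>i. A i) \<in> sets M"
      have Asets: "A i \<in> sets M" for i using A by auto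
      have fin: "T (indicat_real (\<Union>i<k. A i)) x = (\<Sum>i<k. T (indicat_real (A i)) x)" for k
      proof (induction k)
        case 0 then show ?case using \<open>T (indicat_real {}) x = 0\<close> unfolding e by simp
      next
        case (Suc k)
        have dj: "(\<Union>i<k. A i) \<inter> A k = {}"
          using A(2) by (auto simp: disjoint_family_on_def) (metis IntI empty_iff less_irrefl)
        have "(\<Union>i<Suc k. A i) = (\<Union>i<k. A i) \<union> A k" by (auto simp: less_Suc_eq)
        then have "indicat_real (\<Union>i<Suc k. A i) = (\<lambda>x. indicat_real (\<Union>i<k. A i) x + indicat_real (A k) x)"
          using dj by (auto simp: indicator_def fun_eq_iff)
        then have "T (indicat_real (\<Union>i<Suc k. A i)) x =
            T (indicat_real (\<Union>i<k. A i)) x + T (indicat_real (A k)) x"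
          using Asets by (simp add: submarkov_add[OF T] bm_indicator)
        then show ?case using Suc by simp
      qed
      have "(\<lambda>k. T (indicat_real (\<Union>i<k. A i)) x) \<longlonglongrightarrow> T (indicat_real (\<Union>i. A i)) x"
      proof (rule submarkov_lim[OF T, where B=1])
        fix y
        show "(\<lambda>k. indicat_real (\<Union>i<k. A i) y) \<longlonglongrightarrow> indicat_real (\<Union>i. A i) y"
          by (rule LIMSEQ_indicator_UN)
      qed (use Asets A(3) in \<open>auto intro!: bm_indicator simp: indicator_def\<close>)
      then have "(\<lambda>i. T (indicat_real (A i)) x) sums T (indicat_real (\<Union>i. A i)) x"
        unfolding sums_def fin .
      then show "(\<Sum>i. ennreal (T (indicat_real (A i)) x)) = ennreal (T (indicat_real (\<Union>i. A i)) x)"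
        using Asets by (intro suminf_ennreal_eq submarkov_nonneg[OF T] bm_indicator) auto
    qed
  qed (rule B)
qed

text \<open>Both sides are linear and continuous under bounded pointwise convergence, so their
  agreement on indicators passes to simple functions and from these to \<open>f\<close>.\<close>

lemma submarkov_integral_rep:
  assumes T: "submarkov M T" and M: "space M = UNIV" and f: "bm M f" "\<And>y. 0 \<le> f y"
    and N: "sets N = sets M" "\<And>B. B \<in> sets M \<Longrightarrow> emeasure N B = ennreal (T (indicat_real B) x)"
  shows "T f x = (LINT y|N. f y)"
proof -
  have [measurable_cong]: "sets N = sets M" by (rule N)
  have spN: "space N = UNIV" using N(1) M sets_eq_imp_space_eq by metis
  have UM: "UNIV \<in> sets M" using sets.top[of M] by (simp add: M)
  interpret N: finite_measure N
    by standard (simp add: spN N(2)[OF UM])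
  have meas: "measure N B = T (indicat_real B) x" if "B \<in> sets M" for B
    unfolding measure_def N(2)[OF that]
    by (simp add: submarkov_nonneg[OF T bm_indicator[OF that]])
  obtain F where F: "\<And>k. simple_function M (F k)" "\<And>k y. y \<in> space M \<Longrightarrow> norm (F k y) \<le> 2 * norm (f y)"
    "\<And>y. y \<in> space M \<Longrightarrow> (\<lambda>k. F k y) \<longlonglongrightarrow> f y"
    using borel_measurable_implies_sequence_metric[OF bm_measurable[OF f(1)], of 0] by auto blast
  obtain B where B: "B \<ge> 0" "\<And>y. \<bar>f y\<bar> \<le> B" using bm_bound[OF f(1)] by auto
  have FB: "\<bar>F k y\<bar> \<le> 2 * B" for k y using F(2)[of y k] B(2)[of y] M by auto
  have Fm[measurable]: "F k \<in> borel_measurable M" for k by (rule borel_measurable_simple_function[OF F(1)])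
  have Fbm: "bm M (F k)" for k using FB by (intro bmI[where B="2*B"]) auto
  have eq: "T (F k) x = (LINT y|N. F k y)" for k
  proof -
    have fin: "finite (range (F k))" using F(1)[of k] M by (simp add: simple_function_def)
    have S: "F k -` {z} \<in> sets M" for z using F(1)[of k] M
      by (metis Int_UNIV_right borel_measurable_simple_function measurable_sets borel_singleton sets.empty_sets)
    have rep: "F k = (\<lambda>y. \<Sum>z\<in>range (F k). z * indicat_real (F k -` {z}) y)"
    proof
      fix y
      have "(\<Sum>z\<in>range (F k). z * indicat_real (F k -` {z}) y) = (\<Sum>z\<in>range (F k). if z = F k y then z else 0)"
        by (intro sum.cong) (auto simp: indicator_def)
      then show "F k y = (\<Sum>z\<in>range (F k). z * indicat_real (F k -` {z}) y)"
        using fin by simp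
    qed
    have Tsum: "T (\<lambda>y. \<Sum>z\<in>Z. z * indicat_real (F k -` {z}) y) x = (\<Sum>z\<in>Z. z * T (indicat_real (F k -` {z})) x)"
      if "finite Z" for Z using that
    proof (induction Z)
      case empty
      show ?case using submarkov_cmult[OF T, of "\<lambda>_. 0" 0] by (simp add: fun_eq_iff)
    next
      case (insert z Z)
      have "bm M (\<lambda>y. \<Sum>z\<in>Z. z * indicat_real (F k -` {z}) y)"
        by (intro bm_sum bm_cmult bm_indicator S)
      moreover have "bm M (\<lambda>y. z * indicat_real (F k -` {z}) y)"
        by (intro bm_cmult bm_indicator S)
      ultimately have "T (\<lambda>y. z * indicat_real (F k -` {z}) y + (\<Sum>z\<in>Z. z * indicat_real (F k -` {z}) y)) x =
          z * T (indicat_real (F k -` {z})) x + T (\<lambda>y. \<Sum>z\<in>Z. z * indicat_real (F k -` {z}) y) x"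
        using fun_cong[OF submarkov_cmult[OF T bm_indicator[OF S[of z]], of z], of x]
        by (subst submarkov_add[OF T]) auto
      then show ?case using insert by (simp only: sum.insert not_False_eq_True)
    qed
    have "(LINT y|N. F k y) = (LINT y|N. (\<Sum>z\<in>range (F k). z * indicat_real (F k -` {z}) y))"
      using rep by metis
    also have "\<dots> = (\<Sum>z\<in>range (F k). z * measure N (F k -` {z}))"
      using S by (subst Bochner_Integration.integral_sum)
        (auto simp: N.emeasure_finite less_top[symmetric] N(1))
    also have "\<dots> = (\<Sum>z\<in>range (F k). z * T (indicat_real (F k -` {z})) x)"
      by (simp add: meas S)
    also have "\<dots> = T (F k) x" using Tsum[OF fin] rep by metis
    finally show ?thesis by simp
  qed
  have "(\<lambda>k. T (F k) x) \<longlonglongrightarrow> T f x"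
    using F(3) M by (intro submarkov_lim[OF T Fbm f(1) FB]) auto
  moreover have "(\<lambda>k. LINT y|N. F k y) \<longlonglongrightarrow> (LINT y|N. f y)"
    using F(3) M FB f(1) by (intro integral_dominated_convergence[where w="\<lambda>_. 2*B"]) auto
  ultimately show ?thesis using LIMSEQ_unique unfolding eq by blast
qed

section \<open>Symmetric Markov operators\<close>

locale symmetric_markov = prob_space M for M :: "'a measure" +
  fixes S :: "('a \<Rightarrow> real) \<Rightarrow> 'a \<Rightarrow> real"
  assumes space_UNIV: "space M = UNIV"
    and S: "submarkov M S"
    and S_one: "S (\<lambda>_. 1) = (\<lambda>_. 1)"
    and S_sym: "bm M f \<Longrightarrow> bm M g \<Longrightarrow> (LINT x|M. f x * S g x) = (LINT x|M. S f x * g x)"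
begin

definition energy :: "('a \<Rightarrow> real) \<Rightarrow> real" where
  "energy f = (LINT x|M. f x * (f x - S f x))"

lemma S_bm: "bm M f \<Longrightarrow> bm M (S f)"
  by (rule submarkov_bm[OF S])

lemma Sk_bm: "bm M f \<Longrightarrow> bm M ((S ^^ k) f)"
  by (induction k) (auto simp: S_bm)

lemmas S_intros = bm_intros S_bm Sk_bm

lemma integral_S: assumes "bm M f" shows "(LINT x|M. S f x) = (LINT x|M. f x)"
  using S_sym[OF bm_const[of M 1] assms] by (simp add: S_one)

lemma integral_Sk: "bm M f \<Longrightarrow> (LINT x|M. (S ^^ k) f x) = (LINT x|M. f x)"
  by (induction k) (auto simp: integral_S Sk_bm)

lemma Sk_sym: "bm M f \<Longrightarrow> bm M g \<Longrightarrow> (LINT x|M. f x * (S ^^ k) g x) = (LINT x|M. (S ^^ k) f x * g x)"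
proof (induction k arbitrary: f)
  case (Suc k)
  have "(LINT x|M. f x * (S ^^ Suc k) g x) = (LINT x|M. S f x * (S ^^ k) g x)"
    using S_sym[OF Suc.prems(1) Sk_bm[OF Suc.prems(2), of k]] by simp
  also have "\<dots> = (LINT x|M. (S ^^ k) (S f) x * g x)" by (rule Suc.IH) (use Suc.prems S_bm in auto)
  finally show ?case by (simp add: funpow_swap1)
qed simp

lemma integral_abs_S: assumes "bm M f" shows "(LINT x|M. \<bar>S f x\<bar>) \<le> (LINT x|M. \<bar>f x\<bar>)"
proof -
  have "(LINT x|M. \<bar>S f x\<bar>) \<le> (LINT x|M. S (\<lambda>x. \<bar>f x\<bar>) x)"
    using assms by (intro integral_mono integrable_bm S_intros submarkov_abs[OF S])
  then show ?thesis using integral_S[OF bm_abs[OF assms]] by simp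
qed

lemma integral_abs_Sk: "bm M f \<Longrightarrow> (LINT x|M. \<bar>(S ^^ k) f x\<bar>) \<le> (LINT x|M. \<bar>f x\<bar>)"
proof (induction k)
  case (Suc k)
  then show ?case using integral_abs_S[OF Sk_bm[OF Suc.prems, of k]] by simp
qed simp

lemma S_cmult: "bm M f \<Longrightarrow> S (\<lambda>x. c * f x) = (\<lambda>x. c * S f x)"
  by (rule submarkov_cmult[OF S])

lemma S_diff: "bm M f \<Longrightarrow> bm M g \<Longrightarrow> S (\<lambda>x. f x - g x) = (\<lambda>x. S f x - S g x)"
  by (rule submarkov_diff[OF S])

text \<open>For a symmetric operator \<open>0 \<le> P \<le> c\<close> one has \<open>P\<^sup>2 \<le> c P\<close>; here \<open>P = I - S - \<gamma>\<close>, and the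
  hypotheses are the two bounds in the form needed for one function \<open>f\<close>.\<close>

lemma square_le_of_form_bounds:
  fixes \<gamma> c :: real
  assumes f: "bm M f" and c: "0 < c"
  defines "P \<equiv> \<lambda>u x. u x - S u x - \<gamma> * u x"
  assumes pos: "0 \<le> (LINT x|M. (f x - 1/c * P f x) * P (\<lambda>y. f y - 1/c * P f y) x)"
    and le: "(LINT x|M. P f x * P (P f) x) \<le> c * (LINT x|M. (P f x)\<^sup>2)"
  shows "(LINT x|M. (P f x)\<^sup>2) \<le> c * (LINT x|M. f x * P f x)"
proof -
  have P: "P u x = u x - S u x - \<gamma> * u x" for u x by (simp add: P_def)
  have Pbm: "bm M (P u)" if "bm M u" for u unfolding P_def using that by (intro S_intros)
  have sym: "(LINT x|M. f x * P (P f) x) = (LINT x|M. (P f x)\<^sup>2)"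
  proof -
    have "(LINT x|M. f x * P (P f) x) = (LINT x|M. f x * P f x - f x * S (P f) x - \<gamma> * (f x * P f x))"
      unfolding P[of "P f"] by (simp add: algebra_simps)
    also have "\<dots> = (LINT x|M. f x * P f x) - (LINT x|M. f x * S (P f) x) - \<gamma> * (LINT x|M. f x * P f x)"
      using f Pbm[OF f] by (simp only: integral_bm S_intros)
    also have "\<dots> = (LINT x|M. f x * P f x) - (LINT x|M. S f x * P f x) - \<gamma> * (LINT x|M. f x * P f x)"
      using S_sym[OF f Pbm[OF f]] by simp
    also have "\<dots> = (LINT x|M. f x * P f x - S f x * P f x - \<gamma> * (f x * P f x))"
      using f Pbm[OF f] by (simp only: integral_bm S_intros)
    also have "\<dots> = (LINT x|M. (P f x)\<^sup>2)"
      by (simp add: P[of f] power2_eq_square algebra_simps)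
    finally show ?thesis .
  qed
  have lin: "P (\<lambda>y. f y - 1/c * P f y) x = P f x - 1/c * P (P f) x" for x
  proof -
    have "S (\<lambda>y. f y - 1/c * P f y) = (\<lambda>x. S f x - 1/c * S (P f) x)"
      using f Pbm[OF f] by (simp only: S_diff S_cmult bm_cmult)
    then show ?thesis unfolding P[of "\<lambda>y. f y - 1/c * P f y"] P[of "P f"]
      by (simp add: P[of f] algebra_simps)
  qed
  \<comment> \<open>By symmetry, \<open>pos\<close> expands to 0 \<le> (f, P f) - (2/c) |P f|^2 +
    (1/c^2) (P f, P (P f)). The bound \<open>le\<close> turns the last term into |P f|^2 / c, which
    leaves the claim.\<close>
  have "(LINT x|M. (f x - 1/c * P f x) * P (\<lambda>y. f y - 1/c * P f y) x) =
      (LINT x|M. f x * P f x - 1/c * (f x * P (P f) x) - 1/c * (P f x)\<^sup>2 + 1/c^2 * (P f x * P (P f) x))"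
    unfolding lin by (simp add: power2_eq_square algebra_simps)
  also have "\<dots> = (LINT x|M. f x * P f x) - 1/c * (LINT x|M. f x * P (P f) x) - 1/c * (LINT x|M. (P f x)\<^sup>2)
      + 1/c^2 * (LINT x|M. P f x * P (P f) x)"
    using f Pbm[OF f] Pbm[OF Pbm[OF f]]
    by (simp only: integral_bm S_intros)
  finally have "0 \<le> (LINT x|M. f x * P f x) - 2/c * (LINT x|M. (P f x)\<^sup>2)
      + 1/c^2 * (LINT x|M. P f x * P (P f) x)"
    using pos sym by simp
  also have "\<dots> \<le> (LINT x|M. f x * P f x) - 2/c * (LINT x|M. (P f x)\<^sup>2)
      + 1/c^2 * (c * (LINT x|M. (P f x)\<^sup>2))"
    using mult_left_mono[OF le, of "1/c^2"] by simp
  also have "\<dots> = (LINT x|M. f x * P f x) - 1/c * (LINT x|M. (P f x)\<^sup>2)"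
    using c by (simp add: field_simps power2_eq_square)
  finally show ?thesis using c by (simp add: field_simps)
qed

lemma integral_S_square:
  assumes "bm M f"
  shows "(LINT x|M. (S f x)\<^sup>2) = (LINT x|M. (f x)\<^sup>2) - 2 * energy f + (LINT x|M. (f x - S f x)\<^sup>2)"
proof -
  have "(LINT x|M. (f x - S f x)\<^sup>2) = (LINT x|M. (S f x)\<^sup>2 - (f x)\<^sup>2 + 2 * (f x * (f x - S f x)))"
    by (simp add: power2_eq_square algebra_simps)
  also have "\<dots> = (LINT x|M. (S f x)\<^sup>2) - (LINT x|M. (f x)\<^sup>2) + 2 * energy f"
    unfolding energy_def using assms
    by (simp only: integral_bm S_intros)
  finally show ?thesis by simp
qed

end

text \<open>In the language of forms: the spectrum of \<open>S\<close> lies in [-1 + \<delta>, 1].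
  The upper bound for the energy keeps it off -1, where the walk would be nearly periodic.\<close>

locale spectrally_bounded_markov = symmetric_markov +
  fixes \<delta> :: real
  assumes delta: "0 < \<delta>" "\<delta> < 1"
    and energy_nonneg: "bm M f \<Longrightarrow> 0 \<le> energy f"
    and energy_le: "bm M f \<Longrightarrow> energy f \<le> (2 - \<delta>) * (LINT x|M. (f x)\<^sup>2)"
begin

text \<open>On the spectrum this is t^2 \<le> 1 - \<delta> (1 - t), valid for -1 + \<delta> \<le> t
  \<le> 1; it comes from \<open>square_le_of_form_bounds\<close> with \<gamma> = 0 and c = 2 -
  \<delta>. The energy kept on the right drives the Nash argument.\<close>

lemma S_square_le:
  assumes f: "bm M f" shows "(LINT x|M. (S f x)\<^sup>2) \<le> (LINT x|M. (f x)\<^sup>2) - \<delta> * energy f"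
proof -
  have "(LINT x|M. (f x - S f x - 0 * f x)\<^sup>2) \<le> (2 - \<delta>) * (LINT x|M. f x * (f x - S f x - 0 * f x))"
  proof (rule square_le_of_form_bounds[OF f])
    show "0 < 2 - \<delta>" using delta by simp
    let ?u = "\<lambda>x. f x - 1 / (2 - \<delta>) * (f x - S f x - 0 * f x)"
    have "bm M ?u" using f by (intro S_intros)
    from energy_nonneg[OF this] show "0 \<le> (LINT x|M. ?u x * (?u x - S ?u x - 0 * ?u x))"
      by (simp add: energy_def)
    let ?v = "\<lambda>x. f x - S f x - 0 * f x"
    have "bm M ?v" using f by (intro S_intros)
    from energy_le[OF this] show "(LINT x|M. ?v x * (?v x - S ?v x - 0 * ?v x)) \<le> (2 - \<delta>) * (LINT x|M. (?v x)\<^sup>2)"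
      by (simp add: energy_def)
  qed
  then have "(LINT x|M. (f x - S f x)\<^sup>2) \<le> (2 - \<delta>) * energy f" by (simp add: energy_def)
  then show ?thesis unfolding integral_S_square[OF f] by (simp add: algebra_simps)
qed

lemma S_contraction: "bm M f \<Longrightarrow> (LINT x|M. (S f x)\<^sup>2) \<le> (LINT x|M. (f x)\<^sup>2)"
  using S_square_le energy_nonneg delta mult_nonneg_nonneg[of \<delta> "energy f"] by fastforce

text \<open>With P = I - S - g the claim amounts to P^2 \<le> (2 - 2 g) P. On mean-zero functions P
  is nonnegative by the gap, and it is at most 2 - \<delta> - g, which g \<le> \<delta>/2 puts below
  2 - 2 g.\<close>

lemma mean_zero_decay:
  assumes f: "bm M f" and mean: "(LINT x|M. f x) = 0"
    and g: "0 < g" "g \<le> \<delta>/2"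
    and gap: "\<And>u. bm M u \<Longrightarrow> (LINT x|M. u x) = 0 \<Longrightarrow> g * (LINT x|M. (u x)\<^sup>2) \<le> energy u"
  shows "(LINT x|M. (S f x)\<^sup>2) \<le> (1 - g)\<^sup>2 * (LINT x|M. (f x)\<^sup>2)"
proof -
  let ?P = "\<lambda>u x. u x - S u x - g * u x"
  have form: "(LINT x|M. u x * ?P u x) = energy u - g * (LINT x|M. (u x)\<^sup>2)" if u: "bm M u" for u
  proof -
    have "(LINT x|M. u x * ?P u x) = (LINT x|M. u x * (u x - S u x) - g * (u x)\<^sup>2)"
      by (simp add: power2_eq_square algebra_simps)
    also have "\<dots> = energy u - g * (LINT x|M. (u x)\<^sup>2)"
      unfolding energy_def using u
      by (simp only: integral_bm S_intros)
    finally show ?thesis .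
  qed
  have Pmean: "(LINT x|M. ?P f x) = 0"
    using f integral_S[OF f] mean
    by (simp add: integral_bm S_intros)
  have Pbm: "bm M (?P f)" using f by (intro S_intros)
  have *: "(LINT x|M. (?P f x)\<^sup>2) \<le> (2 - 2 * g) * (LINT x|M. f x * ?P f x)"
  proof (rule square_le_of_form_bounds[OF f])
    show "0 < 2 - 2 * g" using g delta by simp
    let ?u = "\<lambda>x. f x - 1 / (2 - 2 * g) * ?P f x"
    have u: "bm M ?u" using f by (intro S_intros)
    \<comment> \<open>The gap hypothesis speaks of mean-zero functions only; \<open>?P\<close>
      preserves this class because \<open>S\<close> preserves the mean.\<close>
    have "(LINT x|M. ?u x) = 0"
      using integral_bm_diff[OF f bm_cmult[OF Pbm, of "1 / (2 - 2 * g)"]] integral_bm_cmult[OF Pbm, of "1 / (2 - 2 * g)"] Pmean mean by simp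
    from gap[OF u this] show "0 \<le> (LINT x|M. ?u x * (?u x - S ?u x - g * ?u x))"
      unfolding form[OF u] by simp
    have "0 \<le> (LINT x|M. (?P f x)\<^sup>2)" by simp
    then have "(\<delta> + g - 2 * g) * (LINT x|M. (?P f x)\<^sup>2) \<ge> 0" using g by (intro mult_nonneg_nonneg) auto
    then show "(LINT x|M. ?P f x * (?P f x - S (?P f) x - g * ?P f x)) \<le> (2 - 2 * g) * (LINT x|M. (?P f x)\<^sup>2)"
      unfolding form[OF Pbm] using energy_le[OF Pbm] by (simp add: algebra_simps)
  qed
  have "(LINT x|M. (?P f x)\<^sup>2) = (LINT x|M. (f x - S f x)\<^sup>2 - 2 * g * (f x * (f x - S f x)) + g\<^sup>2 * (f x)\<^sup>2)"
    by (simp add: power2_eq_square algebra_simps)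
  also have "\<dots> = (LINT x|M. (f x - S f x)\<^sup>2) - 2 * g * energy f + g\<^sup>2 * (LINT x|M. (f x)\<^sup>2)"
    unfolding energy_def using f
    by (simp only: integral_bm S_intros)
  finally have "(LINT x|M. (f x - S f x)\<^sup>2) - 2 * g * energy f + g\<^sup>2 * (LINT x|M. (f x)\<^sup>2)
      \<le> (2 - 2 * g) * (energy f - g * (LINT x|M. (f x)\<^sup>2))"
    using * unfolding form[OF f] by simp
  then show ?thesis unfolding integral_S_square[OF f] by (simp add: power2_eq_square algebra_simps)
qed

lemma mean_zero_decay_power:
  assumes f: "bm M f" and mean: "(LINT x|M. f x) = 0"
    and g: "0 < g" "g \<le> \<delta>/2"
    and gap: "\<And>u. bm M u \<Longrightarrow> (LINT x|M. u x) = 0 \<Longrightarrow> g * (LINT x|M. (u x)\<^sup>2) \<le> energy u"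
  shows "(LINT x|M. ((S ^^ k) f x)\<^sup>2) \<le> exp (- 2 * real k * g) * (LINT x|M. (f x)\<^sup>2)"
proof (induction k)
  case (Suc k)
  have "(LINT x|M. ((S ^^ Suc k) f x)\<^sup>2) \<le> (1 - g)\<^sup>2 * (LINT x|M. ((S ^^ k) f x)\<^sup>2)"
    unfolding funpow.simps comp_apply
    by (rule mean_zero_decay[OF Sk_bm[OF f] _ g gap]) (simp_all add: integral_Sk[OF f] mean)
  also have "\<dots> \<le> (exp (- g))\<^sup>2 * (exp (- 2 * real k * g) * (LINT x|M. (f x)\<^sup>2))"
    using exp_ge_add_one_self[of "-g"] g delta
    by (intro mult_mono Suc power_mono) auto
  also have "\<dots> = exp (- 2 * real (Suc k) * g) * (LINT x|M. (f x)\<^sup>2)"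
    by (simp add: power2_eq_square mult.assoc[symmetric] del: mult_minus_left flip: exp_add)
      (simp add: algebra_simps)
  finally show ?case .
qed simp

end

section \<open>Nash inequalities and convergence to equilibrium\<close>

lemma (in finite_measure) cauchy_schwarz_bm:
  assumes f: "bm M f" and g: "bm M g"
  shows "\<bar>LINT x|M. f x * g x\<bar> \<le> sqrt (LINT x|M. (f x)\<^sup>2) * sqrt (LINT x|M. (g x)\<^sup>2)"
proof -
  let ?F = "LINT x|M. (f x)\<^sup>2" and ?G = "LINT x|M. (g x)\<^sup>2" and ?X = "LINT x|M. f x * g x"
  have nn: "0 \<le> ?F" "0 \<le> ?G" by auto
  have key: "0 \<le> ?F - 2 * t * ?X + t\<^sup>2 * ?G" for t
  proof -
    have "0 \<le> (LINT x|M. (f x - t * g x)\<^sup>2)" by simp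
    also have "\<dots> = (LINT x|M. (f x)\<^sup>2 - 2 * t * (f x * g x) + t\<^sup>2 * (g x)\<^sup>2)"
      by (simp add: power2_eq_square algebra_simps)
    also have "\<dots> = ?F - 2 * t * ?X + t\<^sup>2 * ?G" using f g by (simp only: integral_bm bm_intros)
    finally show ?thesis .
  qed
  have "?X\<^sup>2 \<le> ?F * ?G"
  proof (cases "?G = 0")
    case True
    have "?X = 0"
    proof (rule ccontr)
      assume "?X \<noteq> 0"
      \<comment> \<open>At this value of t the quadratic inequality reads 0 \<le> F - (F +
        1).\<close>
      then show False using key[of "(?F + 1) / (2 * ?X)"] True by (simp add: field_simps)
    qed
    then show ?thesis using True by simp
  next
    case False
    then have "?G > 0" using nn(2) by (metis less_le)
    then show ?thesis using key[of "?X / ?G"] by (simp add: field_simps power2_eq_square)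
  qed
  then have "sqrt (?X\<^sup>2) \<le> sqrt (?F * ?G)" by (rule real_sqrt_le_mono)
  then show ?thesis by (simp add: real_sqrt_mult)
qed

text \<open>The density is a Radon-Nikodym derivative of the kernel of \<open>U\<close> at \<open>x\<close>.\<close>

lemma (in finite_measure) submarkov_density:
  assumes U: "submarkov M U" and sp: "space M = UNIV" and D: "0 \<le> D"
    and dom: "\<And>f. bm M f \<Longrightarrow> (\<And>y. 0 \<le> f y) \<Longrightarrow> U f x \<le> D * (LINT y|M. f y)"
  obtains u where "bm M u" "\<And>y. 0 \<le> u y" "\<And>y. u y \<le> D" "(LINT y|M. u y) \<le> 1"
    "\<And>f. bm M f \<Longrightarrow> U f x = (LINT y|M. u y * f y)"
proof -
  define N where "N = measure_of UNIV (sets M) (\<lambda>B. ennreal (U (indicat_real B) x))"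
  note N = submarkov_measure[OF U sp, where x=x, folded N_def]
  have [measurable_cong]: "sets N = sets M" by (rule N)
  have spN: "space N = UNIV" using N(1) sp sets_eq_imp_space_eq by metis
  have UM: "UNIV \<in> sets M" using sets.top[of M] by (simp add: sp)
  have NM: "emeasure N B \<le> ennreal D * emeasure M B" if B: "B \<in> sets M" for B
  proof -
    have "U (indicat_real B) x \<le> D * measure M B"
      using dom[OF bm_indicator[OF B]] B by simp
    then show ?thesis
      using D by (simp add: N(2)[OF B] emeasure_eq_measure ennreal_mult[symmetric] ennreal_leI)
  qed
  have ac: "absolutely_continuous M N"
    unfolding absolutely_continuous_def
  proof
    fix B assume B: "B \<in> null_sets M"
    then have "emeasure N B \<le> 0" using NM[of B] by (simp add: null_sets_def)
    then show "B \<in> null_sets N" using B N(1) by (simp add: null_sets_def)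
  qed
  define w where "w = RN_deriv M N"
  have w[measurable]: "w \<in> borel_measurable M" by (simp add: w_def)
  have dens: "density M w = N" unfolding w_def by (rule density_RN_deriv[OF ac N(1)])
  have AEw: "AE y in M. w y \<le> ennreal D"
  proof -
    \<comment> \<open>On this set \<open>w\<close> exceeds \<open>D\<close>, although its integral
      there is at most that of \<open>D\<close>. The latter integral is finite, so the difference
      can be integrated and vanishes almost everywhere.\<close>
    let ?A = "{y \<in> space M. ennreal D < w y}"
    have A: "?A \<in> sets M" by measurable
    have "(\<integral>\<^sup>+y. w y * indicator ?A y \<partial>M) = emeasure N ?A"
      using A by (simp add: dens[symmetric] emeasure_density)
    also have "\<dots> \<le> ennreal D * emeasure M ?A" by (rule NM[OF A])
    also have "\<dots> = (\<integral>\<^sup>+y. ennreal D * indicator ?A y \<partial>M)"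
      using A by (simp add: nn_integral_cmult)
    finally have le: "(\<integral>\<^sup>+y. w y * indicator ?A y \<partial>M) \<le> (\<integral>\<^sup>+y. ennreal D * indicator ?A y \<partial>M)" .
    have fin: "(\<integral>\<^sup>+y. ennreal D * indicator ?A y \<partial>M) \<noteq> \<infinity>"
      using A by (simp add: nn_integral_cmult ennreal_mult_eq_top_iff)
    have "(\<integral>\<^sup>+y. w y * indicator ?A y - ennreal D * indicator ?A y \<partial>M) =
        (\<integral>\<^sup>+y. w y * indicator ?A y \<partial>M) - (\<integral>\<^sup>+y. ennreal D * indicator ?A y \<partial>M)"
      using fin by (intro nn_integral_diff) (auto simp: indicator_def)
    also have "\<dots> = 0" using le by (rule diff_eq_0_ennreal[rotated]) (use le fin in \<open>auto simp: less_top[symmetric] top_unique\<close>)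
    finally have "AE y in M. w y * indicator ?A y - ennreal D * indicator ?A y = 0"
      by (subst (asm) nn_integral_0_iff_AE) auto
    then show ?thesis
    proof eventually_elim
      case (elim y)
      show ?case
      proof (rule ccontr)
        assume "\<not> w y \<le> ennreal D"
        then have "ennreal D < w y" by simp
        then show False using elim by (auto simp: sp diff_eq_0_iff_ennreal dest: leD)
      qed
    qed
  qed
  \<comment> \<open>Truncation turns the almost-everywhere bound into one at every point.\<close>
  define u where "u y = enn2real (min (w y) (ennreal D))" for y
  have u_le: "0 \<le> u y" "u y \<le> D" for y
  proof -
    show "0 \<le> u y" by (simp add: u_def)
    have "u y \<le> enn2real (ennreal D)" unfolding u_def by (intro enn2real_mono) auto
    then show "u y \<le> D" using D by simp
  qed
  have "u \<in> borel_measurable M" unfolding u_def by measurable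
  then have ubm: "bm M u" by (rule bmI[where B=D]) (simp add: u_le)
  have uw: "AE y in M. w y = ennreal (u y)"
    using AEw by eventually_elim (auto simp: u_def min_def ennreal_enn2real_if top_unique)
  have N_dens: "N = density M (\<lambda>y. ennreal (u y))"
    unfolding dens[symmetric] using uw ubm by (intro density_cong) auto
  have rep0: "U f x = (LINT y|M. u y * f y)" if f: "bm M f" "\<And>y. 0 \<le> f y" for f
  proof -
    have "U f x = (LINT y|N. f y)" by (rule submarkov_integral_rep[OF U sp f N])
    also have "\<dots> = (LINT y|M. u y * f y)"
      unfolding N_dens using f ubm u_le by (subst integral_density) auto
    finally show ?thesis .
  qed
  have rep: "U f x = (LINT y|M. u y * f y)" if f: "bm M f" for f
  proof -
    obtain B where B: "B \<ge> 0" "\<And>y. \<bar>f y\<bar> \<le> B" using bm_bound[OF f] by auto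
    \<comment> \<open>A shift by a constant reduces signed functions to \<open>rep0\<close>.\<close>
    have "0 \<le> f y + B" for y using B(2)[of y] by linarith
    then have "U (\<lambda>y. f y + B) x = (LINT y|M. u y * (f y + B))"
      using f by (intro rep0 bm_intros)
    also have "\<dots> = (LINT y|M. u y * f y) + (LINT y|M. u y * B)"
      unfolding distrib_left using f ubm by (simp only: integral_bm bm_intros)
    also have "(LINT y|M. u y * B) = U (\<lambda>_. B) x" using B by (intro rep0[symmetric]) auto
    finally show ?thesis using submarkov_add[OF U f bm_const, of B] by simp
  qed
  have "(LINT y|M. u y) = U (\<lambda>_. 1) x" using rep[of "\<lambda>_. 1"] by simp
  then have "(LINT y|M. u y) \<le> 1" using submarkov_one[OF U, of x] by simp
  with that[of u] ubm u_le rep show ?thesis by blast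
qed

text \<open>Write \<beta> for this rate. Time m of the walk is paired with the scale y = \<beta> m
  h^2 of the Nash inequality; the choice makes \<delta> / (\<beta> * C1) = 2 d, twice the exponent
  of the decay to be proved.\<close>

definition nash_rate :: "real \<Rightarrow> nat \<Rightarrow> real \<Rightarrow> real" where
  "nash_rate \<delta> d C1 = \<delta> / (2 * real d * C1)"

text \<open>Origin of time: from m = \<open>nash_shift\<close> on, the scale \<beta> m h^2 is at
  least h^2 and the factor 1 - 2 d / m is nonnegative.\<close>

definition nash_shift :: "real \<Rightarrow> nat \<Rightarrow> real \<Rightarrow> nat" where
  "nash_shift \<delta> d C1 = nat \<lceil>1 / nash_rate \<delta> d C1\<rceil> + 2 * d"

text \<open>The first summand covers time 0; the second lets d times the constant absorb the L1 term
  of the Nash inequality.\<close>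

definition nash_const :: "real \<Rightarrow> nat \<Rightarrow> real \<Rightarrow> real \<Rightarrow> real" where
  "nash_const \<delta> d C1 C0 = C0 * real (nash_shift \<delta> d C1) ^ d
     + \<delta> / nash_rate \<delta> d C1 * (1 / nash_rate \<delta> d C1) ^ d / real d"

section \<open>Decay of L2 norms from a Nash inequality\<close>

context spectrally_bounded_markov
begin

text \<open>With a k the squared L2 norm of S^k u, \<open>S_square_le\<close> gives a (k + 1) \<le>
  a k - \<delta> * energy. The Nash inequality, at a scale that grows linearly in time, bounds the
  energy below by a multiple of a k / m up to the L1 term. So a k decays like (k h^2)^(-d) until the
  scale reaches 1, at a time of order h^-2, and does not increase afterwards.\<close>

lemma nash_decay:
  assumes h: "0 < h" and C1: "0 < C1" and C0: "0 \<le> C0" and d: "0 < d"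
    and nash: "\<And>f y. bm M f \<Longrightarrow> h\<^sup>2 \<le> y \<Longrightarrow> y \<le> 1 \<Longrightarrow>
        (LINT x|M. (f x)\<^sup>2) \<le> C1 * (y / h\<^sup>2 * energy f + (1 / y) ^ d * (LINT x|M. \<bar>f x\<bar>)\<^sup>2)"
    and u: "bm M u" "(LINT x|M. \<bar>u x\<bar>) \<le> 1" "(LINT x|M. (u x)\<^sup>2) \<le> C0 * (1 / h\<^sup>2) ^ d"
    and k: "1 / (nash_rate \<delta> d C1 * h\<^sup>2) \<le> real k"
  shows "(LINT x|M. ((S ^^ k) u x)\<^sup>2) \<le> nash_const \<delta> d C1 C0 * nash_rate \<delta> d C1 ^ d"
proof -
  define \<beta> where "\<beta> = nash_rate \<delta> d C1"
  define k1 where "k1 = nash_shift \<delta> d C1"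
  define A where "A = nash_const \<delta> d C1 C0"
  define a where "a k = (LINT x|M. ((S ^^ k) u x)\<^sup>2)" for k
  have \<beta>: "\<beta> > 0" "\<delta> / (\<beta> * C1) = 2 * real d" using delta C1 d by (auto simp: \<beta>_def nash_rate_def)
  have k1: "1 / \<beta> \<le> real k1" "2 * real d \<le> real k1"
    unfolding k1_def nash_shift_def \<beta>_def[symmetric] using real_nat_ceiling_ge[of "1 / \<beta>"] by auto
  have k1': "1 \<le> k1" using k1(2) d by linarith
  have A1: "C0 * real k1 ^ d \<le> A" "\<delta> / \<beta> * (1 / \<beta>) ^ d \<le> real d * A" "0 \<le> A"
    unfolding A_def nash_const_def k1_def[symmetric] \<beta>_def[symmetric] using \<beta> d C0 delta
    by (auto simp: distrib_left)
  have decr: "a (Suc k) \<le> a k - \<delta> * energy ((S ^^ k) u)" for k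
    using S_square_le[OF Sk_bm[OF u(1), of k]] by (simp add: a_def)
  have mono: "a k \<le> a j" if "j \<le> k" for j k
    using that
  proof (induction k rule: dec_induct)
    case (step k)
    have "a (Suc k) \<le> a k" using S_contraction[OF Sk_bm[OF u(1), of k]] by (simp add: a_def)
    then show ?case using step by simp
  qed simp
  \<comment> \<open>For k + 1 the condition reads \<beta> (k + k1) h^2 \<le> 1, exactly what the
    Nash inequality at time k asks for.\<close>
  have main: "a k \<le> A * (1 / (real (k + k1) * h\<^sup>2)) ^ d" if "k = 0 \<or> \<beta> * real (k + k1 - 1) * h\<^sup>2 \<le> 1" for k
    using that
  proof (induction k)
    case 0
    have "a 0 \<le> C0 * (1 / h\<^sup>2) ^ d" using u by (simp add: a_def)
    also have "\<dots> = C0 * real k1 ^ d * (1 / (real k1 * h\<^sup>2)) ^ d"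
      using k1' by (simp add: power_divide power_mult_distrib)
    also have "\<dots> \<le> A * (1 / (real k1 * h\<^sup>2)) ^ d" using A1 by (intro mult_right_mono) auto
    finally show ?case by simp
  next
    case (Suc k)
    define m where "m = real (k + k1)"
    define X where "X = (1 / (m * h\<^sup>2)) ^ d"
    have m: "1 \<le> m" "1 / \<beta> \<le> m" "2 * real d \<le> m" using k1 k1' by (auto simp: m_def)
    have ym: "\<beta> * m * h\<^sup>2 \<le> 1" using Suc.prems by (simp add: m_def)
    have "a k \<le> A * X"
      unfolding X_def m_def
    proof (rule Suc.IH, cases "k = 0")
      case False
      have "\<beta> * real (k + k1 - 1) * h\<^sup>2 \<le> \<beta> * m * h\<^sup>2"
        using \<beta> by (intro mult_right_mono mult_left_mono) (auto simp: m_def)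
      then show "k = 0 \<or> \<beta> * real (k + k1 - 1) * h\<^sup>2 \<le> 1" using ym by simp
    qed simp
    have X: "X > 0" using m h by (auto simp: X_def)
    have y1: "h\<^sup>2 \<le> \<beta> * m * h\<^sup>2"
      using m(2) \<beta> h by (simp add: field_simps)
    have L1: "(LINT x|M. \<bar>(S ^^ k) u x\<bar>)\<^sup>2 \<le> 1"
      using integral_abs_Sk[OF u(1), of k] u(2) by (intro power_le_one) auto
    have "a k \<le> C1 * (\<beta> * m * h\<^sup>2 / h\<^sup>2 * energy ((S ^^ k) u) + (1 / (\<beta> * m * h\<^sup>2)) ^ d * (LINT x|M. \<bar>(S ^^ k) u x\<bar>)\<^sup>2)"
      unfolding a_def by (rule nash[OF Sk_bm[OF u(1)] y1 ym])
    also have "\<dots> \<le> C1 * (\<beta> * m * energy ((S ^^ k) u) + (1 / (\<beta> * m * h\<^sup>2)) ^ d * 1)"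
      using h C1 \<beta> m L1 by (intro mult_left_mono add_mono) auto
    also have "(1 / (\<beta> * m * h\<^sup>2)) ^ d * 1 = (1 / \<beta>) ^ d * X"
      by (simp add: X_def power_mult_distrib power_divide mult.assoc)
    finally have "a k / C1 - (1 / \<beta>) ^ d * X \<le> \<beta> * m * energy ((S ^^ k) u)"
      using C1 by (simp add: field_simps)
    then have "(\<delta> / (\<beta> * m)) * (a k / C1 - (1 / \<beta>) ^ d * X) \<le> \<delta> / (\<beta> * m) * (\<beta> * m * energy ((S ^^ k) u))"
      using \<beta> m delta by (intro mult_left_mono) auto
    also have "\<dots> = \<delta> * energy ((S ^^ k) u)" using \<beta> m by simp
    finally have "a (Suc k) \<le> a k - (\<delta> / (\<beta> * m)) * (a k / C1 - (1 / \<beta>) ^ d * X)"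
      using decr[of k] by linarith
    also have "\<dots> = (1 - \<delta> / (\<beta> * C1) / m) * a k + (\<delta> / \<beta> * (1 / \<beta>) ^ d) * X / m"
      by (simp add: algebra_simps)
    \<comment> \<open>One half of the gain 2 d / m pays for the L1 term. The other half remains, and
      Bernoulli's inequality 1 - d / (m + 1) \<le> (m / (m + 1))^d turns the power of 1 / m into
      that of 1 / (m + 1).\<close>
    also have "\<dots> \<le> (1 - 2 * real d / m) * (A * X) + (real d * A) * X / m"
      unfolding \<beta>(2) using \<open>a k \<le> A * X\<close> m X A1
      by (intro add_mono mult_left_mono divide_right_mono mult_right_mono) (auto simp: field_simps)
    also have "\<dots> = A * X * (1 - real d / m)" using m by (simp add: field_simps)
    also have "\<dots> \<le> A * X * (1 - real d / (m + 1))"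
      using m A1 X by (intro mult_left_mono) (auto intro!: divide_left_mono)
    also have "\<dots> \<le> A * X * (m / (m + 1)) ^ d"
    proof -
      have "1 + real d * (- (1 / (m + 1))) \<le> (1 + (- (1 / (m + 1)))) ^ d"
        using m by (intro Bernoulli_inequality) auto
      also have "1 + (- (1 / (m + 1))) = m / (m + 1)" using m by (simp add: field_simps)
      finally show ?thesis using A1 X by (intro mult_left_mono) auto
    qed
    also have "\<dots> = A * (1 / ((m + 1) * h\<^sup>2)) ^ d"
      using m by (simp add: X_def power_divide power_mult_distrib)
    finally show ?case by (simp add: m_def add.commute add.left_commute)
  qed
  \<comment> \<open>The time at which the scale reaches 1. If it is at most k1, then h is bounded
    below and the initial bound suffices.\<close>
  define z where "z = 1 / (\<beta> * h\<^sup>2)"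
  have z: "z > 0" "1 / h\<^sup>2 = \<beta> * z" using \<beta> h by (auto simp: z_def)
  have kz: "z \<le> real k" using k by (simp add: z_def \<beta>_def)
  have "a k \<le> A * \<beta> ^ d"
  proof (cases "z \<le> real k1")
    case True
    have "a k \<le> a 0" by (rule mono) simp
    also have "\<dots> \<le> C0 * (\<beta> * z) ^ d" using u by (simp add: a_def z)
    also have "\<dots> \<le> C0 * (\<beta> * real k1) ^ d"
      using True z \<beta> C0 by (intro mult_left_mono power_mono) auto
    also have "\<dots> = C0 * real k1 ^ d * \<beta> ^ d" by (simp add: power_mult_distrib)
    also have "\<dots> \<le> A * \<beta> ^ d" using A1 \<beta> by (intro mult_right_mono) auto
    finally show ?thesis .
  next
    case False
    \<comment> \<open>The last time that \<open>main\<close> reaches is n0 - k1 + 1, because its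
      condition there is \<beta> n0 h^2 \<le> 1; the bound obtained involves n0 + 1 \<ge> z.\<close>
    define n0 where "n0 = nat \<lfloor>z\<rfloor>"
    have n0: "real n0 \<le> z" "z \<le> real n0 + 1" "k1 \<le> n0"
      using False z by (auto simp: n0_def le_nat_iff) linarith+
    have K: "n0 - k1 + 1 \<le> k" using n0 kz k1' by linarith
    have eq: "n0 - k1 + 1 + k1 = n0 + 1" using n0 by simp
    have "\<beta> * real (n0 - k1 + 1 + k1 - 1) * h\<^sup>2 \<le> \<beta> * z * h\<^sup>2"
      unfolding eq using n0 \<beta> by (intro mult_right_mono mult_left_mono) auto
    also have "\<dots> = 1" using \<beta> h by (simp add: z_def)
    finally have "a (n0 - k1 + 1) \<le> A * (1 / (real (n0 + 1) * h\<^sup>2)) ^ d"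
      using main[of "n0 - k1 + 1"] eq by simp
    also have "1 / (real (n0 + 1) * h\<^sup>2) = \<beta> * z / real (n0 + 1)" unfolding z(2)[symmetric] by simp
    also have "A * (\<beta> * z / real (n0 + 1)) ^ d = A * (\<beta> * (z / real (n0 + 1))) ^ d" by simp
    also have "\<dots> \<le> A * \<beta> ^ d"
    proof -
      have "\<beta> * (z / real (n0 + 1)) \<le> \<beta> * 1" using \<beta> n0 by (intro mult_left_mono) auto
      then show ?thesis using A1 \<beta> z by (intro mult_left_mono power_mono) auto
    qed
    finally show ?thesis using mono[OF K] by simp
  qed
  then show ?thesis by (simp add: a_def A_def \<beta>_def)
qed

end

section \<open>Uniform convergence of a walk with a regularizing part\<close>

locale regularizing_walk = spectrally_bounded_markov M S \<delta> for M :: "'a measure" and S \<delta> +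
  fixes U :: "('a \<Rightarrow> real) \<Rightarrow> 'a \<Rightarrow> real" and n d :: nat and h C1 C0 Cg g :: real
  assumes h: "0 < h" "h \<le> 1" and n: "0 < n"
    and nash: "\<And>f y. bm M f \<Longrightarrow> h\<^sup>2 \<le> y \<Longrightarrow> y \<le> 1 \<Longrightarrow>
        (LINT x|M. (f x)\<^sup>2) \<le> C1 * (y / h\<^sup>2 * energy f + (1 / y) ^ d * (LINT x|M. \<bar>f x\<bar>)\<^sup>2)"
    and U: "submarkov M U"
    and U_one: "\<And>x. \<delta> \<le> U (\<lambda>_. 1) x"
    and U_le: "\<And>f x. bm M f \<Longrightarrow> (\<And>y. 0 \<le> f y) \<Longrightarrow> U f x \<le> (S ^^ n) f x"
    and U_dom: "\<And>f x. bm M f \<Longrightarrow> (\<And>y. 0 \<le> f y) \<Longrightarrow> U f x \<le> C0 * (1 / h\<^sup>2) ^ d * (LINT y|M. f y)"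
    and gap_pos: "0 < g" and gap_le: "g \<le> Cg * h\<^sup>2"
    and gap: "\<And>u. bm M u \<Longrightarrow> (LINT x|M. (u x)\<^sup>2) - (LINT x|M. u x)\<^sup>2 \<le> 1 / g * energy u"
begin

lemma Sk_submarkov: "submarkov M (S ^^ k)"
  by (rule submarkov_funpow[OF S])

lemma Sk_one: "(S ^^ k) (\<lambda>_. 1) = (\<lambda>_. 1)"
  by (induction k) (auto simp: S_one)

text \<open>\<open>S\<^sup>n - U\<close> is positive and maps 1 to at most 1 - \<delta>; it is
  applied to B - f and to B + f.\<close>

lemma Sn_minus_U_bound:
  assumes f: "bm M f" "\<And>x. \<bar>f x\<bar> \<le> B"
  shows "\<bar>(S ^^ n) f x\<bar> \<le> (1 - \<delta>) * B + \<bar>U f x\<bar>"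
proof -
  have p: "U (\<lambda>y. B - f y) x \<le> (S ^^ n) (\<lambda>y. B - f y) x" "U (\<lambda>y. B + f y) x \<le> (S ^^ n) (\<lambda>y. B + f y) x"
  proof -
    have "0 \<le> B - f y" "0 \<le> B + f y" for y using f(2)[of y] by linarith+
    then show "U (\<lambda>y. B - f y) x \<le> (S ^^ n) (\<lambda>y. B - f y) x" "U (\<lambda>y. B + f y) x \<le> (S ^^ n) (\<lambda>y. B + f y) x"
      using f(1) by (auto intro!: U_le bm_intros)
  qed
  have B: "B \<ge> 0" using f(2)[of x] by simp
  have c: "U (\<lambda>y. B) x = B * U (\<lambda>_. 1) x" "(S ^^ n) (\<lambda>y. B) x = B"
    using fun_cong[OF submarkov_const[OF U, of B], of x] fun_cong[OF submarkov_const[OF Sk_submarkov, of n B], of x]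
    by (auto simp: Sk_one)
  have "B * \<delta> \<le> B * U (\<lambda>_. 1) x" using B U_one by (intro mult_left_mono) auto
  then show ?thesis
    using p c f by (auto simp: submarkov_diff[OF U] submarkov_add[OF U] submarkov_diff[OF Sk_submarkov] submarkov_add[OF Sk_submarkov] algebra_simps abs_le_iff)
qed

text \<open>Split \<open>S\<^sup>n = V + U\<close> with \<open>V 1 \<le> 1 - \<delta>\<close> and expand the powers.\<close>

lemma power_sup_bound:
  assumes f: "bm M f" "\<And>x. \<bar>f x\<bar> \<le> B" and D: "\<And>l x. \<bar>U ((S ^^ (n * l)) f) x\<bar> \<le> D"
  shows "\<bar>(S ^^ (n * m)) f x\<bar> \<le> (1 - \<delta>) ^ m * B + D / \<delta>"
proof (induction m arbitrary: x)
  case 0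
  have "0 \<le> D" using D[of 0 x] by linarith
  then show ?case using f(2)[of x] delta by (simp add: order_trans[OF f(2)])
next
  case (Suc m)
  have eq: "(S ^^ (n * Suc m)) f = (S ^^ n) ((S ^^ (n * m)) f)" by (simp add: funpow_add)
  have "\<bar>(S ^^ (n * Suc m)) f x\<bar> \<le> (1 - \<delta>) * ((1 - \<delta>) ^ m * B + D / \<delta>) + \<bar>U ((S ^^ (n * m)) f) x\<bar>"
    unfolding eq by (intro Sn_minus_U_bound Sk_bm f Suc.IH)
  also have "\<dots> \<le> (1 - \<delta>) * ((1 - \<delta>) ^ m * B + D / \<delta>) + D" using D[of m x] by simp
  also have "\<dots> = (1 - \<delta>) ^ Suc m * B + D / \<delta>" using delta by (simp add: field_simps)
  finally show ?case .
qed

text \<open>By symmetry S^l passes from \<open>f\<close> to the density u of \<open>U\<close> at x,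
  and Cauchy-Schwarz remains. The norm of u gives at all times a bound that grows like h^(-d); from
  a time of order h^-2 on, \<open>nash_decay\<close> gives one free of h.\<close>

lemma U_power_bounds:
  assumes f: "bm M f" and C1: "0 < C1" and C0: "0 \<le> C0" and d: "0 < d"
  shows "\<bar>U ((S ^^ l) f) x\<bar> \<le> sqrt (C0 * (1 / h\<^sup>2) ^ d) * sqrt (LINT x|M. (f x)\<^sup>2)"
    and "1 / (nash_rate \<delta> d C1 * h\<^sup>2) \<le> real l \<Longrightarrow>
      \<bar>U ((S ^^ l) f) x\<bar> \<le> sqrt (nash_const \<delta> d C1 C0 * nash_rate \<delta> d C1 ^ d) * sqrt (LINT x|M. (f x)\<^sup>2)"
proof -
  define D where "D = C0 * (1 / h\<^sup>2) ^ d"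
  have D: "0 \<le> D" using C0 by (simp add: D_def)
  obtain u where u: "bm M u" "\<And>y. 0 \<le> u y" "\<And>y. u y \<le> D" "(LINT y|M. u y) \<le> 1"
    "\<And>f. bm M f \<Longrightarrow> U f x = (LINT y|M. u y * f y)"
    using submarkov_density[OF U space_UNIV D, of x] U_dom unfolding D_def by blast
  have "U ((S ^^ l) f) x = (LINT y|M. (S ^^ l) u y * f y)"
    using u(5)[OF Sk_bm[OF f]] Sk_sym[OF u(1) f] by simp
  then have cs: "\<bar>U ((S ^^ l) f) x\<bar> \<le> sqrt (LINT y|M. ((S ^^ l) u y)\<^sup>2) * sqrt (LINT x|M. (f x)\<^sup>2)"
    using cauchy_schwarz_bm[OF Sk_bm[OF u(1)] f] by simp
  \<comment> \<open>Here u^2 \<le> D u, and u has mass at most 1.\<close>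
  have "(LINT y|M. (u y)\<^sup>2) \<le> (LINT y|M. D * u y)"
    using u by (intro integral_mono integrable_bm bm_intros) (auto simp: power2_eq_square mult_right_mono)
  also have "\<dots> \<le> D * 1" using u(4) D by (simp add: mult_left_le)
  finally have u2: "(LINT y|M. (u y)\<^sup>2) \<le> C0 * (1 / h\<^sup>2) ^ d" by (simp add: D_def)
  have contr: "(LINT y|M. ((S ^^ l) u y)\<^sup>2) \<le> (LINT y|M. (u y)\<^sup>2)"
  proof (induction l)
    case (Suc l)
    then show ?case using S_contraction[OF Sk_bm[OF u(1), of l]] by simp
  qed simp
  show "\<bar>U ((S ^^ l) f) x\<bar> \<le> sqrt (C0 * (1 / h\<^sup>2) ^ d) * sqrt (LINT x|M. (f x)\<^sup>2)"
    using contr u2 by (intro order_trans[OF cs] mult_right_mono real_sqrt_le_mono) auto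
  assume l: "1 / (nash_rate \<delta> d C1 * h\<^sup>2) \<le> real l"
  have "(LINT y|M. \<bar>u y\<bar>) \<le> 1" using u by simp
  from nash_decay[OF h(1) C1 C0 d nash u(1) this u2 l]
  show "\<bar>U ((S ^^ l) f) x\<bar> \<le> sqrt (nash_const \<delta> d C1 C0 * nash_rate \<delta> d C1 ^ d) * sqrt (LINT x|M. (f x)\<^sup>2)"
    by (intro order_trans[OF cs] mult_right_mono real_sqrt_le_mono) auto
qed

text \<open>A block of m = 2 n L steps, with L of order h^-2, contracts the sup norm up to an L2
  term. In its first half \<open>U\<close> meets only the bound D, of order h^(-d). The second half
  multiplies this by (1 - \<delta>)^L, which beats every power of h; and there \<open>U\<close> acts
  after at least L steps, so the bound free of h applies. The result is sup(m + k) \<le> r sup(k) +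
  C2 a(k), where r e^G \<le> 1/2.\<close>

lemma mean_zero_sup_decay:
  assumes f: "bm M f" "(LINT x|M. f x) = 0" "\<And>x. \<bar>f x\<bar> \<le> 1"
    and C1: "0 < C1" and C0: "0 \<le> C0" and d: "0 < d" and g_le: "g \<le> \<delta> / 2" and Cg: "0 \<le> Cg"
    and G: "G = 2 * real n * Cg * (1 / nash_rate \<delta> d C1 + 1)"
    and C2: "C2 = (sqrt C0 * (fact d * (nash_rate \<delta> d C1 / \<delta>) ^ d) + sqrt (nash_const \<delta> d C1 C0 * nash_rate \<delta> d C1 ^ d)) / \<delta>"
    and small: "exp (- 2 * \<delta> / (nash_rate \<delta> d C1 * h\<^sup>2)) * exp G \<le> 1 / 2"
  shows "\<bar>(S ^^ k) f x\<bar> \<le> (2 * C2 + 1) * exp G * exp (- real k * g)"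
proof -
  define \<beta> where "\<beta> = nash_rate \<delta> d C1"
  define z where "z = 1 / (\<beta> * h\<^sup>2)"
  define L where "L = nat \<lceil>z\<rceil>"
  define m where "m = n * L + n * L"
  define r where "r = (1 - \<delta>) ^ L * (1 - \<delta>) ^ L"
  define a where "a k = sqrt (LINT x|M. ((S ^^ k) f x)\<^sup>2)" for k
  have \<beta>: "\<beta> > 0" using delta C1 d by (auto simp: \<beta>_def nash_rate_def)
  have z: "z > 0" "1 / h\<^sup>2 = \<beta> * z" using \<beta> h by (auto simp: z_def)
  have L: "z \<le> real L" "real L \<le> z + 1" using z unfolding L_def by linarith+
  have h1: "1 \<le> 1 / h\<^sup>2" using h power_le_one[of h 2] by (simp add: field_simps)
  have expL: "(1 - \<delta>) ^ L \<le> exp (- \<delta> * z)"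
  proof -
    have "(1 - \<delta>) ^ L \<le> exp (- \<delta>) ^ L"
      using exp_ge_add_one_self[of "- \<delta>"] delta by (intro power_mono) auto
    also have "\<dots> = exp (- \<delta> * real L)" by (simp add: exp_of_nat_mult[symmetric] mult.commute)
    also have "\<dots> \<le> exp (- \<delta> * z)" using L delta by simp
    finally show ?thesis .
  qed
  have r: "0 \<le> r" "r * exp G \<le> 1 / 2"
  proof -
    show "0 \<le> r" using delta by (simp add: r_def)
    have "r \<le> exp (- \<delta> * z) * exp (- \<delta> * z)"
      unfolding r_def using expL delta by (intro mult_mono) auto
    also have "\<dots> = exp (- 2 * \<delta> / (\<beta> * h\<^sup>2))" by (simp add: exp_add[symmetric] z_def)
    finally have "r * exp G \<le> exp (- 2 * \<delta> / (\<beta> * h\<^sup>2)) * exp G" by (intro mult_right_mono) auto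
    also have "\<dots> \<le> 1 / 2" using small by (simp only: \<beta>_def)
    finally show "r * exp G \<le> 1 / 2" .
  qed
  \<comment> \<open>The upper bound for the gap enters here: over one block the target e^(-k g)
    shrinks by no more than the factor e^G.\<close>
  have mg: "real m * g \<le> G"
  proof -
    have "real m = 2 * real n * real L" by (simp add: m_def)
    also have "\<dots> \<le> 2 * real n * (z + 1)" using L by (intro mult_left_mono) auto
    finally have "real m * g \<le> (2 * real n * (z + 1)) * (Cg * h\<^sup>2)"
      using gap_le gap_pos z by (intro mult_mono) auto
    also have "\<dots> = 2 * real n * Cg * (z * h\<^sup>2 + h\<^sup>2)" by (simp add: algebra_simps)
    also have "z * h\<^sup>2 = 1 / \<beta>" using h by (simp add: z_def)
    also have "2 * real n * Cg * (1 / \<beta> + h\<^sup>2) \<le> G"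
      unfolding G \<beta>_def using Cg h power_le_one[of h 2] by (intro mult_left_mono add_left_mono) auto
    finally show ?thesis .
  qed
  have gap0: "g * (LINT x|M. (u x)\<^sup>2) \<le> energy u" if "bm M u" "(LINT x|M. u x) = 0" for u
    using gap[OF that(1)] that(2) gap_pos by (simp add: field_simps)
  have a_le: "a k \<le> exp (- real k * g)" for k
  proof -
    have "(LINT x|M. (f x)\<^sup>2) \<le> (LINT x|M. 1)"
      using f by (intro integral_mono integrable_bm bm_intros) (auto simp: abs_square_le_1)
    then have f1: "(LINT x|M. (f x)\<^sup>2) \<le> 1" by (simp add: prob_space)
    have "(LINT x|M. ((S ^^ k) f x)\<^sup>2) \<le> exp (- 2 * real k * g) * (LINT x|M. (f x)\<^sup>2)"
      by (rule mean_zero_decay_power[OF f(1,2) gap_pos g_le gap0])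
    also have "\<dots> \<le> exp (- 2 * real k * g) * 1" using f1 by (intro mult_left_mono) auto
    also have "\<dots> = (exp (- real k * g))\<^sup>2" by (simp add: power2_eq_square exp_add[symmetric])
    finally show ?thesis unfolding a_def by (rule real_le_lsqrt[rotated]) auto
  qed
  have step: "\<bar>(S ^^ (m + k)) f x\<bar> \<le> r * B + C2 * a k" if B: "\<And>x. \<bar>(S ^^ k) f x\<bar> \<le> B" for k B x
  proof -
    define w where "w = (S ^^ k) f"
    define D where "D = sqrt (C0 * (1 / h\<^sup>2) ^ d) * a k"
    define D' where "D' = sqrt (nash_const \<delta> d C1 C0 * \<beta> ^ d) * a k"
    have w: "bm M w" "\<And>x. \<bar>w x\<bar> \<le> B" using B f by (auto simp: w_def Sk_bm)
    have ak: "a k = sqrt (LINT x|M. (w x)\<^sup>2)" "0 \<le> a k" by (auto simp: a_def w_def)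
    have b1: "\<bar>(S ^^ (n * L)) w x\<bar> \<le> (1 - \<delta>) ^ L * B + D / \<delta>" for x
      by (rule power_sup_bound[OF w]) (unfold D_def ak, rule U_power_bounds(1)[OF w(1) C1 C0 d])
    have b2: "\<bar>(S ^^ (n * L)) ((S ^^ (n * L)) w) x\<bar> \<le> (1 - \<delta>) ^ L * ((1 - \<delta>) ^ L * B + D / \<delta>) + D' / \<delta>" for x
    proof (rule power_sup_bound[OF Sk_bm[OF w(1)] b1])
      fix l x
      have "z \<le> real (n * l + n * L)"
      proof -
        have "L \<le> n * L" using n by simp
        then have "L \<le> n * l + n * L" by linarith
        then show ?thesis using L(1) of_nat_mono[of L "n * l + n * L", where 'a=real] by linarith
      qed
      then show "\<bar>U ((S ^^ (n * l)) ((S ^^ (n * L)) w)) x\<bar> \<le> D'"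
        using U_power_bounds(2)[OF w(1) C1 C0 d, of "n * l + n * L" x]
        by (simp add: D'_def ak z_def \<beta>_def funpow_add)
    qed
    have "(1 - \<delta>) ^ L * D \<le> sqrt C0 * (fact d * (\<beta> / \<delta>) ^ d) * a k"
    proof -
      \<comment> \<open>The root is dropped, which only enlarges the bound since 1 / h^2 \<ge> 1;
        the loss disappears in the exponential.\<close>
      have "sqrt ((1 / h\<^sup>2) ^ d) \<le> (1 / h\<^sup>2) ^ d"
      proof -
        define X where "X = (1 / h\<^sup>2) ^ d"
        have "1 \<le> X" unfolding X_def by (rule one_le_power[OF h1])
        then have "sqrt X \<le> sqrt (X * X)" by (intro real_sqrt_le_mono) simp
        with \<open>1 \<le> X\<close> show ?thesis by (simp flip: X_def)
      qed
      then have D1: "D \<le> sqrt C0 * (1 / h\<^sup>2) ^ d * a k"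
        unfolding D_def real_sqrt_mult using ak C0 by (intro mult_right_mono mult_left_mono) auto
      \<comment> \<open>A single term of the exponential series controls the power of z, and with it
        the power of 1 / h^2.\<close>
      have "(\<delta> * z) ^ d / fact d \<le> exp (\<delta> * z)"
      proof -
        have "(\<Sum>i\<in>{d}. (\<delta> * z) ^ i /\<^sub>R fact i) \<le> (\<Sum>i. (\<delta> * z) ^ i /\<^sub>R fact i)"
          using delta z by (intro sum_le_suminf summable_exp_generic) auto
        then show ?thesis by (simp add: exp_def field_simps)
      qed
      then have "exp (- \<delta> * z) * (\<delta> * z) ^ d \<le> fact d"
        by (simp add: exp_minus field_simps)
      then have "exp (- \<delta> * z) * (1 / h\<^sup>2) ^ d \<le> fact d * (\<beta> / \<delta>) ^ d"
        using mult_right_mono[of "exp (- \<delta> * z) * (\<delta> * z) ^ d" "fact d" "(\<beta> / \<delta>) ^ d"] delta \<beta>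
        by (simp add: z power_mult_distrib power_divide field_simps)
      then have e: "(1 - \<delta>) ^ L * (1 / h\<^sup>2) ^ d \<le> fact d * (\<beta> / \<delta>) ^ d"
        using mult_right_mono[OF expL, of "(1 / h\<^sup>2) ^ d"] by simp
      have "(1 - \<delta>) ^ L * D \<le> (1 - \<delta>) ^ L * (sqrt C0 * (1 / h\<^sup>2) ^ d * a k)"
        using D1 delta by (intro mult_left_mono) auto
      also have "\<dots> = sqrt C0 * ((1 - \<delta>) ^ L * (1 / h\<^sup>2) ^ d) * a k" by (simp add: algebra_simps)
      also have "\<dots> \<le> sqrt C0 * (fact d * (\<beta> / \<delta>) ^ d) * a k"
        using e C0 ak by (intro mult_right_mono mult_left_mono) auto
      finally show ?thesis .
    qed
    then have "(1 - \<delta>) ^ L * D / \<delta> \<le> sqrt C0 * (fact d * (\<beta> / \<delta>) ^ d) * a k / \<delta>"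
      using delta by (intro divide_right_mono) auto
    moreover have "(S ^^ (m + k)) f = (S ^^ (n * L)) ((S ^^ (n * L)) w)"
      by (simp add: m_def w_def funpow_add)
    ultimately show ?thesis
      using b2[of x] by (simp add: r_def C2 D'_def \<beta>_def[symmetric] algebra_simps add_divide_distrib)
  qed
  have C2nn: "0 \<le> C2"
    unfolding C2 \<beta>_def[symmetric] using delta \<beta> C0 d
    by (auto simp: nash_const_def \<beta>_def[symmetric] intro!: divide_nonneg_nonneg add_nonneg_nonneg mult_nonneg_nonneg)
  let ?Q = "(2 * C2 + 1) * exp G"
  show ?thesis
  proof (induction k arbitrary: x rule: less_induct)
    case (less k)
    show ?case
    proof (cases "k < m")
      case True
      have "1 \<le> exp G * exp (- real k * g)"
      proof -
        have "real k * g \<le> real m * g" using True gap_pos by (intro mult_right_mono) auto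
        then show ?thesis using mg by (simp add: exp_add[symmetric])
      qed
      also have "\<dots> \<le> ?Q * exp (- real k * g)"
        using C2nn by (intro mult_right_mono) auto
      finally show ?thesis
        using submarkov_abs_bound[OF Sk_submarkov f(1,3), of k x] by simp
    next
      case False
      define j where "j = k - m"
      have k: "k = m + j" using False by (simp add: j_def)
      have e: "exp (- real k * g) = exp (- real m * g) * exp (- real j * g)"
        by (simp add: k exp_add[symmetric] algebra_simps)
      have em: "1 \<le> exp G * exp (- real m * g)" using mg by (simp add: exp_add[symmetric])
      have "\<bar>(S ^^ k) f x\<bar> \<le> r * (?Q * exp (- real j * g)) + C2 * a j"
      \<comment> \<open>The block length is positive because L \<ge> z > 0; hence j < k and the
        induction hypothesis applies.\<close>
      proof (cases "m = 0")
        case True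
        then have "L = 0" using n by (simp add: m_def)
        then show ?thesis using L z by simp
      next
        case False
        then show ?thesis unfolding k by (intro step less.IH) (simp add: k)
      qed
      also have "\<dots> \<le> r * (?Q * exp (- real j * g)) + C2 * exp (- real j * g)"
        using a_le[of j] C2nn by (intro add_left_mono mult_left_mono) auto
      also have "\<dots> = ((r * exp G) * (2 * C2 + 1) + C2) * exp (- real j * g)" by (simp add: algebra_simps)
      \<comment> \<open>The constant 2 C2 + 1 is made for this point: half of it plus C2 is again at
        most 2 C2 + 1.\<close>
      also have "\<dots> \<le> (1 / 2 * (2 * C2 + 1) + C2) * exp (- real j * g)"
        using r C2nn by (intro mult_right_mono add_right_mono) auto
      also have "\<dots> \<le> (2 * C2 + 1) * exp (- real j * g)" by (intro mult_right_mono) auto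
      also have "\<dots> \<le> (2 * C2 + 1) * (exp G * exp (- real m * g)) * exp (- real j * g)"
        using em C2nn by (intro mult_right_mono) (auto intro: mult_right_mono[of 1, simplified] simp: mult_le_cancel_left1)
      finally show ?thesis unfolding e by (simp only: mult.assoc)
    qed
  qed
qed

lemma deviation_from_mean:
  assumes B: "B \<in> sets M"
  shows "(S ^^ k) (indicat_real B) x - measure M B = (S ^^ k) (\<lambda>y. indicat_real B y - measure M B) x"
    and "bm M (\<lambda>y. indicat_real B y - measure M B)" "(LINT y|M. indicat_real B y - measure M B) = 0"
    and "\<bar>indicat_real B y - measure M B\<bar> \<le> 1"
proof -
  show 1: "bm M (\<lambda>y. indicat_real B y - measure M B)" using B by (intro bm_intros bm_indicator)
  show "(LINT y|M. indicat_real B y - measure M B) = 0"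
    using integral_bm_diff[OF bm_indicator[OF B] bm_const[of M "measure M B"]] B by (simp add: prob_space)
  show "\<bar>indicat_real B y - measure M B\<bar> \<le> 1"
    using prob_le_1[of B] by (auto simp: indicator_def)
  show "(S ^^ k) (indicat_real B) x - measure M B = (S ^^ k) (\<lambda>y. indicat_real B y - measure M B) x"
    using B submarkov_const[OF Sk_submarkov, of k "measure M B"]
    by (simp add: submarkov_diff[OF Sk_submarkov] bm_indicator Sk_one)
qed

end

text \<open>The space, the operators and the gap are quantified after \<open>h0\<close> and
  \<open>C\<close>: for each h there is another walk, and only the constants are common to all of
  them.\<close>

theorem regularizing_walk_mixing:
  fixes \<delta> C1 C0 Cg :: real and n d :: nat
  assumes \<delta>: "0 < \<delta>" and C1: "0 < C1" and C0: "0 \<le> C0" and Cg: "0 < Cg" and d: "0 < d"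
  shows "\<exists>h0>0. \<exists>C>0. \<forall>h\<in>{0<..h0}. \<forall>(M :: 'a measure) S U g.
    regularizing_walk M S \<delta> U n d h C1 C0 Cg g \<longrightarrow>
    (\<forall>k. \<forall>B\<in>sets M. \<forall>x. \<bar>(S ^^ k) (indicat_real B) x - measure M B\<bar> \<le> C * exp (- real k * g))"
proof -
  define \<beta> where "\<beta> = nash_rate \<delta> d C1"
  define G where "G = 2 * real n * Cg * (1 / \<beta> + 1)"
  define C2 where "C2 = (sqrt C0 * (fact d * (\<beta> / \<delta>) ^ d) + sqrt (nash_const \<delta> d C1 C0 * \<beta> ^ d)) / \<delta>"
  have \<beta>: "\<beta> > 0" using \<delta> C1 d by (simp add: \<beta>_def nash_rate_def)
  have C2nn: "0 \<le> C2"
    unfolding C2_def using \<delta> \<beta> C0 d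
    by (auto simp: nash_const_def \<beta>_def[symmetric] intro!: divide_nonneg_nonneg add_nonneg_nonneg mult_nonneg_nonneg)
  have G0: "G \<ge> 0" using Cg \<beta> by (simp add: G_def)
  \<comment> \<open>The bound h^2 \<le> \<delta> / (2 Cg) gives g \<le> \<delta>/2, as
    \<open>mean_zero_decay\<close> requires; h^2 \<le> 2 \<delta> / (\<beta> (G + 1)) brings the
    contraction factor of a block, multiplied by e^G, down to e^(-1).\<close>
  define q where "q = min (\<delta> / (2 * Cg)) (2 * \<delta> / (\<beta> * (G + 1)))"
  have q: "q > 0" using \<delta> Cg \<beta> G0 by (simp add: q_def)
  have "\<bar>(S ^^ k) (indicat_real B) x - measure M B\<bar> \<le> ((2 * C2 + 1) * exp G) * exp (- real k * g)"
    if hq0: "h \<in> {0<..sqrt q}" and W: "regularizing_walk M S \<delta> U n d h C1 C0 Cg g" and B: "B \<in> sets M"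
    for h and M :: "'a measure" and S U g k B x
  proof -
    interpret regularizing_walk M S \<delta> U n d h C1 C0 Cg g by (rule W)
    have "h\<^sup>2 \<le> (sqrt q)\<^sup>2" using hq0 by (intro power_mono) auto
    then have hq: "h\<^sup>2 \<le> \<delta> / (2 * Cg)" "h\<^sup>2 \<le> 2 * \<delta> / (\<beta> * (G + 1))" using q by (auto simp: q_def)
    have "g \<le> \<delta> / 2"
      using gap_le mult_left_mono[OF hq(1), of Cg] Cg by (simp add: field_simps)
    have "G + 1 \<le> 2 * \<delta> / (\<beta> * h\<^sup>2)"
    proof -
      have "h\<^sup>2 * (\<beta> * (G + 1)) \<le> 2 * \<delta>" using hq(2) \<beta> G0 by (simp add: pos_le_divide_eq)
      then have "(G + 1) * (\<beta> * h\<^sup>2) \<le> 2 * \<delta>" by (simp add: algebra_simps)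
      then show ?thesis using \<beta> h by (simp add: pos_le_divide_eq)
    qed
    then have "exp (- 2 * \<delta> / (\<beta> * h\<^sup>2)) * exp G \<le> exp (- 1)"
      by (simp add: exp_add[symmetric])
    also have "\<dots> \<le> 1 / 2" using exp_ge_add_one_self[of 1] by (simp add: exp_minus field_simps)
    finally have "exp (- 2 * \<delta> / (\<beta> * h\<^sup>2)) * exp G \<le> 1 / 2" .
    then show ?thesis unfolding deviation_from_mean(1)[OF B]
      using \<open>g \<le> \<delta> / 2\<close> Cg
      by (intro mean_zero_sup_decay[OF deviation_from_mean(2-4)[OF B] C1 C0 d]) (simp_all add: \<beta>_def G_def C2_def)
  qed
  then show ?thesis using q C2nn by (intro exI[of _ "sqrt q"] conjI exI[of _ "(2 * C2 + 1) * exp G"]) auto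
qed

section \<open>Increments of functions on boxes\<close>

definition centered_box :: "('n::finite \<Rightarrow> real) \<Rightarrow> (real^'n) set" where
  "centered_box l = {w. \<forall>j. - l j < w $ j \<and> w $ j < l j}"

lemma vec_nth_measurable[measurable]:
  fixes f :: "'a \<Rightarrow> real^'n::finite"
  assumes "f \<in> borel_measurable M" shows "(\<lambda>x. f x $ j) \<in> borel_measurable M"
  using assms by (rule measurable_compose) (intro borel_measurable_continuous_onI continuous_intros)

lemma ennreal_mult_add_distrib:
  assumes "0 \<le> c" "0 \<le> a"
  shows "ennreal c * (ennreal a * D + 2 * L) = ennreal (c * a) * D + ennreal (2 * c) * L"
proof -
  have "ennreal (2 * c) = ennreal c * 2" using assms by (simp add: ennreal_mult mult.commute)
  then show ?thesis using assms by (simp only: ennreal_mult distrib_left mult.assoc)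
qed

lemma ennreal_two_power: "ennreal (2 ^ k) = 2 ^ k"
  by (metis ennreal_numeral ennreal_power zero_le_numeral)

lemma centered_box_eq_box: "centered_box l = box (\<chi> j. - l j) (\<chi> j. l j)"
  by (auto simp: centered_box_def mem_box_cart)

lemma open_centered_box: "open (centered_box l)"
  by (simp add: centered_box_eq_box open_box)

lemma centered_box_measurable[measurable]: "centered_box l \<in> sets borel"
  by (simp add: open_centered_box)

lemma emeasure_centered_box_const:
  assumes "0 \<le> r"
  shows "emeasure lborel (centered_box (\<lambda>_. r) :: (real^'n::finite) set) = ennreal ((2 * r) ^ CARD('n))"
proof -
  have "emeasure lborel (box (\<chi> j::'n. - r) (\<chi> j. r)) = ennreal (\<Prod>b\<in>Basis. ((\<chi> j::'n. r) - (\<chi> j. - r)) \<bullet> b)"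
    using assms by (intro emeasure_lborel_box) (auto simp: Basis_vec_def inner_axis)
  also have "(\<Prod>b\<in>Basis. ((\<chi> j::'n. r) - (\<chi> j. - r)) \<bullet> b) = (\<Prod>b\<in>(Basis :: (real^'n) set). 2 * r)"
    by (intro prod.cong) (auto simp: Basis_vec_def inner_axis)
  also have "\<dots> = (2 * r) ^ CARD('n)" by simp
  finally show ?thesis by (simp add: centered_box_eq_box)
qed

lemma nn_integral_lborel_translate:
  fixes f :: "'a::euclidean_space \<Rightarrow> ennreal"
  assumes [measurable]: "f \<in> borel_measurable borel"
  shows "(\<integral>\<^sup>+x. f (x + a) \<partial>lborel) = (\<integral>\<^sup>+x. f x \<partial>lborel)"
proof -
  have "(\<integral>\<^sup>+x. f x \<partial>lborel) = (\<integral>\<^sup>+x. f x \<partial>(distr lborel borel (\<lambda>x. a + x)))"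
    using lborel_distr_plus[of a] by simp
  also have "\<dots> = (\<integral>\<^sup>+x. f (a + x) \<partial>lborel)" by (intro nn_integral_distr) auto
  finally show ?thesis by (simp add: add.commute)
qed

lemma nn_integral_lborel_reflect:
  fixes f :: "real \<Rightarrow> ennreal"
  assumes [measurable]: "f \<in> borel_measurable borel"
  shows "(\<integral>\<^sup>+x. f (- x) \<partial>lborel) = (\<integral>\<^sup>+x. f x \<partial>lborel)"
proof -
  have "(\<integral>\<^sup>+x. f x \<partial>lborel) = (\<integral>\<^sup>+x. f x \<partial>(distr lborel borel (\<lambda>x::real. - x)))"
    using lborel_distr_uminus by simp
  also have "\<dots> = (\<integral>\<^sup>+x. f (- x) \<partial>lborel)" by (intro nn_integral_distr) auto
  finally show ?thesis by simp
qed

lemma nn_integral_lborel_scale: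
  fixes f :: "'a::euclidean_space \<Rightarrow> ennreal"
  assumes [measurable]: "f \<in> borel_measurable borel" and c: "0 < c"
  shows "(\<integral>\<^sup>+x. f x \<partial>lborel) = ennreal (c ^ DIM('a)) * (\<integral>\<^sup>+x. f (c *\<^sub>R x) \<partial>lborel)"
proof -
  have "(\<integral>\<^sup>+x. f x \<partial>lborel) = (\<integral>\<^sup>+x. f x \<partial>(density (distr lborel borel (\<lambda>x::'a. 0 + c *\<^sub>R x)) (\<lambda>x. ennreal (\<bar>c\<bar> ^ DIM('a)))))"
    using lborel_affine[of c "0::'a"] c by simp
  also have "\<dots> = ennreal (c ^ DIM('a)) * (\<integral>\<^sup>+x. f (c *\<^sub>R x) \<partial>lborel)"
    using c by (simp add: nn_integral_density nn_integral_distr nn_integral_cmult)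
  finally show ?thesis .
qed

lemma nn_integral_lborel_scale_real:
  fixes f :: "real \<Rightarrow> ennreal"
  assumes "f \<in> borel_measurable borel" and "0 < c"
  shows "(\<integral>\<^sup>+x. f x \<partial>lborel) = ennreal c * (\<integral>\<^sup>+x. f (c * x) \<partial>lborel)"
  using nn_integral_lborel_scale[OF assms] by simp

lemma norm_sum_square_le: fixes x y :: "'c::real_normed_vector"
  shows "(norm (x + y))\<^sup>2 \<le> 2 * (norm x)\<^sup>2 + 2 * (norm y)\<^sup>2"
proof -
  have "(norm (x + y))\<^sup>2 \<le> (norm x + norm y)\<^sup>2" by (intro power_mono norm_triangle_ineq) auto
  also have "\<dots> \<le> 2 * (norm x)\<^sup>2 + 2 * (norm y)\<^sup>2"
    using sum_squares_bound[of "norm x" "norm y"] by (simp add: power2_sum)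
  finally show ?thesis .
qed

text \<open>Only pairs with both ends in \<open>b\<close> count, so that functions are never
  extended across the faces of a box.\<close>

definition increment_form :: "(real^'n::finite) set \<Rightarrow> (real^'n \<Rightarrow> 'b::euclidean_space) \<Rightarrow> real^'n \<Rightarrow> ennreal" where
  "increment_form b f v = (\<integral>\<^sup>+w. ennreal ((norm (f (w + v) - f w))\<^sup>2) * indicator b w * indicator b (w + v) \<partial>lborel)"

context
  fixes l :: "'n::finite \<Rightarrow> real" and f :: "real^'n \<Rightarrow> 'b::euclidean_space"
  assumes f[measurable]: "f \<in> borel_measurable borel"
begin

lemma increment_form_measurable[measurable]: "(increment_form (centered_box l) f) \<in> borel_measurable borel"
  unfolding increment_form_def by measurable

text \<open>Under the sign condition every coordinate moves monotonically, so the intermediate point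
  w + v stays in the box and the increment can be split there.\<close>

lemma increment_form_add:
  assumes "\<And>j. 0 \<le> v $ j * v' $ j"
  shows "(increment_form (centered_box l) f) (v + v') \<le> 2 * (increment_form (centered_box l) f) v + 2 * (increment_form (centered_box l) f) v'"
proof -
  have mid: "w + v \<in> (centered_box l)" if "w \<in> (centered_box l)" "w + v + v' \<in> (centered_box l)" for w
    unfolding centered_box_def
  proof safe
    fix j
    have "- l j < w $ j" "w $ j < l j" "- l j < w $ j + v $ j + v' $ j" "w $ j + v $ j + v' $ j < l j"
      using that by (auto simp: centered_box_def)
    moreover have "(0 \<le> v $ j \<and> 0 \<le> v' $ j) \<or> (v $ j \<le> 0 \<and> v' $ j \<le> 0) \<or> v $ j = 0 \<or> v' $ j = 0"
      using assms[of j] by (auto simp: zero_le_mult_iff)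
    ultimately show "- l j < (w + v) $ j" "(w + v) $ j < l j" by auto
  qed
  let ?a = "\<lambda>w. ennreal ((norm (f (w + v) - f w))\<^sup>2) * indicator (centered_box l) w * indicator (centered_box l) (w + v)"
  let ?b = "\<lambda>w. ennreal ((norm (f (w + v') - f w))\<^sup>2) * indicator (centered_box l) w * indicator (centered_box l) (w + v')"
  have "(increment_form (centered_box l) f) (v + v') \<le> (\<integral>\<^sup>+w. 2 * ?a w + 2 * ?b (w + v) \<partial>lborel)"
    unfolding increment_form_def
  proof (intro nn_integral_mono)
    fix w :: "real^'n"
    have "(norm (f (w + v + v') - f w))\<^sup>2 \<le> 2 * (norm (f (w + v) - f w))\<^sup>2 + 2 * (norm (f (w + v + v') - f (w + v)))\<^sup>2"
      using norm_sum_square_le[of "f (w + v) - f w" "f (w + v + v') - f (w + v)"] by (simp add: algebra_simps)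
    then have "ennreal ((norm (f (w + v + v') - f w))\<^sup>2) \<le> ennreal (2 * (norm (f (w + v) - f w))\<^sup>2 + 2 * (norm (f (w + v + v') - f (w + v)))\<^sup>2)"
      by (rule ennreal_leI)
    also have "\<dots> = 2 * ennreal ((norm (f (w + v) - f w))\<^sup>2) + 2 * ennreal ((norm (f (w + v + v') - f (w + v)))\<^sup>2)"
      by (simp add: ennreal_mult ennreal_plus)
    finally show "ennreal ((norm (f (w + (v + v')) - f w))\<^sup>2) * indicator (centered_box l) w * indicator (centered_box l) (w + (v + v'))
        \<le> 2 * ?a w + 2 * ?b (w + v)"
      using mid[of w] by (auto simp: indicator_def add.assoc)
  qed
  also have "\<dots> = 2 * (\<integral>\<^sup>+w. ?a w \<partial>lborel) + 2 * (\<integral>\<^sup>+w. ?b (w + v) \<partial>lborel)"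
    by (simp add: nn_integral_add nn_integral_cmult)
  also have "(\<integral>\<^sup>+w. ?b (w + v) \<partial>lborel) = (\<integral>\<^sup>+w. ?b w \<partial>lborel)"
    by (rule nn_integral_lborel_translate) measurable
  finally show ?thesis unfolding increment_form_def .
qed

lemma increment_form_zero[simp]: "(increment_form (centered_box l) f) 0 = 0"
  by (simp add: increment_form_def)

lemma increment_form_double: "(increment_form (centered_box l) f) (2 *\<^sub>R v) \<le> 4 * (increment_form (centered_box l) f) v"
proof -
  have "(increment_form (centered_box l) f) (v + v) \<le> 2 * (increment_form (centered_box l) f) v + 2 * (increment_form (centered_box l) f) v" by (rule increment_form_add) simp
  then show ?thesis by (simp add: scaleR_2 distrib_right[symmetric])
qed

text \<open>The coordinates are added one at a time. The partial sums and the next axis vector have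
  disjoint supports, so \<open>increment_form_add\<close> applies, at the price of a factor 2 each
  time.\<close>

lemma increment_form_axes:
  "(increment_form (centered_box l) f) v \<le> 2 ^ CARD('n) * (\<Sum>j\<in>UNIV. (increment_form (centered_box l) f) (axis j (v $ j)))"
proof -
  have "(increment_form (centered_box l) f) (\<chi> i. if i \<in> J then v $ i else 0) \<le> 2 ^ card J * (\<Sum>j\<in>J. (increment_form (centered_box l) f) (axis j (v $ j)))" if "finite J" for J
    using that
  proof (induction J)
    case empty
    have "(\<chi> i. 0) = (0 :: real^'n)" by (simp add: vec_eq_iff)
    then show ?case by simp
  next
    case (insert k J)
    let ?u = "\<chi> i. if i \<in> J then v $ i else 0"
    have eq: "(\<chi> i. if i \<in> insert k J then v $ i else 0) = ?u + axis k (v $ k)"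
      using insert.hyps by (auto simp: vec_eq_iff axis_def)
    have "(increment_form (centered_box l) f) (?u + axis k (v $ k)) \<le> 2 * (increment_form (centered_box l) f) ?u + 2 * (increment_form (centered_box l) f) (axis k (v $ k))"
      using insert.hyps by (intro increment_form_add) (auto simp: axis_def)
    also have "\<dots> \<le> 2 * (2 ^ card J * (\<Sum>j\<in>J. (increment_form (centered_box l) f) (axis j (v $ j)))) + 2 * 2 ^ card J * (increment_form (centered_box l) f) (axis k (v $ k))"
    proof (intro add_mono mult_left_mono insert.IH mult_right_mono)
      have "(1::ennreal) \<le> 2 ^ card J" by (rule one_le_power) simp
      then show "(2::ennreal) \<le> 2 * 2 ^ card J" using mult_left_mono[of 1 "2 ^ card J" "2::ennreal"] by simp
    qed auto
    also have "\<dots> = 2 ^ card (insert k J) * (\<Sum>j\<in>insert k J. (increment_form (centered_box l) f) (axis j (v $ j)))"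
      using insert.hyps by (simp add: distrib_left mult.assoc add.commute)
    finally show ?case unfolding eq .
  qed
  from this[of UNIV] show ?thesis by simp
qed

definition cube_form :: "real \<Rightarrow> ennreal" where
  "cube_form r = (\<integral>\<^sup>+v. (increment_form (centered_box l) f) v * indicator (centered_box (\<lambda>_. r)) v \<partial>lborel)"

definition axis_form :: "'n \<Rightarrow> real \<Rightarrow> ennreal" where
  "axis_form j r = (\<integral>\<^sup>+s. (increment_form (centered_box l) f) (axis j s) * indicator {-r<..<r} s \<partial>lborel)"

text \<open>The factor 2^n is the Jacobian and 4 comes from halving the step. Per unit of volume the
  form thus grows at most like r^2, which is the origin of y / h^2 in the Nash inequality.\<close>

lemma cube_form_double: "cube_form (2 * r) \<le> 2 ^ CARD('n) * 4 * cube_form r"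
proof -
  have "cube_form (2 * r) = ennreal (2 ^ CARD('n)) * (\<integral>\<^sup>+v. (increment_form (centered_box l) f) (2 *\<^sub>R v) * indicator (centered_box (\<lambda>_. 2 * r)) (2 *\<^sub>R v) \<partial>lborel)"
    unfolding cube_form_def using nn_integral_lborel_scale[of "\<lambda>v. (increment_form (centered_box l) f) v * indicator (centered_box (\<lambda>_. 2 * r)) v" 2] by simp
  also have "(\<integral>\<^sup>+v. (increment_form (centered_box l) f) (2 *\<^sub>R v) * indicator (centered_box (\<lambda>_. 2 * r)) (2 *\<^sub>R v) \<partial>lborel)
      \<le> (\<integral>\<^sup>+v. 4 * ((increment_form (centered_box l) f) v * indicator (centered_box (\<lambda>_. r)) v) \<partial>lborel)"
  proof (intro nn_integral_mono)
    fix v :: "real^'n"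
    have "indicator (centered_box (\<lambda>_. 2 * r)) (2 *\<^sub>R v) = (indicator (centered_box (\<lambda>_. r)) v :: ennreal)"
      by (auto simp: indicator_def centered_box_def)
    then show "(increment_form (centered_box l) f) (2 *\<^sub>R v) * indicator (centered_box (\<lambda>_. 2 * r)) (2 *\<^sub>R v) \<le> 4 * ((increment_form (centered_box l) f) v * indicator (centered_box (\<lambda>_. r)) v)"
      using mult_right_mono[OF increment_form_double[of v]] by (simp add: mult.assoc)
  qed
  also have "\<dots> = 4 * cube_form r" unfolding cube_form_def by (simp add: nn_integral_cmult)
  finally show ?thesis by (simp add: mult.assoc mult_left_mono ennreal_two_power)
qed

lemma cube_form_power: "cube_form (2 ^ k * r) \<le> (2 ^ CARD('n) * 4) ^ k * cube_form r"
proof (induction k)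
  case (Suc k)
  have "cube_form (2 ^ Suc k * r) \<le> 2 ^ CARD('n) * 4 * cube_form (2 ^ k * r)"
    using cube_form_double[of "2 ^ k * r"] by (simp add: mult.assoc)
  also have "\<dots> \<le> 2 ^ CARD('n) * 4 * ((2 ^ CARD('n) * 4) ^ k * cube_form r)"
    by (intro mult_left_mono Suc) auto
  finally show ?case by (simp add: mult.assoc)
qed simp

end

text \<open>Tonelli and translation invariance along the \<open>j\<close>-th axis stand in for an iterated integral over
  the coordinates.\<close>

lemma nn_integral_axis_cube:
  fixes H :: "real \<Rightarrow> ennreal" and j :: "'n::finite"
  assumes H[measurable]: "H \<in> borel_measurable borel" and r: "0 < r"
  shows "(\<integral>\<^sup>+v. H (v $ j) * indicator (centered_box (\<lambda>_. r)) v \<partial>(lborel :: (real^'n) measure))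
    = ennreal ((2 * r) ^ (CARD('n) - 1)) * (\<integral>\<^sup>+s. H s * indicator {-r<..<r} s \<partial>lborel)"
proof -
  let ?I = "{-r<..<r}"
  let ?R = "{v::real^'n. \<forall>i. i \<noteq> j \<longrightarrow> v $ i \<in> ?I}"
  let ?L = "\<integral>\<^sup>+s. H s * indicator ?I s \<partial>lborel"
  have "?R = (\<Inter>i\<in>{i. i \<noteq> j}. {v. - r < v $ i} \<inter> {v. v $ i < r})" by auto
  also have "open \<dots>"
    by (intro open_INT ballI open_Int open_Collect_less continuous_intros) auto
  finally have R[measurable]: "?R \<in> sets borel" by simp
  have cb: "indicator (centered_box (\<lambda>_. r)) v = (indicator ?R v * indicator ?I (v $ j) :: ennreal)" for v :: "real^'n"
    by (auto simp: centered_box_def indicator_def)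
  have shift: "indicator ?R (v + axis j s) = (indicator ?R v :: ennreal)" for v :: "real^'n" and s
    by (auto simp: indicator_def axis_def)
  have len: "(\<integral>\<^sup>+s. indicator ?I (a - s) \<partial>lborel) = ennreal (2 * r)" for a :: real
  proof -
    have "(\<integral>\<^sup>+s. indicator ?I (a - s) \<partial>lborel) = (\<integral>\<^sup>+s. indicator {a - r<..<a + r} s \<partial>lborel)"
      by (intro nn_integral_cong) (auto simp: indicator_def)
    then show ?thesis using r by simp
  qed
  \<comment> \<open>The slab \<open>?R\<close> leaves coordinate j free. The factor 2 r is written
    as the integral of the indicator of \<open>?I\<close> at v_j - s over s; a shift of v by s along
    axis j then moves s into F and leaves the indicator of the cube.\<close>
  have key: "ennreal (2 * r) * (\<integral>\<^sup>+v. F (v $ j) * indicator ?R v \<partial>lborel) =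
      (\<integral>\<^sup>+v. indicator ?R v * indicator ?I (v $ j) \<partial>lborel) * (\<integral>\<^sup>+s. F s \<partial>lborel)"
    if F[measurable]: "F \<in> borel_measurable borel" for F :: "real \<Rightarrow> ennreal"
  proof -
    have "ennreal (2 * r) * (\<integral>\<^sup>+(v::real^'n). F (v $ j) * indicator ?R v \<partial>lborel)
       = (\<integral>\<^sup>+(v::real^'n). F (v $ j) * indicator ?R v * (\<integral>\<^sup>+s. indicator ?I (v $ j - s) \<partial>lborel) \<partial>lborel)"
      unfolding len by (subst nn_integral_cmult[symmetric]) (auto simp: mult.commute)
    also have "\<dots> = (\<integral>\<^sup>+(v::real^'n). (\<integral>\<^sup>+s. F (v $ j) * indicator ?R v * indicator ?I (v $ j - s) \<partial>lborel) \<partial>lborel)"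
      by (simp add: nn_integral_cmult)
    also have "\<dots> = (\<integral>\<^sup>+s. (\<integral>\<^sup>+(v::real^'n). F (v $ j) * indicator ?R v * indicator ?I (v $ j - s) \<partial>lborel) \<partial>lborel)"
      by (rule lborel_pair.Fubini') measurable
    also have "\<dots> = (\<integral>\<^sup>+s. (\<integral>\<^sup>+(v::real^'n). F (v $ j + s) * indicator ?R v * indicator ?I (v $ j) \<partial>lborel) \<partial>lborel)"
    proof (rule nn_integral_cong)
      fix s :: real
      have "(\<integral>\<^sup>+(v::real^'n). F (v $ j) * indicator ?R v * indicator ?I (v $ j - s) \<partial>lborel) =
        (\<integral>\<^sup>+(v::real^'n). F ((v + axis j s) $ j) * indicator ?R (v + axis j s) * indicator ?I ((v + axis j s) $ j - s) \<partial>lborel)"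
        by (subst nn_integral_lborel_translate[of "\<lambda>v::real^'n. F (v $ j) * indicator ?R v * indicator ?I (v $ j - s)" "axis j s"]) auto
      then show "(\<integral>\<^sup>+(v::real^'n). F (v $ j) * indicator ?R v * indicator ?I (v $ j - s) \<partial>lborel) =
        (\<integral>\<^sup>+(v::real^'n). F (v $ j + s) * indicator ?R v * indicator ?I (v $ j) \<partial>lborel)"
        unfolding shift by simp
    qed
    also have "\<dots> = (\<integral>\<^sup>+(v::real^'n). (\<integral>\<^sup>+s. F (v $ j + s) * indicator ?R v * indicator ?I (v $ j) \<partial>lborel) \<partial>lborel)"
      by (rule lborel_pair.Fubini'[symmetric]) measurable
    also have "\<dots> = (\<integral>\<^sup>+(v::real^'n). indicator ?R v * indicator ?I (v $ j) * (\<integral>\<^sup>+s. F (s + v $ j) \<partial>lborel) \<partial>lborel)"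
      by (intro nn_integral_cong, subst nn_integral_cmult[symmetric]) (auto simp: ac_simps)
    also have "\<dots> = (\<integral>\<^sup>+v. indicator ?R v * indicator ?I (v $ j) \<partial>lborel) * (\<integral>\<^sup>+s. F s \<partial>lborel)"
      by (simp add: nn_integral_lborel_translate nn_integral_multc)
    finally show ?thesis .
  qed
  have vol: "(\<integral>\<^sup>+(v::real^'n). indicator ?R v * indicator ?I (v $ j) \<partial>lborel) = ennreal ((2 * r) ^ CARD('n))"
    unfolding cb[symmetric] using r by (simp add: emeasure_centered_box_const)
  have "CARD('n) = Suc (CARD('n) - 1)" using zero_less_card_finite[where 'a='n] by simp
  then have pow: "(2 * r) ^ CARD('n) = (2 * r) * (2 * r) ^ (CARD('n) - 1)" by (metis power_Suc)
  have "ennreal (2 * r) * (\<integral>\<^sup>+(v::real^'n). (H (v $ j) * indicator ?I (v $ j)) * indicator ?R v \<partial>lborel)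
      = ennreal (2 * r) * (ennreal ((2 * r) ^ (CARD('n) - 1)) * ?L)"
    using key[of "\<lambda>s. H s * indicator ?I s"] r unfolding vol pow
    by (simp add: ennreal_mult mult.assoc)
  then have "(\<integral>\<^sup>+(v::real^'n). (H (v $ j) * indicator ?I (v $ j)) * indicator ?R v \<partial>lborel) = ennreal ((2 * r) ^ (CARD('n) - 1)) * ?L"
    using r by (subst (asm) ennreal_mult_cancel_left) auto
  then show ?thesis unfolding cb by (simp add: ac_simps)
qed

context
  fixes l :: "'n::finite \<Rightarrow> real" and f :: "real^'n \<Rightarrow> 'b::euclidean_space"
  assumes f[measurable]: "f \<in> borel_measurable borel"
begin

lemma axis_measurable[measurable]: "(\<lambda>s. axis j s :: real^'n) \<in> borel_measurable borel"
proof -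
  have "continuous_on UNIV (\<lambda>s. s *\<^sub>R axis j 1 :: real^'n)"
    by (intro continuous_intros)
  then have "continuous_on UNIV (\<lambda>s. axis j s :: real^'n)"
    by (rule continuous_on_eq) (auto simp: axis_def vec_eq_iff)
  then show ?thesis by (rule borel_measurable_continuous_onI)
qed

lemma cube_form_le_axis_form:
  assumes r: "0 < r"
  shows "cube_form l f r \<le> ennreal (2 ^ CARD('n) * (2 * r) ^ (CARD('n) - 1)) * (\<Sum>j\<in>UNIV. axis_form l f j r)"
proof -
  note [measurable] = increment_form_measurable[OF f]
  let ?G = "increment_form (centered_box l) f"
  have "cube_form l f r \<le> (\<integral>\<^sup>+v. 2 ^ CARD('n) * (\<Sum>j\<in>UNIV. ?G (axis j (v $ j)) * indicator (centered_box (\<lambda>_. r)) v) \<partial>lborel)"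
    unfolding cube_form_def[OF f]
    unfolding sum_distrib_right[symmetric] mult.assoc[symmetric]
    by (intro nn_integral_mono mult_right_mono increment_form_axes[OF f]) auto
  also have "\<dots> = 2 ^ CARD('n) * (\<Sum>j\<in>UNIV. \<integral>\<^sup>+v. ?G (axis j (v $ j)) * indicator (centered_box (\<lambda>_. r)) v \<partial>lborel)"
    by (subst nn_integral_cmult, measurable, subst nn_integral_sum) auto
  also have "\<dots> = 2 ^ CARD('n) * (\<Sum>j\<in>UNIV. ennreal ((2 * r) ^ (CARD('n) - 1)) * axis_form l f j r)"
    unfolding axis_form_def[OF f]
    by (intro arg_cong2[where f="(*)"] refl sum.cong nn_integral_axis_cube r) measurable
  also have "\<dots> = ennreal (2 ^ CARD('n) * (2 * r) ^ (CARD('n) - 1)) * (\<Sum>j\<in>UNIV. axis_form l f j r)"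
    using r by (simp add: sum_distrib_left[symmetric] ennreal_mult mult.assoc ennreal_two_power)
  finally show ?thesis .
qed

end

lemma square_le_increment: fixes a b :: real shows "a\<^sup>2 \<le> (b - a)\<^sup>2 + 2 * \<bar>a\<bar> * \<bar>b\<bar>"
proof -
  have "a * b \<le> \<bar>a\<bar> * \<bar>b\<bar>" by (simp add: abs_mult[symmetric])
  then have "2 * (a * b) \<le> b\<^sup>2 + 2 * (\<bar>a\<bar> * \<bar>b\<bar>)" using zero_le_power2[of b] by linarith
  then show ?thesis by (simp add: power2_diff) (simp add: algebra_simps)
qed

text \<open>Every point of the box sees a cube of side \<open>r\<close> of admissible increments; averaging
  \<open>a\<^sup>2 \<le> (b - a)\<^sup>2 + 2 \<bar>a\<bar> \<bar>b\<bar>\<close> over them gives the local form of the Nash inequality.\<close>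

lemma box_local_nash:
  fixes f :: "real^'n::finite \<Rightarrow> real"
  assumes f[measurable]: "f \<in> borel_measurable borel" and r: "0 < r" "\<And>j. r \<le> l j"
  shows "ennreal (r ^ CARD('n)) * (\<integral>\<^sup>+w. ennreal ((f w)\<^sup>2) * indicator (centered_box l) w \<partial>lborel)
    \<le> cube_form l f r + 2 * (\<integral>\<^sup>+w. ennreal \<bar>f w\<bar> * indicator (centered_box l) w \<partial>lborel)\<^sup>2"
proof -
  let ?b = "centered_box l" and ?Q = "centered_box (\<lambda>_. r) :: (real^'n) set"
  have vol: "ennreal (r ^ CARD('n)) \<le> (\<integral>\<^sup>+v. indicator ?Q v * indicator ?b (w + v) \<partial>lborel)" if w: "w \<in> ?b" for w
  proof -
    \<comment> \<open>The cube of side r that points from w, coordinate by coordinate, towards the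
      centre; r \<le> l j keeps w + v inside the box.\<close>
    let ?lo = "\<chi> j. if w $ j \<ge> 0 then - r else 0" and ?hi = "\<chi> j. if w $ j \<ge> 0 then 0 else r"
    have "emeasure lborel (box ?lo ?hi) = ennreal (\<Prod>k\<in>Basis. (?hi - ?lo) \<bullet> k)"
      using r by (intro emeasure_lborel_box) (auto simp: Basis_vec_def inner_axis)
    also have "(\<Prod>k\<in>Basis. (?hi - ?lo) \<bullet> k) = (\<Prod>k\<in>(Basis :: (real^'n) set). r)"
      by (intro prod.cong) (auto simp: Basis_vec_def inner_axis)
    finally have "ennreal (r ^ CARD('n)) = (\<integral>\<^sup>+v. indicator (box ?lo ?hi) v \<partial>lborel)" by simp
    also have "\<dots> \<le> (\<integral>\<^sup>+v. indicator ?Q v * indicator ?b (w + v) \<partial>lborel)"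
    proof (intro nn_integral_mono)
      fix v :: "real^'n"
      have "v \<in> ?Q \<and> w + v \<in> ?b" if v: "v \<in> box ?lo ?hi"
      proof -
        have "- r < v $ j \<and> v $ j < r \<and> - l j < w $ j + v $ j \<and> w $ j + v $ j < l j" for j
        proof -
          have "(if w $ j \<ge> 0 then - r else 0) < v $ j \<and> v $ j < (if w $ j \<ge> 0 then 0 else r)"
            using v by (simp add: mem_box_cart)
          moreover have "- l j < w $ j" "w $ j < l j" using w by (auto simp: centered_box_def)
          ultimately show ?thesis using r(1) r(2)[of j] by (auto split: if_splits)
        qed
        then show ?thesis by (simp add: centered_box_def)
      qed
      then show "indicator (box ?lo ?hi) v \<le> (indicator ?Q v * indicator ?b (w + v) :: ennreal)"
        by (auto simp: indicator_def)
    qed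
    finally show ?thesis .
  qed
  have "ennreal (r ^ CARD('n)) * (\<integral>\<^sup>+w. ennreal ((f w)\<^sup>2) * indicator ?b w \<partial>lborel)
      = (\<integral>\<^sup>+w. ennreal (r ^ CARD('n)) * (ennreal ((f w)\<^sup>2) * indicator ?b w) \<partial>lborel)"
    by (simp add: nn_integral_cmult)
  also have "\<dots> \<le> (\<integral>\<^sup>+w. (\<integral>\<^sup>+v. indicator ?Q v * indicator ?b (w + v) \<partial>lborel) * (ennreal ((f w)\<^sup>2) * indicator ?b w) \<partial>lborel)"
  proof (intro nn_integral_mono)
    fix w :: "real^'n"
    show "ennreal (r ^ CARD('n)) * (ennreal ((f w)\<^sup>2) * indicator ?b w)
       \<le> (\<integral>\<^sup>+v. indicator ?Q v * indicator ?b (w + v) \<partial>lborel) * (ennreal ((f w)\<^sup>2) * indicator ?b w)"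
      using vol[of w] by (cases "w \<in> ?b") (auto intro: mult_right_mono)
  qed
  also have "\<dots> = (\<integral>\<^sup>+w. (\<integral>\<^sup>+v. ennreal ((f w)\<^sup>2) * indicator ?b w * (indicator ?Q v * indicator ?b (w + v)) \<partial>lborel) \<partial>lborel)"
    by (simp add: nn_integral_cmult[symmetric] mult.commute)
  also have "\<dots> \<le> (\<integral>\<^sup>+w. (\<integral>\<^sup>+v. ennreal ((norm (f (w + v) - f w))\<^sup>2) * indicator ?b w * indicator ?b (w + v) * indicator ?Q v
      + 2 * (ennreal \<bar>f w\<bar> * indicator ?b w) * (ennreal \<bar>f (w + v)\<bar> * indicator ?b (w + v)) \<partial>lborel) \<partial>lborel)"
  proof (intro nn_integral_mono)
    fix w v :: "real^'n"
    have "ennreal ((f w)\<^sup>2) \<le> ennreal ((norm (f (w + v) - f w))\<^sup>2 + 2 * \<bar>f w\<bar> * \<bar>f (w + v)\<bar>)"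
      using square_le_increment[of "f w" "f (w + v)"] by (intro ennreal_leI) (simp add: mult.assoc)
    also have "\<dots> = ennreal ((norm (f (w + v) - f w))\<^sup>2) + 2 * ennreal \<bar>f w\<bar> * ennreal \<bar>f (w + v)\<bar>"
      by (simp add: ennreal_plus ennreal_mult)
    finally show "ennreal ((f w)\<^sup>2) * indicator ?b w * (indicator ?Q v * indicator ?b (w + v))
       \<le> ennreal ((norm (f (w + v) - f w))\<^sup>2) * indicator ?b w * indicator ?b (w + v) * indicator ?Q v
      + 2 * (ennreal \<bar>f w\<bar> * indicator ?b w) * (ennreal \<bar>f (w + v)\<bar> * indicator ?b (w + v))"
      by (auto simp: indicator_def)
  qed
  also have "\<dots> = (\<integral>\<^sup>+w. (\<integral>\<^sup>+v. ennreal ((norm (f (w + v) - f w))\<^sup>2) * indicator ?b w * indicator ?b (w + v) * indicator ?Q v \<partial>lborel) \<partial>lborel)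
      + (\<integral>\<^sup>+w. 2 * (ennreal \<bar>f w\<bar> * indicator ?b w) * (\<integral>\<^sup>+v. ennreal \<bar>f (w + v)\<bar> * indicator ?b (w + v) \<partial>lborel) \<partial>lborel)"
    by (simp add: nn_integral_add nn_integral_cmult)
  also have "(\<integral>\<^sup>+w. (\<integral>\<^sup>+v. ennreal ((norm (f (w + v) - f w))\<^sup>2) * indicator ?b w * indicator ?b (w + v) * indicator ?Q v \<partial>lborel) \<partial>lborel)
      = cube_form l f r"
    unfolding cube_form_def[OF f] increment_form_def
    by (subst lborel_pair.Fubini') (auto simp: nn_integral_multc)
  also have "(\<integral>\<^sup>+w. 2 * (ennreal \<bar>f w\<bar> * indicator ?b w) * (\<integral>\<^sup>+v. ennreal \<bar>f (w + v)\<bar> * indicator ?b (w + v) \<partial>lborel) \<partial>lborel)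
      = 2 * (\<integral>\<^sup>+w. ennreal \<bar>f w\<bar> * indicator ?b w \<partial>lborel)\<^sup>2"
  proof -
    have "(\<integral>\<^sup>+v. ennreal \<bar>f (w + v)\<bar> * indicator ?b (w + v) \<partial>lborel) = (\<integral>\<^sup>+v. ennreal \<bar>f v\<bar> * indicator ?b v \<partial>lborel)" for w
      using nn_integral_lborel_translate[of "\<lambda>v. ennreal \<bar>f v\<bar> * indicator ?b v" w] by (simp add: add.commute)
    then have "(\<integral>\<^sup>+w. 2 * (ennreal \<bar>f w\<bar> * indicator ?b w) * (\<integral>\<^sup>+v. ennreal \<bar>f (w + v)\<bar> * indicator ?b (w + v) \<partial>lborel) \<partial>lborel)
      = (\<integral>\<^sup>+w. 2 * (ennreal \<bar>f w\<bar> * indicator ?b w) \<partial>lborel) * (\<integral>\<^sup>+v. ennreal \<bar>f v\<bar> * indicator ?b v \<partial>lborel)"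
      by (simp add: nn_integral_multc)
    then show ?thesis by (simp add: nn_integral_cmult mult.assoc power2_eq_square)
  qed
  finally show ?thesis .
qed

text \<open>\<open>box_local_nash\<close> at the radius 2^k \<eta>, brought down to \<eta> by k
  doublings. The division by the volume cancels the Jacobians, so that only 4^k / \<eta>
  survives.\<close>

lemma box_nash:
  fixes f :: "real^'n::finite \<Rightarrow> real"
  assumes f: "f \<in> borel_measurable borel" and \<eta>: "0 < \<eta>" "\<And>j. 2 ^ k * \<eta> \<le> l j"
  shows "(\<integral>\<^sup>+w. ennreal ((f w)\<^sup>2) * indicator (centered_box l) w \<partial>lborel)
    \<le> ennreal (4 ^ CARD('n) * 4 ^ k / \<eta>) * (\<Sum>j\<in>UNIV. axis_form l f j \<eta>)
      + ennreal (2 / (2 ^ k * \<eta>) ^ CARD('n)) * (\<integral>\<^sup>+w. ennreal \<bar>f w\<bar> * indicator (centered_box l) w \<partial>lborel)\<^sup>2"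
proof -
  let ?n = "CARD('n)" and ?r = "2 ^ k * \<eta>"
  let ?D = "\<Sum>j\<in>UNIV. axis_form l f j \<eta>" and ?L = "(\<integral>\<^sup>+w. ennreal \<bar>f w\<bar> * indicator (centered_box l) w \<partial>lborel)\<^sup>2"
  let ?I = "\<integral>\<^sup>+w. ennreal ((f w)\<^sup>2) * indicator (centered_box l) w \<partial>lborel"
  have r: "0 < ?r" using \<eta> by simp
  have "cube_form l f ?r \<le> (2 ^ ?n * 4) ^ k * cube_form l f \<eta>" by (rule cube_form_power[OF f])
  also have "\<dots> \<le> (2 ^ ?n * 4) ^ k * (ennreal (2 ^ ?n * (2 * \<eta>) ^ (?n - 1)) * ?D)"
    by (intro mult_left_mono cube_form_le_axis_form[OF f] \<eta>) auto
  also have "(2 ^ ?n * 4) ^ k = ennreal ((2 ^ ?n * 4) ^ k)"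
    using ennreal_two_power[of ?n] by (simp add: ennreal_mult ennreal_power[symmetric])
  also have "ennreal ((2 ^ ?n * 4) ^ k) * (ennreal (2 ^ ?n * (2 * \<eta>) ^ (?n - 1)) * ?D)
      = ennreal ((2 ^ ?n * 4) ^ k * (2 ^ ?n * (2 * \<eta>) ^ (?n - 1))) * ?D"
    using \<eta> by (simp add: ennreal_mult mult.assoc)
  finally have 1: "ennreal (?r ^ ?n) * ?I \<le> ennreal ((2 ^ ?n * 4) ^ k * (2 ^ ?n * (2 * \<eta>) ^ (?n - 1))) * ?D + 2 * ?L"
    using box_local_nash[OF f r \<eta>(2)] by (meson add_right_mono order_trans)
  have "?I = ennreal (1 / ?r ^ ?n) * (ennreal (?r ^ ?n) * ?I)"
  proof -
    have "1 / ?r ^ ?n * ?r ^ ?n = 1" using r by (metis nonzero_divide_eq_eq power_not_zero less_numeral_extra(3))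
    then show ?thesis using r
      by (simp only: mult.assoc[symmetric] ennreal_mult[symmetric] zero_le_power zero_le_divide_1_iff less_imp_le) simp
  qed
  also have "\<dots> \<le> ennreal (1 / ?r ^ ?n) * (ennreal ((2 ^ ?n * 4) ^ k * (2 ^ ?n * (2 * \<eta>) ^ (?n - 1))) * ?D + 2 * ?L)"
    by (intro mult_left_mono 1) auto
  also have "\<dots> = ennreal (1 / ?r ^ ?n * ((2 ^ ?n * 4) ^ k * (2 ^ ?n * (2 * \<eta>) ^ (?n - 1)))) * ?D + ennreal (2 / ?r ^ ?n) * ?L"
    using r \<eta> by (subst ennreal_mult_add_distrib) auto
  finally have A: "?I \<le> ennreal (1 / ?r ^ ?n * ((2 ^ ?n * 4) ^ k * (2 ^ ?n * (2 * \<eta>) ^ (?n - 1)))) * ?D + ennreal (2 / ?r ^ ?n) * ?L" .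
  have le: "1 / ?r ^ ?n * ((2 ^ ?n * 4) ^ k * (2 ^ ?n * (2 * \<eta>) ^ (?n - 1))) \<le> 4 ^ ?n * 4 ^ k / \<eta>"
  proof -
    obtain m where m: "?n = Suc m" using zero_less_card_finite[where 'a='n] gr0_conv_Suc by blast
    have "(2::real) ^ k * (2 ^ (k * m) * 4 ^ k) = 2 ^ (k * Suc m) * 4 ^ k" by (simp add: power_add)
    have "1 / ?r ^ ?n * ((2 ^ ?n * 4) ^ k * (2 ^ ?n * (2 * \<eta>) ^ (?n - 1))) = 4 ^ k * (2 ^ ?n * 2 ^ m) / \<eta>"
      using \<eta> unfolding m
      by (simp add: power_mult_distrib field_simps power_mult[symmetric] power_add, simp add: power_mult power_mult_distrib power_commutes field_simps flip: power_mult power_add, simp flip: power_mult_distrib)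
    also have "\<dots> \<le> 4 ^ k * (2 ^ ?n * 2 ^ ?n) / \<eta>"
      using \<eta> unfolding m by (intro divide_right_mono mult_left_mono) auto
    also have "(2::real) ^ ?n * 2 ^ ?n = 4 ^ ?n" by (simp add: power_mult_distrib[symmetric])
    finally show ?thesis by (simp add: mult.commute)
  qed
  show ?thesis
    by (rule order_trans[OF A add_right_mono[OF mult_right_mono[OF ennreal_leI[OF le]]]]) simp
qed

text \<open>Two points of the box differ by less than 2 l j in coordinate j, so the double integral
  is an integral of increments within radius 2^k \<eta>, and k doublings reduce it to radius
  \<eta>.\<close>

lemma box_poincare:
  fixes f :: "real^'n::finite \<Rightarrow> 'b::euclidean_space"
  assumes f[measurable]: "f \<in> borel_measurable borel" and \<eta>: "0 < \<eta>" "\<And>j. 2 * l j \<le> 2 ^ k * \<eta>"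
  shows "(\<integral>\<^sup>+w. (\<integral>\<^sup>+w'. ennreal ((norm (f w' - f w))\<^sup>2) * indicator (centered_box l) w * indicator (centered_box l) w' \<partial>lborel) \<partial>lborel)
    \<le> ennreal ((2 ^ CARD('n) * 4) ^ k * (2 ^ CARD('n) * (2 * \<eta>) ^ (CARD('n) - 1))) * (\<Sum>j\<in>UNIV. axis_form l f j \<eta>)"
proof -
  let ?b = "centered_box l" and ?n = "CARD('n)"
  note [measurable] = increment_form_measurable[OF f]
  have "(\<integral>\<^sup>+w. (\<integral>\<^sup>+w'. ennreal ((norm (f w' - f w))\<^sup>2) * indicator ?b w * indicator ?b w' \<partial>lborel) \<partial>lborel)
      = (\<integral>\<^sup>+w. (\<integral>\<^sup>+v. ennreal ((norm (f (w + v) - f w))\<^sup>2) * indicator ?b w * indicator ?b (w + v) \<partial>lborel) \<partial>lborel)"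
  proof (rule nn_integral_cong)
    fix w :: "real^'n"
    show "(\<integral>\<^sup>+w'. ennreal ((norm (f w' - f w))\<^sup>2) * indicator ?b w * indicator ?b w' \<partial>lborel)
        = (\<integral>\<^sup>+v. ennreal ((norm (f (w + v) - f w))\<^sup>2) * indicator ?b w * indicator ?b (w + v) \<partial>lborel)"
      using nn_integral_lborel_translate[of "\<lambda>w'. ennreal ((norm (f w' - f w))\<^sup>2) * indicator ?b w * indicator ?b w'" w]
      by (simp add: add.commute)
  qed
  also have "\<dots> = (\<integral>\<^sup>+v. increment_form ?b f v \<partial>lborel)"
    unfolding increment_form_def by (rule lborel_pair.Fubini') measurable
  also have "\<dots> \<le> cube_form l f (2 ^ k * \<eta>)"
    unfolding cube_form_def[OF f]
  proof (intro nn_integral_mono)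
    fix v :: "real^'n"
    show "increment_form ?b f v \<le> increment_form ?b f v * indicator (centered_box (\<lambda>_. 2 ^ k * \<eta>)) v"
    proof (cases "v \<in> centered_box (\<lambda>_. 2 ^ k * \<eta>)")
      case False
      then obtain j where j: "v $ j \<le> - (2 ^ k * \<eta>) \<or> 2 ^ k * \<eta> \<le> v $ j"
        by (auto simp: centered_box_def not_less)
      have "indicator ?b w * indicator ?b (w + v) = (0 :: ennreal)" for w
        using j \<eta>(2)[of j] by (auto simp: indicator_def centered_box_def) (smt (verit))+
      then have "(\<lambda>w. ennreal ((norm (f (w + v) - f w))\<^sup>2) * indicator ?b w * indicator ?b (w + v)) = (\<lambda>_. 0)"
        by (simp only: mult.assoc) simp
      then have "increment_form ?b f v = 0"
        unfolding increment_form_def by simp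
      then show ?thesis by simp
    qed simp
  qed
  also have "\<dots> \<le> (2 ^ ?n * 4) ^ k * cube_form l f \<eta>" by (rule cube_form_power[OF f])
  also have "\<dots> \<le> (2 ^ ?n * 4) ^ k * (ennreal (2 ^ ?n * (2 * \<eta>) ^ (?n - 1)) * (\<Sum>j\<in>UNIV. axis_form l f j \<eta>))"
    by (intro mult_left_mono cube_form_le_axis_form[OF f] \<eta>) auto
  also have "(2 ^ ?n * 4) ^ k = ennreal ((2 ^ ?n * 4) ^ k)"
    using ennreal_two_power[of ?n] by (simp add: ennreal_mult ennreal_power[symmetric])
  also have "ennreal ((2 ^ ?n * 4) ^ k) * (ennreal (2 ^ ?n * (2 * \<eta>) ^ (?n - 1)) * (\<Sum>j\<in>UNIV. axis_form l f j \<eta>))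
      = ennreal ((2 ^ ?n * 4) ^ k * (2 ^ ?n * (2 * \<eta>) ^ (?n - 1))) * (\<Sum>j\<in>UNIV. axis_form l f j \<eta>)"
    using \<eta> by (simp add: ennreal_mult mult.assoc)
  finally show ?thesis .
qed

definition sum_form :: "(real^'n::finite) set \<Rightarrow> (real^'n \<Rightarrow> real) \<Rightarrow> real^'n \<Rightarrow> ennreal" where
  "sum_form b f v = (\<integral>\<^sup>+w. ennreal ((f w + f (w + v))\<^sup>2) * indicator b w * indicator b (w + v) \<partial>lborel)"

lemma sum_form_measurable[measurable]:
  assumes [measurable]: "f \<in> borel_measurable borel" "b \<in> sets borel" shows "sum_form b f \<in> borel_measurable borel"
  unfolding sum_form_def by measurable

text \<open>Three points \<open>w\<close>, \<open>w + s\<close>, \<open>w + 2 s\<close> with values \<open>a\<close>, \<open>b\<close>, \<open>c\<close>: since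
  \<open>2 a = (a + b) + (a + c) - (b + c)\<close>, a function cannot be close to odd on all three pairs.\<close>

lemma box_sum_form_pointwise:
  fixes f :: "real^'n::finite \<Rightarrow> real"
  assumes f[measurable]: "f \<in> borel_measurable borel" and s: "2 * \<bar>s\<bar> < l j"
  defines "p \<equiv> \<lambda>s. sum_form (centered_box l) f (axis j s)"
  shows "(\<integral>\<^sup>+w. ennreal ((f w)\<^sup>2) * indicator (centered_box l) w \<partial>lborel)
    \<le> ennreal (3/4) * ((2 * p s + p (2 * s)) + (2 * p (- s) + p (2 * - s)))"
proof -
  let ?b = "centered_box l"
  have half: "(\<integral>\<^sup>+w. ennreal ((f w)\<^sup>2) * indicator ?b w * indicator ?b (w + axis j (2 * s)) \<partial>lborel)
      \<le> ennreal (3/4) * (2 * p s + p (2 * s))" for s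
  proof -
    let ?e = "axis j s :: real^'n"
    let ?F = "\<lambda>w. ennreal ((f w + f (w + ?e))\<^sup>2) * indicator ?b w * indicator ?b (w + ?e)"
    have e2: "axis j (2 * s) = ?e + ?e" by (auto simp: axis_def vec_eq_iff)
    have mid: "w + ?e \<in> ?b" if "w \<in> ?b" "w + (?e + ?e) \<in> ?b" for w
      unfolding centered_box_def
    proof safe
      fix i
      have "- l i < w $ i" "w $ i < l i" "- l i < w $ i + (?e $ i + ?e $ i)" "w $ i + (?e $ i + ?e $ i) < l i"
        using that by (auto simp: centered_box_def)
      then show "- l i < (w + ?e) $ i" "(w + ?e) $ i < l i" by auto
    qed
    have "(\<integral>\<^sup>+w. ennreal ((f w)\<^sup>2) * indicator ?b w * indicator ?b (w + axis j (2 * s)) \<partial>lborel)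
        \<le> (\<integral>\<^sup>+w. ennreal (3/4) * (?F w + ?F (w + ?e) + ennreal ((f w + f (w + axis j (2 * s)))\<^sup>2) * indicator ?b w * indicator ?b (w + axis j (2 * s))) \<partial>lborel)"
    proof (intro nn_integral_mono)
      fix w :: "real^'n"
      define x y z where "x = f w" and "y = f (w + ?e)" and "z = f (w + ?e + ?e)"
      \<comment> \<open>Cauchy-Schwarz for 2 x = (x + y) - (y + z) + (x + z), with the defect
        displayed as a sum of squares.\<close>
      have "3/4 * ((x + y)\<^sup>2 + (y + z)\<^sup>2 + (x + z)\<^sup>2) - x\<^sup>2 =
          1/4 * (((x + y) - (x + z))\<^sup>2 + ((x + y) + (y + z))\<^sup>2 + ((x + z) + (y + z))\<^sup>2)" (is "?L - _ = ?R")
        by (simp add: power2_eq_square field_simps)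
      then have "x\<^sup>2 \<le> 3/4 * ((x + y)\<^sup>2 + (y + z)\<^sup>2 + (x + z)\<^sup>2)"
      proof -
        assume eq: "?L - x\<^sup>2 = ?R"
        have "0 \<le> ?R" by (intro mult_nonneg_nonneg add_nonneg_nonneg) auto
        then show ?thesis unfolding eq[symmetric] by simp
      qed
      then have "ennreal (x\<^sup>2) \<le> ennreal (3/4 * ((x + y)\<^sup>2 + (y + z)\<^sup>2 + (x + z)\<^sup>2))" by (rule ennreal_leI)
      also have "\<dots> = ennreal (3/4) * (ennreal ((x + y)\<^sup>2) + ennreal ((y + z)\<^sup>2) + ennreal ((x + z)\<^sup>2))"
        by (simp only: ennreal_mult ennreal_plus zero_le_power2 add_nonneg_nonneg zero_le_divide_iff zero_le_numeral simp_thms)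
      finally show "ennreal ((f w)\<^sup>2) * indicator ?b w * indicator ?b (w + axis j (2 * s))
         \<le> ennreal (3/4) * (?F w + ?F (w + ?e) + ennreal ((f w + f (w + axis j (2 * s)))\<^sup>2) * indicator ?b w * indicator ?b (w + axis j (2 * s)))"
        using mid[of w] unfolding e2 x_def y_def z_def by (auto simp: indicator_def add.assoc)
    qed
    also have "\<dots> = ennreal (3/4) * ((\<integral>\<^sup>+w. ?F w \<partial>lborel) + (\<integral>\<^sup>+w. ?F (w + ?e) \<partial>lborel) + p (2 * s))"
      unfolding p_def sum_form_def by (simp add: nn_integral_add nn_integral_cmult)
    also have "(\<integral>\<^sup>+w. ?F (w + ?e) \<partial>lborel) = (\<integral>\<^sup>+w. ?F w \<partial>lborel)"
      by (rule nn_integral_lborel_translate) measurable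
    also have "(\<integral>\<^sup>+w. ?F w \<partial>lborel) = p s" by (simp add: p_def sum_form_def)
    finally show ?thesis by (simp only: mult_2)
  qed
  have "(\<integral>\<^sup>+w. ennreal ((f w)\<^sup>2) * indicator ?b w \<partial>lborel)
      \<le> (\<integral>\<^sup>+w. ennreal ((f w)\<^sup>2) * indicator ?b w * indicator ?b (w + axis j (2 * s))
        + ennreal ((f w)\<^sup>2) * indicator ?b w * indicator ?b (w + axis j (2 * - s)) \<partial>lborel)"
  proof (intro nn_integral_mono)
    fix w :: "real^'n"
    \<comment> \<open>Of the two double steps, the one against the sign of the j-th coordinate moves
      towards the centre and cannot overshoot, as 2 \<bar>s\<bar> < l j.\<close>
    have "w + axis j (2 * s) \<in> ?b \<or> w + axis j (2 * - s) \<in> ?b" if w: "w \<in> ?b"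
    proof (cases "0 \<le> s * w $ j")
      case True
      have "- l i < (w + axis j (2 * - s)) $ i \<and> (w + axis j (2 * - s)) $ i < l i" for i
      proof (cases "i = j")
        case i: True
        have "- l j < w $ j" "w $ j < l j" using w by (auto simp: centered_box_def)
        then show ?thesis using True s i by (cases "s = 0") (auto simp: axis_def zero_le_mult_iff abs_if split: if_splits)
      qed (use w in \<open>auto simp: centered_box_def axis_def\<close>)
      then show ?thesis by (auto simp: centered_box_def)
    next
      case False
      have "- l i < (w + axis j (2 * s)) $ i \<and> (w + axis j (2 * s)) $ i < l i" for i
      proof (cases "i = j")
        case i: True
        have "- l j < w $ j" "w $ j < l j" using w by (auto simp: centered_box_def)
        then show ?thesis using False s i by (auto simp: axis_def zero_le_mult_iff abs_if not_le split: if_splits)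
      qed (use w in \<open>auto simp: centered_box_def axis_def\<close>)
      then show ?thesis by (auto simp: centered_box_def)
    qed
    then show "ennreal ((f w)\<^sup>2) * indicator ?b w \<le> ennreal ((f w)\<^sup>2) * indicator ?b w * indicator ?b (w + axis j (2 * s))
        + ennreal ((f w)\<^sup>2) * indicator ?b w * indicator ?b (w + axis j (2 * - s))"
      by (auto simp: indicator_def)
  qed
  also have "\<dots> \<le> ennreal (3/4) * (2 * p s + p (2 * s)) + ennreal (3/4) * (2 * p (- s) + p (2 * - s))"
    using half[of s] half[of "- s"] by (subst nn_integral_add) (auto intro!: add_mono)
  finally show ?thesis by (simp only: distrib_left)
qed

lemma box_sum_form:
  fixes f :: "real^'n::finite \<Rightarrow> real"
  assumes f[measurable]: "f \<in> borel_measurable borel" and \<eta>: "0 < \<eta>" "\<eta> \<le> l j"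
  shows "(\<integral>\<^sup>+w. ennreal ((f w)\<^sup>2) * indicator (centered_box l) w \<partial>lborel)
    \<le> ennreal (9 / (2 * \<eta>)) * (\<integral>\<^sup>+s. sum_form (centered_box l) f (axis j s) * indicator {-\<eta><..<\<eta>} s \<partial>lborel)"
proof -
  define p where "p s = sum_form (centered_box l) f (axis j s)" for s
  have p[measurable]: "p \<in> borel_measurable borel" unfolding p_def by measurable
  let ?I = "\<integral>\<^sup>+w. ennreal ((f w)\<^sup>2) * indicator (centered_box l) w \<partial>lborel"
  \<comment> \<open>Averaging over \<bar>s\<bar> < \<eta>/2 only keeps the double steps 2 s within
    the range of the right-hand side.\<close>
  let ?h = "{-(\<eta>/2)<..<\<eta>/2}"
  let ?P = "\<integral>\<^sup>+s. p s * indicator {-\<eta><..<\<eta>} s \<partial>lborel"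
  have small: "(\<integral>\<^sup>+s. p s * indicator ?h s \<partial>lborel) \<le> ?P"
    using \<eta> by (intro nn_integral_mono mult_left_mono) (auto simp: indicator_def)
  have refl: "(\<integral>\<^sup>+s. q (- s) * indicator ?h s \<partial>lborel) = (\<integral>\<^sup>+s. q s * indicator ?h s \<partial>lborel)"
    if [measurable]: "q \<in> borel_measurable borel" for q :: "real \<Rightarrow> ennreal"
  proof -
    have "(\<integral>\<^sup>+s. q (- s) * indicator ?h s \<partial>lborel) = (\<integral>\<^sup>+s. q (- s) * indicator ?h (- s) \<partial>lborel)"
      by (intro nn_integral_cong) (auto simp: indicator_def)
    also have "\<dots> = (\<integral>\<^sup>+s. q s * indicator ?h s \<partial>lborel)"
      by (rule nn_integral_lborel_reflect[of "\<lambda>s. q s * indicator ?h s"]) measurable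
    finally show ?thesis .
  qed
  have dbl: "(\<integral>\<^sup>+s. p (2 * s) * indicator ?h s \<partial>lborel) \<le> ?P"
  proof -
    have "?P = 2 * (\<integral>\<^sup>+s. p (2 * s) * indicator {-\<eta><..<\<eta>} (2 * s) \<partial>lborel)"
      using nn_integral_lborel_scale_real[of "\<lambda>s. p s * indicator {-\<eta><..<\<eta>} s" 2] by simp
    also have "(\<integral>\<^sup>+s. p (2 * s) * indicator {-\<eta><..<\<eta>} (2 * s) \<partial>lborel) = (\<integral>\<^sup>+s. p (2 * s) * indicator ?h s \<partial>lborel)"
      by (intro nn_integral_cong) (auto simp: indicator_def)
    finally have "?P = 2 * (\<integral>\<^sup>+s. p (2 * s) * indicator ?h s \<partial>lborel)" .
    then show ?thesis using mult_right_mono[of 1 2 "\<integral>\<^sup>+s. p (2 * s) * indicator ?h s \<partial>lborel :: ennreal"] by simp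
  qed
  have "ennreal \<eta> * ?I = (\<integral>\<^sup>+s. ?I * indicator ?h s \<partial>lborel)"
    using \<eta> by (subst nn_integral_cmult_indicator) (auto simp: mult.commute)
  also have "\<dots> \<le> (\<integral>\<^sup>+s. ennreal (3/4) * ((2 * p s + p (2 * s)) + (2 * p (- s) + p (2 * - s))) * indicator ?h s \<partial>lborel)"
  proof (intro nn_integral_mono)
    fix s :: real
    show "?I * indicator ?h s \<le> ennreal (3/4) * ((2 * p s + p (2 * s)) + (2 * p (- s) + p (2 * - s))) * indicator ?h s"
      using box_sum_form_pointwise[OF f, of s l j] \<eta> by (cases "s \<in> ?h") (auto simp: p_def abs_le_iff)
  qed
  also have "\<dots> = (\<integral>\<^sup>+s. ennreal (3/4) * ((2 * (p s * indicator ?h s) + p (2 * s) * indicator ?h s)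
      + (2 * (p (- s) * indicator ?h s) + p (2 * - s) * indicator ?h s)) \<partial>lborel)"
    by (intro nn_integral_cong) (simp only: distrib_right distrib_left mult.assoc)
  also have "\<dots> = ennreal (3/4) * ((2 * (\<integral>\<^sup>+s. p s * indicator ?h s \<partial>lborel) + (\<integral>\<^sup>+s. p (2 * s) * indicator ?h s \<partial>lborel))
     + (2 * (\<integral>\<^sup>+s. p (- s) * indicator ?h s \<partial>lborel) + (\<integral>\<^sup>+s. p (2 * - s) * indicator ?h s \<partial>lborel)))"
    by (simp add: nn_integral_add nn_integral_cmult)
  also have "\<dots> \<le> ennreal (3/4) * ((2 * ?P + ?P) + (2 * ?P + ?P))"
    using small dbl refl[of p] refl[of "\<lambda>s. p (2 * s)"]
    by (intro mult_left_mono add_mono) auto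
  also have "\<dots> = ennreal (9/2) * ?P"
  proof -
    have "(2 * ?P + ?P) + (2 * ?P + ?P) = ennreal 6 * ?P"
    proof -
      have 6: "ennreal 6 = (2 + 1) + (2 + 1)" by simp
      show ?thesis unfolding 6 by (simp only: distrib_right mult_1)
    qed
    moreover have "ennreal (3/4) * ennreal 6 = ennreal (9/2)" by (subst ennreal_mult[symmetric]) auto
    ultimately show ?thesis by (metis mult.assoc)
  qed
  finally have le: "ennreal \<eta> * ?I \<le> ennreal (9/2) * ?P" .
  have "?I = ennreal (1 / \<eta>) * (ennreal \<eta> * ?I)"
    using \<eta> by (simp only: mult.assoc[symmetric] ennreal_mult[symmetric] zero_le_divide_1_iff less_imp_le) simp
  also have "\<dots> \<le> ennreal (1 / \<eta>) * (ennreal (9/2) * ?P)" by (intro mult_left_mono le) auto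
  also have "\<dots> = ennreal (9 / (2 * \<eta>)) * ?P"
    using \<eta> by (simp only: mult.assoc[symmetric] ennreal_mult[symmetric] zero_le_divide_1_iff less_imp_le) (simp add: ac_simps flip: ennreal_mult)
  finally show ?thesis unfolding p_def .
qed

section \<open>Flows along a coordinate line\<close>

text \<open>The integral of \<open>\<phi>\<close> from \<open>0\<close> to \<open>s\<close>, rescaled to \<open>[0, 1]\<close> so that one formula covers both signs of \<open>s\<close>:
  the time needed to travel from \<open>0\<close> to \<open>s\<close> at the speed \<open>1 / \<phi>\<close>.\<close>

definition travel_time :: "(real \<Rightarrow> real) \<Rightarrow> real \<Rightarrow> real" where
  "travel_time \<phi> s = s * (LINT \<sigma>:{0..1}|lborel. \<phi> (\<sigma> * s))"

lemma travel_time_zero[simp]: "travel_time \<phi> 0 = 0"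
  by (simp add: travel_time_def)

lemma travel_time_eq_integral:
  assumes cont: "continuous_on {p..q} \<phi>" and pq: "p \<le> 0" "0 \<le> q" and s: "s \<in> {p..q}"
  shows "travel_time \<phi> s = integral {p..s} \<phi> - integral {p..0} \<phi>"
proof -
  have seg: "\<sigma> * s \<in> {p..q}" if "\<sigma> \<in> {0..1}" for \<sigma>
  proof -
    have "min 0 s \<le> \<sigma> * s \<and> \<sigma> * s \<le> max 0 s"
      using that by (cases "0 \<le> s") (auto simp: mult_left_le_one_le mult_nonneg_nonpos mult_le_cancel_right1 min_def max_def)
    then show ?thesis using s pq by auto
  qed
  have "continuous_on {0..1} (\<lambda>\<sigma>. \<phi> (\<sigma> * s))"
    by (rule continuous_on_compose2[OF cont]) (use seg in \<open>auto intro!: continuous_intros\<close>)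
  then have c: "continuous_on {0..1} (\<lambda>\<sigma>. \<phi> (\<sigma> * s))" .
  have "(LINT \<sigma>:{0..1}|lborel. \<phi> (\<sigma> * s)) = integral {0..1} (\<lambda>\<sigma>. \<phi> (\<sigma> * s))"
    by (intro set_borel_integral_eq_integral borel_integrable_atLeastAtMost' c)
  moreover have "((\<lambda>\<sigma>. s * \<phi> (\<sigma> * s)) has_integral (integral {p..1 * s} \<phi> - integral {p..0 * s} \<phi>)) {0..1}"
  proof (rule fundamental_theorem_of_calculus)
    fix \<sigma> :: real assume \<sigma>: "\<sigma> \<in> {0..1}"
    have "((\<lambda>x. integral {p..x} \<phi>) has_real_derivative \<phi> (\<sigma> * s)) (at (\<sigma> * s) within {p..q})"
      by (rule integral_has_real_derivative[OF cont seg[OF \<sigma>]])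
    then have "((\<lambda>x. integral {p..x} \<phi>) has_real_derivative \<phi> (\<sigma> * s)) (at (\<sigma> * s) within (\<lambda>\<sigma>. \<sigma> * s) ` {0..1})"
      by (rule DERIV_subset) (use seg in auto)
    moreover have "((\<lambda>\<sigma>. \<sigma> * s) has_real_derivative s) (at \<sigma> within {0..1})"
      by (auto intro!: derivative_eq_intros)
    ultimately have "((\<lambda>x. integral {p..x} \<phi>) \<circ> (\<lambda>\<sigma>. \<sigma> * s) has_real_derivative \<phi> (\<sigma> * s) * s) (at \<sigma> within {0..1})"
      by (rule DERIV_image_chain)
    then show "((\<lambda>\<sigma>. integral {p..\<sigma> * s} \<phi>) has_vector_derivative s * \<phi> (\<sigma> * s)) (at \<sigma> within {0..1})"
      by (simp add: has_real_derivative_iff_has_vector_derivative o_def mult.commute)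
  qed simp
  from integral_unique[OF this]
  have "integral {0..1} (\<lambda>\<sigma>. s * \<phi> (\<sigma> * s)) = integral {p..s} \<phi> - integral {p..0} \<phi>"
    by (simp only: mult_1 mult_zero_left)
  ultimately show ?thesis by (simp add: travel_time_def)
qed

lemma travel_time_deriv:
  assumes cont: "continuous_on {A<..<B} \<phi>" and AB: "A < 0" "0 < B" and t: "t \<in> {A<..<B}"
  shows "(travel_time \<phi> has_real_derivative \<phi> t) (at t)"
proof -
  \<comment> \<open>A compact subinterval that has both 0 and t in its interior.\<close>
  define p q where "p = (A + min t 0) / 2" and "q = (B + max t 0) / 2"
  have pq: "A < p" "p < t" "p < 0" "t < q" "0 < q" "q < B" using AB t by (auto simp: p_def q_def)
  have c: "continuous_on {p..q} \<phi>" by (rule continuous_on_subset[OF cont]) (use pq in auto)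
  have "((\<lambda>x. integral {p..x} \<phi> - integral {p..0} \<phi>) has_real_derivative \<phi> t) (at t within {p..q})"
    using integral_has_real_derivative[OF c, of t] pq by (auto intro!: derivative_eq_intros)
  then have "((\<lambda>x. integral {p..x} \<phi> - integral {p..0} \<phi>) has_real_derivative \<phi> t) (at t)"
    using pq by (subst (asm) at_within_interior) auto
  then show ?thesis
  proof (rule has_field_derivative_transform_within_open[of _ _ _ "{p<..<q}"])
    fix x assume "x \<in> {p<..<q}"
    then show "integral {p..x} \<phi> - integral {p..0} \<phi> = travel_time \<phi> x"
      using travel_time_eq_integral[OF c, of x] pq by auto
  qed (use pq in auto)
qed

text \<open>\<phi> is the reciprocal of the velocity on the open interval where the field lives. The
  lower bound m on [-a, a] ensures that up to time m a the flow from 0 stays inside [-a, a].\<close>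

locale line_flow =
  fixes \<phi> :: "real \<Rightarrow> real" and A B a m :: real
  assumes cont: "continuous_on {A<..<B} \<phi>" and pos: "\<And>s. s \<in> {A<..<B} \<Longrightarrow> 0 < \<phi> s"
    and a: "0 < a" "A < - a" "a < B" and m: "0 < m" "\<And>s. s \<in> {-a..a} \<Longrightarrow> m \<le> \<phi> s"
begin

abbreviation "\<T> \<equiv> travel_time \<phi>"

lemma T_deriv: "t \<in> {A<..<B} \<Longrightarrow> (\<T> has_real_derivative \<phi> t) (at t)"
  using a by (intro travel_time_deriv[OF cont]) auto

lemma T_strict: assumes "s < t" "s \<in> {A<..<B}" "t \<in> {A<..<B}" shows "\<T> s < \<T> t"
proof (rule DERIV_pos_imp_increasing[OF assms(1)])
  fix x assume "s \<le> x" "x \<le> t"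
  then have "x \<in> {A<..<B}" using assms by auto
  then show "\<exists>y. (\<T> has_real_derivative y) (at x) \<and> 0 < y" using T_deriv pos by blast
qed

lemma T_inj: "s \<in> {A<..<B} \<Longrightarrow> t \<in> {A<..<B} \<Longrightarrow> \<T> s = \<T> t \<Longrightarrow> s = t"
  using T_strict by (metis less_irrefl linorder_neqE)

lemma T_cont: "continuous_on {A<..<B} \<T>"
  by (intro DERIV_continuous_on[of _ _ \<phi>] has_field_derivative_at_within[OF T_deriv])

lemma T_expand: assumes "x \<le> y" "x \<in> {-a..a}" "y \<in> {-a..a}" shows "m * (y - x) \<le> \<T> y - \<T> x"
proof -
  have "\<T> x - m * x \<le> \<T> y - m * y"
  proof (rule DERIV_nonneg_imp_nondecreasing[OF assms(1), of "\<lambda>s. \<T> s - m * s"])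
    fix z assume z: "x \<le> z" "z \<le> y"
    then show "\<exists>d. ((\<lambda>s. \<T> s - m * s) has_real_derivative d) (at z) \<and> 0 \<le> d"
      using T_deriv[of z] m(2)[of z] a assms by (intro exI[of _ "\<phi> z - m"]) (auto intro!: derivative_eq_intros)
  qed
  then show ?thesis by (simp add: algebra_simps)
qed

lemma T_lower: assumes "0 \<le> s" "s \<le> a" shows "m * s \<le> \<T> s" "\<T> (- s) \<le> - (m * s)"
  using T_expand[of 0 s] T_expand[of "- s" 0] assms by auto

lemma T_surj: assumes t: "\<bar>t\<bar> < m * a" shows "\<exists>z\<in>{-a<..<a}. \<T> z = t"
proof -
  have "\<exists>z\<ge>-a. z \<le> a \<and> \<T> z = t"
    using T_lower[of a] t a by (intro IVT' continuous_on_subset[OF T_cont]) auto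
  then obtain z where z: "- a \<le> z" "z \<le> a" "\<T> z = t" by auto
  moreover have "z \<noteq> a" "z \<noteq> - a" using T_lower[of a] t a z by auto
  ultimately show ?thesis by (intro bexI[of _ z]) auto
qed

definition position :: "real \<Rightarrow> real" where
  "position t = (THE z. z \<in> {-a<..<a} \<and> \<T> z = t)"

lemma position: assumes "\<bar>t\<bar> < m * a" shows "position t \<in> {-a<..<a}" "\<T> (position t) = t"
proof -
  obtain z where z: "z \<in> {-a<..<a}" "\<T> z = t" using T_surj[OF assms] by auto
  have "position t \<in> {-a<..<a} \<and> \<T> (position t) = t"
    unfolding position_def
  proof (rule theI[of _ z])
    fix x assume "x \<in> {-a<..<a} \<and> \<T> x = t"
    then show "x = z" using z a T_inj[of x z] by auto
  qed (use z in auto)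
  then show "position t \<in> {-a<..<a}" "\<T> (position t) = t" by auto
qed

lemma position_eqI: "\<bar>t\<bar> < m * a \<Longrightarrow> z \<in> {A<..<B} \<Longrightarrow> \<T> z = t \<Longrightarrow> position t = z"
  using position[of t] a T_inj[of "position t" z] by auto

lemma position_zero[simp]: "position 0 = 0"
  using a m by (intro position_eqI) auto

lemma position_lipschitz:
  assumes "\<bar>s\<bar> < m * a" "\<bar>t\<bar> < m * a" shows "\<bar>position s - position t\<bar> \<le> \<bar>s - t\<bar> / m"
proof -
  have "\<bar>position s - position t\<bar> * m \<le> \<bar>\<T> (position s) - \<T> (position t)\<bar>"
    using T_expand[of "position s" "position t"] T_expand[of "position t" "position s"]
      position(1)[OF assms(1)] position(1)[OF assms(2)]
    by (cases "position s \<le> position t") (auto simp: algebra_simps abs_if)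
  then show ?thesis using position(2) assms m by (simp add: field_simps)
qed

lemma position_cont: "continuous_on {-(m * a)<..<m * a} position"
proof (rule lipschitz_on_continuous_on[of "1 / m"], rule lipschitz_onI)
  fix s t assume "s \<in> {-(m * a)<..<m * a}" "t \<in> {-(m * a)<..<m * a}"
  then show "dist (position s) (position t) \<le> 1 / m * dist s t"
    using position_lipschitz[of s t] by (auto simp: dist_real_def abs_less_iff)
qed (use m in simp)

lemma position_deriv: assumes "\<bar>t\<bar> < m * a"
  shows "(position has_real_derivative 1 / \<phi> (position t)) (at t)"
proof -
  note p = position[OF assms]
  have pAB: "position t \<in> {A<..<B}" using p a by auto
  have "(position has_real_derivative inverse (\<phi> (position t))) (at t)"
  proof (rule DERIV_inverse_function[where f="\<T>" and a="- (m * a)" and b="m * a"])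
    show "(\<T> has_real_derivative \<phi> (position t)) (at (position t))" by (rule T_deriv[OF pAB])
    show "isCont position t"
    proof -
      have "t \<in> {-(m * a)<..<m * a}" using assms by (auto simp: abs_less_iff)
      then show ?thesis using position_cont by (simp add: continuous_on_eq_continuous_at)
    qed
  qed (use assms pos[OF pAB] position(2) in auto)
  then show ?thesis by (simp add: inverse_eq_divide)
qed

text \<open>Along an integral curve \<open>\<T> (z s) - s\<close> has derivative 0. Since
  \<open>\<T>\<close> is injective, this settles uniqueness of the flow.\<close>

lemma curve_time:
  assumes z: "\<And>s. s \<in> closed_segment 0 t \<Longrightarrow> z s \<in> {A<..<B}"
    and z': "\<And>s. s \<in> closed_segment 0 t \<Longrightarrow> (z has_vector_derivative 1 / \<phi> (z s)) (at s within closed_segment 0 t)"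
    and z0: "z 0 = 0"
  shows "\<T> (z t) = t"
proof -
  have "((\<lambda>s. \<T> (z s) - s) has_vector_derivative 0) (at s within closed_segment 0 t)"
    if s: "s \<in> closed_segment 0 t" for s
  proof -
    have "(z has_real_derivative 1 / \<phi> (z s)) (at s within closed_segment 0 t)"
      using z'[OF s] by (simp add: has_real_derivative_iff_has_vector_derivative)
    from DERIV_chain2[OF T_deriv[OF z[OF s]] this]
    have "((\<lambda>s. \<T> (z s)) has_real_derivative 1) (at s within closed_segment 0 t)"
      using pos[OF z[OF s]] by simp
    then have "((\<lambda>s. \<T> (z s) - s) has_real_derivative 1 - 1) (at s within closed_segment 0 t)"
      by (intro derivative_intros)
    then show ?thesis by (simp add: has_real_derivative_iff_has_vector_derivative)
  qed
  then obtain c where c: "\<And>s. s \<in> closed_segment 0 t \<Longrightarrow> \<T> (z s) - s = c"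
    using has_vector_derivative_zero_constant[of "closed_segment 0 t" "\<lambda>s. \<T> (z s) - s"] by auto
  from c[of 0] c[of t] z0 show ?thesis by simp
qed

text \<open>Substituting \<open>t = \<T> z\<close> in a time average along the flow.\<close>

lemma time_average:
  fixes g :: "real \<Rightarrow> 'b::{banach, second_countable_topology}"
  assumes h: "0 < h" "h \<le> m * a" and g[measurable]: "g \<in> borel_measurable borel"
  shows "(LINT t|lborel. indicator {-h<..<h} t *\<^sub>R g (position t))
    = (LINT z|lborel. (indicator {-a..a} z * indicator {-h<..<h} (\<T> z) * \<phi> z) *\<^sub>R g z)"
proof -
  have sub: "{-a..a} \<subseteq> {A<..<B}" using a by auto
  define T' where "T' z = (if z \<in> {-a..a} then \<T> z else 0)" for z
  define \<phi>' where "\<phi>' z = (if z \<in> {-a..a} then \<phi> z else 0)" for z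
  define p' where "p' t = (if t \<in> {-(m * a)<..<m * a} then position t else 0)" for t
  have [measurable]: "T' \<in> borel_measurable borel"
    unfolding T'_def by (rule borel_measurable_continuous_on_if) (auto intro: continuous_on_subset[OF T_cont sub])
  have [measurable]: "\<phi>' \<in> borel_measurable borel"
    unfolding \<phi>'_def by (rule borel_measurable_continuous_on_if) (auto intro: continuous_on_subset[OF cont sub])
  have [measurable]: "p' \<in> borel_measurable borel"
    unfolding p'_def by (rule borel_measurable_continuous_on_if) (auto intro: position_cont)
  have nn: "0 \<le> \<phi>' z" for z using pos[of z] sub by (cases "z \<in> {-a..a}") (force simp: \<phi>'_def)+
  define J where "J = {\<T> (-a)..\<T> a}"
  \<comment> \<open>The substitution is carried out once, as an equality of measures; integrals of
    Banach-valued functions then transform without any integrability to check.\<close>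
  have eq: "distr (density lborel (\<lambda>z. ennreal (\<phi>' z))) borel T' = density lborel (\<lambda>t. indicator J t)"
  proof (rule measure_eqI)
    fix X assume "X \<in> sets (distr (density lborel (\<lambda>z. ennreal (\<phi>' z))) borel T')"
    then have X[measurable]: "X \<in> sets borel" by simp
    have "emeasure (distr (density lborel (\<lambda>z. ennreal (\<phi>' z))) borel T') X
        = (\<integral>\<^sup>+z. ennreal (\<phi>' z) * indicator (T' -` X) z \<partial>lborel)"
    proof -
      have "T' -` X \<in> sets borel" by (rule measurable_sets_borel[OF _ X]) measurable
      then show ?thesis by (simp add: emeasure_distr emeasure_density)
    qed
    also have "\<dots> = (\<integral>\<^sup>+z. indicator X (\<T> z) * ennreal (\<phi> z) * indicator {-a..a} z \<partial>lborel)"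
      by (intro nn_integral_cong) (auto simp: \<phi>'_def T'_def indicator_def)
    also have "\<dots> = (\<integral>\<^sup>+t. indicator X t * indicator {\<T> (-a)..\<T> a} t \<partial>lborel)"
    proof (rule nn_integral_substitution_aux[symmetric])
      show "continuous_on {-a..a} \<phi>" by (rule continuous_on_subset[OF cont sub])
      show "0 \<le> \<phi> z" if "z \<in> {-a..a}" for z using nn[of z] that by (simp add: \<phi>'_def)
    qed (use a sub T_deriv in auto)
    also have "\<dots> = emeasure (density lborel (\<lambda>t. indicator J t)) X"
      by (simp add: emeasure_density J_def mult.commute)
    finally show "emeasure (distr (density lborel (\<lambda>z. ennreal (\<phi>' z))) borel T') X = \<dots>" .
  qed simp
  have J: "{-h<..<h} \<subseteq> J" using T_lower[of a] a h by (auto simp: J_def)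
  have "(LINT t|lborel. indicator {-h<..<h} t *\<^sub>R g (position t))
      = (LINT t|lborel. indicator J t *\<^sub>R (indicator {-h<..<h} t *\<^sub>R g (p' t)))"
  proof (rule Bochner_Integration.integral_cong[OF refl])
    fix t show "indicator {-h<..<h} t *\<^sub>R g (position t) = indicator J t *\<^sub>R (indicator {-h<..<h} t *\<^sub>R g (p' t))"
      using J h by (auto simp: indicator_def p'_def subset_eq)
  qed
  also have "\<dots> = (LINT t|density lborel (\<lambda>t. ennreal (indicator J t)). indicator {-h<..<h} t *\<^sub>R g (p' t))"
    by (subst integral_density) (auto simp: J_def)
  also have "density lborel (\<lambda>t. ennreal (indicator J t)) = distr (density lborel (\<lambda>z. ennreal (\<phi>' z))) borel T'"
    unfolding eq by (simp add: ennreal_indicator)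
  also have "(LINT t|distr (density lborel (\<lambda>z. ennreal (\<phi>' z))) borel T'. indicator {-h<..<h} t *\<^sub>R g (p' t))
      = (LINT z|density lborel (\<lambda>z. ennreal (\<phi>' z)). indicator {-h<..<h} (T' z) *\<^sub>R g (p' (T' z)))"
    by (subst integral_distr) auto
  also have "\<dots> = (LINT z|lborel. \<phi>' z *\<^sub>R (indicator {-h<..<h} (T' z) *\<^sub>R g (p' (T' z))))"
    by (subst integral_density) (auto simp: nn)
  also have "\<dots> = (LINT z|lborel. (indicator {-a..a} z * indicator {-h<..<h} (\<T> z) * \<phi> z) *\<^sub>R g z)"
  proof (rule Bochner_Integration.integral_cong[OF refl])
    fix z
    show "\<phi>' z *\<^sub>R (indicator {-h<..<h} (T' z) *\<^sub>R g (p' (T' z))) = (indicator {-a..a} z * indicator {-h<..<h} (\<T> z) * \<phi> z) *\<^sub>R g z"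
    proof (cases "z \<in> {-a..a} \<and> \<bar>\<T> z\<bar> < h")
      case True
      then have lt: "\<bar>\<T> z\<bar> < m * a" using h by auto
      then have "position (\<T> z) = z" using True sub by (intro position_eqI) auto
      then show ?thesis using True lt by (auto simp: \<phi>'_def T'_def p'_def indicator_def abs_less_iff)
    qed (auto simp: \<phi>'_def T'_def indicator_def abs_less_iff)
  qed
  finally show ?thesis .
qed

end

section \<open>Cubes with a density\<close>

lemma axis_add: "axis j (s + t) = axis j s + (axis j t :: real^'n)"
  by (auto simp: axis_def vec_eq_iff)

lemma axis_minus: "axis j (- s) = - (axis j s :: real^'n)"
  by (auto simp: axis_def vec_eq_iff)

lemma axis_scale: "axis j s = s *\<^sub>R (axis j 1 :: real^'n)"
  by (auto simp: axis_def vec_eq_iff)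

lemma axis_0[simp]: "axis j 0 = (0 :: real^'n)"
  by (auto simp: axis_def vec_eq_iff)

lemma axis_continuous:
  assumes "continuous_on S f" shows "continuous_on S (\<lambda>x. axis j (f x) :: real^'n::finite)"
proof -
  have "continuous_on S (\<lambda>x. f x *\<^sub>R axis j 1 :: real^'n)" by (intro continuous_intros assms)
  then show ?thesis by (rule continuous_on_eq) (simp add: axis_scale[symmetric])
qed

lemma centered_box_axis_iff:
  assumes "w \<in> centered_box l"
  shows "w + axis j s \<in> centered_box l \<longleftrightarrow> s \<in> {- l j - w $ j<..<l j - w $ j}"
  using assms by (auto simp: centered_box_def axis_def)

lemma centered_box_axis_segment:
  assumes "w \<in> centered_box l" "w + axis j s \<in> centered_box l" "\<sigma> \<in> {0..1}"
  shows "w + axis j (\<sigma> * s) \<in> centered_box l"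
proof -
  have "convex (centered_box l)" by (simp add: centered_box_eq_box)
  from convexD_alt[OF this assms(1,2), of \<sigma>] assms(3)
  have "(1 - \<sigma>) *\<^sub>R w + \<sigma> *\<^sub>R (w + axis j s) \<in> centered_box l" by auto
  also have "(1 - \<sigma>) *\<^sub>R w + \<sigma> *\<^sub>R (w + axis j s) = w + axis j (\<sigma> * s)"
    by (simp add: scaleR_add_right axis_def vec_eq_iff) (simp add: algebra_simps)
  finally show ?thesis .
qed

text \<open>\<open>par\<close> is the inverse coordinate map, \<open>l\<close> and \<open>L\<close>
  are the half-sides of the cube and of its dilation, and \<open>d\<close> is the density of
  \<open>M\<close>. The density is bounded within distance \<open>a\<close> of the cube along each
  axis, since a flow line may leave the cube before time h.\<close>

locale cube_chart =
  fixes par :: "real^'n::finite \<Rightarrow> 'm::{t2_space, second_countable_topology}"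
    and l L :: "'n \<Rightarrow> real" and d :: "real^'n \<Rightarrow> real" and M :: "'m measure" and \<Lambda> a :: real
  assumes l: "\<And>j. 0 < l j" "\<And>j. l j < L j"
    and inj: "inj_on par (centered_box L)"
    and cont_par: "continuous_on (centered_box L) par"
    and open_image: "\<And>W. open W \<Longrightarrow> W \<subseteq> centered_box L \<Longrightarrow> open (par ` W)"
    and sets_M: "sets M = sets borel"
    and meas: "\<And>B. B \<in> sets borel \<Longrightarrow> B \<subseteq> centered_box L \<Longrightarrow>
        emeasure M (par ` B) = (\<integral>\<^sup>+w\<in>B. ennreal (d w) \<partial>lborel)"
    and d_cont: "continuous_on (centered_box L) d"
    and d_pos: "\<And>w. w \<in> centered_box L \<Longrightarrow> 0 < d w"
    and \<Lambda>: "1 \<le> \<Lambda>" and a: "0 < a"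
    and near: "\<And>w j s. w \<in> centered_box l \<Longrightarrow> \<bar>s\<bar> \<le> a \<Longrightarrow>
        w + axis j s \<in> centered_box L \<and> 1 / \<Lambda> \<le> d (w + axis j s) \<and> d (w + axis j s) \<le> \<Lambda>"
begin

abbreviation "b \<equiv> centered_box l"
abbreviation "bL \<equiv> centered_box L"
abbreviation "Q \<equiv> par ` b"

lemma b_sub: "b \<subseteq> bL"
proof
  fix w assume "w \<in> b"
  then have "- l j < w $ j \<and> w $ j < l j" for j by (simp add: centered_box_def)
  then have "- L j < w $ j \<and> w $ j < L j" for j using l(2)[of j] by (smt (verit))
  then show "w \<in> bL" by (simp add: centered_box_def)
qed

lemma d_bounds: assumes "w \<in> b" shows "1 / \<Lambda> \<le> d w" "d w \<le> \<Lambda>"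
  using near[OF assms, of 0] a by auto

definition d0 :: "real^'n \<Rightarrow> real" where "d0 w = (if w \<in> bL then d w else 0)"

lemma d0_measurable[measurable]: "d0 \<in> borel_measurable borel"
  unfolding d0_def by (rule borel_measurable_continuous_on_if) (auto intro: d_cont)

lemma d0_nonneg: "0 \<le> d0 w"
  using d_pos[of w] by (simp add: d0_def less_imp_le)

lemma d0_b: "w \<in> b \<Longrightarrow> 1 / \<Lambda> \<le> d0 w \<and> d0 w \<le> \<Lambda>"
  using d_bounds b_sub by (auto simp: d0_def)

text \<open>The reciprocal of the velocity c / d along the axis-j line through w: the function
  \<phi> of \<open>line_flow\<close>.\<close>

definition speed :: "'n \<Rightarrow> real \<Rightarrow> real^'n \<Rightarrow> real \<Rightarrow> real" where
  "speed j c w z = d0 (w + axis j z) / c"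

text \<open>The signed time that the flow needs from w to w + s e_j.\<close>

definition \<theta> :: "'n \<Rightarrow> real \<Rightarrow> real^'n \<Rightarrow> real \<Rightarrow> real" where
  "\<theta> j c w s = travel_time (speed j c w) s"

lemma \<theta>_measurable[measurable]:
  assumes [measurable]: "f \<in> borel_measurable N" "g \<in> borel_measurable N"
  shows "(\<lambda>x. \<theta> j c (f x) (g x)) \<in> borel_measurable N"
proof -
  have "(\<lambda>(w, s). \<theta> j c w s) \<in> borel_measurable (borel \<Otimes>\<^sub>M borel)"
    unfolding \<theta>_def travel_time_def speed_def set_lebesgue_integral_def
    by measurable
  then have "(\<lambda>x. (\<lambda>(w, s). \<theta> j c w s) (f x, g x)) \<in> borel_measurable N"
    by (rule measurable_compose[rotated]) measurable
  then show ?thesis by simp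
qed

text \<open>The substitution \<sigma> -> 1 - \<sigma> runs the path backwards. This antisymmetry is
  what makes the jumps reversible.\<close>

lemma \<theta>_reverse: "\<theta> j c (w + axis j s) (- s) = - \<theta> j c w s"
proof -
  have "(LINT \<sigma>:{0..1}|lborel. speed j c (w + axis j s) (\<sigma> * - s)) = (LINT \<sigma>|lborel. indicator {0..1} \<sigma> * speed j c w ((1 - \<sigma>) * s))"
    unfolding set_lebesgue_integral_def speed_def
    by (simp add: add.assoc axis_add[symmetric] algebra_simps)
  also have "\<dots> = (LINT \<sigma>|lborel. indicator {0..1} (1 + (-1) * \<sigma>) * speed j c w ((1 - (1 + (-1) * \<sigma>)) * s))"
    by (subst lborel_integral_real_affine[where c="-1" and t=1]) auto
  also have "\<dots> = (LINT \<sigma>:{0..1}|lborel. speed j c w (\<sigma> * s))"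
    unfolding set_lebesgue_integral_def by (intro Bochner_Integration.integral_cong) (auto simp: indicator_def)
  finally show ?thesis unfolding \<theta>_def travel_time_def by simp
qed

lemma line_flow:
  assumes w: "w \<in> b" and c: "0 < c"
  shows "line_flow (speed j c w) (- L j - w $ j) (L j - w $ j) a (1 / (\<Lambda> * c))"
proof
  have wL: "w \<in> bL" using w b_sub by auto
  note iff = centered_box_axis_iff[OF wL, of j]
  show "continuous_on {- L j - w $ j<..<L j - w $ j} (speed j c w)"
  proof -
    have "continuous_on {- L j - w $ j<..<L j - w $ j} (\<lambda>z. d (w + axis j z) / c)"
    proof -
      have "continuous_on {- L j - w $ j<..<L j - w $ j} (\<lambda>z. w + axis j z)"
        by (intro continuous_on_add continuous_on_const axis_continuous continuous_on_id)
      moreover have "(\<lambda>z. w + axis j z) ` {- L j - w $ j<..<L j - w $ j} \<subseteq> bL"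
        using iff by (auto simp del: greaterThanLessThan_iff)
      ultimately have "continuous_on {- L j - w $ j<..<L j - w $ j} (\<lambda>z. d (w + axis j z))"
        by (rule continuous_on_compose2[OF d_cont])
      then show ?thesis using c by (intro continuous_on_divide continuous_on_const) auto
    qed
    then show ?thesis
      by (rule continuous_on_eq) (use iff in \<open>auto simp: speed_def d0_def\<close>)
  qed
  show "0 < speed j c w s" if "s \<in> {- L j - w $ j<..<L j - w $ j}" for s
    using that iff[of s] d_pos c by (simp add: speed_def d0_def)
  show "- L j - w $ j < - a" using near[OF w, of "- a" j] iff[of "- a"] a by auto
  show "a < L j - w $ j" using near[OF w, of a j] iff[of a] a by auto
  show "0 < 1 / (\<Lambda> * c)" using \<Lambda> c by simp
  show "1 / (\<Lambda> * c) \<le> speed j c w s" if "s \<in> {-a..a}" for s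
  proof -
    have "\<bar>s\<bar> \<le> a" using that by (auto simp: abs_le_iff)
    then have "w + axis j s \<in> bL" "1 / \<Lambda> \<le> d (w + axis j s)" using near[OF w] by auto
    then show ?thesis using c by (simp add: speed_def d0_def divide_right_mono flip: divide_divide_eq_left)
  qed
qed (rule a)

definition pos :: "'n \<Rightarrow> real \<Rightarrow> real^'n \<Rightarrow> real \<Rightarrow> real" where
  "pos j c w t = line_flow.position (speed j c w) a t"

lemma pos_range: assumes "w \<in> b" "0 < c" "\<bar>t\<bar> < a / (\<Lambda> * c)"
  shows "pos j c w t \<in> {-a<..<a}" "w + axis j (pos j c w t) \<in> bL"
proof -
  interpret line_flow "speed j c w" "- L j - w $ j" "L j - w $ j" a "1 / (\<Lambda> * c)" by (rule line_flow) fact+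
  show 1: "pos j c w t \<in> {-a<..<a}" using position[of t] assms by (simp add: pos_def)
  then show "w + axis j (pos j c w t) \<in> bL" using near[OF assms(1), of "pos j c w t" j] by auto
qed

text \<open>The field has a j-th component only, so along a solution the other coordinates are
  constant and the problem is that of \<open>line_flow\<close>. Injectivity of \<open>par\<close>
  fixes the starting point of the curve in coordinates.\<close>

lemma flows_to_pos:
  assumes w: "w \<in> b" and c: "0 < c" and t: "\<bar>t\<bar> < a / (\<Lambda> * c)"
  shows "flows_to par bL (\<lambda>w. (c / d w) *\<^sub>R axis j 1) t (par w) y \<longleftrightarrow> y = par (w + axis j (pos j c w t))"
proof -
  interpret line_flow "speed j c w" "- L j - w $ j" "L j - w $ j" a "1 / (\<Lambda> * c)" by (rule line_flow) fact+
  have wL: "w \<in> bL" using w b_sub by auto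
  note iff = centered_box_axis_iff[OF wL, of j]
  show ?thesis
  proof
    assume "flows_to par bL (\<lambda>w. (c / d w) *\<^sub>R axis j 1) t (par w) y"
    then obtain v where v: "par (v 0) = par w" "par (v t) = y"
      and vs: "\<And>s. s \<in> closed_segment 0 t \<Longrightarrow> v s \<in> bL"
        "\<And>s. s \<in> closed_segment 0 t \<Longrightarrow> (v has_vector_derivative (c / d (v s)) *\<^sub>R axis j 1) (at s within closed_segment 0 t)"
      unfolding flows_to_def by blast
    have v0: "v 0 = w" using v(1) inj vs(1)[of 0] wL by (auto dest: inj_onD)
    have comp: "((\<lambda>s. v s $ i) has_vector_derivative ((c / d (v s)) *\<^sub>R axis j 1) $ i) (at s within closed_segment 0 t)"
      if "s \<in> closed_segment 0 t" for s i
      by (rule bounded_linear.has_vector_derivative[OF bounded_linear_vec_nth vs(2)[OF that]])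
    have other: "v s $ i = w $ i" if s: "s \<in> closed_segment 0 t" and i: "i \<noteq> j" for s i
    proof -
      have "((\<lambda>s. v s $ i) has_vector_derivative 0) (at s within closed_segment 0 t)" if "s \<in> closed_segment 0 t" for s
        using comp[OF that, of i] i by (simp add: axis_def)
      then obtain k where "\<And>s. s \<in> closed_segment 0 t \<Longrightarrow> v s $ i = k"
        using has_vector_derivative_zero_constant[of "closed_segment 0 t" "\<lambda>s. v s $ i"] by auto
      then show ?thesis using s v0 by (metis ends_in_segment(1))
    qed
    define z where "z s = v s $ j - w $ j" for s
    have vz: "v s = w + axis j (z s)" if "s \<in> closed_segment 0 t" for s
      using other[OF that] by (auto simp: vec_eq_iff axis_def z_def)
    have "\<T> (z t) = t"
    proof (rule curve_time)
      fix s assume s: "s \<in> closed_segment 0 t"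
      show "z s \<in> {- L j - w $ j<..<L j - w $ j}" using vs(1)[OF s] vz[OF s] iff by simp
      have "(z has_vector_derivative (c / d (v s)) - 0) (at s within closed_segment 0 t)"
        unfolding z_def using comp[OF s, of j] by (intro has_vector_derivative_diff) (auto simp: axis_def)
      then show "(z has_vector_derivative 1 / speed j c w (z s)) (at s within closed_segment 0 t)"
        using vs(1)[OF s] vz[OF s] by (simp add: speed_def d0_def)
    qed (simp add: z_def v0)
    moreover have "z t \<in> {- L j - w $ j<..<L j - w $ j}" using vs(1)[of t] vz[of t] iff by simp
    ultimately have "pos j c w t = z t" unfolding pos_def using t by (intro position_eqI) auto
    then show "y = par (w + axis j (pos j c w t))" using v(2) vz[of t] by simp
  next
    assume y: "y = par (w + axis j (pos j c w t))"
    define v where "v s = w + axis j (pos j c w s)" for s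
    have st: "\<bar>s\<bar> < a / (\<Lambda> * c)" if "s \<in> closed_segment 0 t" for s
      using that t by (auto simp: closed_segment_eq_real_ivl split: if_splits)
    show "flows_to par bL (\<lambda>w. (c / d w) *\<^sub>R axis j 1) t (par w) y"
      unfolding flows_to_def
    proof (intro exI[of _ v] conjI ballI)
      have "pos j c w 0 = 0" by (simp add: pos_def)
      then show "par (v 0) = par w" by (simp add: v_def)
      show "par (v t) = y" by (simp add: v_def y)
      fix s assume s: "s \<in> closed_segment 0 t"
      show vL: "v s \<in> bL" unfolding v_def by (rule pos_range(2)[OF w c st[OF s]])
      have "(pos j c w has_real_derivative 1 / speed j c w (pos j c w s)) (at s within closed_segment 0 t)"
        unfolding pos_def using position_deriv[of s] st[OF s] by (simp add: has_field_derivative_at_within)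
      then have "(pos j c w has_vector_derivative c / d (v s)) (at s within closed_segment 0 t)"
        using vL by (simp add: has_real_derivative_iff_has_vector_derivative speed_def d0_def v_def)
      then have "((\<lambda>s. pos j c w s *\<^sub>R axis j 1 :: real^'n) has_vector_derivative (c / d (v s)) *\<^sub>R axis j 1) (at s within closed_segment 0 t)"
        by (rule bounded_linear.has_vector_derivative[OF bounded_linear_scaleR_left])
      then have "((\<lambda>s. w + pos j c w s *\<^sub>R axis j 1 :: real^'n) has_vector_derivative 0 + (c / d (v s)) *\<^sub>R axis j 1) (at s within closed_segment 0 t)"
        by (intro derivative_intros)
      then show "(v has_vector_derivative (c / d (v s)) *\<^sub>R axis j 1) (at s within closed_segment 0 t)"
        by (simp add: v_def[abs_def] axis_scale[symmetric])
    qed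
  qed
qed

text \<open>The density, with respect to \<open>s\<close>, of the jump \<open>w \<mapsto> w + s e\<^sub>j\<close>.\<close>

definition jump :: "'n \<Rightarrow> real \<Rightarrow> real \<Rightarrow> real^'n \<Rightarrow> real \<Rightarrow> real" where
  "jump j c h w s = indicator b (w + axis j s) * indicator {-h<..<h} (\<theta> j c w s) * d0 (w + axis j s) / (2 * h * c)"

lemma jump_measurable[measurable]:
  assumes [measurable]: "f \<in> borel_measurable N" "g \<in> borel_measurable N"
  shows "(\<lambda>x. jump j c h (f x) (g x)) \<in> borel_measurable N"
  unfolding jump_def by measurable

lemma jump_nonneg: "0 < h \<Longrightarrow> 0 < c \<Longrightarrow> 0 \<le> jump j c h w s"
  by (simp add: jump_def d0_nonneg)

text \<open>Detailed balance: multiplication by d0 w completes the density to d0 w * d0 (w + s e_j),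
  symmetric in the end points, and \<bar>\<theta>\<bar> < h is symmetric by
  \<open>\<theta>_reverse\<close>. The factor 1 / d in the field makes this exact.\<close>

lemma jump_reverse:
  assumes "w \<in> b" "w + axis j s \<in> b"
  shows "d0 (w + axis j s) * jump j c h (w + axis j s) (- s) = d0 w * jump j c h w s"
proof -
  have eq: "w + axis j s + axis j (- s) = w" by (simp add: axis_minus)
  show ?thesis using assms unfolding jump_def \<theta>_reverse eq
    by (auto simp: indicator_def)
qed

lemma \<theta>_bounds:
  assumes w: "w \<in> b" "w + axis j s \<in> b" and c: "0 < c"
  shows "\<bar>s\<bar> / (\<Lambda> * c) \<le> \<bar>\<theta> j c w s\<bar>" "\<bar>\<theta> j c w s\<bar> \<le> \<Lambda> * \<bar>s\<bar> / c"
proof -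
  let ?f = "\<lambda>\<sigma>. speed j c w (\<sigma> * s)"
  have seg: "w + axis j (\<sigma> * s) \<in> b" if "\<sigma> \<in> {0..1}" for \<sigma>
    by (rule centered_box_axis_segment[OF w that])
  have bd: "1 / (\<Lambda> * c) \<le> ?f \<sigma>" "?f \<sigma> \<le> \<Lambda> / c" if "\<sigma> \<in> {0..1}" for \<sigma>
    using d0_b[OF seg[OF that]] c unfolding speed_def
    by (auto simp: divide_right_mono simp flip: divide_divide_eq_left)
  have m: "set_borel_measurable lborel {0..1} ?f" unfolding set_borel_measurable_def speed_def by measurable
  have int: "set_integrable lborel {0..1::real} ?f"
  proof (rule set_integrable_bound[of _ _ "\<lambda>_. \<Lambda> / c"])
    have nn: "0 \<le> 1 / (\<Lambda> * c)" using \<Lambda> c by simp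
    have "norm (?f x) \<le> norm (\<Lambda> / c)" if "x \<in> {0..1}" for x
      using bd[OF that] nn by (smt (verit) real_norm_def)
    then show "AE x in lborel. x \<in> {0..1} \<longrightarrow> norm (?f x) \<le> norm (\<Lambda> / c)"
      by (intro AE_I2) auto
  qed (use m in \<open>auto intro: borel_integrable_atLeastAtMost'\<close>)
  have one: "(LINT \<sigma>:{0..1::real}|lborel. k) = k" for k :: real
    by (simp add: set_integral_const)
  have ci: "set_integrable lborel {0..1::real} (\<lambda>_. k)" for k :: real
    by (intro borel_integrable_atLeastAtMost' continuous_on_const)
  have lo: "1 / (\<Lambda> * c) \<le> (LINT \<sigma>:{0..1}|lborel. ?f \<sigma>)"
    using set_integral_mono[OF ci int bd(1)] unfolding one .
  have hi: "(LINT \<sigma>:{0..1}|lborel. ?f \<sigma>) \<le> \<Lambda> / c"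
    using set_integral_mono[OF int ci bd(2)] unfolding one .
  have 0: "0 \<le> (LINT \<sigma>:{0..1}|lborel. ?f \<sigma>)" using lo \<Lambda> c by (auto intro: order_trans[rotated])
  have th: "\<bar>\<theta> j c w s\<bar> = \<bar>s\<bar> * (LINT \<sigma>:{0..1}|lborel. ?f \<sigma>)"
    using 0 by (simp add: \<theta>_def travel_time_def abs_mult)
  show "\<bar>s\<bar> / (\<Lambda> * c) \<le> \<bar>\<theta> j c w s\<bar>" using mult_left_mono[OF lo, of "\<bar>s\<bar>"] by (simp add: th)
  show "\<bar>\<theta> j c w s\<bar> \<le> \<Lambda> * \<bar>s\<bar> / c" using mult_left_mono[OF hi, of "\<bar>s\<bar>"] by (simp add: th mult.commute)
qed

lemma jump_lower:
  assumes w: "w \<in> b" "w + axis j s \<in> b" and c: "0 < c" and h: "0 < h" and s: "\<bar>s\<bar> < c * h / \<Lambda>"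
  shows "1 / (2 * h * c * \<Lambda>) \<le> jump j c h w s"
proof -
  have "\<Lambda> * \<bar>s\<bar> / c < h" using s \<Lambda> c by (simp add: field_simps)
  then have "\<bar>\<theta> j c w s\<bar> < h" using \<theta>_bounds(2)[OF w c] by linarith
  then have "jump j c h w s = d0 (w + axis j s) / (2 * h * c)" using w by (auto simp: jump_def abs_less_iff)
  moreover have "1 / \<Lambda> / (2 * h * c) \<le> d0 (w + axis j s) / (2 * h * c)"
    using d0_b[OF w(2)] h c by (intro divide_right_mono) auto
  ultimately show ?thesis by (simp add: mult.commute mult.left_commute)
qed

lemma jump_upper:
  assumes w: "w \<in> b" and c: "0 < c" and h: "0 < h"
  shows "jump j c h w s \<le> \<Lambda> / (2 * h * c) * indicator b (w + axis j s) * indicator {-(\<Lambda> * c * h)..\<Lambda> * c * h} s"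
proof (cases "w + axis j s \<in> b \<and> \<bar>\<theta> j c w s\<bar> < h")
  case True
  then have "\<bar>s\<bar> / (\<Lambda> * c) < h" using \<theta>_bounds(1)[OF w _ c, of j s] by linarith
  then have "\<bar>s\<bar> \<le> \<Lambda> * c * h" using \<Lambda> c by (simp add: field_simps)
  moreover have "d0 (w + axis j s) / (2 * h * c) \<le> \<Lambda> / (2 * h * c)"
    using d0_b[of "w + axis j s"] True h c by (intro divide_right_mono) auto
  ultimately show ?thesis using True by (auto simp: jump_def abs_less_iff abs_le_iff)
next
  case False
  then have "jump j c h w s = 0" by (auto simp: jump_def indicator_def abs_less_iff)
  then show ?thesis using \<Lambda> h c by simp
qed

end

section \<open>The jump kernel of a coordinate direction\<close>

context cube_chart
begin

lemma open_Q: "open Q"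
  using b_sub by (intro open_image open_centered_box)

lemma Q_measurable[measurable]: "Q \<in> sets borel"
  using open_Q by simp

definition par' :: "real^'n \<Rightarrow> 'm" where "par' w = (if w \<in> bL then par w else par 0)"

definition coord :: "'m \<Rightarrow> real^'n" where "coord x = (if x \<in> par ` bL then inv_into bL par x else 0)"

lemma par'_measurable[measurable]: "par' \<in> borel_measurable borel"
  unfolding par'_def by (rule borel_measurable_continuous_on_if) (auto intro: cont_par)

lemma coord_par: "w \<in> bL \<Longrightarrow> coord (par w) = w"
  using inj by (simp add: coord_def)

lemma coord_par_b: "w \<in> b \<Longrightarrow> coord (par w) = w"
  using coord_par b_sub by auto

lemma par'_b: "w \<in> b \<Longrightarrow> par' w = par w"
  using b_sub by (auto simp: par'_def)

lemma coord_Q: "x \<in> Q \<Longrightarrow> coord x \<in> b" "x \<in> Q \<Longrightarrow> par (coord x) = x" "x \<in> Q \<Longrightarrow> par' (coord x) = x"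
  using coord_par_b par'_b by auto

lemma par_in_Q_iff: "w \<in> bL \<Longrightarrow> par w \<in> Q \<longleftrightarrow> w \<in> b"
  using inj b_sub by (auto dest: inj_onD)

lemma par'_in_Q: "w \<in> b \<Longrightarrow> par' w \<in> Q"
  by (simp add: par'_b)

lemma coord_measurable[measurable]: "coord \<in> borel_measurable borel"
proof -
  have "continuous_on (par ` bL) (inv_into bL par)"
  proof (rule continuous_on_inverse_open_map[OF cont_par])
    show "par ` bL = par ` bL" ..
    show "inv_into bL par (par x) = x" if "x \<in> bL" for x using inj that by simp
    fix U assume "openin (top_of_set bL) U"
    then have "open U" "U \<subseteq> bL"
      using open_centered_box[of L] by (auto simp: openin_open_eq)
    then have "open (par ` U)" by (rule open_image)
    then show "openin (top_of_set (par ` bL)) (par ` U)"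
      using \<open>U \<subseteq> bL\<close> by (simp add: openin_open_eq open_image open_centered_box image_mono)
  qed
  moreover have "open (par ` bL)" by (intro open_image open_centered_box) simp
  ultimately show ?thesis unfolding coord_def
    by (intro borel_measurable_continuous_on_if) auto
qed

lemma nn_integral_Q:
  assumes [measurable]: "F \<in> borel_measurable borel"
  shows "(\<integral>\<^sup>+x. F x * indicator Q x \<partial>M) = (\<integral>\<^sup>+w. F (par' w) * ennreal (d0 w) * indicator b w \<partial>lborel)"
proof -
  have [measurable_cong]: "sets M = sets borel" by (rule sets_M)
  let ?D = "density lborel (\<lambda>w. ennreal (d0 w) * indicator b w)"
  have eq: "density M (indicator Q) = distr ?D borel par'"
  proof (rule measure_eqI)
    show "sets (density M (indicator Q)) = sets (distr ?D borel par')" by (simp add: sets_M)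
    fix X assume "X \<in> sets (density M (indicator Q))"
    then have X[measurable]: "X \<in> sets borel" by (simp add: sets_M)
    have pX[measurable]: "par' -` X \<in> sets borel" by (rule measurable_sets_borel[OF _ X]) measurable
    have im: "Q \<inter> X = par ` (b \<inter> par' -` X)" by (auto simp: par'_b)
    have "emeasure (density M (indicator Q)) X = emeasure M (Q \<inter> X)"
    proof -
      have "emeasure (density M (indicator Q)) X = (\<integral>\<^sup>+x. indicator Q x * indicator X x \<partial>M)"
        by (subst emeasure_density) (auto simp: sets_M)
      also have "\<dots> = (\<integral>\<^sup>+x. indicator (Q \<inter> X) x \<partial>M)" by (simp add: indicator_inter_arith)
      finally show ?thesis by (simp add: sets_M)
    qed
    also have "\<dots> = (\<integral>\<^sup>+w. ennreal (d w) * indicator (b \<inter> par' -` X) w \<partial>lborel)"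
      unfolding im using b_sub by (intro meas) auto
    also have "\<dots> = (\<integral>\<^sup>+w. ennreal (d0 w) * indicator b w * indicator (par' -` X) w \<partial>lborel)"
      using b_sub by (intro nn_integral_cong) (auto simp: d0_def indicator_def)
    also have "\<dots> = emeasure (distr ?D borel par') X"
      by (simp add: emeasure_distr emeasure_density)
    finally show "emeasure (density M (indicator Q)) X = \<dots>" .
  qed
  have "(\<integral>\<^sup>+x. F x * indicator Q x \<partial>M) = (\<integral>\<^sup>+x. F x \<partial>density M (indicator Q))"
    by (subst nn_integral_density) (auto simp: mult.commute)
  also have "\<dots> = (\<integral>\<^sup>+w. F (par' w) * ennreal (d0 w) * indicator b w \<partial>lborel)"
    unfolding eq by (simp add: nn_integral_distr nn_integral_density ac_simps)
  finally show ?thesis .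
qed

text \<open>A sub-probability: jumps that would end outside the cube are suppressed, and
  \<open>S_field_eq_ker\<close> leaves their mass at x.\<close>

definition ker :: "'n \<Rightarrow> real \<Rightarrow> real \<Rightarrow> 'm \<Rightarrow> 'm measure" where
  "ker j c h x = (if x \<in> Q then distr (density lborel (\<lambda>s. ennreal (jump j c h (coord x) s))) borel
      (\<lambda>s. par' (coord x + axis j s)) else null_measure borel)"

lemma sets_ker[simp, measurable_cong]: "sets (ker j c h x) = sets borel"
  by (simp add: ker_def)

lemma space_ker[simp]: "space (ker j c h x) = UNIV"
  using sets_eq_imp_space_eq[OF sets_ker] by simp

lemma nn_integral_ker:
  assumes [measurable]: "F \<in> borel_measurable borel"
  shows "(\<integral>\<^sup>+y. F y \<partial>ker j c h x) =
    indicator Q x * (\<integral>\<^sup>+s. ennreal (jump j c h (coord x) s) * F (par' (coord x + axis j s)) \<partial>lborel)"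
  by (auto simp: ker_def nn_integral_distr nn_integral_density nn_integral_null_measure)

lemma emeasure_ker:
  assumes [measurable]: "X \<in> sets borel"
  shows "emeasure (ker j c h x) X =
    indicator Q x * (\<integral>\<^sup>+s. ennreal (jump j c h (coord x) s) * indicator X (par' (coord x + axis j s)) \<partial>lborel)"
proof -
  have "emeasure (ker j c h x) X = (\<integral>\<^sup>+y. indicator X y \<partial>ker j c h x)" by simp
  then show ?thesis by (simp only: nn_integral_ker[of "indicator X"] borel_measurable_indicator assms)
qed

lemma integral_ker:
  fixes f :: "'m \<Rightarrow> 'b::{banach, second_countable_topology}"
  assumes f[measurable]: "f \<in> borel_measurable borel" and hc: "0 < h" "0 < c"
  shows "(LINT y|ker j c h x. f y) = indicator Q x *\<^sub>R (LINT s|lborel. jump j c h (coord x) s *\<^sub>R f (par' (coord x + axis j s)))"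
proof (cases "x \<in> Q")
  case True
  then show ?thesis using hc
    by (simp add: ker_def integral_distr integral_density jump_nonneg)
next
  case False
  then show ?thesis by (simp add: ker_def integral_null_measure)
qed

lemma time_average_jump:
  fixes f :: "'m \<Rightarrow> 'b::{banach, second_countable_topology}"
  assumes f[measurable]: "f \<in> borel_measurable borel" and w: "w \<in> b" and c: "0 < c" and h: "0 < h" "h \<le> a / (\<Lambda> * c)"
  shows "(LINT t|lborel. indicator {-h<..<h} t *\<^sub>R (indicator b (w + axis j (pos j c w t)) *\<^sub>R f (par' (w + axis j (pos j c w t)))))
    = (2 * h) *\<^sub>R (LINT s|lborel. jump j c h w s *\<^sub>R f (par' (w + axis j s)))"
proof -
  interpret line_flow "speed j c w" "- L j - w $ j" "L j - w $ j" a "1 / (\<Lambda> * c)" by (rule line_flow) fact+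
  define g where "g z = indicator b (w + axis j z) *\<^sub>R f (par' (w + axis j z))" for z
  have g[measurable]: "g \<in> borel_measurable borel" unfolding g_def by measurable
  have "(LINT t|lborel. indicator {-h<..<h} t *\<^sub>R g (pos j c w t))
      = (LINT z|lborel. (indicator {-a..a} z * indicator {-h<..<h} (\<T> z) * speed j c w z) *\<^sub>R g z)"
    unfolding pos_def using h by (intro time_average) auto
  also have "\<dots> = (LINT z|lborel. (2 * h) *\<^sub>R (jump j c h w z *\<^sub>R f (par' (w + axis j z))))"
  proof (rule Bochner_Integration.integral_cong[OF refl])
    fix z
    \<comment> \<open>The cutoff to [-a, a] may be dropped: inside the box, a travel time below h
      forces \<bar>z\<bar> \<le> a.\<close>
    have "z \<in> {-a..a}" if "w + axis j z \<in> b" "\<bar>\<T> z\<bar> < h"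
    proof -
      have "\<bar>z\<bar> / (\<Lambda> * c) \<le> \<bar>\<T> z\<bar>" using \<theta>_bounds(1)[OF w that(1) c] by (simp add: \<theta>_def)
      then have "\<bar>z\<bar> / (\<Lambda> * c) \<le> a / (\<Lambda> * c)" using that h by linarith
      then have "\<bar>z\<bar> \<le> a" using \<Lambda> c by (simp add: divide_le_cancel)
      then show ?thesis by (auto simp: abs_le_iff)
    qed
    then show "(indicator {-a..a} z * indicator {-h<..<h} (\<T> z) * speed j c w z) *\<^sub>R g z
        = (2 * h) *\<^sub>R (jump j c h w z *\<^sub>R f (par' (w + axis j z)))"
      using h c by (auto simp: g_def jump_def \<theta>_def speed_def indicator_def abs_less_iff)
  qed
  also have "\<dots> = (2 * h) *\<^sub>R (LINT z|lborel. jump j c h w z *\<^sub>R f (par' (w + axis j z)))"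
    by (rule integral_scaleR_right)
  finally show ?thesis unfolding g_def .
qed

lemma jump_integrable:
  assumes w: "w \<in> b" and c: "0 < c" and h: "0 < h"
  shows "integrable lborel (jump j c h w)"
proof (rule Bochner_Integration.integrable_bound)
  show "integrable lborel (\<lambda>s. \<Lambda> / (2 * h * c) * indicator {-(\<Lambda> * c * h)..\<Lambda> * c * h} s)"
    by (intro integrable_mult_right integrable_real_indicator) (auto simp: emeasure_lborel_Icc_eq)
  show "AE s in lborel. norm (jump j c h w s) \<le> norm (\<Lambda> / (2 * h * c) * indicator {-(\<Lambda> * c * h)..\<Lambda> * c * h} s)"
  proof (intro AE_I2)
    fix s
    have "jump j c h w s \<le> \<Lambda> / (2 * h * c) * indicator b (w + axis j s) * indicator {-(\<Lambda> * c * h)..\<Lambda> * c * h} s"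
      by (rule jump_upper[OF w c h])
    also have "\<dots> \<le> \<Lambda> / (2 * h * c) * indicator {-(\<Lambda> * c * h)..\<Lambda> * c * h} s"
      using \<Lambda> h c by (auto simp: indicator_def)
    finally show "norm (jump j c h w s) \<le> norm (\<Lambda> / (2 * h * c) * indicator {-(\<Lambda> * c * h)..\<Lambda> * c * h} s)"
      using jump_nonneg[OF h c, of j w s] \<Lambda> h c by simp
  qed
qed measurable

lemma jump_mass_le_1:
  assumes w: "w \<in> b" and c: "0 < c" and h: "0 < h" "h \<le> a / (\<Lambda> * c)"
  shows "(LINT s|lborel. jump j c h w s) \<le> 1"
proof -
  have "2 * h * (LINT s|lborel. jump j c h w s)
     = (LINT t|lborel. indicator {-h<..<h} t * indicator b (w + axis j (pos j c w t)))"
    using time_average_jump[of "\<lambda>_. 1::real", OF _ w c h, of j] by simp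
  also have "\<dots> \<le> (LINT t|lborel. indicator {-h<..<h} t)"
  proof (rule integral_mono')
    show "integrable lborel (indicat_real {-h<..<h})" using h by (intro integrable_real_indicator) auto
  qed (auto simp: indicator_def)
  also have "\<dots> = 2 * h" using h by simp
  finally show ?thesis using h by simp
qed

lemma emeasure_ker_le_1:
  assumes c: "0 < c" and h: "0 < h" "h \<le> a / (\<Lambda> * c)"
  shows "emeasure (ker j c h x) UNIV \<le> 1"
proof (cases "x \<in> Q")
  case True
  have "emeasure (ker j c h x) UNIV = (\<integral>\<^sup>+s. ennreal (jump j c h (coord x) s) \<partial>lborel)"
    using True by (simp add: emeasure_ker)
  also have "\<dots> = ennreal (LINT s|lborel. jump j c h (coord x) s)"
    using True c h by (intro nn_integral_eq_integral jump_integrable) (auto simp: coord_Q jump_nonneg)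
  also have "\<dots> \<le> 1" using True c h by (simp add: jump_mass_le_1 coord_Q)
  finally show ?thesis .
next
  case False then show ?thesis by (simp add: emeasure_ker)
qed

lemma ker_measurable:
  assumes "0 < c" "0 < h" "h \<le> a / (\<Lambda> * c)"
  shows "ker j c h \<in> measurable M (subprob_algebra M)"
proof -
  have "subprob_algebra M = subprob_algebra borel" by (rule subprob_algebra_cong[OF sets_M])
  moreover have "measurable M N = measurable borel N" for N :: "'m measure measure" by (rule measurable_cong_sets[OF sets_M refl])
  moreover have "ker j c h \<in> measurable borel (subprob_algebra borel)"
  proof (rule measurable_subprob_algebra)
    fix x show "subprob_space (ker j c h x)"
      using emeasure_ker_le_1[OF assms] by (intro subprob_spaceI) auto
    fix X :: "'m set" assume [measurable]: "X \<in> sets borel"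
    show "(\<lambda>x. emeasure (ker j c h x) X) \<in> borel_measurable borel"
      unfolding emeasure_ker[OF \<open>X \<in> sets borel\<close>] by measurable
  qed simp
  ultimately show ?thesis by metis
qed

text \<open>\<open>time_average_jump\<close> converts the time average into an average over jumps.
  At \<bar>t\<bar> = h \<open>chi\<close> vanishes, so the closed time interval may be replaced by
  the open one.\<close>

lemma S_field_eq_ker:
  fixes f :: "'m \<Rightarrow> 'b::{banach, second_countable_topology}"
  assumes f[measurable]: "f \<in> borel_measurable borel" and c: "0 < c" and h: "0 < h" "h \<le> a / (\<Lambda> * c)"
    and F: "\<And>x t. x \<in> Q \<Longrightarrow> \<bar>t\<bar> < h \<Longrightarrow> F t x = par (coord x + axis j (pos j c (coord x) t))"
  shows "S_field Q F h f x = (1 - measure (ker j c h x) UNIV) *\<^sub>R f x + (LINT y|ker j c h x. f y)"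
proof (cases "x \<in> Q")
  case False
  then have "measure (ker j c h x) UNIV = 0" by (simp add: measure_def emeasure_ker)
  then show ?thesis using False integral_ker[OF f h(1) c] by (simp add: S_field_def chi_def)
next
  case True
  define w where "w = coord x"
  have w: "w \<in> b" using True by (simp add: w_def coord_Q)
  have *: "(LINT t:{-h..h}|lborel. chi Q F h t x *\<^sub>R u (F t x)) = (2 * h) *\<^sub>R (LINT y|ker j c h x. u y)"
    if u[measurable]: "u \<in> borel_measurable borel" for u :: "'m \<Rightarrow> 'e::{banach, second_countable_topology}"
  proof -
    have "(LINT t:{-h..h}|lborel. chi Q F h t x *\<^sub>R u (F t x))
        = (LINT t|lborel. indicator {-h<..<h} t *\<^sub>R (indicator b (w + axis j (pos j c w t)) *\<^sub>R u (par' (w + axis j (pos j c w t)))))"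
      unfolding set_lebesgue_integral_def
    proof (rule Bochner_Integration.integral_cong[OF refl])
      fix t
      show "indicator {-h..h} t *\<^sub>R chi Q F h t x *\<^sub>R u (F t x)
        = indicator {-h<..<h} t *\<^sub>R (indicator b (w + axis j (pos j c w t)) *\<^sub>R u (par' (w + axis j (pos j c w t))))"
      proof (cases "\<bar>t\<bar> < h")
        case t: True
        then have L: "w + axis j (pos j c w t) \<in> bL" using pos_range(2)[OF w c, of t] h by auto
        have "F t x = par (w + axis j (pos j c w t))" using F[OF True t] by (simp add: w_def)
        then show ?thesis using t True L par_in_Q_iff[OF L]
          by (auto simp: chi_def indicator_def par'_b abs_less_iff)
      qed (auto simp: chi_def indicator_def abs_less_iff)
    qed
    also have "\<dots> = (2 * h) *\<^sub>R (LINT s|lborel. jump j c h w s *\<^sub>R u (par' (w + axis j s)))"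
      by (rule time_average_jump[OF u w c h])
    also have "\<dots> = (2 * h) *\<^sub>R (LINT y|ker j c h x. u y)"
      using True integral_ker[OF u h(1) c, of j x] by (simp add: w_def)
    finally show ?thesis .
  qed
  have "(LINT t:{-h..h}|lborel. chi Q F h t x) = 2 * h * measure (ker j c h x) UNIV"
    using *[of "\<lambda>_. 1::real"] by simp
  then show ?thesis unfolding S_field_def *[OF f] using h by simp
qed

lemma nn_integral_pairs:
  assumes F[measurable]: "(\<lambda>(x, y). F x y) \<in> borel_measurable (borel \<Otimes>\<^sub>M borel)"
  shows "(\<integral>\<^sup>+x. \<integral>\<^sup>+y. F x y \<partial>ker j c h x \<partial>M) = (\<integral>\<^sup>+w. \<integral>\<^sup>+s.
     indicator b w * ennreal (d0 w) * ennreal (jump j c h w s) * F (par' w) (par' (w + axis j s)) \<partial>lborel \<partial>lborel)"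
proof -
  have [measurable]: "F x \<in> borel_measurable borel" for x
    using measurable_compose[OF measurable_Pair1'[of x borel borel] F] by simp
  have [measurable]: "(\<lambda>z. F (f z) (g z)) \<in> borel_measurable N"
    if "f \<in> borel_measurable N" "g \<in> borel_measurable N" for f g and N :: "'z measure"
    using measurable_compose[OF measurable_Pair[OF that] F] by simp
  let ?H = "\<lambda>x. \<integral>\<^sup>+s. ennreal (jump j c h (coord x) s) * F x (par' (coord x + axis j s)) \<partial>lborel"
  have "(\<integral>\<^sup>+x. \<integral>\<^sup>+y. F x y \<partial>ker j c h x \<partial>M) = (\<integral>\<^sup>+x. ?H x * indicator Q x \<partial>M)"
    by (simp add: nn_integral_ker mult.commute)
  also have "\<dots> = (\<integral>\<^sup>+w. ?H (par' w) * ennreal (d0 w) * indicator b w \<partial>lborel)"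
    by (rule nn_integral_Q) measurable
  also have "\<dots> = (\<integral>\<^sup>+w. indicator b w * ennreal (d0 w) * (\<integral>\<^sup>+s. ennreal (jump j c h w s) * F (par' w) (par' (w + axis j s)) \<partial>lborel) \<partial>lborel)"
    by (intro nn_integral_cong) (auto simp: indicator_def par'_b coord_par_b mult.commute)
  also have "\<dots> = (\<integral>\<^sup>+w. \<integral>\<^sup>+s.
     indicator b w * ennreal (d0 w) * ennreal (jump j c h w s) * F (par' w) (par' (w + axis j s)) \<partial>lborel \<partial>lborel)"
    by (simp add: nn_integral_cmult[symmetric] mult.assoc)
  finally show ?thesis .
qed

text \<open>In coordinates the substitutions s -> -s and w -> w + s e_j exchange the two end points,
  and \<open>jump_reverse\<close> preserves the weight.\<close>

lemma ker_symmetric: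
  assumes F[measurable]: "(\<lambda>(x, y). F x y) \<in> borel_measurable (borel \<Otimes>\<^sub>M borel)" and c: "0 < c" and h: "0 < h"
  shows "(\<integral>\<^sup>+x. \<integral>\<^sup>+y. F x y \<partial>ker j c h x \<partial>M) = (\<integral>\<^sup>+x. \<integral>\<^sup>+y. F y x \<partial>ker j c h x \<partial>M)"
proof -
  have [measurable]: "(\<lambda>z. F (f z) (g z)) \<in> borel_measurable N"
    if "f \<in> borel_measurable N" "g \<in> borel_measurable N" for f g and N :: "'z measure"
    using measurable_compose[OF measurable_Pair[OF that] F] by simp
  let ?\<Phi> = "\<lambda>w s. indicator b w * ennreal (d0 w) * ennreal (jump j c h w s) * F (par' w) (par' (w + axis j s))"
  have "(\<integral>\<^sup>+x. \<integral>\<^sup>+y. F x y \<partial>ker j c h x \<partial>M) = (\<integral>\<^sup>+w. \<integral>\<^sup>+s. ?\<Phi> w s \<partial>lborel \<partial>lborel)"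
    by (rule nn_integral_pairs[OF F])
  also have "\<dots> = (\<integral>\<^sup>+s. \<integral>\<^sup>+w. ?\<Phi> w s \<partial>lborel \<partial>lborel)"
    by (rule lborel_pair.Fubini') measurable
  also have "\<dots> = (\<integral>\<^sup>+s. \<integral>\<^sup>+w. ?\<Phi> w (- s) \<partial>lborel \<partial>lborel)"
    by (rule nn_integral_lborel_reflect[symmetric]) measurable
  also have "\<dots> = (\<integral>\<^sup>+s. \<integral>\<^sup>+w. ?\<Phi> (w + axis j s) (- s) \<partial>lborel \<partial>lborel)"
  proof (rule nn_integral_cong)
    fix s :: real
    show "(\<integral>\<^sup>+w. ?\<Phi> w (- s) \<partial>lborel) = (\<integral>\<^sup>+w. ?\<Phi> (w + axis j s) (- s) \<partial>lborel)"
      by (rule nn_integral_lborel_translate[symmetric]) measurable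
  qed
  also have "\<dots> = (\<integral>\<^sup>+s. \<integral>\<^sup>+w. indicator b w * ennreal (d0 w) * ennreal (jump j c h w s) * F (par' (w + axis j s)) (par' w) \<partial>lborel \<partial>lborel)"
  proof (intro nn_integral_cong)
    fix s :: real and w :: "real^'n"
    have eq: "w + axis j s + axis j (- s) = w" by (simp add: axis_minus)
    show "?\<Phi> (w + axis j s) (- s) = indicator b w * ennreal (d0 w) * ennreal (jump j c h w s) * F (par' (w + axis j s)) (par' w)"
    proof (cases "w \<in> b \<and> w + axis j s \<in> b")
      case True
      have "ennreal (d0 (w + axis j s)) * ennreal (jump j c h (w + axis j s) (- s)) = ennreal (d0 w) * ennreal (jump j c h w s)"
        using jump_reverse[of w j s c h] True d0_nonneg jump_nonneg[OF h c]
        by (simp add: ennreal_mult[symmetric])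
      then show ?thesis using True unfolding eq by (simp add: mult.assoc[symmetric])
    next
      case False
      have "indicator b (w + axis j s) * ennreal (jump j c h (w + axis j s) (- s)) = 0"
        using False unfolding jump_def eq by (auto simp: indicator_def)
      moreover have "indicator b w * ennreal (jump j c h w s) = 0"
        using False unfolding jump_def by (auto simp: indicator_def)
      ultimately show ?thesis unfolding eq by (auto simp: mult.commute mult.left_commute)
    qed
  qed
  also have "\<dots> = (\<integral>\<^sup>+w. \<integral>\<^sup>+s. indicator b w * ennreal (d0 w) * ennreal (jump j c h w s) * F (par' (w + axis j s)) (par' w) \<partial>lborel \<partial>lborel)"
    by (rule lborel_pair.Fubini'[symmetric]) measurable
  also have "\<dots> = (\<integral>\<^sup>+x. \<integral>\<^sup>+y. F y x \<partial>ker j c h x \<partial>M)"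
    by (rule nn_integral_pairs[symmetric]) measurable
  finally show ?thesis .
qed

text \<open>For \<bar>s\<bar> < c h / \<Lambda> the joint density d0 w * jump is at least 1 / (2 h c
  \<Lambda>^2). With squared differences or squared sums for F, this bounds a form of the walk below
  by increments on the box.\<close>

lemma pair_form_lower:
  assumes F[measurable]: "(\<lambda>(x, y). F x y) \<in> borel_measurable (borel \<Otimes>\<^sub>M borel)" and c: "0 < c" and h: "0 < h"
  shows "(\<integral>\<^sup>+s. (\<integral>\<^sup>+w. F (par' w) (par' (w + axis j s)) * indicator b w * indicator b (w + axis j s) \<partial>lborel)
      * indicator {-(c * h / \<Lambda>)<..<c * h / \<Lambda>} s \<partial>lborel)
    \<le> ennreal (2 * h * c * \<Lambda>\<^sup>2) * (\<integral>\<^sup>+x. \<integral>\<^sup>+y. F x y \<partial>ker j c h x \<partial>M)"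
proof -
  have [measurable]: "(\<lambda>z. F (f z) (g z)) \<in> borel_measurable N"
    if "f \<in> borel_measurable N" "g \<in> borel_measurable N" for f g and N :: "'z measure"
    using measurable_compose[OF measurable_Pair[OF that] F] by simp
  let ?\<Phi> = "\<lambda>w s. indicator b w * ennreal (d0 w) * ennreal (jump j c h w s) * F (par' w) (par' (w + axis j s))"
  let ?I = "{-(c * h / \<Lambda>)<..<c * h / \<Lambda>}"
  have "(\<integral>\<^sup>+s. (\<integral>\<^sup>+w. F (par' w) (par' (w + axis j s)) * indicator b w * indicator b (w + axis j s) \<partial>lborel) * indicator ?I s \<partial>lborel)
      = (\<integral>\<^sup>+s. \<integral>\<^sup>+w. F (par' w) (par' (w + axis j s)) * indicator b w * indicator b (w + axis j s) * indicator ?I s \<partial>lborel \<partial>lborel)"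
    by (simp add: nn_integral_multc)
  also have "\<dots> \<le> (\<integral>\<^sup>+s. \<integral>\<^sup>+w. ennreal (2 * h * c * \<Lambda>\<^sup>2) * ?\<Phi> w s \<partial>lborel \<partial>lborel)"
  proof (intro nn_integral_mono)
    fix s :: real and w :: "real^'n"
    show "F (par' w) (par' (w + axis j s)) * indicator b w * indicator b (w + axis j s) * indicator ?I s
        \<le> ennreal (2 * h * c * \<Lambda>\<^sup>2) * ?\<Phi> w s"
    proof (cases "w \<in> b \<and> w + axis j s \<in> b \<and> s \<in> ?I")
      case True
      then have s: "\<bar>s\<bar> < c * h / \<Lambda>" by (auto simp: abs_less_iff)
      have "1 / \<Lambda> * (1 / (2 * h * c * \<Lambda>)) \<le> d0 w * jump j c h w s"
        using True d0_b[of w] jump_lower[of w j s c h] s c h \<Lambda> by (intro mult_mono) (auto simp: d0_nonneg)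
      then have "1 \<le> 2 * h * c * \<Lambda>\<^sup>2 * (d0 w * jump j c h w s)"
        using c h \<Lambda> by (simp add: field_simps power2_eq_square)
      then have "1 \<le> ennreal (2 * h * c * \<Lambda>\<^sup>2) * (ennreal (d0 w) * ennreal (jump j c h w s))"
        using c h \<Lambda> d0_nonneg jump_nonneg[OF h c] by (simp add: ennreal_mult[symmetric])
      then have "1 * F (par' w) (par' (w + axis j s)) \<le> ennreal (2 * h * c * \<Lambda>\<^sup>2) * (ennreal (d0 w) * ennreal (jump j c h w s)) * F (par' w) (par' (w + axis j s))"
        by (rule mult_right_mono) simp
      then show ?thesis using True by (simp add: mult.assoc)
    qed (auto simp: indicator_def)
  qed
  also have "\<dots> = (\<integral>\<^sup>+w. \<integral>\<^sup>+s. ennreal (2 * h * c * \<Lambda>\<^sup>2) * ?\<Phi> w s \<partial>lborel \<partial>lborel)"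
    by (rule lborel_pair.Fubini'[symmetric]) measurable
  also have "\<dots> = ennreal (2 * h * c * \<Lambda>\<^sup>2) * (\<integral>\<^sup>+w. \<integral>\<^sup>+s. ?\<Phi> w s \<partial>lborel \<partial>lborel)"
    by (simp add: nn_integral_cmult)
  also have "(\<integral>\<^sup>+w. \<integral>\<^sup>+s. ?\<Phi> w s \<partial>lborel \<partial>lborel) = (\<integral>\<^sup>+x. \<integral>\<^sup>+y. F x y \<partial>ker j c h x \<partial>M)"
    by (rule nn_integral_pairs[OF F, symmetric])
  finally show ?thesis .
qed

text \<open>Jumps of length below c h / \<Lambda> towards the centre stay in the cube, also from
  points near its boundary; this interval times the lower bound 1 / (2 h c \<Lambda>) of the density
  gives the constant.\<close>

lemma emeasure_ker_lower:
  assumes x: "x \<in> Q" and c: "0 < c" and h: "0 < h" "c * h / \<Lambda> \<le> l j"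
  shows "ennreal (1 / (2 * \<Lambda>\<^sup>2)) \<le> emeasure (ker j c h x) UNIV"
proof -
  define w where "w = coord x"
  have w: "w \<in> b" using x by (simp add: w_def coord_Q)
  let ?r = "c * h / \<Lambda>"
  have r: "?r > 0" using c h \<Lambda> by simp
  let ?J = "if 0 \<le> w $ j then {- ?r<..<0} else {0<..<?r}"
  have J: "w + axis j s \<in> b" "\<bar>s\<bar> < ?r" if "s \<in> ?J" for s
  proof -
    have "- l j < w $ j" "w $ j < l j" using w by (auto simp: centered_box_def)
    then show "w + axis j s \<in> b" unfolding centered_box_axis_iff[OF w] using that h(2) by (auto split: if_splits)
    show "\<bar>s\<bar> < ?r" using that by (auto split: if_splits)
  qed
  have "ennreal (1 / (2 * \<Lambda>\<^sup>2)) = ennreal (1 / (2 * h * c * \<Lambda>) * ?r)"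
    using c h \<Lambda> by (simp add: power2_eq_square)
  also have "\<dots> = ennreal (1 / (2 * h * c * \<Lambda>)) * emeasure lborel ?J"
  proof -
    have "emeasure lborel ?J = ennreal ?r" using r by simp
    then show ?thesis using r c h \<Lambda> by (subst ennreal_mult) auto
  qed
  also have "\<dots> = (\<integral>\<^sup>+s. ennreal (1 / (2 * h * c * \<Lambda>)) * indicator ?J s \<partial>lborel)"
    by (subst nn_integral_cmult_indicator) auto
  also have "\<dots> \<le> (\<integral>\<^sup>+s. ennreal (jump j c h w s) \<partial>lborel)"
    using J jump_lower[OF w _ c h(1)] by (intro nn_integral_mono) (auto simp: indicator_def intro!: ennreal_leI)
  also have "\<dots> = emeasure (ker j c h x) UNIV" using x by (simp add: emeasure_ker w_def)
  finally show ?thesis .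
qed

end

text \<open>Averages over the coordinates in \<open>J\<close> of the translates of \<open>w\<close>, all of them written as integrals over
  the whole space by spreading the remaining coordinates over a unit cube.\<close>

definition coord_average :: "'n set \<Rightarrow> (real^'n::finite \<Rightarrow> ennreal) \<Rightarrow> real^'n \<Rightarrow> ennreal" where
  "coord_average J G w = (\<integral>\<^sup>+v. indicator {v. \<forall>i. i \<notin> J \<longrightarrow> v $ i \<in> {-(1/2)<..<1/2}} v
      * G (w + (\<chi> i. if i \<in> J then v $ i else 0)) \<partial>lborel)"

lemma restrict_coords_measurable[measurable]:
  assumes [measurable]: "f \<in> borel_measurable M"
  shows "(\<lambda>x. \<chi> i. if i \<in> J then f x $ i else 0 :: real^'n::finite) \<in> borel_measurable M"
proof -
  have "linear (\<lambda>v :: real^'n. (\<chi> i. if i \<in> J then v $ i else 0) :: real^'n)"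
    by (intro linearI) (auto simp: vec_eq_iff)
  then have "continuous_on UNIV (\<lambda>v :: real^'n. (\<chi> i. if i \<in> J then v $ i else 0) :: real^'n)"
    by (intro linear_continuous_on) (simp add: linear_conv_bounded_linear)
  then show ?thesis
    by (rule measurable_compose[OF assms borel_measurable_continuous_onI])
qed

text \<open>The coordinate v_j is replaced by a new variable s, and the freed v_j is spread over a
  unit interval. This gives an iterated integral without leaving the vector space.\<close>

lemma nn_integral_axis_split:
  fixes \<Phi> :: "real^'n::finite \<Rightarrow> ennreal"
  assumes [measurable]: "\<Phi> \<in> borel_measurable borel"
  shows "(\<integral>\<^sup>+v. \<Phi> v \<partial>lborel) =
    (\<integral>\<^sup>+v. indicator {-(1/2)<..<1/2} (v $ j) * (\<integral>\<^sup>+s. \<Phi> (v + axis j (s - v $ j)) \<partial>lborel) \<partial>lborel)"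
proof -
  let ?I = "{-(1/2)<..<1/2 :: real}"
  have len: "(\<integral>\<^sup>+s. indicator ?I (t - s) \<partial>lborel) = 1" for t :: real
  proof -
    have "(\<integral>\<^sup>+s. indicator ?I (t - s) \<partial>lborel) = (\<integral>\<^sup>+s. indicator {t - 1/2<..<t + 1/2} s \<partial>lborel)"
      by (intro nn_integral_cong) (auto simp: indicator_def)
    then show ?thesis by simp
  qed
  have "(\<integral>\<^sup>+v. \<Phi> v \<partial>lborel) = (\<integral>\<^sup>+v. \<integral>\<^sup>+s. \<Phi> v * indicator ?I (v $ j - s) \<partial>lborel \<partial>lborel)"
    by (simp add: nn_integral_cmult len)
  also have "\<dots> = (\<integral>\<^sup>+s. \<integral>\<^sup>+v. \<Phi> v * indicator ?I (v $ j - s) \<partial>lborel \<partial>lborel)"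
    by (rule lborel_pair.Fubini') measurable
  also have "\<dots> = (\<integral>\<^sup>+s. \<integral>\<^sup>+v. \<Phi> (v + axis j s) * indicator ?I (v $ j) \<partial>lborel \<partial>lborel)"
  proof (rule nn_integral_cong)
    fix s :: real
    have "(\<integral>\<^sup>+v. \<Phi> (v + axis j s) * indicator ?I ((v + axis j s) $ j - s) \<partial>lborel) = (\<integral>\<^sup>+v. \<Phi> v * indicator ?I (v $ j - s) \<partial>lborel)"
      by (rule nn_integral_lborel_translate[of "\<lambda>v. \<Phi> v * indicator ?I (v $ j - s)"]) measurable
    then show "(\<integral>\<^sup>+v. \<Phi> v * indicator ?I (v $ j - s) \<partial>lborel) = (\<integral>\<^sup>+v. \<Phi> (v + axis j s) * indicator ?I (v $ j) \<partial>lborel)"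
      by (simp add: axis_def)
  qed
  also have "\<dots> = (\<integral>\<^sup>+v. \<integral>\<^sup>+s. \<Phi> (v + axis j s) * indicator ?I (v $ j) \<partial>lborel \<partial>lborel)"
    by (rule lborel_pair.Fubini'[symmetric]) measurable
  also have "\<dots> = (\<integral>\<^sup>+v. indicator ?I (v $ j) * (\<integral>\<^sup>+s. \<Phi> (v + axis j s) \<partial>lborel) \<partial>lborel)"
    by (simp add: nn_integral_multc mult.commute)
  also have "\<dots> = (\<integral>\<^sup>+v. indicator ?I (v $ j) * (\<integral>\<^sup>+s. \<Phi> (v + axis j (s - v $ j)) \<partial>lborel) \<partial>lborel)"
  proof (rule nn_integral_cong)
    fix v :: "real^'n"
    have "(\<integral>\<^sup>+s. \<Phi> (v + axis j s) \<partial>lborel) = (\<integral>\<^sup>+s. \<Phi> (v + axis j (s - v $ j)) \<partial>lborel)"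
      using nn_integral_lborel_translate[of "\<lambda>s. \<Phi> (v + axis j s)" "- v $ j"] by simp
    then show "indicator ?I (v $ j) * (\<integral>\<^sup>+s. \<Phi> (v + axis j s) \<partial>lborel) =
        indicator ?I (v $ j) * (\<integral>\<^sup>+s. \<Phi> (v + axis j (s - v $ j)) \<partial>lborel)" by simp
  qed
  finally show ?thesis .
qed

lemma coord_average_insert:
  fixes G :: "real^'n::finite \<Rightarrow> ennreal"
  assumes [measurable]: "G \<in> borel_measurable borel" and j: "j \<notin> J"
  shows "(\<integral>\<^sup>+s. coord_average J G (w + axis j s) \<partial>lborel) = coord_average (insert j J) G w"
proof -
  let ?I = "{-(1/2)<..<1/2 :: real}"
  let ?R = "\<lambda>J. {v :: real^'n. \<forall>i. i \<notin> J \<longrightarrow> v $ i \<in> ?I}"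
  let ?p = "\<lambda>J v. \<chi> i. if i \<in> J then v $ i else (0::real)"
  have R: "indicator ?I (v $ j) * indicator (?R (insert j J)) (v + axis j t) = (indicator (?R J) v :: ennreal)" for v t
    using j by (auto simp: indicator_def axis_def)
  have p: "w + ?p (insert j J) (v + axis j (s - v $ j)) = w + axis j s + ?p J v" for v s
    using j by (auto simp: vec_eq_iff axis_def)
  have "coord_average (insert j J) G w = (\<integral>\<^sup>+v. indicator ?I (v $ j) * (\<integral>\<^sup>+s. indicator (?R (insert j J)) (v + axis j (s - v $ j))
      * G (w + ?p (insert j J) (v + axis j (s - v $ j))) \<partial>lborel) \<partial>lborel)"
    unfolding coord_average_def by (rule nn_integral_axis_split) measurable
  also have "\<dots> = (\<integral>\<^sup>+v. (\<integral>\<^sup>+s. indicator ?I (v $ j) * indicator (?R (insert j J)) (v + axis j (s - v $ j))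
      * G (w + axis j s + ?p J v) \<partial>lborel) \<partial>lborel)"
    unfolding p by (intro nn_integral_cong, subst nn_integral_cmult[symmetric]) (auto simp: mult.assoc)
  also have "\<dots> = (\<integral>\<^sup>+v. (\<integral>\<^sup>+s. indicator (?R J) v * G (w + axis j s + ?p J v) \<partial>lborel) \<partial>lborel)"
    unfolding R ..
  also have "\<dots> = (\<integral>\<^sup>+s. coord_average J G (w + axis j s) \<partial>lborel)"
    unfolding coord_average_def by (rule lborel_pair.Fubini') measurable
  finally show ?thesis ..
qed

lemma coord_average_empty: "coord_average {} G (w :: real^'n::finite) = G w"
proof -
  have "(\<chi> i. 0) = (0 :: real^'n)" by (simp add: vec_eq_iff)
  moreover have "{v :: real^'n. \<forall>i. v $ i \<in> {-(1/2)<..<1/2}} = centered_box (\<lambda>_. 1/2)"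
    by (auto simp: centered_box_def)
  ultimately show ?thesis
    by (simp add: coord_average_def nn_integral_multc emeasure_centered_box_const)
qed

lemma coord_average_UNIV:
  assumes [measurable]: "G \<in> borel_measurable borel"
  shows "coord_average UNIV G (w :: real^'n::finite) = (\<integral>\<^sup>+v. G v \<partial>lborel)"
  using nn_integral_lborel_translate[of G w] by (simp add: coord_average_def add.commute)

section \<open>One jump along every axis\<close>

context cube_chart
begin

definition iterate :: "('n \<Rightarrow> real) \<Rightarrow> real \<Rightarrow> 'n list \<Rightarrow> ('m \<Rightarrow> ennreal) \<Rightarrow> 'm \<Rightarrow> ennreal" where
  "iterate c h js F = foldr (\<lambda>j F x. \<integral>\<^sup>+y. F y \<partial>ker j (c j) h x) js F"

lemma iterate_measurable:
  assumes "F \<in> borel_measurable borel" shows "iterate c h js F \<in> borel_measurable borel"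
proof (induction js)
  case (Cons j js)
  then have [measurable]: "iterate c h js F \<in> borel_measurable borel" .
  have "iterate c h (j # js) F = (\<lambda>x. \<integral>\<^sup>+y. iterate c h js F y \<partial>ker j (c j) h x)"
    by (simp add: iterate_def)
  also have "\<dots> \<in> borel_measurable borel" unfolding nn_integral_ker[OF \<open>iterate c h js F \<in> _\<close>] by measurable
  finally show ?case .
qed (use assms in \<open>simp add: iterate_def\<close>)

text \<open>Each jump has a density in s of at most \<Lambda>^2 / (2 h) and ends inside the box. As
  the axes are distinct, the successive one-dimensional integrals combine into one average over the
  coordinates used.\<close>

lemma iterate_le_average:
  assumes F[measurable]: "F \<in> borel_measurable borel" and h: "0 < h" and c: "\<And>j. 1 / \<Lambda> \<le> c j"
    and js: "distinct js" and w: "w \<in> b"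
  shows "iterate c h js F (par w) \<le> ennreal ((\<Lambda>\<^sup>2 / (2 * h)) ^ length js) *
    coord_average (set js) (\<lambda>w. indicator b w * F (par' w)) w"
  using js w
proof (induction js arbitrary: w)
  case Nil
  then show ?case by (simp add: iterate_def coord_average_empty par'_b)
next
  case (Cons j js)
  let ?K = "\<Lambda>\<^sup>2 / (2 * h)" and ?G = "\<lambda>w. indicator b w * F (par' w)"
  have K: "0 \<le> ?K" using h by simp
  have cj: "0 < c j" using c[of j] \<Lambda> by (smt (verit) divide_pos_pos)
  note [measurable] = iterate_measurable[OF F]
  have "jump j (c j) h w s \<le> ?K * indicator b (w + axis j s)" for s
  proof -
    have "jump j (c j) h w s \<le> \<Lambda> / (2 * h * c j) * indicator b (w + axis j s) * indicator {-(\<Lambda> * c j * h)..\<Lambda> * c j * h} s"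
      by (rule jump_upper[OF Cons.prems(2) cj h])
    also have "\<dots> \<le> \<Lambda> / (2 * h * c j) * indicator b (w + axis j s)"
      using \<Lambda> h cj by (auto simp: indicator_def)
    also have "\<Lambda> / (2 * h * c j) \<le> ?K"
    proof -
      have "1 / c j \<le> \<Lambda>" using c[of j] cj \<Lambda> by (simp add: field_simps)
      then have "\<Lambda> / (2 * h) * (1 / c j) \<le> \<Lambda> / (2 * h) * \<Lambda>" using \<Lambda> h by (intro mult_left_mono) auto
      then show ?thesis by (simp add: power2_eq_square)
    qed
    finally show ?thesis by (simp add: mult_right_mono)
  qed
  then have jump: "ennreal (jump j (c j) h w s) \<le> ennreal ?K * indicator b (w + axis j s)" for s
    using K by (simp add: ennreal_mult[symmetric] ennreal_indicator[symmetric] ennreal_leI)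
  have "iterate c h (j # js) F (par w) = (\<integral>\<^sup>+s. ennreal (jump j (c j) h w s) * iterate c h js F (par' (w + axis j s)) \<partial>lborel)"
    using Cons.prems(2) by (simp add: iterate_def nn_integral_ker[OF iterate_measurable[OF F, unfolded iterate_def]] coord_par_b)
  also have "\<dots> \<le> (\<integral>\<^sup>+s. ennreal ?K * (ennreal (?K ^ length js) * coord_average (set js) ?G (w + axis j s)) \<partial>lborel)"
  proof (intro nn_integral_mono)
    fix s :: real
    show "ennreal (jump j (c j) h w s) * iterate c h js F (par' (w + axis j s))
        \<le> ennreal ?K * (ennreal (?K ^ length js) * coord_average (set js) ?G (w + axis j s))"
    proof (cases "w + axis j s \<in> b")
      case True
      then show ?thesis
        using jump[of s] Cons.IH[OF _ True] Cons.prems by (intro mult_mono) (auto simp: par'_b)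
    next
      case False
      then show ?thesis using jump[of s] by simp
    qed
  qed
  also have "\<dots> = ennreal (?K ^ length (j # js)) * (\<integral>\<^sup>+s. coord_average (set js) ?G (w + axis j s) \<partial>lborel)"
  proof -
    have [measurable]: "coord_average (set js) ?G \<in> borel_measurable borel"
      unfolding coord_average_def by measurable
    have "ennreal (?K ^ length (j # js)) = ennreal ?K * ennreal (?K ^ length js)"
    proof -
      have "length (j # js) = Suc (length js)" by simp
      then show ?thesis using K by (simp only: power_Suc ennreal_mult zero_le_power)
    qed
    then show ?thesis by (simp only: mult.assoc) (simp add: nn_integral_cmult)
  qed
  also have "(\<integral>\<^sup>+s. coord_average (set js) ?G (w + axis j s) \<partial>lborel) = coord_average (set (j # js)) ?G w"
    using Cons.prems by (subst coord_average_insert) auto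
  finally show ?case .
qed

text \<open>With every axis used once, the average runs over the full space, and the lower bound of
  \<open>d0\<close> on the box passes from Lebesgue measure to \<open>M\<close>.\<close>

lemma iterate_le_integral:
  assumes F[measurable]: "F \<in> borel_measurable borel" and h: "0 < h" and c: "\<And>j. 1 / \<Lambda> \<le> c j"
    and js: "distinct js" "set js = UNIV"
  shows "iterate c h js F x \<le> ennreal (\<Lambda> * (\<Lambda>\<^sup>2 / (2 * h)) ^ CARD('n)) * (\<integral>\<^sup>+y. F y \<partial>M)"
proof (cases "x \<in> Q")
  case True
  have [measurable_cong]: "sets M = sets borel" by (rule sets_M)
  have len: "length js = CARD('n)" using js distinct_card by metis
  let ?K = "(\<Lambda>\<^sup>2 / (2 * h)) ^ CARD('n)"
  have K: "0 \<le> ?K" using h by simp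
  have 1: "iterate c h js F x \<le> ennreal ?K * (\<integral>\<^sup>+w. indicator b w * F (par' w) \<partial>lborel)"
    using iterate_le_average[OF F h c js(1) coord_Q(1)[OF True]] js(2) len
    by (simp add: coord_average_UNIV coord_Q(2)[OF True])
  have "(\<integral>\<^sup>+w. indicator b w * F (par' w) \<partial>lborel) \<le> (\<integral>\<^sup>+w. ennreal \<Lambda> * (F (par' w) * ennreal (d0 w) * indicator b w) \<partial>lborel)"
  proof (intro nn_integral_mono)
    fix w :: "real^'n"
    show "indicator b w * F (par' w) \<le> ennreal \<Lambda> * (F (par' w) * ennreal (d0 w) * indicator b w)"
    proof (cases "w \<in> b")
      case True
      have "1 \<le> \<Lambda> * d0 w" using d0_b[OF True] \<Lambda> by (simp add: field_simps)
      then have "1 \<le> ennreal \<Lambda> * ennreal (d0 w)" using \<Lambda> d0_nonneg by (simp add: ennreal_mult[symmetric])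
      then have "1 * F (par' w) \<le> ennreal \<Lambda> * ennreal (d0 w) * F (par' w)" by (rule mult_right_mono) simp
      then show ?thesis using True by (simp add: ac_simps)
    qed simp
  qed
  also have "\<dots> = ennreal \<Lambda> * (\<integral>\<^sup>+x. F x * indicator Q x \<partial>M)"
    by (simp add: nn_integral_Q nn_integral_cmult)
  also have "\<dots> \<le> ennreal \<Lambda> * (\<integral>\<^sup>+x. F x \<partial>M)"
    by (intro mult_left_mono nn_integral_mono) (auto simp: indicator_def)
  finally have "(\<integral>\<^sup>+w. indicator b w * F (par' w) \<partial>lborel) \<le> ennreal \<Lambda> * (\<integral>\<^sup>+x. F x \<partial>M)" .
  from order_trans[OF 1 mult_left_mono[OF this]]
  have "iterate c h js F x \<le> ennreal ?K * (ennreal \<Lambda> * (\<integral>\<^sup>+x. F x \<partial>M))" by simp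
  also have "\<dots> = ennreal (\<Lambda> * ?K) * (\<integral>\<^sup>+x. F x \<partial>M)"
    using K \<Lambda> by (subst ennreal_mult) (auto simp: ac_simps)
  finally show ?thesis .
next
  case False
  have "js \<noteq> []" using js(2) by auto
  then obtain j js' where "js = j # js'" by (cases js) auto
  then have "iterate c h js F x = 0"
    using False nn_integral_ker[OF iterate_measurable[OF F, of c h js'], of j "c j" h x] by (simp add: iterate_def)
  then show ?thesis by simp
qed

end

section \<open>Averages of symmetric kernels\<close>

locale kernel_family = prob_space M for M :: "'a measure" +
  fixes I :: "'i set" and \<kappa> :: "'i \<Rightarrow> 'a \<Rightarrow> 'a measure"
  assumes space_UNIV: "space M = UNIV" and I: "finite I" "I \<noteq> {}"
    and ker[measurable]: "\<And>i. i \<in> I \<Longrightarrow> \<kappa> i \<in> measurable M (subprob_algebra M)"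
    and sym: "\<And>i F. i \<in> I \<Longrightarrow> (\<lambda>(x, y). F x y) \<in> borel_measurable (M \<Otimes>\<^sub>M M) \<Longrightarrow>
      (\<integral>\<^sup>+x. \<integral>\<^sup>+y. F x y \<partial>\<kappa> i x \<partial>M) = (\<integral>\<^sup>+x. \<integral>\<^sup>+y. F y x \<partial>\<kappa> i x \<partial>M)"
begin

definition mass :: "'i \<Rightarrow> 'a \<Rightarrow> real" where "mass i x = measure (\<kappa> i x) UNIV"

text \<open>The mass that \<kappa> i x lacks is spent on staying at x.\<close>

definition step :: "'i \<Rightarrow> ('a \<Rightarrow> 'b::{banach, second_countable_topology}) \<Rightarrow> 'a \<Rightarrow> 'b" where
  "step i f x = (1 - mass i x) *\<^sub>R f x + (LINT y|\<kappa> i x. f y)"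

definition walk :: "('a \<Rightarrow> 'b::{banach, second_countable_topology}) \<Rightarrow> 'a \<Rightarrow> 'b" where
  "walk f x = (1 / real (card I)) *\<^sub>R (\<Sum>i\<in>I. step i f x)"

lemma ker_subprob: assumes "i \<in> I" shows "subprob_space (\<kappa> i x)" "sets (\<kappa> i x) = sets M" "space (\<kappa> i x) = UNIV"
proof -
  have "\<kappa> i x \<in> space (subprob_algebra M)"
    using measurable_space[OF ker[OF assms], of x] space_UNIV by simp
  then show "subprob_space (\<kappa> i x)" "sets (\<kappa> i x) = sets M" by (auto simp: space_subprob_algebra)
  then show "space (\<kappa> i x) = UNIV" using space_UNIV sets_eq_imp_space_eq by metis
qed

lemma mass_bounds: assumes "i \<in> I" shows "0 \<le> mass i x" "mass i x \<le> 1"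
proof -
  interpret subprob_space "\<kappa> i x" by (rule ker_subprob[OF assms])
  show "0 \<le> mass i x" "mass i x \<le> 1" using subprob_measure_le_1 by (auto simp: mass_def)
qed

lemma integral_one_mass: assumes "i \<in> I" shows "(LINT y|\<kappa> i x. (1::real)) = mass i x"
proof -
  interpret subprob_space "\<kappa> i x" by (rule ker_subprob[OF assms])
  show ?thesis using ker_subprob(3)[OF assms] by (simp add: mass_def)
qed

lemma emeasure_ker_mass: assumes "i \<in> I" shows "emeasure (\<kappa> i x) UNIV = ennreal (mass i x)"
proof -
  interpret subprob_space "\<kappa> i x" by (rule ker_subprob[OF assms])
  show ?thesis by (simp add: mass_def emeasure_eq_measure)
qed

lemma mass_measurable[measurable]: assumes "i \<in> I" shows "mass i \<in> borel_measurable M"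
proof -
  have "UNIV \<in> sets M" using sets.top[of M] by (simp add: space_UNIV)
  then show ?thesis unfolding mass_def measure_def
    using measurable_emeasure_kernel[OF ker[OF assms]] by measurable
qed

lemma ker_integral_measurable:
  fixes f :: "'a \<Rightarrow> 'b::{banach, second_countable_topology}"
  assumes i: "i \<in> I" and f[measurable]: "f \<in> borel_measurable M"
  shows "(\<lambda>x. LINT y|\<kappa> i x. f y) \<in> borel_measurable M"
  by (rule measurable_compose[OF ker[OF i] integral_measurable_subprob_algebra[OF f]])

lemma step_measurable:
  fixes f :: "'a \<Rightarrow> 'b::{banach, second_countable_topology}"
  assumes i: "i \<in> I" and f[measurable]: "f \<in> borel_measurable M"
  shows "step i f \<in> borel_measurable M"
proof -
  note [measurable] = ker_integral_measurable[OF i f] mass_measurable[OF i]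
  show ?thesis unfolding step_def[abs_def] by measurable
qed

lemma bm_ker: "i \<in> I \<Longrightarrow> bm M f \<Longrightarrow> bm (\<kappa> i x) f"
  using ker_subprob(2)[of i x] by (auto simp: bm_def cong: measurable_cong_sets)

lemma ker_submarkov: assumes i: "i \<in> I" shows "submarkov M (\<lambda>f x. LINT y|\<kappa> i x. f y)"
  unfolding submarkov_def
proof safe
  have fin: "finite_measure (\<kappa> i x)" for x
    using ker_subprob(1)[OF i] by (simp add: subprob_space_def)
  fix f assume f: "bm M f"
  show "bm M (\<lambda>x. LINT y|\<kappa> i x. f y)"
  proof -
    obtain B where B: "B \<ge> 0" "\<And>y. \<bar>f y\<bar> \<le> B" using bm_bound[OF f] by auto
    have "\<bar>LINT y|\<kappa> i x. f y\<bar> \<le> B" for x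
    proof -
      interpret subprob_space "\<kappa> i x" by (rule ker_subprob[OF i])
      have "\<bar>LINT y|\<kappa> i x. f y\<bar> \<le> (LINT y|\<kappa> i x. \<bar>f y\<bar>)" by (rule integral_abs_bound)
      also have "\<dots> \<le> (LINT y|\<kappa> i x. B)"
        using B by (intro integral_mono integrable_bm bm_intros bm_ker[OF i f])
      also have "\<dots> = B * mass i x" using ker_subprob(3)[OF i] by (simp add: mass_def)
      also have "\<dots> \<le> B" using B mass_bounds[OF i, of x] by (simp add: mult_left_le)
      finally show ?thesis .
    qed
    then show ?thesis by (rule bmI[OF ker_integral_measurable[OF i bm_measurable[OF f]]])
  qed
  fix g assume g: "bm M g"
  show "(\<lambda>x. LINT y|\<kappa> i x. f y + g y) = (\<lambda>x. (LINT y|\<kappa> i x. f y) + (LINT y|\<kappa> i x. g y))"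
    using finite_measure.integral_bm_add[OF fin bm_ker[OF i f] bm_ker[OF i g]] by simp
next
  fix f and c :: real
  show "(\<lambda>x. LINT y|\<kappa> i x. c * f y) = (\<lambda>x. c * (LINT y|\<kappa> i x. f y))" by simp
next
  fix f x assume "bm M f" "\<forall>x. 0 \<le> f x"
  then show "0 \<le> (LINT y|\<kappa> i x. f y)" by simp
next
  fix x show "(LINT y|\<kappa> i x. (1::real)) \<le> 1"
    using mass_bounds[OF i, of x] integral_one_mass[OF i] by simp
next
  fix F :: "nat \<Rightarrow> 'a \<Rightarrow> real" and f B x
  assume F: "\<forall>k. bm M (F k)" "bm M f" "\<forall>k x. \<bar>F k x\<bar> \<le> B" "\<forall>x. (\<lambda>k. F k x) \<longlonglongrightarrow> f x"
  interpret subprob_space "\<kappa> i x" by (rule ker_subprob[OF i])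
  show "(\<lambda>k. LINT y|\<kappa> i x. F k y) \<longlonglongrightarrow> (LINT y|\<kappa> i x. f y)"
  proof (rule integral_dominated_convergence[where w="\<lambda>_. B"])
    show "f \<in> borel_measurable (\<kappa> i x)" "\<And>k. F k \<in> borel_measurable (\<kappa> i x)"
      using bm_ker[OF i] F by auto
  qed (use F in auto)
qed

lemma step_submarkov: assumes i: "i \<in> I" shows "submarkov M (step i)"
proof -
  note T = ker_submarkov[OF i]
  have mb: "bm M (\<lambda>x. 1 - mass i x)"
    using mass_measurable[OF i] mass_bounds[OF i] by (intro bmI[where B=1]) auto
  show ?thesis
    unfolding submarkov_def step_def[abs_def] real_scaleR_def
  proof safe
    fix f assume f: "bm M f"
    show "bm M (\<lambda>x. (1 - mass i x) * f x + (LINT y|\<kappa> i x. f y))"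
      using f mb by (intro bm_add bm_mult submarkov_bm[OF T])
    fix g assume g: "bm M g"
    show "(\<lambda>x. (1 - mass i x) * (f x + g x) + (LINT y|\<kappa> i x. f y + g y)) =
       (\<lambda>x. (1 - mass i x) * f x + (LINT y|\<kappa> i x. f y) + ((1 - mass i x) * g x + (LINT y|\<kappa> i x. g y)))"
      using submarkov_add[OF T f g] by (simp add: fun_eq_iff algebra_simps)
  next
    fix f and c :: real
    show "(\<lambda>x. (1 - mass i x) * (c * f x) + (LINT y|\<kappa> i x. c * f y)) =
       (\<lambda>x. c * ((1 - mass i x) * f x + (LINT y|\<kappa> i x. f y)))"
      by (simp add: fun_eq_iff algebra_simps)
  next
    fix f x assume "bm M f" "\<forall>x. 0 \<le> f x"
    then show "0 \<le> (1 - mass i x) * f x + (LINT y|\<kappa> i x. f y)"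
      using mass_bounds[OF i, of x] by (intro add_nonneg_nonneg mult_nonneg_nonneg) auto
  next
    fix x show "(1 - mass i x) * 1 + (LINT y|\<kappa> i x. (1::real)) \<le> 1"
      using integral_one_mass[OF i] by simp
  next
    fix F :: "nat \<Rightarrow> 'a \<Rightarrow> real" and f B x
    assume F: "\<forall>k. bm M (F k)" "bm M f" "\<forall>k x. \<bar>F k x\<bar> \<le> B" "\<forall>x. (\<lambda>k. F k x) \<longlonglongrightarrow> f x"
    then show "(\<lambda>k. (1 - mass i x) * F k x + (LINT y|\<kappa> i x. F k y)) \<longlonglongrightarrow> (1 - mass i x) * f x + (LINT y|\<kappa> i x. f y)"
      by (intro tendsto_intros submarkov_lim[OF T, where B=B]) auto
  qed
qed

lemma walk_eq_average: "walk f x = 1 / real (card I) * (\<Sum>i\<in>I. step i f x)" for f :: "'a \<Rightarrow> real"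
  by (simp add: walk_def)

lemma walk_submarkov: "submarkov M (walk :: ('a \<Rightarrow> real) \<Rightarrow> 'a \<Rightarrow> real)"
  unfolding walk_eq_average[abs_def] by (rule submarkov_average[OF I step_submarkov])

lemma walk_one: "walk (\<lambda>_. 1 :: real) = (\<lambda>_. 1)"
proof
  fix x
  have "step i (\<lambda>_. 1 :: real) x = 1" if "i \<in> I" for i
    using integral_one_mass[OF that] by (simp add: step_def)
  then show "walk (\<lambda>_. 1 :: real) x = 1" using I by (simp add: walk_def)
qed

lemma ker_sym_nonneg:
  assumes i: "i \<in> I" and f: "bm M f" "\<And>x. 0 \<le> f x" and g: "bm M g" "\<And>x. 0 \<le> g x"
  shows "(LINT x|M. f x * (LINT y|\<kappa> i x. g y)) = (LINT x|M. g x * (LINT y|\<kappa> i x. f y))"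
proof -
  have *: "ennreal (LINT x|M. u x * (LINT y|\<kappa> i x. v y)) = (\<integral>\<^sup>+x. \<integral>\<^sup>+y. ennreal (u x) * ennreal (v y) \<partial>\<kappa> i x \<partial>M)"
    if u: "bm M u" "\<And>x. 0 \<le> u x" and v: "bm M v" "\<And>x. 0 \<le> v x" for u v
  proof -
    have in_x: "(\<integral>\<^sup>+y. ennreal (u x) * ennreal (v y) \<partial>\<kappa> i x) = ennreal (u x * (LINT y|\<kappa> i x. v y))" for x
    proof -
      interpret subprob_space "\<kappa> i x" by (rule ker_subprob[OF i])
      have "(\<integral>\<^sup>+y. ennreal (u x) * ennreal (v y) \<partial>\<kappa> i x) = ennreal (u x) * (\<integral>\<^sup>+y. ennreal (v y) \<partial>\<kappa> i x)"
        using bm_ker[OF i v(1)] by (intro nn_integral_cmult) auto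
      also have "(\<integral>\<^sup>+y. ennreal (v y) \<partial>\<kappa> i x) = ennreal (LINT y|\<kappa> i x. v y)"
        using v by (intro nn_integral_eq_integral integrable_bm bm_ker[OF i]) auto
      finally show ?thesis using u v by (simp add: ennreal_mult)
    qed
    have "bm M (\<lambda>x. u x * (LINT y|\<kappa> i x. v y))"
      using u v by (intro bm_mult submarkov_bm[OF ker_submarkov[OF i]])
    then show ?thesis unfolding in_x
      using u v by (intro nn_integral_eq_integral[symmetric] integrable_bm) (auto intro!: mult_nonneg_nonneg)
  qed
  have [measurable]: "f \<in> borel_measurable M" "g \<in> borel_measurable M" using f g by auto
  have "ennreal (LINT x|M. f x * (LINT y|\<kappa> i x. g y)) = (\<integral>\<^sup>+x. \<integral>\<^sup>+y. ennreal (f y) * ennreal (g x) \<partial>\<kappa> i x \<partial>M)"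
    unfolding *[OF f g] by (rule sym[OF i]) measurable
  also have "\<dots> = ennreal (LINT x|M. g x * (LINT y|\<kappa> i x. f y))"
    unfolding *[OF g f] by (simp add: mult.commute)
  finally show ?thesis
    using f g by (subst (asm) ennreal_inj) (auto intro!: Bochner_Integration.integral_nonneg mult_nonneg_nonneg)
qed

text \<open>Adding constants makes both functions nonnegative. The cross terms produced in this way
  cancel by \<open>half\<close>, the symmetry against the constant 1.\<close>

lemma ker_sym:
  assumes i: "i \<in> I" and f: "bm M f" and g: "bm M g"
  shows "(LINT x|M. f x * (LINT y|\<kappa> i x. g y)) = (LINT x|M. g x * (LINT y|\<kappa> i x. f y))"
proof -
  let ?T = "\<lambda>f x. LINT y|\<kappa> i x. f y"
  note T = ker_submarkov[OF i]
  have shift: "\<exists>C\<ge>0. \<forall>x. 0 \<le> f x + C" if fb: "bm M f" for f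
  proof -
    obtain B where B: "B \<ge> 0" "\<forall>x. \<bar>f x\<bar> \<le> B" using bm_bound[OF fb] by auto
    have "0 \<le> f x + B" for x using B(2)[rule_format, of x] by linarith
    then show ?thesis using B(1) by auto
  qed
  obtain C D where C: "C \<ge> 0" "\<And>x. 0 \<le> f x + C" and D: "D \<ge> 0" "\<And>x. 0 \<le> g x + D"
    using shift[OF f] shift[OF g] by auto
  have Tbm: "bm M (?T u)" if "bm M u" for u using submarkov_bm[OF T that] .
  have Tadd: "?T (\<lambda>x. u x + c) x = ?T u x + c * ?T (\<lambda>_. 1) x" if "bm M u" for u c x
    using fun_cong[OF submarkov_add[OF T that bm_const[of M c]], of x] fun_cong[OF submarkov_const[OF T, of c], of x] by simp
  have half: "(LINT x|M. u x * ?T (\<lambda>_. 1) x) = (LINT x|M. ?T u x)" if u: "bm M u" "\<And>x. 0 \<le> u x + c" for u c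
  proof -
    have "(LINT x|M. (u x + c) * ?T (\<lambda>_. 1) x) = (LINT x|M. 1 * ?T (\<lambda>x. u x + c) x)"
      using u by (intro ker_sym_nonneg[OF i]) (auto intro: bm_intros)
    then have "(LINT x|M. u x * ?T (\<lambda>_. 1) x + c * ?T (\<lambda>_. 1) x) = (LINT x|M. ?T u x + c * ?T (\<lambda>_. 1) x)"
      by (simp only: distrib_right mult_1 Tadd[OF u(1)])
    then show ?thesis using u(1) Tbm[OF u(1)] Tbm[OF bm_const[of M 1]]
      by (simp only: integral_bm bm_intros)
  qed
  have "(LINT x|M. (f x + C) * ?T (\<lambda>x. g x + D) x) = (LINT x|M. (g x + D) * ?T (\<lambda>x. f x + C) x)"
    using f g C D by (intro ker_sym_nonneg[OF i]) (auto intro: bm_intros)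
  then have "(LINT x|M. f x * ?T g x + D * (f x * ?T (\<lambda>_. 1) x) + C * ?T g x + C * D * ?T (\<lambda>_. 1) x)
      = (LINT x|M. g x * ?T f x + C * (g x * ?T (\<lambda>_. 1) x) + D * ?T f x + C * D * ?T (\<lambda>_. 1) x)"
    unfolding Tadd[OF f] Tadd[OF g] by (simp only: algebra_simps)
  then show ?thesis
    using half[OF f C(2)] half[OF g D(2)] f g Tbm[OF f] Tbm[OF g] Tbm[OF bm_const[of M 1]]
    by (simp only: integral_bm bm_intros)
qed

lemma step_sym:
  assumes i: "i \<in> I" and f: "bm M f" and g: "bm M g"
  shows "(LINT x|M. f x * step i g x) = (LINT x|M. step i f x * g x)"
proof -
  let ?T = "\<lambda>f x. LINT y|\<kappa> i x. f y"
  have Tbm: "bm M (?T u)" if "bm M u" for u using submarkov_bm[OF ker_submarkov[OF i] that] .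
  have mb: "bm M (\<lambda>x. 1 - mass i x)"
    using mass_measurable[OF i] mass_bounds[OF i] by (intro bmI[where B=1]) auto
  have "(LINT x|M. f x * step i g x) = (LINT x|M. (1 - mass i x) * (f x * g x) + f x * ?T g x)"
    by (simp add: step_def algebra_simps)
  also have "\<dots> = (LINT x|M. (1 - mass i x) * (f x * g x)) + (LINT x|M. f x * ?T g x)"
    using f g mb Tbm[OF g] by (simp only: integral_bm bm_intros)
  also have "(LINT x|M. f x * ?T g x) = (LINT x|M. g x * ?T f x)" by (rule ker_sym[OF i f g])
  also have "(LINT x|M. (1 - mass i x) * (f x * g x)) + (LINT x|M. g x * ?T f x) = (LINT x|M. (1 - mass i x) * (f x * g x) + g x * ?T f x)"
    using f g mb Tbm[OF f] by (simp only: integral_bm bm_intros)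
  also have "\<dots> = (LINT x|M. step i f x * g x)" by (simp add: step_def algebra_simps)
  finally show ?thesis .
qed

sublocale symmetric_markov M "walk :: ('a \<Rightarrow> real) \<Rightarrow> 'a \<Rightarrow> real"
proof
  show "space M = UNIV" by (rule space_UNIV)
  show "submarkov M (walk :: ('a \<Rightarrow> real) \<Rightarrow> 'a \<Rightarrow> real)" by (rule walk_submarkov)
  show "walk (\<lambda>_. 1 :: real) = (\<lambda>_. 1)" by (rule walk_one)
  fix f g :: "'a \<Rightarrow> real" assume f: "bm M f" and g: "bm M g"
  have sb: "bm M (step i u)" if "i \<in> I" "bm M u" for i u using submarkov_bm[OF step_submarkov[OF that(1)] that(2)] .
  have "(LINT x|M. f x * walk g x) = (LINT x|M. 1 / real (card I) * (\<Sum>i\<in>I. f x * step i g x))"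
    by (simp add: walk_eq_average sum_distrib_left mult.left_commute)
  also have "\<dots> = 1 / real (card I) * (\<Sum>i\<in>I. LINT x|M. f x * step i g x)"
    using f g sb by (simp add: Bochner_Integration.integral_sum integrable_bm bm_mult)
  also have "\<dots> = 1 / real (card I) * (\<Sum>i\<in>I. LINT x|M. step i f x * g x)"
    using step_sym[OF _ f g] by simp
  also have "\<dots> = (LINT x|M. 1 / real (card I) * (\<Sum>i\<in>I. step i f x * g x))"
    using f g sb by (simp add: Bochner_Integration.integral_sum integrable_bm bm_mult)
  also have "\<dots> = (LINT x|M. walk f x * g x)"
    by (simp add: walk_eq_average sum_distrib_right)
  finally show "(LINT x|M. f x * walk g x) = (LINT x|M. walk f x * g x)" .
qed

text \<open>Twice the form of I - \<open>step i\<close>. Values in a Euclidean space serve both the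
  complex functions in the definition of the gap and the real ones elsewhere.\<close>

definition dirichlet :: "'i \<Rightarrow> ('a \<Rightarrow> 'b::euclidean_space) \<Rightarrow> ennreal" where
  "dirichlet i u = (\<integral>\<^sup>+x. \<integral>\<^sup>+y. ennreal ((norm (u y - u x))\<^sup>2) \<partial>\<kappa> i x \<partial>M)"

text \<open>Small only on functions that nearly change sign at each jump, the danger at the lower
  end -1 of the spectrum.\<close>

definition sum_dirichlet :: "'i \<Rightarrow> ('a \<Rightarrow> real) \<Rightarrow> ennreal" where
  "sum_dirichlet i u = (\<integral>\<^sup>+x. \<integral>\<^sup>+y. ennreal ((u x + u y)\<^sup>2) \<partial>\<kappa> i x \<partial>M)"

text \<open>By symmetry the pair measure has equal marginals.\<close>

lemma pair_mass:
  assumes i: "i \<in> I" and v[measurable]: "v \<in> borel_measurable M"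
  shows "(\<integral>\<^sup>+x. \<integral>\<^sup>+y. v y \<partial>\<kappa> i x \<partial>M) = (\<integral>\<^sup>+x. v x * ennreal (mass i x) \<partial>M)"
proof -
  have "(\<integral>\<^sup>+x. \<integral>\<^sup>+y. v y \<partial>\<kappa> i x \<partial>M) = (\<integral>\<^sup>+x. \<integral>\<^sup>+y. v x \<partial>\<kappa> i x \<partial>M)"
    by (rule sym[OF i]) measurable
  also have "\<dots> = (\<integral>\<^sup>+x. v x * ennreal (mass i x) \<partial>M)"
    by (simp add: nn_integral_const ker_subprob(3)[OF i] emeasure_ker_mass[OF i])
  finally show ?thesis .
qed

text \<open>Since \<open>u\<close> is merely square integrable, its integral against \<kappa> i x
  can diverge. That requires N x to be infinite, and by \<open>pair_mass\<close> N has a finite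
  integral; off this null set the claim is the expansion of a square.\<close>

lemma dirichlet_identity:
  fixes u :: "'a \<Rightarrow> 'b::euclidean_space"
  assumes i: "i \<in> I" and u[measurable]: "u \<in> borel_measurable M"
    and fin: "(\<integral>\<^sup>+x. ennreal ((norm (u x))\<^sup>2) \<partial>M) < \<infinity>"
  shows "dirichlet i u < \<infinity>" and "integrable M (\<lambda>x. (u x - step i u x) \<bullet> u x)"
    and "(LINT x|M. (u x - step i u x) \<bullet> u x) = enn2real (dirichlet i u) / 2"
proof -
  note [measurable] = mass_measurable[OF i] step_measurable[OF i u]
  define N where "N x = (\<integral>\<^sup>+y. ennreal ((norm (u y))\<^sup>2) \<partial>\<kappa> i x)" for x
  define D where "D x = (\<integral>\<^sup>+y. ennreal ((norm (u y - u x))\<^sup>2) \<partial>\<kappa> i x)" for x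
  have N[measurable]: "N \<in> borel_measurable M"
    unfolding N_def by (rule nn_integral_measurable_subprob_algebra2[OF _ ker[OF i]]) measurable
  have D[measurable]: "D \<in> borel_measurable M"
    unfolding D_def by (rule nn_integral_measurable_subprob_algebra2[OF _ ker[OF i]]) measurable
  have um: "u \<in> borel_measurable (\<kappa> i x)" for x
    using u ker_subprob(2)[OF i, of x] by (simp cong: measurable_cong_sets)
  let ?m = "\<lambda>x. mass i x * (norm (u x))\<^sup>2"
  have intN: "(\<integral>\<^sup>+x. N x \<partial>M) = (\<integral>\<^sup>+x. ennreal (?m x) \<partial>M)"
    unfolding N_def by (subst pair_mass[OF i]) (auto simp: ennreal_mult mass_bounds[OF i] mult.commute)
  have mle: "(\<integral>\<^sup>+x. ennreal (?m x) \<partial>M) \<le> (\<integral>\<^sup>+x. ennreal ((norm (u x))\<^sup>2) \<partial>M)"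
    using mass_bounds[OF i] by (intro nn_integral_mono ennreal_leI mult_left_le_one_le) auto
  have mfin: "(\<integral>\<^sup>+x. ennreal (?m x) \<partial>M) < \<infinity>" using mle fin by (rule le_less_trans)
  have D_le: "D x \<le> 2 * N x + 2 * ennreal (?m x)" for x
  proof -
    have "D x \<le> (\<integral>\<^sup>+y. 2 * ennreal ((norm (u y))\<^sup>2) + 2 * ennreal ((norm (u x))\<^sup>2) \<partial>\<kappa> i x)"
      unfolding D_def
    proof (intro nn_integral_mono)
      fix y
      have "(norm (u y - u x))\<^sup>2 \<le> 2 * (norm (u y))\<^sup>2 + 2 * (norm (u x))\<^sup>2"
        using norm_sum_square_le[of "u y" "- u x"] by simp
      then have "ennreal ((norm (u y - u x))\<^sup>2) \<le> ennreal (2 * (norm (u y))\<^sup>2 + 2 * (norm (u x))\<^sup>2)" by (rule ennreal_leI)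
      then show "ennreal ((norm (u y - u x))\<^sup>2) \<le> 2 * ennreal ((norm (u y))\<^sup>2) + 2 * ennreal ((norm (u x))\<^sup>2)"
        by (simp add: ennreal_mult)
    qed
    also have "\<dots> = 2 * N x + 2 * ennreal (?m x)"
      using um[of x] by (simp add: nn_integral_add nn_integral_cmult N_def ker_subprob(3)[OF i]
          emeasure_ker_mass[OF i] ennreal_mult mass_bounds[OF i] mult.assoc) (simp add: mult.commute)
    finally show ?thesis .
  qed
  have "(\<integral>\<^sup>+x. D x \<partial>M) \<le> (\<integral>\<^sup>+x. 2 * N x + 2 * ennreal (?m x) \<partial>M)"
    by (intro nn_integral_mono D_le)
  also have "\<dots> = 2 * (\<integral>\<^sup>+x. N x \<partial>M) + 2 * (\<integral>\<^sup>+x. ennreal (?m x) \<partial>M)"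
    by (simp add: nn_integral_add nn_integral_cmult)
  also have "\<dots> < \<infinity>" using mfin unfolding intN by (simp add: ennreal_mult_less_top)
  finally have Dfin: "(\<integral>\<^sup>+x. D x \<partial>M) < \<infinity>" .
  have dD: "dirichlet i u = (\<integral>\<^sup>+x. D x \<partial>M)" by (simp add: dirichlet_def D_def)
  then show "dirichlet i u < \<infinity>" using Dfin by simp
  have ND: "N x = ennreal (enn2real (N x))" "D x = ennreal (enn2real (D x))" if "N x \<noteq> \<infinity>" for x
  proof -
    show "N x = ennreal (enn2real (N x))" using that by (simp add: less_top)
    have "D x < \<infinity>" using that by (intro le_less_trans[OF D_le]) (simp add: less_top ennreal_mult_less_top)
    then show "D x = ennreal (enn2real (D x))" by simp
  qed
  have id: "(u x - step i u x) \<bullet> u x = (?m x - enn2real (N x) + enn2real (D x)) / 2" if "N x \<noteq> \<infinity>" for x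
  proof -
    interpret subprob_space "\<kappa> i x" by (rule ker_subprob[OF i])
    note [measurable] = um[of x]
    have sq: "integrable (\<kappa> i x) (\<lambda>y. (norm (u y))\<^sup>2)"
      using that by (intro integrableI_bounded) (auto simp: N_def less_top)
    have int: "integrable (\<kappa> i x) u"
    proof (rule Bochner_Integration.integrable_bound)
      show "integrable (\<kappa> i x) (\<lambda>y. 1 + (norm (u y))\<^sup>2)" using sq by simp
      have "norm (u y) \<le> 1 + (norm (u y))\<^sup>2" for y
      proof -
        have "2 * norm (u y) \<le> (norm (u y))\<^sup>2 + 1" using sum_squares_bound[of "norm (u y)" 1] by simp
        then show ?thesis using norm_ge_zero[of "u y"] by linarith
      qed
      then show "AE y in \<kappa> i x. norm (u y) \<le> norm (1 + (norm (u y))\<^sup>2)" by simp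
    qed measurable
    have nr: "enn2real (N x) = (LINT y|\<kappa> i x. (norm (u y))\<^sup>2)"
      unfolding N_def by (subst integral_eq_nn_integral) auto
    have exp: "(norm (u y - u x))\<^sup>2 = (norm (u y))\<^sup>2 - 2 * (u y \<bullet> u x) + (norm (u x))\<^sup>2" for y
      by (simp add: power2_norm_eq_inner inner_diff_left inner_diff_right inner_commute)
    have "enn2real (D x) = (LINT y|\<kappa> i x. (norm (u y - u x))\<^sup>2)"
      unfolding D_def by (subst integral_eq_nn_integral) auto
    also have "\<dots> = (LINT y|\<kappa> i x. (norm (u y))\<^sup>2) - 2 * (LINT y|\<kappa> i x. u y \<bullet> u x) + (LINT y|\<kappa> i x. (norm (u x))\<^sup>2)"
      unfolding exp using sq int by simp
    also have "(LINT y|\<kappa> i x. u y \<bullet> u x) = (LINT y|\<kappa> i x. u y) \<bullet> u x"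
      using int by (rule integral_inner_left)
    also have "(LINT y|\<kappa> i x. (norm (u x))\<^sup>2) = ?m x"
      using ker_subprob(3)[OF i, of x] by (simp add: mass_def)
    finally have "(LINT y|\<kappa> i x. u y) \<bullet> u x = (enn2real (N x) + ?m x - enn2real (D x)) / 2" using nr by simp
    then show ?thesis
      by (simp add: step_def inner_diff_left inner_add_left power2_norm_eq_inner algebra_simps)
  qed
  have AEN: "AE x in M. N x \<noteq> \<infinity>"
    using mfin by (intro nn_integral_PInf_AE) (auto simp: intN)
  have im: "integrable M ?m" using mfin mass_bounds[OF i] by (intro integrableI_nonneg) auto
  have iN: "integrable M (\<lambda>x. enn2real (N x))" and iN': "(LINT x|M. enn2real (N x)) = (LINT x|M. ?m x)"
  proof -
    have e: "(\<integral>\<^sup>+x. ennreal (enn2real (N x)) \<partial>M) = (\<integral>\<^sup>+x. ennreal (?m x) \<partial>M)"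
    proof -
      have "AE x in M. ennreal (enn2real (N x)) = N x" using AEN by eventually_elim (rule ND(1)[symmetric])
      from nn_integral_cong_AE[OF this] show ?thesis by (simp only: intN)
    qed
    show "integrable M (\<lambda>x. enn2real (N x))" using mfin e by (intro integrableI_nonneg) auto
    show "(LINT x|M. enn2real (N x)) = (LINT x|M. ?m x)"
      using e mass_bounds[OF i] by (subst (1 2) integral_eq_nn_integral) auto
  qed
  have eD: "(\<integral>\<^sup>+x. ennreal (enn2real (D x)) \<partial>M) = (\<integral>\<^sup>+x. D x \<partial>M)"
  proof (rule nn_integral_cong_AE)
    show "AE x in M. ennreal (enn2real (D x)) = D x" using AEN by eventually_elim (rule ND(2)[symmetric])
  qed
  have iD: "integrable M (\<lambda>x. enn2real (D x))" using Dfin eD by (intro integrableI_nonneg) auto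
  have iD': "(LINT x|M. enn2real (D x)) = enn2real (dirichlet i u)"
    unfolding dD eD[symmetric] by (subst integral_eq_nn_integral) auto
  have AEid: "AE x in M. (?m x - enn2real (N x) + enn2real (D x)) / 2 = (u x - step i u x) \<bullet> u x"
    using AEN by eventually_elim (simp add: id)
  have i1: "integrable M (\<lambda>x. (?m x - enn2real (N x) + enn2real (D x)) / 2)"
    by (intro integrable_divide Bochner_Integration.integrable_add Bochner_Integration.integrable_diff im iN iD)
  have meas: "(\<lambda>x. (u x - step i u x) \<bullet> u x) \<in> borel_measurable M" by measurable
  show "integrable M (\<lambda>x. (u x - step i u x) \<bullet> u x)"
    by (rule integrable_cong_AE_imp[OF i1 meas AEid])
  have "(LINT x|M. (u x - step i u x) \<bullet> u x) = (LINT x|M. (?m x - enn2real (N x) + enn2real (D x)) / 2)"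
    by (rule integral_cong_AE[OF meas borel_measurable_integrable[OF i1] AE_symmetric[OF AEid]])
  also have "\<dots> = enn2real (dirichlet i u) / 2" using im iN iD iN' iD' by simp
  finally show "(LINT x|M. (u x - step i u x) \<bullet> u x) = enn2real (dirichlet i u) / 2" .
qed

lemma walk_dirichlet:
  fixes u :: "'a \<Rightarrow> 'b::euclidean_space"
  assumes u[measurable]: "u \<in> borel_measurable M"
    and fin: "(\<integral>\<^sup>+x. ennreal ((norm (u x))\<^sup>2) \<partial>M) < \<infinity>"
  shows "(LINT x|M. (u x - walk u x) \<bullet> u x) = 1 / (2 * real (card I)) * (\<Sum>i\<in>I. enn2real (dirichlet i u))"
    and "integrable M (\<lambda>x. (u x - walk u x) \<bullet> u x)"
proof -
  have card: "real (card I) > 0" using I by (simp add: card_gt_0_iff)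
  have eq: "(u x - walk u x) \<bullet> u x = 1 / real (card I) * (\<Sum>i\<in>I. (u x - step i u x) \<bullet> u x)" for x
  proof -
    have "u x - walk u x = (1 / real (card I)) *\<^sub>R (\<Sum>i\<in>I. u x - step i u x)"
      using card by (simp add: walk_def sum_subtractf scaleR_diff_right sum_constant_scaleR)
    then show ?thesis by (simp add: inner_sum_left)
  qed
  show "(LINT x|M. (u x - walk u x) \<bullet> u x) = 1 / (2 * real (card I)) * (\<Sum>i\<in>I. enn2real (dirichlet i u))"
  proof -
    have "(LINT x|M. (u x - walk u x) \<bullet> u x) = 1 / real (card I) * (\<Sum>i\<in>I. LINT x|M. (u x - step i u x) \<bullet> u x)"
      unfolding eq integral_mult_right_zero
      using dirichlet_identity(2)[OF _ u fin] by (subst Bochner_Integration.integral_sum) auto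
    also have "(\<Sum>i\<in>I. LINT x|M. (u x - step i u x) \<bullet> u x) = (\<Sum>i\<in>I. enn2real (dirichlet i u) / 2)"
      by (intro sum.cong refl dirichlet_identity(3)[OF _ u fin])
    finally show ?thesis by (simp add: sum_divide_distrib[symmetric])
  qed
  show "integrable M (\<lambda>x. (u x - walk u x) \<bullet> u x)"
    unfolding eq using dirichlet_identity(2)[OF _ u fin] by (intro integrable_mult_right Bochner_Integration.integrable_sum)
qed

lemma bm_square_finite: "bm M f \<Longrightarrow> (\<integral>\<^sup>+x. ennreal ((norm (f x))\<^sup>2) \<partial>M) < \<infinity>"
  using integrable_bm[OF bm_power2, of f] by (simp add: nn_integral_eq_integral)

lemma energy_eq_dirichlet:
  assumes "bm M f" shows "energy f = 1 / (2 * real (card I)) * (\<Sum>i\<in>I. enn2real (dirichlet i f))"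
  using walk_dirichlet(1)[OF bm_measurable[OF assms] bm_square_finite[OF assms]]
  by (simp add: energy_def mult.commute)

lemma dirichlet_bm_finite: "i \<in> I \<Longrightarrow> bm M f \<Longrightarrow> dirichlet i f < \<infinity>"
  by (rule dirichlet_identity(1)[OF _ bm_measurable bm_square_finite])

lemma dirichlet_le_energy:
  assumes i: "i \<in> I" and f: "bm M f"
  shows "dirichlet i f \<le> ennreal (2 * real (card I) * energy f)"
proof -
  have "enn2real (dirichlet i f) \<le> (\<Sum>i\<in>I. enn2real (dirichlet i f))"
    using i I by (intro member_le_sum) auto
  also have "\<dots> = 2 * real (card I) * energy f"
    using I by (simp add: energy_eq_dirichlet[OF f])
  finally show ?thesis
    using dirichlet_bm_finite[OF i f] by (metis ennreal_enn2real ennreal_leI infinity_ennreal_def)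
qed

lemma energy_nonneg: "bm M f \<Longrightarrow> 0 \<le> energy f"
  by (simp add: energy_eq_dirichlet sum_nonneg)

text \<open>The parallelogram law under the integral; \<open>pair_mass\<close> moves the square at y
  back to x.\<close>

lemma dirichlet_add_sum_dirichlet:
  assumes i: "i \<in> I" and f: "bm M f"
  shows "dirichlet i f + sum_dirichlet i f \<le> ennreal (4 * (LINT x|M. (f x)\<^sup>2))"
proof -
  have [measurable]: "f \<in> borel_measurable M" using f by auto
  have fm: "f \<in> borel_measurable (\<kappa> i x)" for x
    using f ker_subprob(2)[OF i, of x] by (simp add: bm_def cong: measurable_cong_sets)
  let ?q = "\<lambda>x. ennreal ((f x)\<^sup>2)"
  have m1[measurable]: "(\<lambda>x. \<integral>\<^sup>+y. ennreal ((f y - f x)\<^sup>2) \<partial>\<kappa> i x) \<in> borel_measurable M"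
    by (rule nn_integral_measurable_subprob_algebra2[OF _ ker[OF i]]) measurable
  have m2[measurable]: "(\<lambda>x. \<integral>\<^sup>+y. ennreal ((f x + f y)\<^sup>2) \<partial>\<kappa> i x) \<in> borel_measurable M"
    by (rule nn_integral_measurable_subprob_algebra2[OF _ ker[OF i]]) measurable
  have m3[measurable]: "(\<lambda>x. \<integral>\<^sup>+y. ?q y \<partial>\<kappa> i x) \<in> borel_measurable M"
    by (rule nn_integral_measurable_subprob_algebra2[OF _ ker[OF i]]) measurable
  have "dirichlet i f + sum_dirichlet i f = (\<integral>\<^sup>+x. (\<integral>\<^sup>+y. ennreal ((f y - f x)\<^sup>2) \<partial>\<kappa> i x) + (\<integral>\<^sup>+y. ennreal ((f x + f y)\<^sup>2) \<partial>\<kappa> i x) \<partial>M)"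
    unfolding dirichlet_def sum_dirichlet_def by (subst nn_integral_add) auto
  also have "\<dots> = (\<integral>\<^sup>+x. 2 * (\<integral>\<^sup>+y. ?q y \<partial>\<kappa> i x) + 2 * (?q x * ennreal (mass i x)) \<partial>M)"
  proof (rule nn_integral_cong)
    fix x
    note [measurable] = fm[of x]
    have "(\<integral>\<^sup>+y. ennreal ((f y - f x)\<^sup>2) \<partial>\<kappa> i x) + (\<integral>\<^sup>+y. ennreal ((f x + f y)\<^sup>2) \<partial>\<kappa> i x)
        = (\<integral>\<^sup>+y. ennreal ((f y - f x)\<^sup>2) + ennreal ((f x + f y)\<^sup>2) \<partial>\<kappa> i x)"
      by (subst nn_integral_add) auto
    also have "\<dots> = (\<integral>\<^sup>+y. 2 * ?q y + 2 * ?q x \<partial>\<kappa> i x)"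
    proof (rule nn_integral_cong)
      fix y
      have "ennreal ((f y - f x)\<^sup>2) + ennreal ((f x + f y)\<^sup>2) = ennreal (2 * (f y)\<^sup>2 + 2 * (f x)\<^sup>2)"
      proof -
        have "(f y - f x)\<^sup>2 + (f x + f y)\<^sup>2 = 2 * (f y)\<^sup>2 + 2 * (f x)\<^sup>2"
          by (simp add: power2_eq_square algebra_simps)
        then show ?thesis by (simp only: ennreal_plus[symmetric] zero_le_power2)
      qed
      then show "ennreal ((f y - f x)\<^sup>2) + ennreal ((f x + f y)\<^sup>2) = 2 * ?q y + 2 * ?q x"
        by (simp add: ennreal_mult)
    qed
    also have "\<dots> = 2 * (\<integral>\<^sup>+y. ?q y \<partial>\<kappa> i x) + 2 * (?q x * ennreal (mass i x))"
      by (simp add: nn_integral_add nn_integral_cmult ker_subprob(3)[OF i] emeasure_ker_mass[OF i] mult.assoc)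
    finally show "(\<integral>\<^sup>+y. ennreal ((f y - f x)\<^sup>2) \<partial>\<kappa> i x) + (\<integral>\<^sup>+y. ennreal ((f x + f y)\<^sup>2) \<partial>\<kappa> i x)
        = 2 * (\<integral>\<^sup>+y. ?q y \<partial>\<kappa> i x) + 2 * (?q x * ennreal (mass i x))" .
  qed
  also have "\<dots> = 2 * (\<integral>\<^sup>+x. \<integral>\<^sup>+y. ?q y \<partial>\<kappa> i x \<partial>M) + 2 * (\<integral>\<^sup>+x. ?q x * ennreal (mass i x) \<partial>M)"
    using mass_measurable[OF i] by (simp add: nn_integral_add nn_integral_cmult)
  also have "(\<integral>\<^sup>+x. \<integral>\<^sup>+y. ?q y \<partial>\<kappa> i x \<partial>M) = (\<integral>\<^sup>+x. ?q x * ennreal (mass i x) \<partial>M)"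
    by (rule pair_mass[OF i]) measurable
  also have "2 * (\<integral>\<^sup>+x. ?q x * ennreal (mass i x) \<partial>M) + 2 * (\<integral>\<^sup>+x. ?q x * ennreal (mass i x) \<partial>M)
      = (2 + 2) * (\<integral>\<^sup>+x. ?q x * ennreal (mass i x) \<partial>M)" by (simp only: distrib_right)
  also have "\<dots> \<le> (2 + 2) * (\<integral>\<^sup>+x. ?q x \<partial>M)"
    using mass_bounds[OF i] by (intro mult_left_mono nn_integral_mono) (auto intro!: mult_left_le simp: ennreal_le_1)
  also have "(\<integral>\<^sup>+x. ?q x \<partial>M) = ennreal (LINT x|M. (f x)\<^sup>2)"
    using f by (intro nn_integral_eq_integral integrable_bm bm_power2) auto
  also have "(2 + 2) * ennreal (LINT x|M. (f x)\<^sup>2) = ennreal (4 * (LINT x|M. (f x)\<^sup>2))"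
    by (simp add: ennreal_mult)
  finally show ?thesis .
qed

text \<open>For each index the two forms share the budget 4 |f|^2, so what the sum forms are known
  to take is missing from the energy.\<close>

lemma energy_le_of_sum_dirichlet:
  assumes f: "bm M f" and i: "i \<in> I" and lower: "ennreal (c * (LINT x|M. (f x)\<^sup>2)) \<le> (\<Sum>i\<in>I. sum_dirichlet i f)" and c: "0 \<le> c"
  shows "energy f \<le> (2 - c / (2 * real (card I))) * (LINT x|M. (f x)\<^sup>2)"
proof -
  let ?Y = "LINT x|M. (f x)\<^sup>2" and ?n = "real (card I)"
  have n: "?n > 0" using I by (simp add: card_gt_0_iff)
  have fin: "dirichlet i f < \<infinity>" "sum_dirichlet i f < \<infinity>" if "i \<in> I" for i
  proof -
    have "dirichlet i f + sum_dirichlet i f < \<infinity>"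
      using dirichlet_add_sum_dirichlet[OF that f] by (rule le_less_trans) simp
    then show "dirichlet i f < \<infinity>" "sum_dirichlet i f < \<infinity>" by auto
  qed
  have 1: "enn2real (dirichlet i f) + enn2real (sum_dirichlet i f) \<le> 4 * ?Y" if "i \<in> I" for i
  proof -
    have "ennreal (enn2real (dirichlet i f) + enn2real (sum_dirichlet i f)) = dirichlet i f + sum_dirichlet i f"
      using fin[OF that] by (simp add: ennreal_plus)
    also have "\<dots> \<le> ennreal (4 * ?Y)" by (rule dirichlet_add_sum_dirichlet[OF that f])
    finally show ?thesis by (subst (asm) ennreal_le_iff) auto
  qed
  have "ennreal (c * ?Y) \<le> ennreal (\<Sum>i\<in>I. enn2real (sum_dirichlet i f))"
    using lower fin(2) by (simp add: sum_ennreal[symmetric] cong: sum.cong)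
  then have 2: "c * ?Y \<le> (\<Sum>i\<in>I. enn2real (sum_dirichlet i f))"
    by (subst (asm) ennreal_le_iff) (auto intro: sum_nonneg)
  have "(\<Sum>i\<in>I. enn2real (dirichlet i f)) + (\<Sum>i\<in>I. enn2real (sum_dirichlet i f)) \<le> (\<Sum>i\<in>I. 4 * ?Y)"
    unfolding sum.distrib[symmetric] by (intro sum_mono 1)
  then have "(\<Sum>i\<in>I. enn2real (dirichlet i f)) \<le> ?n * (4 * ?Y) - c * ?Y" using 2 by simp
  then have "1 / (2 * ?n) * (\<Sum>i\<in>I. enn2real (dirichlet i f)) \<le> 1 / (2 * ?n) * (?n * (4 * ?Y) - c * ?Y)"
    using n by (intro mult_left_mono) auto
  also have "\<dots> = (2 - c / (2 * ?n)) * ?Y" using n by (simp add: field_simps)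
  finally show ?thesis by (simp add: energy_eq_dirichlet[OF f])
qed

end

section \<open>The walk on a union of cubes\<close>

text \<open>\<Lambda> and \<open>a\<close> serve all cubes and all h. The bound h \<le> a /
  \<Lambda>^2 keeps the flows up to time h where the density is controlled; h \<le> 1 / \<Lambda>
  keeps the jump lengths c h / \<Lambda> below the half-sides.\<close>

locale cube_walk = prob_space M for M :: "'m::{t2_space, second_countable_topology} measure" +
  fixes N :: nat and par :: "nat \<Rightarrow> real^'n::finite \<Rightarrow> 'm" and l L c :: "nat \<Rightarrow> 'n \<Rightarrow> real"
    and d :: "nat \<Rightarrow> real^'n \<Rightarrow> real" and \<Lambda> a h :: real
  assumes chart: "\<And>i. i < N \<Longrightarrow> cube_chart (par i) (l i) (L i) (d i) M \<Lambda> a"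
    and N: "0 < N" and cover: "(\<Union>i<N. par i ` centered_box (l i)) = UNIV"
    and c: "\<And>i j. i < N \<Longrightarrow> 1 / \<Lambda> \<le> c i j" "\<And>i j. i < N \<Longrightarrow> c i j \<le> \<Lambda>"
    and l: "\<And>i j. i < N \<Longrightarrow> 1 / \<Lambda> \<le> l i j" "\<And>i j. i < N \<Longrightarrow> l i j \<le> \<Lambda>"
    and h: "0 < h" "h \<le> 1" "h \<le> 1 / \<Lambda>" "h \<le> a / \<Lambda>\<^sup>2"
begin

definition ix :: "(nat \<times> 'n) set" where "ix = {..<N} \<times> UNIV"

definition \<kappa> :: "nat \<times> 'n \<Rightarrow> 'm \<Rightarrow> 'm measure" where
  "\<kappa> = (\<lambda>(i, j). cube_chart.ker (par i) (l i) (L i) (d i) j (c i j) h)"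

lemma \<Lambda>_ge_1: "1 \<le> \<Lambda>"
  using cube_chart.\<Lambda>[OF chart[OF N]] .

lemma sets_M: "sets M = sets borel"
  using cube_chart.sets_M[OF chart[OF N]] .

lemma space_M: "space M = UNIV"
  using sets_eq_imp_space_eq[OF sets_M] by simp

lemma c_pos: "i < N \<Longrightarrow> 0 < c i j"
  using c(1)[of i j] \<Lambda>_ge_1 by (smt (verit) divide_pos_pos)

lemma h_le: assumes "i < N" shows "h \<le> a / (\<Lambda> * c i j)" "c i j * h / \<Lambda> \<le> l i j" "h / \<Lambda>\<^sup>2 \<le> c i j * h / \<Lambda>"
proof -
  have a: "0 < a" using cube_chart.a[OF chart[OF N]] .
  have "h \<le> a / \<Lambda>\<^sup>2" by (rule h(4))
  also have "\<dots> \<le> a / (\<Lambda> * c i j)"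
    using a \<Lambda>_ge_1 c(2)[OF assms, of j] c_pos[OF assms, of j]
    by (intro divide_left_mono) (auto simp: power2_eq_square)
  finally show "h \<le> a / (\<Lambda> * c i j)" .
  have "c i j * h / \<Lambda> \<le> \<Lambda> * h / \<Lambda>"
    using c(2)[OF assms, of j] h \<Lambda>_ge_1 by (intro divide_right_mono mult_right_mono) auto
  also have "\<dots> \<le> l i j" using h(3) l(1)[OF assms, of j] \<Lambda>_ge_1 by simp
  finally show "c i j * h / \<Lambda> \<le> l i j" .
  have "1 / \<Lambda> * h / \<Lambda> \<le> c i j * h / \<Lambda>"
    using c(1)[OF assms, of j] h \<Lambda>_ge_1 by (intro divide_right_mono mult_right_mono) auto
  then show "h / \<Lambda>\<^sup>2 \<le> c i j * h / \<Lambda>" by (simp add: power2_eq_square)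
qed

lemma kernel_family: "kernel_family M ix \<kappa>"
proof
  show "space M = UNIV" by (rule space_M)
  show "finite ix" "ix \<noteq> {}" using N by (auto simp: ix_def)
  fix p assume p: "p \<in> ix"
  then obtain i j where ij: "p = (i, j)" "i < N" by (auto simp: ix_def)
  interpret C: cube_chart "par i" "l i" "L i" "d i" M \<Lambda> a by (rule chart[OF ij(2)])
  show "\<kappa> p \<in> measurable M (subprob_algebra M)"
    unfolding \<kappa>_def ij prod.case by (rule C.ker_measurable[OF c_pos[OF ij(2)] h(1) h_le(1)[OF ij(2)]])
  fix F :: "'m \<Rightarrow> 'm \<Rightarrow> ennreal" assume "(\<lambda>(x, y). F x y) \<in> borel_measurable (M \<Otimes>\<^sub>M M)"
  then have "(\<lambda>(x, y). F x y) \<in> borel_measurable (borel \<Otimes>\<^sub>M borel)"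
    unfolding measurable_cong_sets[OF sets_pair_measure_cong[OF sets_M sets_M] refl] .
  then show "(\<integral>\<^sup>+x. \<integral>\<^sup>+y. F x y \<partial>\<kappa> p x \<partial>M) = (\<integral>\<^sup>+x. \<integral>\<^sup>+y. F y x \<partial>\<kappa> p x \<partial>M)"
    unfolding \<kappa>_def ij prod.case by (rule C.ker_symmetric[OF _ c_pos[OF ij(2)] h(1)])
qed

sublocale kernel_family M ix \<kappa>
  by (rule kernel_family)

lemma card_ix: "card ix = N * CARD('n)"
  by (simp add: ix_def card_cartesian_product)

lemma card_ix_ge_1: "1 \<le> real (card ix)"
  using N zero_less_card_finite[where 'a='n] by (simp add: card_ix Suc_le_eq flip: of_nat_mult)

text \<open>The radius h / \<Lambda>^2 lies below c i j h / \<Lambda> for all i and j, so one radius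
  serves every cube and every axis.\<close>

lemma axis_form_le_dirichlet:
  fixes f :: "'m \<Rightarrow> 'b::euclidean_space"
  assumes i: "i < N" and f[measurable]: "f \<in> borel_measurable borel"
  shows "axis_form (l i) (f \<circ> cube_chart.par' (par i) (L i)) j (h / \<Lambda>\<^sup>2) \<le> ennreal (2 * h * \<Lambda> ^ 3) * dirichlet (i, j) f"
proof -
  interpret C: cube_chart "par i" "l i" "L i" "d i" M \<Lambda> a by (rule chart[OF i])
  let ?F = "\<lambda>x y. ennreal ((norm (f y - f x))\<^sup>2)"
  have fp: "f \<circ> C.par' \<in> borel_measurable borel" by measurable
  have "axis_form (l i) (f \<circ> C.par') j (h / \<Lambda>\<^sup>2) \<le>
    (\<integral>\<^sup>+s. (\<integral>\<^sup>+w. ?F (C.par' w) (C.par' (w + axis j s)) * indicator C.b w * indicator C.b (w + axis j s) \<partial>lborel)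
      * indicator {-(c i j * h / \<Lambda>)<..<c i j * h / \<Lambda>} s \<partial>lborel)"
    unfolding axis_form_def[OF fp] increment_form_def
    unfolding comp_def
    using h_le(3)[OF i, of j] by (intro nn_integral_mono mult_left_mono) (auto simp: indicator_def)
  also have "\<dots> \<le> ennreal (2 * h * c i j * \<Lambda>\<^sup>2) * (\<integral>\<^sup>+x. \<integral>\<^sup>+y. ?F x y \<partial>C.ker j (c i j) h x \<partial>M)"
    by (rule C.pair_form_lower[OF _ c_pos[OF i] h(1)]) measurable
  also have "\<dots> = ennreal (2 * h * c i j * \<Lambda>\<^sup>2) * dirichlet (i, j) f"
    unfolding dirichlet_def unfolding \<kappa>_def prod.case ..
  also have "\<dots> \<le> ennreal (2 * h * \<Lambda> ^ 3) * dirichlet (i, j) f"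
  proof (intro mult_right_mono ennreal_leI)
    have "2 * h * \<Lambda>\<^sup>2 * c i j \<le> 2 * h * \<Lambda>\<^sup>2 * \<Lambda>" using c(2)[OF i, of j] h by (intro mult_left_mono) auto
    then show "2 * h * c i j * \<Lambda>\<^sup>2 \<le> 2 * h * \<Lambda> ^ 3" by (simp add: power2_eq_square power3_eq_cube algebra_simps)
  qed simp
  finally show ?thesis .
qed

lemma nn_integral_le_sum_cubes:
  assumes [measurable]: "F \<in> borel_measurable borel"
  shows "(\<integral>\<^sup>+x. F x \<partial>M) \<le> (\<Sum>i<N. ennreal \<Lambda> *
    (\<integral>\<^sup>+w. F (cube_chart.par' (par i) (L i) w) * indicator (centered_box (l i)) w \<partial>lborel))"
proof -
  have [measurable_cong]: "sets M = sets borel" by (rule sets_M)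
  have Qm[measurable]: "par i ` centered_box (l i) \<in> sets borel" if "i < N" for i
    using cube_chart.Q_measurable[OF chart[OF that]] .
  have "(\<integral>\<^sup>+x. F x \<partial>M) \<le> (\<integral>\<^sup>+x. (\<Sum>i<N. F x * indicator (par i ` centered_box (l i)) x) \<partial>M)"
  proof (intro nn_integral_mono)
    fix x
    obtain i where i: "i < N" "x \<in> par i ` centered_box (l i)" using cover by blast
    have "F x = F x * indicator (par i ` centered_box (l i)) x" using i by simp
    also have "\<dots> \<le> (\<Sum>i<N. F x * indicator (par i ` centered_box (l i)) x)"
      using i by (intro member_le_sum) auto
    finally show "F x \<le> (\<Sum>i<N. F x * indicator (par i ` centered_box (l i)) x)" .
  qed
  also have "\<dots> = (\<Sum>i<N. \<integral>\<^sup>+x. F x * indicator (par i ` centered_box (l i)) x \<partial>M)"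
    by (intro nn_integral_sum) auto
  also have "\<dots> \<le> (\<Sum>i<N. ennreal \<Lambda> * (\<integral>\<^sup>+w. F (cube_chart.par' (par i) (L i) w) * indicator (centered_box (l i)) w \<partial>lborel))"
  proof (intro sum_mono)
    fix i assume "i \<in> {..<N}"
    then have i: "i < N" by simp
    interpret C: cube_chart "par i" "l i" "L i" "d i" M \<Lambda> a by (rule chart[OF i])
    have "(\<integral>\<^sup>+x. F x * indicator C.Q x \<partial>M) = (\<integral>\<^sup>+w. F (C.par' w) * ennreal (C.d0 w) * indicator C.b w \<partial>lborel)"
      by (rule C.nn_integral_Q) measurable
    also have "\<dots> \<le> (\<integral>\<^sup>+w. ennreal \<Lambda> * (F (C.par' w) * indicator C.b w) \<partial>lborel)"
    proof (intro nn_integral_mono)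
      fix w
      show "F (C.par' w) * ennreal (C.d0 w) * indicator C.b w \<le> ennreal \<Lambda> * (F (C.par' w) * indicator C.b w)"
      proof (cases "w \<in> C.b")
        case True
        then have "ennreal (C.d0 w) \<le> ennreal \<Lambda>" using C.d0_b by (intro ennreal_leI) auto
        then have "F (C.par' w) * ennreal (C.d0 w) \<le> F (C.par' w) * ennreal \<Lambda>" by (rule mult_left_mono) simp
        then show ?thesis using True by (simp add: mult.commute)
      qed simp
    qed
    also have "\<dots> = ennreal \<Lambda> * (\<integral>\<^sup>+w. F (C.par' w) * indicator C.b w \<partial>lborel)"
      by (intro nn_integral_cmult) measurable
    finally show "(\<integral>\<^sup>+x. F x * indicator C.Q x \<partial>M) \<le> ennreal \<Lambda> * (\<integral>\<^sup>+w. F (C.par' w) * indicator C.b w \<partial>lborel)" .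
  qed
  finally show ?thesis .
qed

lemma nn_integral_box_le:
  assumes [measurable]: "F \<in> borel_measurable borel" and i: "i < N"
  shows "(\<integral>\<^sup>+w. F (cube_chart.par' (par i) (L i) w) * indicator (centered_box (l i)) w \<partial>lborel) \<le> ennreal \<Lambda> * (\<integral>\<^sup>+x. F x \<partial>M)"
proof -
  interpret C: cube_chart "par i" "l i" "L i" "d i" M \<Lambda> a by (rule chart[OF i])
  have [measurable_cong]: "sets M = sets borel" by (rule sets_M)
  have "(\<integral>\<^sup>+w. F (C.par' w) * indicator C.b w \<partial>lborel) \<le> (\<integral>\<^sup>+w. ennreal \<Lambda> * (F (C.par' w) * ennreal (C.d0 w) * indicator C.b w) \<partial>lborel)"
  proof (intro nn_integral_mono)
    fix w
    show "F (C.par' w) * indicator C.b w \<le> ennreal \<Lambda> * (F (C.par' w) * ennreal (C.d0 w) * indicator C.b w)"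
    proof (cases "w \<in> C.b")
      case True
      have "1 \<le> \<Lambda> * C.d0 w" using C.d0_b[OF True] \<Lambda>_ge_1 by (simp add: field_simps)
      then have "1 \<le> ennreal \<Lambda> * ennreal (C.d0 w)" using \<Lambda>_ge_1 C.d0_nonneg by (simp add: ennreal_mult[symmetric])
      then have "1 * F (C.par' w) \<le> ennreal \<Lambda> * ennreal (C.d0 w) * F (C.par' w)" by (rule mult_right_mono) simp
      then show ?thesis using True by (simp add: ac_simps)
    qed simp
  qed
  also have "\<dots> = ennreal \<Lambda> * (\<integral>\<^sup>+x. F x * indicator C.Q x \<partial>M)"
    by (simp add: C.nn_integral_Q nn_integral_cmult)
  also have "\<dots> \<le> ennreal \<Lambda> * (\<integral>\<^sup>+x. F x \<partial>M)"
    by (intro mult_left_mono nn_integral_mono) (auto simp: indicator_def)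
  finally show ?thesis .
qed

lemma bm_borel: "bm M f \<Longrightarrow> f \<in> borel_measurable borel"
  unfolding bm_def measurable_cong_sets[OF sets_M refl] by simp

lemma sum_const_ennreal:
  assumes "0 \<le> p" "0 \<le> q" shows "(\<Sum>i<N. ennreal p * ennreal q) = ennreal (real N * p * q)"
proof -
  have "(\<Sum>i<N. ennreal p * ennreal q) = ennreal (real N) * (ennreal p * ennreal q)"
    by (simp add: ennreal_of_nat_eq_real_of_nat)
  then show ?thesis using assms by (simp add: ennreal_mult mult.assoc)
qed

text \<open>\<open>box_nash\<close> in each cube, at a radius of order sqrt y. The radii at hand are
  2^k h / \<Lambda>^2, and k is the largest exponent with 2^k \<le> sqrt y / h.\<close>

lemma walk_nash:
  assumes f: "bm M f" and y: "h\<^sup>2 \<le> y" "y \<le> 1"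
  defines "n \<equiv> CARD('n)"
  shows "(LINT x|M. (f x)\<^sup>2) \<le> (real N * \<Lambda> * (4 ^ Suc n * real n * \<Lambda> ^ 5 * (real N * real n) + 2 * (2 * \<Lambda>\<^sup>2) ^ n * \<Lambda>\<^sup>2)) *
     (y / h\<^sup>2 * energy f + (1 / y) ^ n * (LINT x|M. \<bar>f x\<bar>)\<^sup>2)"
proof -
  have [measurable_cong]: "sets M = sets borel" by (rule sets_M)
  have fb[measurable]: "f \<in> borel_measurable borel" by (rule bm_borel[OF f])
  define \<eta> where "\<eta> = h / \<Lambda>\<^sup>2"
  define q where "q = sqrt y / h"
  define E where "E = energy f"
  define A where "A = (LINT x|M. \<bar>f x\<bar>)"
  have \<eta>: "0 < \<eta>" using h \<Lambda>_ge_1 by (simp add: \<eta>_def)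
  have y0: "0 < y" using y h by (smt (verit) zero_less_power)
  have E0: "0 \<le> E" using energy_nonneg[OF f] by (simp add: E_def)
  have A0: "0 \<le> A" by (simp add: A_def)
  have q1: "1 \<le> q" using y h real_sqrt_le_mono[OF y(1)] by (simp add: q_def)
  obtain k where k: "2 ^ k \<le> q" "q < 2 ^ Suc k"
  proof -
    define K where "K = {k. (2::real) ^ k \<le> q}"
    have "finite K"
    proof (rule finite_subset)
      show "K \<subseteq> {..nat \<lceil>q\<rceil>}"
      proof
        fix k assume "k \<in> K"
        then have "2 ^ k \<le> q" by (simp add: K_def)
        moreover have "real k < 2 ^ k" by (rule of_nat_less_two_power)
        ultimately have "real k \<le> q" by linarith
        then show "k \<in> {..nat \<lceil>q\<rceil>}" by (simp add: nat_le_iff le_nat_iff) linarith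
      qed
    qed simp
    moreover have "0 \<in> K" using q1 by (simp add: K_def)
    ultimately have "Max K \<in> K" by (metis Max_in empty_iff)
    moreover have "Suc (Max K) \<notin> K" using Max_ge[OF \<open>finite K\<close>, of "Suc (Max K)"] by auto
    ultimately show ?thesis using that[of "Max K"] by (auto simp: K_def not_le)
  qed
  define r where "r = 2 ^ k * \<eta>"
  have r: "0 < r" using \<eta> by (simp add: r_def)
  have r_le: "r \<le> l i j" if "i < N" for i j
  proof -
    have "r \<le> q * \<eta>" using k(1) \<eta> by (simp add: r_def)
    also have "\<dots> = sqrt y / \<Lambda>\<^sup>2" using h by (simp add: q_def \<eta>_def)
    also have "\<dots> \<le> 1 / \<Lambda>\<^sup>2" using y by (intro divide_right_mono) auto
    also have "\<dots> \<le> 1 / \<Lambda>" using \<Lambda>_ge_1 by (intro divide_left_mono) (auto simp: power2_eq_square)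
    also have "\<dots> \<le> l i j" using l(1)[OF that] .
    finally show ?thesis .
  qed
  have k4: "4 ^ k \<le> y / h\<^sup>2"
  proof -
    have "(4::real) ^ k = (2 ^ k)\<^sup>2" by (simp add: power_mult[symmetric] mult.commute[of k] power_mult)
    also have "\<dots> \<le> q\<^sup>2" using k by (intro power_mono) auto
    also have "\<dots> = y / h\<^sup>2" using y0 by (simp add: q_def power_divide)
    finally show ?thesis .
  qed
  have rn: "2 / r ^ n \<le> 2 * (2 * \<Lambda>\<^sup>2) ^ n * (1 / y) ^ n"
  proof -
    have "1 / r \<le> 2 * \<Lambda>\<^sup>2 / sqrt y"
    proof -
      have "sqrt y / h * \<eta> \<le> 2 * r" using mult_right_mono[of "sqrt y / h" "2 ^ Suc k" \<eta>] k(2) \<eta> by (simp add: q_def r_def)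
      then have "sqrt y \<le> 2 * \<Lambda>\<^sup>2 * r" using h \<Lambda>_ge_1 by (simp add: \<eta>_def field_simps)
      then show ?thesis using r y0 by (simp add: field_simps)
    qed
    also have "\<dots> \<le> 2 * \<Lambda>\<^sup>2 * (1 / y)"
    proof -
      \<comment> \<open>As y \<le> 1, the factor 1 / sqrt y may be weakened to 1 / y; the exponent
        n/2 becomes n and stays natural.\<close>
      have "y \<le> sqrt y" using y0 y real_sqrt_le_mono[of "y * y" y] by simp
      then have "1 / sqrt y \<le> 1 / y" using y0 by (intro divide_left_mono) auto
      then show ?thesis using mult_left_mono[of "1 / sqrt y" "1 / y" "2 * \<Lambda>\<^sup>2"] by simp
    qed
    finally have "(1 / r) ^ n \<le> (2 * \<Lambda>\<^sup>2 * (1 / y)) ^ n" using r by (intro power_mono) auto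
    then show ?thesis by (simp add: power_divide power_mult_distrib)
  qed
  have cube: "(\<integral>\<^sup>+w. ennreal ((f (cube_chart.par' (par i) (L i) w))\<^sup>2) * indicator (centered_box (l i)) w \<partial>lborel)
      \<le> ennreal (4 ^ Suc n * real n * \<Lambda> ^ 5 * (real N * real n) * (y / h\<^sup>2 * E) + 2 * (2 * \<Lambda>\<^sup>2) ^ n * \<Lambda>\<^sup>2 * ((1 / y) ^ n * A\<^sup>2))"
    if i: "i < N" for i
  proof -
    interpret C: cube_chart "par i" "l i" "L i" "d i" M \<Lambda> a by (rule chart[OF i])
    let ?f = "f \<circ> C.par'"
    have fm: "?f \<in> borel_measurable borel" by measurable
    have D: "(\<Sum>j\<in>UNIV. axis_form (l i) ?f j \<eta>) \<le> ennreal (real n * (2 * h * \<Lambda> ^ 3) * (2 * (real N * real n) * E))"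
    proof -
      have "(\<Sum>j\<in>UNIV. axis_form (l i) ?f j \<eta>) \<le> (\<Sum>j\<in>(UNIV :: 'n set). ennreal (2 * h * \<Lambda> ^ 3 * (2 * (real N * real n) * E)))"
      proof (intro sum_mono)
        fix j :: 'n
        have "axis_form (l i) ?f j \<eta> \<le> ennreal (2 * h * \<Lambda> ^ 3) * dirichlet (i, j) f"
          unfolding \<eta>_def by (rule axis_form_le_dirichlet[OF i fb])
        also have "\<dots> \<le> ennreal (2 * h * \<Lambda> ^ 3) * ennreal (2 * (real N * real n) * E)"
          using dirichlet_le_energy[OF _ f, of "(i, j)"] i
          by (intro mult_left_mono) (auto simp: ix_def card_cartesian_product E_def n_def)
        also have "\<dots> = ennreal (2 * h * \<Lambda> ^ 3 * (2 * (real N * real n) * E))"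
          using h \<Lambda>_ge_1 E0 by (intro ennreal_mult[symmetric]) auto
        finally show "axis_form (l i) ?f j \<eta> \<le> \<dots>" .
      qed
      also have "\<dots> = ennreal (real n * (2 * h * \<Lambda> ^ 3) * (2 * (real N * real n) * E))"
        using h \<Lambda>_ge_1 E0 by (simp add: n_def ennreal_of_nat_eq_real_of_nat ennreal_mult[symmetric] mult.assoc)
      finally show ?thesis .
    qed
    have L1: "(\<integral>\<^sup>+w. ennreal \<bar>?f w\<bar> * indicator C.b w \<partial>lborel)\<^sup>2 \<le> ennreal (\<Lambda>\<^sup>2 * A\<^sup>2)"
    proof -
      have "(\<integral>\<^sup>+w. ennreal \<bar>?f w\<bar> * indicator C.b w \<partial>lborel) \<le> ennreal \<Lambda> * (\<integral>\<^sup>+x. ennreal \<bar>f x\<bar> \<partial>M)"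
        unfolding comp_def by (rule nn_integral_box_le[OF _ i]) measurable
      also have "(\<integral>\<^sup>+x. ennreal \<bar>f x\<bar> \<partial>M) = ennreal A"
        unfolding A_def using f by (intro nn_integral_eq_integral integrable_bm bm_abs) auto
      also have "ennreal \<Lambda> * ennreal A = ennreal (\<Lambda> * A)" using \<Lambda>_ge_1 A0 by (simp add: ennreal_mult)
      finally have "(\<integral>\<^sup>+w. ennreal \<bar>?f w\<bar> * indicator C.b w \<partial>lborel)\<^sup>2 \<le> (ennreal (\<Lambda> * A))\<^sup>2"
        by (intro power_mono) auto
      then show ?thesis using \<Lambda>_ge_1 A0 by (simp add: ennreal_power power_mult_distrib)
    qed
    have "(\<integral>\<^sup>+w. ennreal ((?f w)\<^sup>2) * indicator C.b w \<partial>lborel)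
      \<le> ennreal (4 ^ n * 4 ^ k / \<eta>) * (\<Sum>j\<in>UNIV. axis_form (l i) ?f j \<eta>)
        + ennreal (2 / (2 ^ k * \<eta>) ^ n) * (\<integral>\<^sup>+w. ennreal \<bar>?f w\<bar> * indicator C.b w \<partial>lborel)\<^sup>2"
      unfolding n_def using r_le[OF i] by (intro box_nash[OF fm \<eta>]) (simp add: r_def)
    also have "\<dots> \<le> ennreal (4 ^ n * 4 ^ k / \<eta>) * ennreal (real n * (2 * h * \<Lambda> ^ 3) * (2 * (real N * real n) * E))
        + ennreal (2 / (2 ^ k * \<eta>) ^ n) * ennreal (\<Lambda>\<^sup>2 * A\<^sup>2)"
      by (intro add_mono mult_left_mono D L1) auto
    also have "\<dots> = ennreal (4 ^ n * 4 ^ k / \<eta> * (real n * (2 * h * \<Lambda> ^ 3) * (2 * (real N * real n) * E)) + 2 / r ^ n * (\<Lambda>\<^sup>2 * A\<^sup>2))"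
    proof -
      have p: "0 \<le> 4 ^ n * 4 ^ k / \<eta>" "0 \<le> real n * (2 * h * \<Lambda> ^ 3) * (2 * (real N * real n) * E)"
        "0 \<le> 2 / r ^ n" "0 \<le> \<Lambda>\<^sup>2 * A\<^sup>2"
        using \<eta> r h \<Lambda>_ge_1 E0 by auto
      show ?thesis
        unfolding r_def[symmetric] ennreal_mult[OF p(1,2), symmetric] ennreal_mult[OF p(3,4), symmetric]
        by (intro ennreal_plus[symmetric] mult_nonneg_nonneg p)
    qed
    also have "\<dots> \<le> ennreal (4 ^ Suc n * real n * \<Lambda> ^ 5 * (real N * real n) * (y / h\<^sup>2 * E) + 2 * (2 * \<Lambda>\<^sup>2) ^ n * \<Lambda>\<^sup>2 * ((1 / y) ^ n * A\<^sup>2))"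
    proof (intro ennreal_leI add_mono)
      have "4 ^ n * 4 ^ k / \<eta> * (real n * (2 * h * \<Lambda> ^ 3) * (2 * (real N * real n) * E)) =
          (4 ^ Suc n * real n * \<Lambda> ^ 5 * (real N * real n) * E) * 4 ^ k"
        using h \<Lambda>_ge_1 by (simp add: \<eta>_def field_simps power2_eq_square eval_nat_numeral)
      also have "\<dots> \<le> (4 ^ Suc n * real n * \<Lambda> ^ 5 * (real N * real n) * E) * (y / h\<^sup>2)"
        using E0 \<Lambda>_ge_1 by (intro mult_left_mono k4) auto
      finally show "4 ^ n * 4 ^ k / \<eta> * (real n * (2 * h * \<Lambda> ^ 3) * (2 * (real N * real n) * E)) \<le> 4 ^ Suc n * real n * \<Lambda> ^ 5 * (real N * real n) * (y / h\<^sup>2 * E)"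
        by (simp add: algebra_simps)
      have "2 / r ^ n * (\<Lambda>\<^sup>2 * A\<^sup>2) \<le> 2 * (2 * \<Lambda>\<^sup>2) ^ n * (1 / y) ^ n * (\<Lambda>\<^sup>2 * A\<^sup>2)"
        by (intro mult_right_mono rn) auto
      then show "2 / r ^ n * (\<Lambda>\<^sup>2 * A\<^sup>2) \<le> 2 * (2 * \<Lambda>\<^sup>2) ^ n * \<Lambda>\<^sup>2 * ((1 / y) ^ n * A\<^sup>2)"
        by (simp add: algebra_simps)
    qed
    finally show ?thesis by simp
  qed
  let ?a = "4 ^ Suc n * real n * \<Lambda> ^ 5 * (real N * real n)" and ?b = "2 * (2 * \<Lambda>\<^sup>2) ^ n * \<Lambda>\<^sup>2"
  let ?X = "y / h\<^sup>2 * E" and ?Y = "(1 / y) ^ n * A\<^sup>2"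
  have nn: "0 \<le> ?a" "0 \<le> ?b" "0 \<le> ?X" "0 \<le> ?Y" using \<Lambda>_ge_1 y0 E0 by auto
  have "ennreal (LINT x|M. (f x)\<^sup>2) = (\<integral>\<^sup>+x. ennreal ((f x)\<^sup>2) \<partial>M)"
    using f by (intro nn_integral_eq_integral[symmetric] integrable_bm bm_power2) auto
  also have "\<dots> \<le> (\<Sum>i<N. ennreal \<Lambda> * (\<integral>\<^sup>+w. ennreal ((f (cube_chart.par' (par i) (L i) w))\<^sup>2) * indicator (centered_box (l i)) w \<partial>lborel))"
    by (rule nn_integral_le_sum_cubes) measurable
  also have "\<dots> \<le> (\<Sum>i<N. ennreal \<Lambda> * ennreal (?a * ?X + ?b * ?Y))"
    using cube by (intro sum_mono mult_left_mono) auto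
  also have "\<dots> = ennreal (real N * \<Lambda> * (?a * ?X + ?b * ?Y))"
    using \<Lambda>_ge_1 y0 E0 by (intro sum_const_ennreal add_nonneg_nonneg mult_nonneg_nonneg) auto
  finally have le: "ennreal (LINT x|M. (f x)\<^sup>2) \<le> ennreal (real N * \<Lambda> * (?a * ?X + ?b * ?Y))" .
  have "0 \<le> real N * \<Lambda> * (?a * ?X + ?b * ?Y)"
    by (rule mult_nonneg_nonneg[OF mult_nonneg_nonneg add_nonneg_nonneg[OF mult_nonneg_nonneg[OF nn(1,3)] mult_nonneg_nonneg[OF nn(2,4)]]])
      (use \<Lambda>_ge_1 in auto)
  from ennreal_le_iff[OF this, THEN iffD1, OF le]
  have "(LINT x|M. (f x)\<^sup>2) \<le> real N * \<Lambda> * (?a * ?X + ?b * ?Y)" .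
  also have "\<dots> \<le> real N * \<Lambda> * ((?a + ?b) * (?X + ?Y))"
  proof (intro mult_left_mono)
    have "0 \<le> ?a * ?Y + ?b * ?X"
      by (rule add_nonneg_nonneg[OF mult_nonneg_nonneg[OF nn(1,4)] mult_nonneg_nonneg[OF nn(2,3)]])
    then show "?a * ?X + ?b * ?Y \<le> (?a + ?b) * (?X + ?Y)" by (simp only: distrib_left distrib_right)
  qed (use \<Lambda>_ge_1 in auto)
  finally show ?thesis by (simp only: mult.assoc E_def A_def)
qed

lemma walk_sum_dirichlet_lower:
  assumes f: "bm M f"
  shows "ennreal (1 / (9 * \<Lambda> ^ 4) * (LINT x|M. (f x)\<^sup>2)) \<le> (\<Sum>p\<in>ix. sum_dirichlet p f)"
proof -
  have [measurable_cong]: "sets M = sets borel" by (rule sets_M)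
  have fb[measurable]: "f \<in> borel_measurable borel" by (rule bm_borel[OF f])
  \<comment> \<open>Any axis will do: increments along a single one already control the L2 norm in
    \<open>box_sum_form\<close>.\<close>
  define j0 :: 'n where "j0 = undefined"
  have cube: "ennreal \<Lambda> * (\<integral>\<^sup>+w. ennreal ((f (cube_chart.par' (par i) (L i) w))\<^sup>2) * indicator (centered_box (l i)) w \<partial>lborel)
      \<le> ennreal (9 * \<Lambda> ^ 4) * sum_dirichlet (i, j0) f" if i: "i < N" for i
  proof -
    interpret C: cube_chart "par i" "l i" "L i" "d i" M \<Lambda> a by (rule chart[OF i])
    let ?f = "f \<circ> C.par'" and ?e = "c i j0 * h / \<Lambda>"
    have fm: "?f \<in> borel_measurable borel" by measurable
    have e: "0 < ?e" using c_pos[OF i] h \<Lambda>_ge_1 by simp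
    have 1: "(\<integral>\<^sup>+w. ennreal ((?f w)\<^sup>2) * indicator C.b w \<partial>lborel)
        \<le> ennreal (9 / (2 * ?e)) * (\<integral>\<^sup>+s. sum_form C.b ?f (axis j0 s) * indicator {-?e<..<?e} s \<partial>lborel)"
      by (rule box_sum_form[where l="l i" and j=j0, OF fm e h_le(2)[OF i]])
    have "(\<integral>\<^sup>+s. sum_form C.b ?f (axis j0 s) * indicator {-?e<..<?e} s \<partial>lborel)
        \<le> ennreal (2 * h * c i j0 * \<Lambda>\<^sup>2) * (\<integral>\<^sup>+x. \<integral>\<^sup>+y. ennreal ((f x + f y)\<^sup>2) \<partial>C.ker j0 (c i j0) h x \<partial>M)"
      unfolding sum_form_def comp_def by (rule C.pair_form_lower[OF _ c_pos[OF i] h(1)]) measurable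
    also have "(\<integral>\<^sup>+x. \<integral>\<^sup>+y. ennreal ((f x + f y)\<^sup>2) \<partial>C.ker j0 (c i j0) h x \<partial>M) = sum_dirichlet (i, j0) f"
      unfolding sum_dirichlet_def unfolding \<kappa>_def prod.case ..
    finally have 2: "(\<integral>\<^sup>+s. sum_form C.b ?f (axis j0 s) * indicator {-?e<..<?e} s \<partial>lborel)
        \<le> ennreal (2 * h * c i j0 * \<Lambda>\<^sup>2) * sum_dirichlet (i, j0) f" .
    have "ennreal \<Lambda> * (\<integral>\<^sup>+w. ennreal ((?f w)\<^sup>2) * indicator C.b w \<partial>lborel)
        \<le> ennreal \<Lambda> * (ennreal (9 / (2 * ?e)) * (ennreal (2 * h * c i j0 * \<Lambda>\<^sup>2) * sum_dirichlet (i, j0) f))"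
      by (intro mult_left_mono order_trans[OF 1 mult_left_mono[OF 2]]) auto
    also have "\<dots> = ennreal (\<Lambda> * (9 / (2 * ?e) * (2 * h * c i j0 * \<Lambda>\<^sup>2))) * sum_dirichlet (i, j0) f"
      using \<Lambda>_ge_1 e h c_pos[OF i, of j0] by (simp only: ennreal_mult mult.assoc zero_le_divide_iff mult_nonneg_nonneg less_imp_le zero_le_numeral zero_le_power2 simp_thms order_trans[OF zero_le_one])
    also have "\<Lambda> * (9 / (2 * ?e) * (2 * h * c i j0 * \<Lambda>\<^sup>2)) = 9 * \<Lambda> ^ 4"
      using \<Lambda>_ge_1 h c_pos[OF i, of j0] by (simp add: field_simps eval_nat_numeral)
    finally show ?thesis by simp
  qed
  have "ennreal (LINT x|M. (f x)\<^sup>2) = (\<integral>\<^sup>+x. ennreal ((f x)\<^sup>2) \<partial>M)"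
    using f by (intro nn_integral_eq_integral[symmetric] integrable_bm bm_power2) auto
  also have "\<dots> \<le> (\<Sum>i<N. ennreal \<Lambda> * (\<integral>\<^sup>+w. ennreal ((f (cube_chart.par' (par i) (L i) w))\<^sup>2) * indicator (centered_box (l i)) w \<partial>lborel))"
    by (rule nn_integral_le_sum_cubes) measurable
  also have "\<dots> \<le> (\<Sum>i<N. ennreal (9 * \<Lambda> ^ 4) * sum_dirichlet (i, j0) f)"
    using cube by (intro sum_mono) auto
  also have "\<dots> = ennreal (9 * \<Lambda> ^ 4) * (\<Sum>p\<in>(\<lambda>i. (i, j0)) ` {..<N}. sum_dirichlet p f)"
    by (subst sum.reindex) (auto simp: inj_on_def sum_distrib_left)
  also have "\<dots> \<le> ennreal (9 * \<Lambda> ^ 4) * (\<Sum>p\<in>ix. sum_dirichlet p f)"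
    by (intro mult_left_mono sum_mono2) (auto simp: ix_def)
  finally have "ennreal (1 / (9 * \<Lambda> ^ 4)) * ennreal (LINT x|M. (f x)\<^sup>2) \<le> ennreal (1 / (9 * \<Lambda> ^ 4)) * (ennreal (9 * \<Lambda> ^ 4) * (\<Sum>p\<in>ix. sum_dirichlet p f))"
    by (intro mult_left_mono) auto
  also have "\<dots> = (\<Sum>p\<in>ix. sum_dirichlet p f)"
    using \<Lambda>_ge_1 by (simp add: mult.assoc[symmetric] ennreal_mult[symmetric])
  finally show ?thesis using \<Lambda>_ge_1 by (subst ennreal_mult) auto
qed

lemma walk_energy_le:
  assumes f: "bm M f"
  shows "energy f \<le> (2 - 1 / (18 * \<Lambda> ^ 4 * (real N * real CARD('n)))) * (LINT x|M. (f x)\<^sup>2)"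
proof -
  obtain p where "p \<in> ix" using I by auto
  from energy_le_of_sum_dirichlet[OF f this walk_sum_dirichlet_lower[OF f]]
  show ?thesis using \<Lambda>_ge_1 by (simp add: card_ix mult.assoc)
qed

section \<open>A smoothing part of the n-th power of the walk\<close>

definition axis_op :: "nat \<Rightarrow> 'n \<Rightarrow> ('m \<Rightarrow> real) \<Rightarrow> 'm \<Rightarrow> real" where
  "axis_op i j f x = (LINT y|\<kappa> (i, j) x. f y)"

lemma axis_op_submarkov: "i < N \<Longrightarrow> submarkov M (axis_op i j)"
  unfolding axis_op_def[abs_def] by (rule ker_submarkov) (simp add: ix_def)

lemma foldr_axis_op_submarkov: "i < N \<Longrightarrow> submarkov M (foldr (axis_op i) js)"
proof (induction js)
  case Nil then show ?case using submarkov_id[of M] by (simp add: id_def)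
next
  case (Cons j js)
  then show ?case using submarkov_comp[OF axis_op_submarkov[OF Cons.prems] Cons.IH[OF Cons.prems]]
    by (simp add: comp_def)
qed

lemma axis_op_le_walk:
  assumes i: "i < N" and f: "bm M f" "\<And>x. 0 \<le> f x"
  shows "axis_op i j f x \<le> real (card ix) * walk f x"
proof -
  have ij: "(i, j) \<in> ix" using i by (simp add: ix_def)
  have nn: "0 \<le> step p f x" if "p \<in> ix" for p by (rule submarkov_nonneg[OF step_submarkov[OF that] f])
  have "axis_op i j f x \<le> step (i, j) f x"
    using mass_bounds[OF ij, of x] f(2)[of x] by (simp add: axis_op_def step_def)
  also have "\<dots> \<le> (\<Sum>p\<in>ix. step p f x)"
    using ij nn I by (intro member_le_sum) auto
  also have "\<dots> = real (card ix) * walk f x" using card_ix_ge_1 by (simp add: walk_def)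
  finally show ?thesis .
qed

lemma foldr_axis_op_le_walk:
  assumes i: "i < N" and f: "bm M f" "\<And>x. 0 \<le> f x"
  shows "foldr (axis_op i) js f x \<le> real (card ix) ^ length js * (walk ^^ length js) f x"
proof (induction js arbitrary: x)
  case (Cons j js)
  let ?g = "(walk ^^ length js) f"
  have sm: "submarkov M (walk ^^ length js :: ('m \<Rightarrow> real) \<Rightarrow> 'm \<Rightarrow> real)" by (rule submarkov_funpow[OF walk_submarkov])
  have g: "bm M ?g" "\<And>x. 0 \<le> ?g x" using submarkov_bm[OF sm f(1)] submarkov_nonneg[OF sm f] by auto
  have "foldr (axis_op i) (j # js) f x \<le> axis_op i j (\<lambda>x. real (card ix) ^ length js * ?g x) x"
    using Cons.IH f g submarkov_bm[OF foldr_axis_op_submarkov[OF i] f(1)]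
    by (simp, intro submarkov_mono[OF axis_op_submarkov[OF i]] bm_cmult) auto
  also have "\<dots> = real (card ix) ^ length js * axis_op i j ?g x"
    using fun_cong[OF submarkov_cmult[OF axis_op_submarkov[OF i] g(1)]] by simp
  also have "\<dots> \<le> real (card ix) ^ length js * (real (card ix) * walk ?g x)"
    by (intro mult_left_mono axis_op_le_walk[OF i g]) auto
  finally show ?case by (simp add: mult.assoc mult.left_commute)
qed simp

lemma foldr_axis_op_iterate:
  assumes i: "i < N" and f: "bm M f" "\<And>x. 0 \<le> f x"
  shows "ennreal (foldr (axis_op i) js f x) =
    cube_chart.iterate (par i) (l i) (L i) (d i) (c i) h js (\<lambda>x. ennreal (f x)) x"
proof (induction js arbitrary: x)
  case Nil
  then show ?case using cube_chart.iterate_def[OF chart[OF i]] by simp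
next
  case (Cons j js)
  interpret C: cube_chart "par i" "l i" "L i" "d i" M \<Lambda> a by (rule chart[OF i])
  let ?g = "foldr (axis_op i) js f"
  have g: "bm M ?g" "\<And>x. 0 \<le> ?g x"
    using submarkov_bm[OF foldr_axis_op_submarkov[OF i] f(1)] submarkov_nonneg[OF foldr_axis_op_submarkov[OF i] f] by auto
  have ij: "(i, j) \<in> ix" using i by (simp add: ix_def)
  interpret K: subprob_space "\<kappa> (i, j) x" by (rule ker_subprob[OF ij])
  have "ennreal (foldr (axis_op i) (j # js) f x) = ennreal (LINT y|\<kappa> (i, j) x. ?g y)" by (simp add: axis_op_def)
  also have "\<dots> = (\<integral>\<^sup>+y. ennreal (?g y) \<partial>\<kappa> (i, j) x)"
    using g by (intro nn_integral_eq_integral[symmetric] K.integrable_bm bm_ker[OF ij]) auto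
  also have "\<dots> = (\<integral>\<^sup>+y. C.iterate (c i) h js (\<lambda>x. ennreal (f x)) y \<partial>C.ker j (c i j) h x)"
    unfolding Cons.IH by (simp add: \<kappa>_def)
  also have "\<dots> = C.iterate (c i) h (j # js) (\<lambda>x. ennreal (f x)) x" by (simp add: C.iterate_def)
  finally show ?case .
qed

lemma foldr_axis_op_le_integral:
  assumes i: "i < N" and f: "bm M f" "\<And>x. 0 \<le> f x" and js: "distinct js" "set js = UNIV"
  shows "foldr (axis_op i) js f x \<le> \<Lambda> * (\<Lambda>\<^sup>2 / 2) ^ CARD('n) * (1 / h\<^sup>2) ^ CARD('n) * (LINT y|M. f y)"
proof -
  interpret C: cube_chart "par i" "l i" "L i" "d i" M \<Lambda> a by (rule chart[OF i])
  have fb[measurable]: "f \<in> borel_measurable borel" by (rule bm_borel[OF f(1)])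
  let ?n = "CARD('n)"
  have int: "(\<integral>\<^sup>+y. ennreal (f y) \<partial>M) = ennreal (LINT y|M. f y)"
    using f by (intro nn_integral_eq_integral integrable_bm) auto
  have nn: "0 \<le> (LINT y|M. f y)" using f by (intro Bochner_Integration.integral_nonneg) auto
  have "ennreal (foldr (axis_op i) js f x) \<le> ennreal (\<Lambda> * (\<Lambda>\<^sup>2 / (2 * h)) ^ ?n) * (\<integral>\<^sup>+y. ennreal (f y) \<partial>M)"
    unfolding foldr_axis_op_iterate[OF i f]
    using c(1)[OF i] by (intro C.iterate_le_integral h(1) js) measurable
  also have "\<dots> = ennreal (\<Lambda> * (\<Lambda>\<^sup>2 / (2 * h)) ^ ?n * (LINT y|M. f y))"
    unfolding int using \<Lambda>_ge_1 h nn by (intro ennreal_mult[symmetric]) auto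
  finally have "foldr (axis_op i) js f x \<le> \<Lambda> * (\<Lambda>\<^sup>2 / (2 * h)) ^ ?n * (LINT y|M. f y)"
    using \<Lambda>_ge_1 h nn by (subst (asm) ennreal_le_iff) auto
  \<comment> \<open>Since h \<le> 1, the bound h^(-n) is weakened to h^(-2n), to share the exponent
    of the Nash inequality.\<close>
  also have "\<dots> \<le> \<Lambda> * (\<Lambda>\<^sup>2 / 2 * (1 / h\<^sup>2)) ^ ?n * (LINT y|M. f y)"
  proof (intro mult_right_mono mult_left_mono)
    show "(\<Lambda>\<^sup>2 / (2 * h)) ^ ?n \<le> (\<Lambda>\<^sup>2 / 2 * (1 / h\<^sup>2)) ^ ?n"
  proof (rule power_mono)
    have "h\<^sup>2 \<le> h" using h by (simp add: power2_eq_square mult_left_le)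
    then have "1 / h \<le> 1 / h\<^sup>2" using h by (intro divide_left_mono) auto
    then show "\<Lambda>\<^sup>2 / (2 * h) \<le> \<Lambda>\<^sup>2 / 2 * (1 / h\<^sup>2)"
      using mult_left_mono[of "1 / h" "1 / h\<^sup>2" "\<Lambda>\<^sup>2 / 2"] by simp
  qed (use h in auto)
  qed (use \<Lambda>_ge_1 nn in auto)
  finally show ?thesis by (simp only: power_mult_distrib mult.assoc)
qed

text \<open>\<open>jump\<close> vanishes outside the box, so every jump from the cube ends in the
  cube and the lower bounds for the masses multiply.\<close>

lemma foldr_axis_op_one_lower:
  assumes i: "i < N" and x: "x \<in> par i ` centered_box (l i)"
  shows "(1 / (2 * \<Lambda>\<^sup>2)) ^ length js \<le> foldr (axis_op i) js (\<lambda>_. 1) x"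
proof -
  interpret C: cube_chart "par i" "l i" "L i" "d i" M \<Lambda> a by (rule chart[OF i])
  have "ennreal ((1 / (2 * \<Lambda>\<^sup>2)) ^ length js) \<le> C.iterate (c i) h js (\<lambda>_. 1) x"
    using x
  proof (induction js arbitrary: x)
    case Nil
    then show ?case by (simp add: C.iterate_def)
  next
    case (Cons j js)
    let ?v = "ennreal ((1 / (2 * \<Lambda>\<^sup>2)) ^ length js)"
    have im: "C.iterate (c i) h js (\<lambda>_. 1) \<in> borel_measurable borel" by (rule C.iterate_measurable) simp
    have "ennreal ((1 / (2 * \<Lambda>\<^sup>2)) ^ length (j # js)) = ennreal (1 / (2 * \<Lambda>\<^sup>2)) * ?v"
      by (simp only: length_Cons power_Suc, subst ennreal_mult) auto
    also have "\<dots> \<le> emeasure (C.ker j (c i j) h x) UNIV * ?v"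
      by (intro mult_right_mono C.emeasure_ker_lower[OF Cons.prems c_pos[OF i] h(1) h_le(2)[OF i]]) auto
    also have "\<dots> = (\<integral>\<^sup>+s. ennreal (C.jump j (c i j) h (C.coord x) s) * ?v \<partial>lborel)"
      using Cons.prems by (simp add: C.emeasure_ker nn_integral_multc)
    also have "\<dots> \<le> (\<integral>\<^sup>+s. ennreal (C.jump j (c i j) h (C.coord x) s) * C.iterate (c i) h js (\<lambda>_. 1) (C.par' (C.coord x + axis j s)) \<partial>lborel)"
    proof (intro nn_integral_mono)
      fix s
      show "ennreal (C.jump j (c i j) h (C.coord x) s) * ?v \<le>
          ennreal (C.jump j (c i j) h (C.coord x) s) * C.iterate (c i) h js (\<lambda>_. 1) (C.par' (C.coord x + axis j s))"
      proof (cases "C.coord x + axis j s \<in> C.b")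
        case True
        then show ?thesis by (intro mult_left_mono Cons.IH C.par'_in_Q) auto
      next
        case False
        then show ?thesis by (simp add: C.jump_def)
      qed
    qed
    also have "\<dots> = C.iterate (c i) h (j # js) (\<lambda>_. 1) x"
      using Cons.prems C.nn_integral_ker[OF im, of j "c i j" h x] by (simp add: C.iterate_def)
    finally show ?case .
  qed
  also have "\<dots> = ennreal (foldr (axis_op i) js (\<lambda>_. 1) x)"
    using foldr_axis_op_iterate[OF i, of "\<lambda>_. 1" js x] by simp
  finally show ?thesis
    using submarkov_nonneg[OF foldr_axis_op_submarkov[OF i] bm_const, of 1 js x] by (subst (asm) ennreal_le_iff) auto
qed

definition axes :: "'n list" where "axes = (SOME js. distinct js \<and> set js = UNIV)"

lemma axes: "distinct axes" "set axes = UNIV" "length axes = CARD('n)"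
proof -
  have "\<exists>js :: 'n list. distinct js \<and> set js = UNIV" using finite_distinct_list[of "UNIV :: 'n set"] by auto
  then have "distinct axes \<and> set axes = (UNIV :: 'n set)" unfolding axes_def by (rule someI_ex)
  then show "distinct axes" "set axes = (UNIV :: 'n set)" by auto
  then show "length axes = CARD('n)" using distinct_card by metis
qed

text \<open>The power of 1 / card ix is the probability that the walk picks the axes of cube i in
  the given order. The average over i provides every point with a cube that contains it.\<close>

definition smoothing :: "('m \<Rightarrow> real) \<Rightarrow> 'm \<Rightarrow> real" where
  "smoothing f x = 1 / real (card {..<N}) * (\<Sum>i\<in>{..<N}. (1 / real (card ix)) ^ CARD('n) * foldr (axis_op i) axes f x)"

lemma smoothing_submarkov: "submarkov M smoothing"
  unfolding smoothing_def[abs_def]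
proof (rule submarkov_average)
  show "{..<N} \<noteq> {}" using N by auto
  fix i assume "i \<in> {..<N}"
  then show "submarkov M (\<lambda>f x. (1 / real (card ix)) ^ CARD('n) * foldr (axis_op i) axes f x)"
    using card_ix_ge_1 by (intro submarkov_scale foldr_axis_op_submarkov power_le_one) auto
qed simp

lemma smoothing_lower: "1 / real N * (1 / (real N * real CARD('n))) ^ CARD('n) * (1 / (2 * \<Lambda>\<^sup>2)) ^ CARD('n) \<le> smoothing (\<lambda>_. 1) x"
proof -
  obtain i where i: "i < N" "x \<in> par i ` centered_box (l i)" using cover by blast
  have nn: "0 \<le> foldr (axis_op i) axes (\<lambda>_. 1) x" if "i < N" for i
    by (rule submarkov_nonneg[OF foldr_axis_op_submarkov[OF that]]) auto
  have "(1 / real (card ix)) ^ CARD('n) * (1 / (2 * \<Lambda>\<^sup>2)) ^ CARD('n) \<le> (1 / real (card ix)) ^ CARD('n) * foldr (axis_op i) axes (\<lambda>_. 1) x"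
    using foldr_axis_op_one_lower[OF i, of axes] by (intro mult_left_mono) (auto simp: axes)
  also have "\<dots> \<le> (\<Sum>i\<in>{..<N}. (1 / real (card ix)) ^ CARD('n) * foldr (axis_op i) axes (\<lambda>_. 1) x)"
    using i nn by (intro member_le_sum) auto
  finally have "1 / real N * ((1 / real (card ix)) ^ CARD('n) * (1 / (2 * \<Lambda>\<^sup>2)) ^ CARD('n)) \<le> smoothing (\<lambda>_. 1) x"
    unfolding smoothing_def by (simp only: card_lessThan) (intro mult_left_mono; simp)
  then show ?thesis by (simp add: card_ix mult.assoc)
qed

lemma smoothing_le_walk:
  assumes f: "bm M f" "\<And>x. 0 \<le> f x"
  shows "smoothing f x \<le> (walk ^^ CARD('n)) f x"
proof -
  let ?w = "(walk ^^ CARD('n)) f x"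
  have "(\<Sum>i\<in>{..<N}. (1 / real (card ix)) ^ CARD('n) * foldr (axis_op i) axes f x) \<le> (\<Sum>i\<in>{..<N}. ?w)"
  proof (intro sum_mono)
    fix i assume "i \<in> {..<N}"
    then have i: "i < N" by simp
    have "(1 / real (card ix)) ^ CARD('n) * foldr (axis_op i) axes f x
        \<le> (1 / real (card ix)) ^ CARD('n) * (real (card ix) ^ CARD('n) * ?w)"
      using foldr_axis_op_le_walk[OF i f, of axes x] by (intro mult_left_mono) (auto simp: axes)
    also have "\<dots> = ?w" using card_ix_ge_1 by (simp add: power_divide)
    finally show "(1 / real (card ix)) ^ CARD('n) * foldr (axis_op i) axes f x \<le> ?w" .
  qed
  then have "1 / real N * (\<Sum>i\<in>{..<N}. (1 / real (card ix)) ^ CARD('n) * foldr (axis_op i) axes f x) \<le> 1 / real N * (real N * ?w)"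
    by (intro mult_left_mono) auto
  then show ?thesis using N by (simp add: smoothing_def)
qed

lemma smoothing_le_integral:
  assumes f: "bm M f" "\<And>x. 0 \<le> f x"
  shows "smoothing f x \<le> \<Lambda> * (\<Lambda>\<^sup>2 / 2) ^ CARD('n) * (1 / h\<^sup>2) ^ CARD('n) * (LINT y|M. f y)"
proof -
  let ?w = "\<Lambda> * (\<Lambda>\<^sup>2 / 2) ^ CARD('n) * (1 / h\<^sup>2) ^ CARD('n) * (LINT y|M. f y)"
  have "(\<Sum>i\<in>{..<N}. (1 / real (card ix)) ^ CARD('n) * foldr (axis_op i) axes f x) \<le> (\<Sum>i\<in>{..<N}. ?w)"
  proof (intro sum_mono)
    fix i assume "i \<in> {..<N}"
    then have i: "i < N" by simp
    have "(1 / real (card ix)) ^ CARD('n) * foldr (axis_op i) axes f x \<le> 1 * foldr (axis_op i) axes f x"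
      using card_ix_ge_1 submarkov_nonneg[OF foldr_axis_op_submarkov[OF i] f] by (intro mult_right_mono power_le_one) auto
    also have "\<dots> \<le> ?w" using foldr_axis_op_le_integral[OF i f axes(1,2)] by simp
    finally show "(1 / real (card ix)) ^ CARD('n) * foldr (axis_op i) axes f x \<le> ?w" .
  qed
  then have "1 / real N * (\<Sum>i\<in>{..<N}. (1 / real (card ix)) ^ CARD('n) * foldr (axis_op i) axes f x) \<le> 1 / real N * (real N * ?w)"
    by (intro mult_left_mono) auto
  then show ?thesis using N by (simp add: smoothing_def)
qed

end

section \<open>A Poincare inequality\<close>

lemma emeasure_lborel_open_pos:
  fixes W :: "'a::euclidean_space set"
  assumes "open W" "W \<noteq> {}" shows "0 < emeasure lborel W"
proof (rule ccontr)
  assume "\<not> 0 < emeasure lborel W"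
  then have "W \<in> null_sets lborel" using assms(1) by (auto simp: null_sets_def)
  then have "negligible W" by (simp add: negligible_iff_null_sets null_sets_completionI)
  then show False using open_not_negligible[OF assms] by simp
qed

lemma (in sigma_finite_measure) nn_integral_double_sum:
  assumes m: "\<And>i k. i \<in> I \<Longrightarrow> k \<in> J \<Longrightarrow> (\<lambda>(x, y). G i k x y) \<in> borel_measurable (N \<Otimes>\<^sub>M M)"
  shows "(\<integral>\<^sup>+x. \<integral>\<^sup>+y. (\<Sum>i\<in>I. \<Sum>k\<in>J. G i k x y) \<partial>M \<partial>N) = (\<Sum>i\<in>I. \<Sum>k\<in>J. \<integral>\<^sup>+x. \<integral>\<^sup>+y. G i k x y \<partial>M \<partial>N)"
proof -
  have "(\<integral>\<^sup>+x. \<integral>\<^sup>+y. (\<Sum>i\<in>I. \<Sum>k\<in>J. G i k x y) \<partial>M \<partial>N) = (\<integral>\<^sup>+x. (\<Sum>i\<in>I. \<Sum>k\<in>J. \<integral>\<^sup>+y. G i k x y \<partial>M) \<partial>N)"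
  proof (rule nn_integral_cong)
    fix x assume x: "x \<in> space N"
    have G: "G i k x \<in> borel_measurable M" if "i \<in> I" "k \<in> J" for i k
      using measurable_compose[OF measurable_Pair1'[OF x] m[OF that]] by simp
    have "(\<integral>\<^sup>+y. (\<Sum>i\<in>I. \<Sum>k\<in>J. G i k x y) \<partial>M) = (\<Sum>i\<in>I. \<integral>\<^sup>+y. (\<Sum>k\<in>J. G i k x y) \<partial>M)"
      using G by (intro nn_integral_sum borel_measurable_sum) auto
    also have "\<dots> = (\<Sum>i\<in>I. \<Sum>k\<in>J. \<integral>\<^sup>+y. G i k x y \<partial>M)"
      using G by (intro sum.cong refl nn_integral_sum) auto
    finally show "(\<integral>\<^sup>+y. (\<Sum>i\<in>I. \<Sum>k\<in>J. G i k x y) \<partial>M) = (\<Sum>i\<in>I. \<Sum>k\<in>J. \<integral>\<^sup>+y. G i k x y \<partial>M)" .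
  qed
  also have "\<dots> = (\<Sum>i\<in>I. \<integral>\<^sup>+x. (\<Sum>k\<in>J. \<integral>\<^sup>+y. G i k x y \<partial>M) \<partial>N)"
    by (intro nn_integral_sum borel_measurable_sum borel_measurable_nn_integral m)
  also have "\<dots> = (\<Sum>i\<in>I. \<Sum>k\<in>J. \<integral>\<^sup>+x. \<integral>\<^sup>+y. G i k x y \<partial>M \<partial>N)"
    by (intro sum.cong refl nn_integral_sum borel_measurable_nn_integral m)
  finally show ?thesis .
qed

text \<open>For fixed x the integral over y is the variance plus the squared distance of u x from
  the mean, so the bound holds before the integration over x.\<close>

lemma (in prob_space) variance_le_nn:
  fixes u :: "'a \<Rightarrow> 'b::euclidean_space"
  assumes u[measurable]: "u \<in> borel_measurable M" and sq: "integrable M (\<lambda>x. (norm (u x))\<^sup>2)"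
  shows "ennreal ((LINT x|M. (norm (u x))\<^sup>2) - (norm (LINT x|M. u x))\<^sup>2)
    \<le> (\<integral>\<^sup>+x. \<integral>\<^sup>+y. ennreal ((norm (u y - u x))\<^sup>2) \<partial>M \<partial>M)"
proof -
  have int: "integrable M u"
  proof (rule Bochner_Integration.integrable_bound)
    show "integrable M (\<lambda>y. 1 + (norm (u y))\<^sup>2)" using sq by simp
    have "norm (u y) \<le> 1 + (norm (u y))\<^sup>2" for y
    proof -
      have "2 * norm (u y) \<le> (norm (u y))\<^sup>2 + 1" using sum_squares_bound[of "norm (u y)" 1] by simp
      then show ?thesis using norm_ge_zero[of "u y"] by linarith
    qed
    then show "AE y in M. norm (u y) \<le> norm (1 + (norm (u y))\<^sup>2)" by simp
  qed measurable
  define m where "m = (LINT x|M. u x)"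
  define A where "A = (LINT x|M. (norm (u x))\<^sup>2)"
  have "ennreal (A - (norm m)\<^sup>2) \<le> (\<integral>\<^sup>+y. ennreal ((norm (u y - u x))\<^sup>2) \<partial>M)" for x
  proof -
    have exp: "(norm (u y - u x))\<^sup>2 = (norm (u y))\<^sup>2 - 2 * (u y \<bullet> u x) + (norm (u x))\<^sup>2" for y
      by (simp add: power2_norm_eq_inner inner_diff_left inner_diff_right inner_commute)
    have iint: "integrable M (\<lambda>y. (norm (u y - u x))\<^sup>2)" unfolding exp using sq int by simp
    have "(LINT y|M. (norm (u y - u x))\<^sup>2) = A - 2 * (m \<bullet> u x) + (norm (u x))\<^sup>2"
      unfolding exp A_def m_def using sq int by (simp add: prob_space)
    moreover have "0 \<le> (norm (m - u x))\<^sup>2" by simp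
    then have "- (norm m)\<^sup>2 \<le> - 2 * (m \<bullet> u x) + (norm (u x))\<^sup>2"
      by (simp add: power2_norm_eq_inner inner_diff_left inner_diff_right inner_commute)
    ultimately have "A - (norm m)\<^sup>2 \<le> (LINT y|M. (norm (u y - u x))\<^sup>2)" by linarith
    then have "ennreal (A - (norm m)\<^sup>2) \<le> ennreal (LINT y|M. (norm (u y - u x))\<^sup>2)" by (rule ennreal_leI)
    also have "\<dots> = (\<integral>\<^sup>+y. ennreal ((norm (u y - u x))\<^sup>2) \<partial>M)"
      using iint by (intro nn_integral_eq_integral[symmetric]) auto
    finally show ?thesis .
  qed
  then have "(\<integral>\<^sup>+x. ennreal (A - (norm m)\<^sup>2) \<partial>M) \<le> (\<integral>\<^sup>+x. \<integral>\<^sup>+y. ennreal ((norm (u y - u x))\<^sup>2) \<partial>M \<partial>M)"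
    by (intro nn_integral_mono)
  then show ?thesis by (simp add: emeasure_space_1 A_def m_def)
qed

section \<open>Chains of overlapping cubes\<close>

context cube_walk
begin

lemma emeasure_open_pos:
  assumes W: "open W" "W \<noteq> {}" shows "0 < emeasure M W"
proof -
  obtain x i where i: "i < N" and x: "x \<in> W" "x \<in> par i ` centered_box (l i)" using W cover by blast
  interpret C: cube_chart "par i" "l i" "L i" "d i" M \<Lambda> a by (rule chart[OF i])
  have [measurable_cong]: "sets M = sets borel" by (rule sets_M)
  have Wm[measurable]: "W \<in> sets borel" using W by simp
  let ?V = "C.b \<inter> par i -` W"
  have "open ?V"
    using continuous_on_subset[OF C.cont_par C.b_sub] W(1) open_centered_box
    by (metis Int_commute continuous_on_open_vimage)
  moreover have "?V \<noteq> {}" using x by auto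
  ultimately have V: "0 < emeasure lborel ?V" "?V \<in> sets borel" using emeasure_lborel_open_pos by auto
  have "0 < ennreal (1 / \<Lambda>) * emeasure lborel ?V"
    using V \<Lambda>_ge_1 by (simp add: ennreal_zero_less_mult_iff)
  also have "\<dots> = (\<integral>\<^sup>+w. ennreal (1 / \<Lambda>) * indicator ?V w \<partial>lborel)"
    using V by (subst nn_integral_cmult_indicator) auto
  also have "\<dots> \<le> (\<integral>\<^sup>+w. indicator W (C.par' w) * ennreal (C.d0 w) * indicator C.b w \<partial>lborel)"
    using C.d0_b by (intro nn_integral_mono) (auto simp: indicator_def C.par'_b intro!: ennreal_leI)
  also have "\<dots> = (\<integral>\<^sup>+x. indicator W x * indicator C.Q x \<partial>M)"
    by (rule C.nn_integral_Q[symmetric]) measurable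
  also have "\<dots> \<le> (\<integral>\<^sup>+x. indicator W x \<partial>M)" by (intro nn_integral_mono) (auto simp: indicator_def)
  also have "\<dots> = emeasure M W" by simp
  finally show ?thesis .
qed

definition cube :: "nat \<Rightarrow> 'm set" where "cube i = par i ` centered_box (l i)"

lemma cube_open: "i < N \<Longrightarrow> open (cube i)"
  unfolding cube_def by (rule cube_chart.open_Q[OF chart])

lemma cube_nonempty: assumes "i < N" shows "cube i \<noteq> {}"
proof -
  have "0 \<in> centered_box (l i)"
    using cube_chart.l(1)[OF chart[OF assms]] by (auto simp: centered_box_def)
  then show ?thesis by (auto simp: cube_def)
qed

definition total_form :: "('m \<Rightarrow> complex) \<Rightarrow> ennreal" where
  "total_form u = (\<Sum>p\<in>ix. dirichlet p u)"

definition pair_variation :: "'m set \<Rightarrow> 'm set \<Rightarrow> ('m \<Rightarrow> complex) \<Rightarrow> ennreal" where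
  "pair_variation A B u = (\<integral>\<^sup>+x. \<integral>\<^sup>+y. ennreal ((norm (u y - u x))\<^sup>2) * indicator A x * indicator B y \<partial>M \<partial>M)"

text \<open>The constant may depend on h: these bounds yield the positivity of the gap, never its
  size.\<close>

definition controlled :: "nat \<Rightarrow> nat \<Rightarrow> bool" where
  "controlled i i' \<longleftrightarrow> (\<exists>C::real. 0 \<le> C \<and> (\<forall>u\<in>borel_measurable borel. pair_variation (cube i) (cube i') u \<le> ennreal C * total_form u))"

lemma controlled_refl: assumes i: "i < N" shows "controlled i i"
proof -
  interpret C: cube_chart "par i" "l i" "L i" "d i" M \<Lambda> a by (rule chart[OF i])
  have [measurable_cong]: "sets M = sets borel" by (rule sets_M)
  define \<eta> where "\<eta> = h / \<Lambda>\<^sup>2"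
  have \<eta>: "0 < \<eta>" using h \<Lambda>_ge_1 by (simp add: \<eta>_def)
  obtain k where k: "2 * \<Lambda> / \<eta> < 2 ^ k" using real_arch_pow[of 2 "2 * \<Lambda> / \<eta>"] by auto
  have kl: "2 * l i j \<le> 2 ^ k * \<eta>" for j
    using k l(2)[OF i, of j] \<eta> by (simp add: field_simps)
  define c0 where "c0 = (2 ^ CARD('n) * 4) ^ k * (2 ^ CARD('n) * (2 * \<eta>) ^ (CARD('n) - 1))"
  have c0: "0 \<le> c0" using \<eta> by (simp add: c0_def)
  have "pair_variation (cube i) (cube i) u \<le> ennreal (\<Lambda>\<^sup>2 * c0 * (2 * h * \<Lambda> ^ 3)) * total_form u"
    if u[measurable]: "u \<in> borel_measurable borel" for u
  proof -
    let ?f = "u \<circ> C.par'"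
    have fm[measurable]: "?f \<in> borel_measurable borel" by measurable
    have "pair_variation (cube i) (cube i) u = (\<integral>\<^sup>+x. (\<integral>\<^sup>+y. (ennreal ((norm (u y - u x))\<^sup>2)) * indicator C.Q y \<partial>M) * indicator C.Q x \<partial>M)"
      unfolding pair_variation_def cube_def
      by (subst nn_integral_multc[symmetric]) (auto simp: mult.assoc mult.commute mult.left_commute)
    also have "\<dots> = (\<integral>\<^sup>+x. (\<integral>\<^sup>+w'. ennreal ((norm (u (C.par' w') - u x))\<^sup>2) * ennreal (C.d0 w') * indicator C.b w' \<partial>lborel) * indicator C.Q x \<partial>M)"
    proof (intro nn_integral_cong)
      fix x
      have "(\<integral>\<^sup>+y. (ennreal ((norm (u y - u x))\<^sup>2)) * indicator C.Q y \<partial>M) = (\<integral>\<^sup>+w'. ennreal ((norm (u (C.par' w') - u x))\<^sup>2) * ennreal (C.d0 w') * indicator C.b w' \<partial>lborel)"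
        by (rule C.nn_integral_Q) measurable
      then show "(\<integral>\<^sup>+y. (ennreal ((norm (u y - u x))\<^sup>2)) * indicator C.Q y \<partial>M) * indicator C.Q x = (\<integral>\<^sup>+w'. ennreal ((norm (u (C.par' w') - u x))\<^sup>2) * ennreal (C.d0 w') * indicator C.b w' \<partial>lborel) * indicator C.Q x"
        by simp
    qed
    also have "\<dots> = (\<integral>\<^sup>+w. (\<integral>\<^sup>+w'. ennreal ((norm (u (C.par' w') - u (C.par' w)))\<^sup>2) * ennreal (C.d0 w') * indicator C.b w' \<partial>lborel) * ennreal (C.d0 w) * indicator C.b w \<partial>lborel)"
      by (rule C.nn_integral_Q) measurable
    also have "\<dots> = (\<integral>\<^sup>+w. \<integral>\<^sup>+w'. ennreal ((norm (?f w' - ?f w))\<^sup>2) * ennreal (C.d0 w') * indicator C.b w' * ennreal (C.d0 w) * indicator C.b w \<partial>lborel \<partial>lborel)"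
      by (simp add: nn_integral_multc)
    also have "\<dots> \<le> (\<integral>\<^sup>+w. \<integral>\<^sup>+w'. ennreal (\<Lambda>\<^sup>2) * (ennreal ((norm (?f w' - ?f w))\<^sup>2) * indicator C.b w * indicator C.b w') \<partial>lborel \<partial>lborel)"
    proof (intro nn_integral_mono)
      fix w w' :: "real^'n"
      show "ennreal ((norm (?f w' - ?f w))\<^sup>2) * ennreal (C.d0 w') * indicator C.b w' * ennreal (C.d0 w) * indicator C.b w
          \<le> ennreal (\<Lambda>\<^sup>2) * (ennreal ((norm (?f w' - ?f w))\<^sup>2) * indicator C.b w * indicator C.b w')"
      proof (cases "w \<in> C.b \<and> w' \<in> C.b")
        case True
        have "C.d0 w' * C.d0 w \<le> \<Lambda> * \<Lambda>"
          using C.d0_b[of w] C.d0_b[of w'] True C.d0_nonneg \<Lambda>_ge_1 by (intro mult_mono) auto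
        then have "ennreal (C.d0 w') * ennreal (C.d0 w) \<le> ennreal (\<Lambda>\<^sup>2)"
          using C.d0_nonneg by (simp add: ennreal_mult[symmetric] ennreal_leI power2_eq_square)
        from mult_left_mono[OF this, of "ennreal ((norm (?f w' - ?f w))\<^sup>2)"]
        show ?thesis using True by (simp add: mult.assoc) (simp add: mult.commute)
      qed auto
    qed
    also have "\<dots> = ennreal (\<Lambda>\<^sup>2) * (\<integral>\<^sup>+w. \<integral>\<^sup>+w'. ennreal ((norm (?f w' - ?f w))\<^sup>2) * indicator C.b w * indicator C.b w' \<partial>lborel \<partial>lborel)"
      by (simp add: nn_integral_cmult)
    also have "\<dots> \<le> ennreal (\<Lambda>\<^sup>2) * (ennreal c0 * (\<Sum>j\<in>UNIV. axis_form (l i) ?f j \<eta>))"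
      unfolding c0_def by (intro mult_left_mono box_poincare[OF fm \<eta> kl]) auto
    also have "\<dots> \<le> ennreal (\<Lambda>\<^sup>2) * (ennreal c0 * (\<Sum>j\<in>UNIV. ennreal (2 * h * \<Lambda> ^ 3) * dirichlet (i, j) u))"
      unfolding \<eta>_def by (intro mult_left_mono sum_mono axis_form_le_dirichlet[OF i u]) auto
    also have "(\<Sum>j\<in>UNIV. ennreal (2 * h * \<Lambda> ^ 3) * dirichlet (i, j) u) \<le> ennreal (2 * h * \<Lambda> ^ 3) * total_form u"
    proof -
      have "(\<Sum>j\<in>(UNIV :: 'n set). dirichlet (i, j) u) = (\<Sum>p\<in>Pair i ` UNIV. dirichlet p u)"
        by (subst sum.reindex) (auto simp: inj_on_def)
      also have "\<dots> \<le> total_form u"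
        unfolding total_form_def using i by (intro sum_mono2) (auto simp: ix_def)
      finally show ?thesis unfolding sum_distrib_left[symmetric] by (intro mult_left_mono) auto
    qed
    finally have "pair_variation (cube i) (cube i) u \<le> ennreal (\<Lambda>\<^sup>2) * (ennreal c0 * (ennreal (2 * h * \<Lambda> ^ 3) * total_form u))"
      by (simp add: mult_left_mono)
    also have "\<dots> = ennreal (\<Lambda>\<^sup>2 * c0 * (2 * h * \<Lambda> ^ 3)) * total_form u"
    proof -
      have "ennreal (\<Lambda>\<^sup>2 * c0 * (2 * h * \<Lambda> ^ 3)) = ennreal (\<Lambda>\<^sup>2) * ennreal c0 * ennreal (2 * h * \<Lambda> ^ 3)"
        using c0 h \<Lambda>_ge_1 by (subst ennreal_mult, simp, simp, subst ennreal_mult) auto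
      then show ?thesis by (simp only: mult.assoc)
    qed
    finally show ?thesis .
  qed
  moreover have "0 \<le> \<Lambda>\<^sup>2 * c0 * (2 * h * \<Lambda> ^ 3)" using c0 h \<Lambda>_ge_1 by simp
  ultimately show ?thesis unfolding controlled_def by blast
qed

lemma pair_variation_mono:
  assumes "A \<subseteq> A'" "B \<subseteq> B'" shows "pair_variation A B u \<le> pair_variation A' B' u"
  unfolding pair_variation_def using assms by (intro nn_integral_mono) (auto simp: indicator_def)

text \<open>\<open>\<parallel>u x - u z\<parallel>\<^sup>2 \<le> 2 \<parallel>u x - u y\<parallel>\<^sup>2 + 2 \<parallel>u y - u z\<parallel>\<^sup>2\<close>, averaged over \<open>y \<in> B\<close>.\<close>

lemma pair_variation_chain:
  assumes u[measurable]: "u \<in> borel_measurable borel"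
    and [measurable]: "A \<in> sets borel" "B \<in> sets borel" "D \<in> sets borel"
  shows "emeasure M B * pair_variation A D u \<le> 2 * pair_variation A B u + 2 * pair_variation B D u"
proof -
  have [measurable_cong]: "sets M = sets borel" by (rule sets_M)
  interpret pair_sigma_finite M M by (rule pair_sigma_finite.intro) unfold_locales
  have le1: "emeasure M X \<le> 1" for X by (rule emeasure_le_1)
  let ?F = "\<lambda>x y. ennreal ((norm (u y - u x))\<^sup>2)"
  have "emeasure M B * pair_variation A D u = (\<integral>\<^sup>+y. pair_variation A D u * indicator B y \<partial>M)"
    by (subst nn_integral_cmult_indicator) (auto simp: mult.commute sets_M)
  also have "\<dots> = (\<integral>\<^sup>+y. \<integral>\<^sup>+x. \<integral>\<^sup>+z. ?F x z * indicator A x * indicator D z * indicator B y \<partial>M \<partial>M \<partial>M)"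
    unfolding pair_variation_def by (simp add: nn_integral_multc)
  also have "\<dots> \<le> (\<integral>\<^sup>+y. \<integral>\<^sup>+x. \<integral>\<^sup>+z. 2 * (?F x y * indicator A x * indicator B y) * indicator D z
      + 2 * (?F y z * indicator B y * indicator D z) * indicator A x \<partial>M \<partial>M \<partial>M)"
  proof (intro nn_integral_mono)
    fix x y z
    have "(norm (u z - u x))\<^sup>2 \<le> 2 * (norm (u y - u x))\<^sup>2 + 2 * (norm (u z - u y))\<^sup>2"
      using norm_sum_square_le[of "u y - u x" "u z - u y"] by simp
    then have "?F x z \<le> ennreal (2 * (norm (u y - u x))\<^sup>2 + 2 * (norm (u z - u y))\<^sup>2)" by (rule ennreal_leI)
    also have "\<dots> = 2 * ?F x y + 2 * ?F y z" by (simp add: ennreal_mult)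
    finally show "?F x z * indicator A x * indicator D z * indicator B y \<le>
       2 * (?F x y * indicator A x * indicator B y) * indicator D z + 2 * (?F y z * indicator B y * indicator D z) * indicator A x"
      by (auto simp: indicator_def)
  qed
  also have "\<dots> = (\<integral>\<^sup>+y. \<integral>\<^sup>+x. 2 * (?F x y * indicator A x * indicator B y) * emeasure M D \<partial>M \<partial>M)
      + (\<integral>\<^sup>+y. 2 * (\<integral>\<^sup>+z. ?F y z * indicator B y * indicator D z \<partial>M) * emeasure M A \<partial>M)"
    by (simp add: nn_integral_add nn_integral_cmult nn_integral_multc sets_M)
  also have "\<dots> \<le> (\<integral>\<^sup>+y. \<integral>\<^sup>+x. 2 * (?F x y * indicator A x * indicator B y) * 1 \<partial>M \<partial>M)
      + (\<integral>\<^sup>+y. 2 * (\<integral>\<^sup>+z. ?F y z * indicator B y * indicator D z \<partial>M) * 1 \<partial>M)"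
    by (intro add_mono nn_integral_mono mult_left_mono le1) auto
  also have "\<dots> = 2 * (\<integral>\<^sup>+y. \<integral>\<^sup>+x. ?F x y * indicator A x * indicator B y \<partial>M \<partial>M) + 2 * pair_variation B D u"
    unfolding pair_variation_def by (simp add: nn_integral_cmult)
  also have "(\<integral>\<^sup>+y. \<integral>\<^sup>+x. ?F x y * indicator A x * indicator B y \<partial>M \<partial>M) = pair_variation A B u"
    unfolding pair_variation_def by (rule Fubini'[symmetric]) measurable
  finally show ?thesis .
qed

text \<open>\<open>pair_variation_chain\<close> through W, divided by the measure of W, which is
  positive because W is open and nonempty.\<close>

lemma controlled_through:
  assumes i: "i < N" "i' < N" and W: "open W" "W \<noteq> {}"
    and C: "\<And>u. u \<in> borel_measurable borel \<Longrightarrow> pair_variation (cube i) W u \<le> ennreal C * total_form u" "0 \<le> C"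
    and D: "\<And>u. u \<in> borel_measurable borel \<Longrightarrow> pair_variation W (cube i') u \<le> ennreal D * total_form u" "0 \<le> D"
  shows "controlled i i'"
proof -
  have Wp: "0 < measure M W"
    using emeasure_open_pos[OF W] by (simp add: emeasure_eq_measure)
  have [measurable]: "cube i \<in> sets borel" "cube i' \<in> sets borel" "W \<in> sets borel"
    using cube_open i W by auto
  have "pair_variation (cube i) (cube i') u \<le> ennreal (2 * (C + D) / measure M W) * total_form u"
    if u: "u \<in> borel_measurable borel" for u
  proof -
    have "emeasure M W * pair_variation (cube i) (cube i') u \<le> 2 * (ennreal C * total_form u) + 2 * (ennreal D * total_form u)"
      using pair_variation_chain[OF u, of "cube i" W "cube i'"] C(1)[OF u] D(1)[OF u]
      by (meson \<open>W \<in> sets borel\<close> \<open>cube i \<in> sets borel\<close> \<open>cube i' \<in> sets borel\<close> add_mono mult_left_mono order_trans zero_le)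
    also have "\<dots> = ennreal (2 * (C + D)) * total_form u"
      using C(2) D(2) by (simp add: ennreal_mult distrib_left distrib_right mult.assoc)
    finally have "ennreal (1 / measure M W) * (ennreal (measure M W) * pair_variation (cube i) (cube i') u) \<le> ennreal (1 / measure M W) * (ennreal (2 * (C + D)) * total_form u)"
      unfolding emeasure_eq_measure by (rule mult_left_mono) simp
    moreover have "ennreal (1 / measure M W) * ennreal (measure M W) = 1"
      using Wp by (simp add: ennreal_mult[symmetric])
    moreover have "ennreal (1 / measure M W) * ennreal (2 * (C + D)) = ennreal (2 * (C + D) / measure M W)"
      using Wp C(2) D(2) by (subst ennreal_mult[symmetric]) auto
    ultimately show ?thesis by (simp only: mult.assoc[symmetric] mult_1_left)
  qed
  moreover have "0 \<le> 2 * (C + D) / measure M W" using C D by simp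
  ultimately show ?thesis unfolding controlled_def by blast
qed

lemma controlled_overlap:
  assumes i: "i < N" "i' < N" and ov: "cube i \<inter> cube i' \<noteq> {}" shows "controlled i i'"
proof -
  obtain C where C: "0 \<le> C" "\<And>u. u \<in> borel_measurable borel \<Longrightarrow> pair_variation (cube i) (cube i) u \<le> ennreal C * total_form u"
    using controlled_refl[OF i(1)] unfolding controlled_def by blast
  obtain D where D: "0 \<le> D" "\<And>u. u \<in> borel_measurable borel \<Longrightarrow> pair_variation (cube i') (cube i') u \<le> ennreal D * total_form u"
    using controlled_refl[OF i(2)] unfolding controlled_def by blast
  show ?thesis
  proof (rule controlled_through[OF i _ ov])
    show "open (cube i \<inter> cube i')" using cube_open i by auto
    show "pair_variation (cube i) (cube i \<inter> cube i') u \<le> ennreal C * total_form u" if "u \<in> borel_measurable borel" for u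
      by (rule order_trans[OF pair_variation_mono C(2)[OF that]]) auto
    show "pair_variation (cube i \<inter> cube i') (cube i') u \<le> ennreal D * total_form u" if "u \<in> borel_measurable borel" for u
      by (rule order_trans[OF pair_variation_mono D(2)[OF that]]) auto
  qed (use C D in auto)
qed

lemma controlled_trans:
  assumes i: "i < N" "j < N" "k < N" and c: "controlled i j" "controlled j k" shows "controlled i k"
proof -
  obtain C where C: "0 \<le> C" "\<And>u. u \<in> borel_measurable borel \<Longrightarrow> pair_variation (cube i) (cube j) u \<le> ennreal C * total_form u"
    using c(1) unfolding controlled_def by blast
  obtain D where D: "0 \<le> D" "\<And>u. u \<in> borel_measurable borel \<Longrightarrow> pair_variation (cube j) (cube k) u \<le> ennreal D * total_form u"
    using c(2) unfolding controlled_def by blast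
  show ?thesis
    by (rule controlled_through[OF i(1,3) cube_open[OF i(2)] cube_nonempty[OF i(2)] C(2,1) D(2,1)])
qed

text \<open>Overlapping cubes control each other. Otherwise the cubes controlled by i and the
  remaining ones would have disjoint open unions that cover a connected space.\<close>

lemma controlled_all:
  assumes conn: "connected (UNIV :: 'm set)" and i: "i < N" and k: "k < N" shows "controlled i k"
proof (rule ccontr)
  assume nk: "\<not> controlled i k"
  let ?A = "\<Union>j\<in>{j. j < N \<and> controlled i j}. cube j" and ?B = "\<Union>j\<in>{j. j < N \<and> \<not> controlled i j}. cube j"
  have oA: "open ?A" and oB: "open ?B" using cube_open by auto
  have disj: "?A \<inter> ?B = {}"
  proof (rule ccontr)
    assume "?A \<inter> ?B \<noteq> {}"
    then obtain j j' where j: "j < N" "controlled i j" "j' < N" "\<not> controlled i j'" "cube j \<inter> cube j' \<noteq> {}" by blast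
    then show False using controlled_trans[OF i j(1,3,2) controlled_overlap[OF j(1,3,5)]] by simp
  qed
  have cov: "UNIV \<subseteq> ?A \<union> ?B"
  proof
    fix x :: 'm
    obtain j where "j < N" "x \<in> cube j" using cover unfolding cube_def by blast
    then show "x \<in> ?A \<union> ?B" by blast
  qed
  have "?A \<noteq> {}" using cube_nonempty[OF i] controlled_refl[OF i] i by blast
  moreover have "?B \<noteq> {}" using cube_nonempty[OF k] nk k by blast
  ultimately show False using connectedD[OF conn oA oB _ cov] disj unfolding Int_UNIV_right by blast
qed

lemma total_poincare:
  assumes conn: "connected (UNIV :: 'm set)"
  shows "\<exists>C>0. \<forall>u\<in>borel_measurable borel. (\<integral>\<^sup>+x. \<integral>\<^sup>+y. ennreal ((norm (u y - u x))\<^sup>2) \<partial>M \<partial>M) \<le> ennreal C * total_form u"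
proof -
  have [measurable_cong]: "sets M = sets borel" by (rule sets_M)
  have "\<exists>C. \<forall>p\<in>{..<N} \<times> {..<N}. 0 \<le> C p \<and> (\<forall>u\<in>borel_measurable borel. pair_variation (cube (fst p)) (cube (snd p)) u \<le> ennreal (C p) * total_form u)"
    by (rule bchoice) (use controlled_all[OF conn] in \<open>auto simp: controlled_def\<close>)
  then obtain C where C: "\<And>i k. i < N \<Longrightarrow> k < N \<Longrightarrow> 0 \<le> C (i, k)"
    "\<And>i k u. i < N \<Longrightarrow> k < N \<Longrightarrow> u \<in> borel_measurable borel \<Longrightarrow> pair_variation (cube i) (cube k) u \<le> ennreal (C (i, k)) * total_form u"
    by auto
  define K where "K = 1 + (\<Sum>i<N. \<Sum>k<N. C (i, k))"
  have Knn: "0 \<le> (\<Sum>i<N. \<Sum>k<N. C (i, k))" using C(1) by (intro sum_nonneg) auto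
  have "(\<integral>\<^sup>+x. \<integral>\<^sup>+y. ennreal ((norm (u y - u x))\<^sup>2) \<partial>M \<partial>M) \<le> ennreal K * total_form u"
    if u[measurable]: "u \<in> borel_measurable borel" for u
  proof -
    have cm: "cube i \<in> sets borel" if "i < N" for i using cube_open[OF that] by simp
    let ?F = "\<lambda>x y. ennreal ((norm (u y - u x))\<^sup>2)"
    have "(\<integral>\<^sup>+x. \<integral>\<^sup>+y. ?F x y \<partial>M \<partial>M) \<le> (\<integral>\<^sup>+x. \<integral>\<^sup>+y. (\<Sum>i<N. \<Sum>k<N. ?F x y * indicator (cube i) x * indicator (cube k) y) \<partial>M \<partial>M)"
    proof (intro nn_integral_mono)
      fix x y
      have ex: "\<exists>i<N. z \<in> cube i" for z using cover unfolding cube_def by blast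
      obtain i where i: "i < N" "x \<in> cube i" using ex by blast
      obtain k where k: "k < N" "y \<in> cube k" using ex by blast
      note ik = i k
      have "?F x y = ?F x y * indicator (cube i) x * indicator (cube k) y" using ik by simp
      also have "\<dots> \<le> (\<Sum>k<N. ?F x y * indicator (cube i) x * indicator (cube k) y)"
        using ik by (intro member_le_sum) auto
      also have "\<dots> \<le> (\<Sum>i<N. \<Sum>k<N. ?F x y * indicator (cube i) x * indicator (cube k) y)"
        using ik by (intro member_le_sum) auto
      finally show "?F x y \<le> (\<Sum>i<N. \<Sum>k<N. ?F x y * indicator (cube i) x * indicator (cube k) y)" .
    qed
    also have "\<dots> = (\<Sum>i<N. \<Sum>k<N. pair_variation (cube i) (cube k) u)"
      unfolding pair_variation_def
    proof (rule nn_integral_double_sum)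
      fix i k assume ik: "i \<in> {..<N}" "k \<in> {..<N}"
      have [measurable]: "cube i \<in> sets borel" "cube k \<in> sets borel" using cm ik by auto
      show "(\<lambda>(x, y). ?F x y * indicator (cube i) x * indicator (cube k) y) \<in> borel_measurable (M \<Otimes>\<^sub>M M)" by measurable
    qed
    also have "\<dots> \<le> (\<Sum>i<N. \<Sum>k<N. ennreal (C (i, k)) * total_form u)"
      using C(2)[OF _ _ u] by (intro sum_mono) auto
    also have "\<dots> = ennreal (\<Sum>i<N. \<Sum>k<N. C (i, k)) * total_form u"
    proof -
      have "(\<Sum>k<N. ennreal (C (i, k))) = ennreal (\<Sum>k<N. C (i, k))" if "i < N" for i
        using C(1)[OF that] by (intro sum_ennreal) auto
      then have "(\<Sum>i<N. \<Sum>k<N. ennreal (C (i, k))) = (\<Sum>i<N. ennreal (\<Sum>k<N. C (i, k)))" by simp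
      also have "\<dots> = ennreal (\<Sum>i<N. \<Sum>k<N. C (i, k))"
        using C(1) by (intro sum_ennreal sum_nonneg) auto
      finally show ?thesis by (simp only: sum_distrib_right[symmetric])
    qed
    also have "\<dots> \<le> ennreal K * total_form u"
      by (intro mult_right_mono ennreal_leI) (auto simp: K_def)
    finally show ?thesis .
  qed
  moreover have "K > 0" using Knn by (simp add: K_def)
  ultimately show ?thesis by blast
qed

end

section \<open>The spectral gap\<close>

lemma Re_mult_cnj: "Re (a * cnj b) = a \<bullet> b"
  by (simp add: inner_complex_def)

context kernel_family
begin

text \<open>The majorant involves the real function |u| only, and \<open>dirichlet_identity\<close>
  makes it integrable; this dominates the complex integrand.\<close>

lemma step_defect_bound:
  fixes u :: "'a \<Rightarrow> complex"
  assumes i: "i \<in> I"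
  shows "norm ((u x - step i u x) * cnj (u x)) \<le> 2 * (mass i x * (norm (u x))\<^sup>2) - (norm (u x) - step i (\<lambda>x. norm (u x)) x) \<bullet> norm (u x)"
proof -
  let ?J = "LINT y|\<kappa> i x. norm (u y)"
  have "u x - step i u x = mass i x *\<^sub>R u x - (LINT y|\<kappa> i x. u y)" by (simp add: step_def algebra_simps)
  then have "norm (u x - step i u x) \<le> mass i x * norm (u x) + norm (LINT y|\<kappa> i x. u y)"
    using norm_triangle_ineq4[of "mass i x *\<^sub>R u x" "LINT y|\<kappa> i x. u y"] mass_bounds[OF i] by simp
  also have "\<dots> \<le> mass i x * norm (u x) + ?J" by (intro add_left_mono integral_norm_bound)
  finally have "norm (u x - step i u x) * norm (u x) \<le> (mass i x * norm (u x) + ?J) * norm (u x)"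
    by (rule mult_right_mono) simp
  also have "\<dots> = 2 * (mass i x * (norm (u x))\<^sup>2) - (norm (u x) - step i (\<lambda>x. norm (u x)) x) \<bullet> norm (u x)"
    by (simp add: step_def algebra_simps power2_eq_square)
  finally show ?thesis unfolding norm_mult complex_mod_cnj .
qed

text \<open>For \<open>L2_form\<close>: the real part is taken under a Bochner integral, which calls
  for integrability of the complex integrand itself.\<close>

lemma walk_form_integrable:
  fixes u :: "'a \<Rightarrow> complex"
  assumes u[measurable]: "u \<in> borel_measurable M" and sq: "integrable M (\<lambda>x. (norm (u x))\<^sup>2)"
  shows "integrable M (\<lambda>x. (u x - walk u x) * cnj (u x))"
proof -
  have fin: "(\<integral>\<^sup>+x. ennreal ((norm (norm (u x)))\<^sup>2) \<partial>M) < \<infinity>"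
    using sq by (simp add: nn_integral_eq_integral)
  have card: "real (card I) > 0" using I by (simp add: card_gt_0_iff)
  have eq: "(u x - walk u x) * cnj (u x) = (1 / real (card I)) *\<^sub>R (\<Sum>i\<in>I. (u x - step i u x) * cnj (u x))" for x
  proof -
    have "u x - walk u x = (1 / real (card I)) *\<^sub>R (\<Sum>i\<in>I. u x - step i u x)"
      using card by (simp add: walk_def sum_subtractf scaleR_diff_right scaleR_conv_of_real diff_divide_distrib)
    then show ?thesis by (simp add: sum_distrib_right)
  qed
  have "integrable M (\<lambda>x. (u x - step i u x) * cnj (u x))" if i: "i \<in> I" for i
  proof (rule Bochner_Integration.integrable_bound)
    note [measurable] = mass_measurable[OF i] step_measurable[OF i u]
    have "integrable M (\<lambda>x. mass i x * (norm (u x))\<^sup>2)"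
    proof (rule Bochner_Integration.integrable_bound[OF sq])
      show "AE x in M. norm (mass i x * (norm (u x))\<^sup>2) \<le> norm ((norm (u x))\<^sup>2)"
        using mass_bounds[OF i] by (auto simp: abs_mult mult_left_le_one_le)
    qed measurable
    then show "integrable M (\<lambda>x. 2 * (mass i x * (norm (u x))\<^sup>2) - (norm (u x) - step i (\<lambda>x. norm (u x)) x) \<bullet> norm (u x))"
      using dirichlet_identity(2)[OF i _ fin] by (intro Bochner_Integration.integrable_diff integrable_mult_right) auto
    show "AE x in M. norm ((u x - step i u x) * cnj (u x))
      \<le> norm (2 * (mass i x * (norm (u x))\<^sup>2) - (norm (u x) - step i (\<lambda>x. norm (u x)) x) \<bullet> norm (u x))"
    proof (rule AE_I2)
      fix x
      show "norm ((u x - step i u x) * cnj (u x))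
        \<le> norm (2 * (mass i x * (norm (u x))\<^sup>2) - (norm (u x) - step i (\<lambda>x. norm (u x)) x) \<bullet> norm (u x))"
        unfolding real_norm_def by (rule order_trans[OF step_defect_bound[OF i] abs_ge_self])
    qed
    have "(\<lambda>x. cnj (u x)) \<in> borel_measurable M"
      by (rule borel_measurable_continuous_on[OF _ u]) (intro continuous_intros)
    then show "(\<lambda>x. (u x - step i u x) * cnj (u x)) \<in> borel_measurable M" by measurable
  qed
  then show ?thesis unfolding eq by (intro integrable_scaleR_right Bochner_Integration.integrable_sum)
qed

lemma L2_form:
  assumes u: "u \<in> L2 M"
  shows "Re (L2_inner M (\<lambda>x. u x - walk u x) u) = 1 / (2 * real (card I)) * (\<Sum>i\<in>I. enn2real (dirichlet i u))"
proof -
  have um: "u \<in> borel_measurable M" and sq: "integrable M (\<lambda>x. (norm (u x))\<^sup>2)" using u by (auto simp: L2_def)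
  have fin: "(\<integral>\<^sup>+x. ennreal ((norm (u x))\<^sup>2) \<partial>M) < \<infinity>"
    using sq by (simp add: nn_integral_eq_integral)
  have "Re (L2_inner M (\<lambda>x. u x - walk u x) u) = (LINT x|M. Re ((u x - walk u x) * cnj (u x)))"
    unfolding L2_inner_def by (rule integral_Re[symmetric]) (rule walk_form_integrable[OF um sq])
  also have "\<dots> = (LINT x|M. (u x - walk u x) \<bullet> u x)" by (simp only: Re_mult_cnj)
  finally show ?thesis using walk_dirichlet(1)[OF um fin] by simp
qed

definition gap_bounds :: "real set" where
  "gap_bounds = {g. 0 < g \<and> (\<forall>u\<in>L2 M.
     (L2_norm M u)\<^sup>2 - (cmod (L2_inner M u (\<lambda>_. 1)))\<^sup>2 \<le> 1 / g * Re (L2_inner M (\<lambda>x. u x - walk u x) u))}"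

lemma gap_bounds_energy:
  assumes g: "g \<in> gap_bounds" and f: "bm M f"
  shows "g * ((LINT x|M. (f x)\<^sup>2) - (LINT x|M. f x)\<^sup>2) \<le> energy f"
proof -
  define u where "u x = complex_of_real (f x)" for x
  have [measurable]: "f \<in> borel_measurable M" using f by auto
  have g0: "0 < g" using g by (simp add: gap_bounds_def)
  have u: "u \<in> L2 M"
    using f by (auto simp: L2_def u_def[abs_def] intro: integrable_bm bm_power2)
  have "dirichlet i u = dirichlet i f" for i
    unfolding dirichlet_def u_def by (simp flip: of_real_diff)
  then have "Re (L2_inner M (\<lambda>x. u x - walk u x) u) = energy f"
    by (simp add: L2_form[OF u] energy_eq_dirichlet[OF f])
  moreover have "(L2_norm M u)\<^sup>2 = (LINT x|M. (f x)\<^sup>2)"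
    by (simp add: L2_norm_def u_def)
  moreover have "(cmod (L2_inner M u (\<lambda>_. 1)))\<^sup>2 = (LINT x|M. f x)\<^sup>2"
    by (simp add: L2_inner_def u_def)
  ultimately have "(LINT x|M. (f x)\<^sup>2) - (LINT x|M. f x)\<^sup>2 \<le> 1 / g * energy f"
    using g u unfolding gap_bounds_def by (metis (mono_tags, lifting) mem_Collect_eq)
  then show ?thesis using g0 by (simp add: field_simps)
qed

text \<open>A supremum of reals is informative only for a nonempty set that is bounded above; the
  test function \<psi> provides the bound, and at the same time the upper estimate of the
  gap.\<close>

lemma Sup_gap_bounds:
  assumes ne: "gap_bounds \<noteq> {}" and \<psi>: "bm M \<psi>" and var: "0 < (LINT x|M. (\<psi> x)\<^sup>2) - (LINT x|M. \<psi> x)\<^sup>2"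
  shows "0 < Sup gap_bounds"
    and "Sup gap_bounds \<le> energy \<psi> / ((LINT x|M. (\<psi> x)\<^sup>2) - (LINT x|M. \<psi> x)\<^sup>2)"
    and "\<And>f. bm M f \<Longrightarrow> (LINT x|M. (f x)\<^sup>2) - (LINT x|M. f x)\<^sup>2 \<le> 1 / Sup gap_bounds * energy f"
proof -
  have le: "g \<le> energy \<psi> / ((LINT x|M. (\<psi> x)\<^sup>2) - (LINT x|M. \<psi> x)\<^sup>2)" if "g \<in> gap_bounds" for g
    using gap_bounds_energy[OF that \<psi>] var by (simp add: pos_le_divide_eq)
  then show "Sup gap_bounds \<le> energy \<psi> / ((LINT x|M. (\<psi> x)\<^sup>2) - (LINT x|M. \<psi> x)\<^sup>2)"
    using ne by (intro cSup_least)
  have bdd: "bdd_above gap_bounds" using le by (auto simp: bdd_above_def)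
  obtain g where g: "g \<in> gap_bounds" using ne by auto
  then have "0 < g" "g \<le> Sup gap_bounds" using bdd by (auto simp: gap_bounds_def intro: cSup_upper)
  then show pos: "0 < Sup gap_bounds" by linarith
  fix f assume f: "bm M f"
  define V where "V = (LINT x|M. (f x)\<^sup>2) - (LINT x|M. f x)\<^sup>2"
  have "V * Sup gap_bounds \<le> energy f"
  proof (cases "0 < V")
    case True
    have "Sup gap_bounds \<le> energy f / V"
      using gap_bounds_energy[OF _ f] True ne by (intro cSup_least) (auto simp: V_def pos_le_divide_eq)
    then show ?thesis using True by (simp add: field_simps)
  next
    case False
    then have "V * Sup gap_bounds \<le> 0" using pos by (simp add: mult_nonpos_nonneg)
    then show ?thesis using energy_nonneg[OF f] by linarith
  qed
  then show "(LINT x|M. (f x)\<^sup>2) - (LINT x|M. f x)\<^sup>2 \<le> 1 / Sup gap_bounds * energy f"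
    using pos by (simp add: V_def field_simps)
qed

end

context cube_walk
begin

lemma gap_bounds_nonempty:
  assumes conn: "connected (UNIV :: 'm set)" shows "gap_bounds \<noteq> {}"
proof -
  obtain C where C: "0 < C" "\<And>u. u \<in> borel_measurable borel \<Longrightarrow>
      (\<integral>\<^sup>+x. \<integral>\<^sup>+y. ennreal ((norm (u y - u x :: complex))\<^sup>2) \<partial>M \<partial>M) \<le> ennreal C * total_form u"
    using total_poincare[OF conn] by blast
  have card: "0 < real (card ix)" using card_ix_ge_1 by linarith
  have "1 / (2 * real (card ix) * C) \<in> gap_bounds"
    unfolding gap_bounds_def
  proof safe
    show "0 < 1 / (2 * real (card ix) * C)" using C card by simp
    fix u assume u: "u \<in> L2 M"
    have um: "u \<in> borel_measurable M" and sq: "integrable M (\<lambda>x. (norm (u x))\<^sup>2)" using u by (auto simp: L2_def)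
    have ub: "u \<in> borel_measurable borel" using um unfolding measurable_cong_sets[OF sets_M refl] .
    have fin: "(\<integral>\<^sup>+x. ennreal ((norm (u x))\<^sup>2) \<partial>M) < \<infinity>"
      using sq by (simp add: nn_integral_eq_integral)
    have eq: "total_form u = ennreal (\<Sum>p\<in>ix. enn2real (dirichlet p u))"
    proof -
      have "dirichlet p u = ennreal (enn2real (dirichlet p u))" if "p \<in> ix" for p
        using dirichlet_identity(1)[OF that um fin] by simp
      then have "total_form u = (\<Sum>p\<in>ix. ennreal (enn2real (dirichlet p u)))"
        unfolding total_form_def by (rule sum.cong[OF refl])
      then show ?thesis by (simp add: sum_ennreal)
    qed
    have "ennreal ((LINT x|M. (norm (u x))\<^sup>2) - (norm (LINT x|M. u x))\<^sup>2) \<le> ennreal C * total_form u"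
      by (rule order_trans[OF variance_le_nn[OF um sq] C(2)[OF ub]])
    also have "\<dots> = ennreal (C * (\<Sum>p\<in>ix. enn2real (dirichlet p u)))"
      using C(1) by (simp add: eq ennreal_mult sum_nonneg)
    finally have "(LINT x|M. (norm (u x))\<^sup>2) - (norm (LINT x|M. u x))\<^sup>2 \<le> C * (\<Sum>p\<in>ix. enn2real (dirichlet p u))"
      using C(1) by (subst (asm) ennreal_le_iff) (auto intro!: mult_nonneg_nonneg sum_nonneg)
    then show "(L2_norm M u)\<^sup>2 - (cmod (L2_inner M u (\<lambda>_. 1)))\<^sup>2
        \<le> 1 / (1 / (2 * real (card ix) * C)) * Re (L2_inner M (\<lambda>x. u x - walk u x) u)"
      unfolding L2_form[OF u] using card by (simp add: L2_norm_def L2_inner_def)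
  qed
  then show ?thesis by auto
qed

section \<open>The upper bound for the gap from a Lipschitz function\<close>

lemma dirichlet_lipschitz:
  fixes f :: "'m \<Rightarrow> real"
  assumes i: "i < N" and f[measurable]: "f \<in> borel_measurable borel" and K: "0 \<le> K"
    and lip: "\<And>w s. w \<in> centered_box (l i) \<Longrightarrow> w + axis j s \<in> centered_box (l i) \<Longrightarrow>
       \<bar>f (par i (w + axis j s)) - f (par i w)\<bar> \<le> K * \<bar>s\<bar>"
  shows "dirichlet (i, j) f \<le> ennreal ((K * \<Lambda>\<^sup>2 * h)\<^sup>2)"
proof -
  interpret C: cube_chart "par i" "l i" "L i" "d i" M \<Lambda> a by (rule chart[OF i])
  let ?B = "ennreal ((K * \<Lambda>\<^sup>2 * h)\<^sup>2)"
  have "dirichlet (i, j) f = (\<integral>\<^sup>+x. \<integral>\<^sup>+y. ennreal ((norm (f y - f x))\<^sup>2) \<partial>C.ker j (c i j) h x \<partial>M)"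
    unfolding dirichlet_def unfolding \<kappa>_def prod.case ..
  also have "\<dots> = (\<integral>\<^sup>+w. \<integral>\<^sup>+s. indicator C.b w * ennreal (C.d0 w) * ennreal (C.jump j (c i j) h w s)
      * ennreal ((norm (f (C.par' (w + axis j s)) - f (C.par' w)))\<^sup>2) \<partial>lborel \<partial>lborel)"
    by (rule C.nn_integral_pairs) measurable
  also have "\<dots> \<le> (\<integral>\<^sup>+w. \<integral>\<^sup>+s. indicator C.b w * ennreal (C.d0 w) * ennreal (C.jump j (c i j) h w s) * ?B \<partial>lborel \<partial>lborel)"
  proof (intro nn_integral_mono)
    fix w s
    show "indicator C.b w * ennreal (C.d0 w) * ennreal (C.jump j (c i j) h w s)
      * ennreal ((norm (f (C.par' (w + axis j s)) - f (C.par' w)))\<^sup>2)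
      \<le> indicator C.b w * ennreal (C.d0 w) * ennreal (C.jump j (c i j) h w s) * ?B"
    proof (cases "w \<in> C.b \<and> C.jump j (c i j) h w s > 0")
      case True
      \<comment> \<open>Where the jump density is positive, \<open>jump_upper\<close> confines s to
        length \<Lambda> c h \<le> \<Lambda>^2 h and keeps the end point in the box.\<close>
      have "0 < \<Lambda> / (2 * h * c i j) * indicator C.b (w + axis j s) * indicator {-(\<Lambda> * c i j * h)..\<Lambda> * c i j * h} s"
        using True C.jump_upper[of w "c i j" h j s] c_pos[OF i, of j] h by linarith
      then have "indicator C.b (w + axis j s) \<noteq> (0::real)" "indicator {-(\<Lambda> * c i j * h)..\<Lambda> * c i j * h} s \<noteq> (0::real)"
        by (metis less_irrefl mult_zero_left mult_zero_right)+
      then have s: "w + axis j s \<in> C.b" "\<bar>s\<bar> \<le> \<Lambda> * c i j * h"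
        by (auto simp: indicator_eq_0_iff)
      have "\<Lambda> * c i j * h \<le> \<Lambda> * \<Lambda> * h" using c(2)[OF i, of j] \<Lambda>_ge_1 h by (intro mult_right_mono mult_left_mono) auto
      then have "\<bar>s\<bar> \<le> \<Lambda>\<^sup>2 * h" using s by (simp add: power2_eq_square)
      then have "K * \<bar>s\<bar> \<le> K * \<Lambda>\<^sup>2 * h" using K by (simp add: mult_left_mono mult.assoc)
      then have "norm (f (C.par' (w + axis j s)) - f (C.par' w)) \<le> K * \<Lambda>\<^sup>2 * h"
        using lip[of w s] True s by (simp add: C.par'_b)
      then have "ennreal ((norm (f (C.par' (w + axis j s)) - f (C.par' w)))\<^sup>2) \<le> ?B"
        by (intro ennreal_leI power_mono) auto
      then show ?thesis by (rule mult_left_mono) simp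
    next
      case False
      then have "indicator C.b w * ennreal (C.d0 w) * ennreal (C.jump j (c i j) h w s) = 0"
        by (auto simp: ennreal_neg)
      then show ?thesis by (simp only: mult_zero_left order_refl)
    qed
  qed
  also have "\<dots> = (\<integral>\<^sup>+x. \<integral>\<^sup>+y. ?B \<partial>C.ker j (c i j) h x \<partial>M)"
    by (rule C.nn_integral_pairs[symmetric]) measurable
  also have "\<dots> = (\<integral>\<^sup>+x. ?B * emeasure (C.ker j (c i j) h x) UNIV \<partial>M)"
    by (simp add: nn_integral_const)
  also have "\<dots> \<le> (\<integral>\<^sup>+x. ?B * 1 \<partial>M)"
    by (intro nn_integral_mono mult_left_mono C.emeasure_ker_le_1[OF c_pos[OF i] h(1) h_le(1)[OF i]]) auto
  also have "\<dots> = ?B" by (simp add: emeasure_space_1)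
  finally show ?thesis .
qed

lemma energy_lipschitz:
  assumes f: "bm M f" and K: "0 \<le> K"
    and lip: "\<And>i j w s. i < N \<Longrightarrow> w \<in> centered_box (l i) \<Longrightarrow> w + axis j s \<in> centered_box (l i) \<Longrightarrow>
       \<bar>f (par i (w + axis j s)) - f (par i w)\<bar> \<le> K * \<bar>s\<bar>"
  shows "energy f \<le> (K * \<Lambda>\<^sup>2)\<^sup>2 * h\<^sup>2"
proof -
  have fb: "f \<in> borel_measurable borel" by (rule bm_borel[OF f])
  have "enn2real (dirichlet p f) \<le> (K * \<Lambda>\<^sup>2 * h)\<^sup>2" if pix: "p \<in> ix" for p
  proof -
    obtain i j where p: "p = (i, j)" "i < N" using pix by (auto simp: ix_def)
    from dirichlet_lipschitz[OF p(2) fb K lip[OF p(2)], where j=j]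
    show ?thesis unfolding p by (simp add: enn2real_leI)
  qed
  then have "(\<Sum>p\<in>ix. enn2real (dirichlet p f)) \<le> (\<Sum>p\<in>ix. (K * \<Lambda>\<^sup>2 * h)\<^sup>2)" by (rule sum_mono)
  then have "energy f \<le> 1 / (2 * real (card ix)) * (real (card ix) * (K * \<Lambda>\<^sup>2 * h)\<^sup>2)"
    unfolding energy_eq_dirichlet[OF f] by (intro mult_left_mono) auto
  also have "\<dots> \<le> (K * \<Lambda>\<^sup>2 * h)\<^sup>2" using card_ix_ge_1 by simp
  finally show ?thesis by (simp add: power_mult_distrib)
qed

text \<open>With zero variance \<open>f\<close> would equal its mean almost everywhere, but the open
  set where it differs is nonempty and has positive measure.\<close>

lemma variance_pos:
  assumes f: "bm M f" and cont: "continuous_on UNIV f" and ne: "f x \<noteq> f y"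
  shows "0 < (LINT x|M. (f x)\<^sup>2) - (LINT x|M. f x)\<^sup>2"
proof (rule ccontr)
  assume *: "\<not> ?thesis"
  define m where "m = (LINT x|M. f x)"
  have i1: "integrable M f" "integrable M (\<lambda>x. (f x)\<^sup>2)" using f by (auto intro: integrable_bm bm_power2)
  have "(LINT x|M. (f x - m)\<^sup>2) = (LINT x|M. (f x)\<^sup>2) - m\<^sup>2"
  proof -
    have "(LINT x|M. (f x - m)\<^sup>2) = (LINT x|M. (f x)\<^sup>2 - 2 * m * f x + m\<^sup>2)"
      by (simp add: power2_diff algebra_simps)
    also have "\<dots> = (LINT x|M. (f x)\<^sup>2) - 2 * m * m + m\<^sup>2" using i1 by (simp add: m_def prob_space)
    finally show ?thesis by (simp add: power2_eq_square)
  qed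
  moreover have bm2: "bm M (\<lambda>x. (f x - m)\<^sup>2)" using f by (intro bm_power2 bm_diff) auto
  moreover have "0 \<le> (LINT x|M. (f x - m)\<^sup>2)" by simp
  ultimately have "(LINT x|M. (f x - m)\<^sup>2) = 0" using * by (simp add: m_def)
  then have ae: "AE x in M. f x = m"
    using integral_nonneg_eq_0_iff_AE[OF integrable_bm[OF bm2]] by simp
  obtain z where z: "f z \<noteq> m" using ne by metis
  let ?W = "{x. f x \<noteq> m}"
  have W: "open ?W"
    using continuous_on_open_vimage[of UNIV f] cont open_delete[of UNIV m] by (auto simp: vimage_def)
  have "?W \<in> sets M" using W by (simp add: sets_M)
  then have "emeasure M ?W = 0" using ae by (subst (asm) AE_iff_measurable[of ?W]) (auto simp: space_M)
  then show False using emeasure_open_pos[OF W] z by auto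
qed

text \<open>The constants are written out so that they visibly do not contain h; the last one is the
  energy bound of \<psi>, without h^2, over its variance.\<close>

lemma regularizing:
  fixes \<psi> :: "'m \<Rightarrow> real"
  assumes conn: "connected (UNIV :: 'm set)"
    and \<psi>: "bm M \<psi>" and var: "0 < (LINT x|M. (\<psi> x)\<^sup>2) - (LINT x|M. \<psi> x)\<^sup>2" and K: "0 \<le> K"
    and lip: "\<And>i j w s. i < N \<Longrightarrow> w \<in> centered_box (l i) \<Longrightarrow> w + axis j s \<in> centered_box (l i) \<Longrightarrow>
       \<bar>\<psi> (par i (w + axis j s)) - \<psi> (par i w)\<bar> \<le> K * \<bar>s\<bar>"
    and \<delta>: "0 < \<delta>" "\<delta> < 1" "\<delta> \<le> 1 / (18 * \<Lambda> ^ 4 * (real N * real CARD('n)))"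
      "\<delta> \<le> 1 / real N * (1 / (real N * real CARD('n))) ^ CARD('n) * (1 / (2 * \<Lambda>\<^sup>2)) ^ CARD('n)"
  shows "regularizing_walk M walk \<delta> smoothing CARD('n) CARD('n) h
     (real N * \<Lambda> * (4 ^ Suc CARD('n) * real CARD('n) * \<Lambda> ^ 5 * (real N * real CARD('n)) + 2 * (2 * \<Lambda>\<^sup>2) ^ CARD('n) * \<Lambda>\<^sup>2))
     (\<Lambda> * (\<Lambda>\<^sup>2 / 2) ^ CARD('n)) ((K * \<Lambda>\<^sup>2)\<^sup>2 / ((LINT x|M. (\<psi> x)\<^sup>2) - (LINT x|M. \<psi> x)\<^sup>2)) (Sup gap_bounds)"
proof
  note gap = Sup_gap_bounds[OF gap_bounds_nonempty[OF conn] \<psi> var]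
  show "0 < \<delta>" "\<delta> < 1" "0 < h" "h \<le> 1" using \<delta> h by auto
  show "0 < CARD('n)" by simp
  show "energy f \<le> (2 - \<delta>) * (LINT x|M. (f x)\<^sup>2)" if "bm M f" for f
    by (rule order_trans[OF walk_energy_le[OF that]]) (use \<delta>(3) in \<open>intro mult_right_mono; simp\<close>)
  show "0 \<le> energy f" if "bm M f" for f by (rule energy_nonneg[OF that])
  show "submarkov M smoothing" by (rule smoothing_submarkov)
  show "\<delta> \<le> smoothing (\<lambda>_. 1) x" for x using \<delta>(4) smoothing_lower[of x] by linarith
  show "smoothing f x \<le> (walk ^^ CARD('n)) f x" if "bm M f" "\<And>y. 0 \<le> f y" for f x
    by (rule smoothing_le_walk[OF that])
  show "smoothing f x \<le> \<Lambda> * (\<Lambda>\<^sup>2 / 2) ^ CARD('n) * (1 / h\<^sup>2) ^ CARD('n) * (LINT y|M. f y)" if "bm M f" "\<And>y. 0 \<le> f y" for f x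
    by (rule smoothing_le_integral[OF that])
  show "0 < Sup gap_bounds" by (rule gap(1))
  show "(LINT x|M. (u x)\<^sup>2) - (LINT x|M. u x)\<^sup>2 \<le> 1 / Sup gap_bounds * energy u" if "bm M u" for u
    by (rule gap(3)[OF that])
  show "(LINT x|M. (f x)\<^sup>2) \<le> real N * \<Lambda> * (4 ^ Suc CARD('n) * real CARD('n) * \<Lambda> ^ 5 * (real N * real CARD('n)) + 2 * (2 * \<Lambda>\<^sup>2) ^ CARD('n) * \<Lambda>\<^sup>2) *
     (y / h\<^sup>2 * energy f + (1 / y) ^ CARD('n) * (LINT x|M. \<bar>f x\<bar>)\<^sup>2)" if "bm M f" "h\<^sup>2 \<le> y" "y \<le> 1" for f y
    by (rule walk_nash[OF that])
  have "Sup gap_bounds \<le> energy \<psi> / ((LINT x|M. (\<psi> x)\<^sup>2) - (LINT x|M. \<psi> x)\<^sup>2)" by (rule gap(2))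
  also have "\<dots> \<le> (K * \<Lambda>\<^sup>2)\<^sup>2 * h\<^sup>2 / ((LINT x|M. (\<psi> x)\<^sup>2) - (LINT x|M. \<psi> x)\<^sup>2)"
    using energy_lipschitz[OF \<psi> K lip] var by (intro divide_right_mono) auto
  finally show "Sup gap_bounds \<le> (K * \<Lambda>\<^sup>2)\<^sup>2 / ((LINT x|M. (\<psi> x)\<^sup>2) - (LINT x|M. \<psi> x)\<^sup>2) * h\<^sup>2" by simp
qed

end

section \<open>Locally Lipschitz functions\<close>

definition lipschitz_near :: "('a::metric_space \<Rightarrow> 'b::metric_space) \<Rightarrow> 'a \<Rightarrow> bool" where
  "lipschitz_near f x \<longleftrightarrow> (\<exists>e>0. \<exists>K. K-lipschitz_on (ball x e) f)"

lemma lipschitz_near_cong: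
  assumes S: "open S" "x \<in> S" and eq: "\<And>y. y \<in> S \<Longrightarrow> f y = g y" and g: "lipschitz_near g x"
  shows "lipschitz_near f x"
proof -
  obtain e K where e: "0 < e" and K: "K-lipschitz_on (ball x e) g" using g unfolding lipschitz_near_def by blast
  obtain e' where e': "0 < e'" "ball x e' \<subseteq> S" using S open_contains_ball by blast
  have "K-lipschitz_on (ball x (min e e')) g" by (rule lipschitz_on_subset[OF K]) auto
  then have "K-lipschitz_on (ball x (min e e')) f"
    by (rule lipschitz_on_transform) (use e' eq in auto)
  then show ?thesis unfolding lipschitz_near_def using e e'(1) by (meson min_less_iff_conj)
qed

lemma lipschitz_near_comp:
  assumes f: "lipschitz_near f x" and g: "lipschitz_near g (f x)"
  shows "lipschitz_near (g \<circ> f) x"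
proof -
  obtain e K where e: "0 < e" and K: "K-lipschitz_on (ball x e) f" using f unfolding lipschitz_near_def by blast
  obtain e' K' where e': "0 < e'" and K': "K'-lipschitz_on (ball (f x) e') g" using g unfolding lipschitz_near_def by blast
  have "continuous_on (ball x e) f" using K by (rule lipschitz_on_continuous_on)
  then have "isCont f x" using e by (simp add: continuous_on_eq_continuous_at)
  then obtain s where s: "0 < s" "\<And>y. dist y x < s \<Longrightarrow> dist (f y) (f x) < e'"
    unfolding continuous_at_eps_delta using e' by blast
  let ?b = "ball x (min e s)"
  have "f ` ?b \<subseteq> ball (f x) e'" using s(2) by (auto simp: dist_commute)
  then have "K'-lipschitz_on (f ` ?b) g" using K' lipschitz_on_subset by blast
  moreover have "K-lipschitz_on ?b f" by (rule lipschitz_on_subset[OF K]) auto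
  ultimately have "(K' * K)-lipschitz_on ?b (g \<circ> f)" unfolding comp_def by (rule lipschitz_on_compose2[rotated])
  then show ?thesis unfolding lipschitz_near_def using e s(1) by (meson min_less_iff_conj)
qed

text \<open>\<open>Ck_on\<close> gives continuity of each directional derivative rather than of the
  derivative as an operator. Bounds for the n axis derivatives near x bound the operator norm, and
  the mean value inequality on a ball concludes.\<close>

lemma lipschitz_near_smooth:
  fixes f :: "real^'n::finite \<Rightarrow> 'b::real_normed_vector"
  assumes f: "smooth_on S f" and S: "open S" "x \<in> S"
  shows "lipschitz_near f x"
proof -
  have C1: "Ck_on (Suc 0) S f" using f by (simp add: smooth_on_def)
  define D where "D y = frechet_derivative f (at y)" for y
  have deriv: "(f has_derivative D y) (at y)" if "y \<in> S" for y
    using C1 that unfolding D_def by (simp add: frechet_derivative_works)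
  have cont: "isCont (\<lambda>y. D y v) x" for v
    using C1 S unfolding D_def by (simp add: continuous_on_eq_continuous_at)
  have "\<forall>\<^sub>F y in nhds x. \<forall>j\<in>UNIV. norm (D y (axis j 1)) < norm (D x (axis j 1)) + 1"
  proof (rule eventually_ball_finite[OF finite], rule ballI)
    fix j :: 'n
    have "((\<lambda>y. norm (D y (axis j 1))) \<longlongrightarrow> norm (D x (axis j 1))) (nhds x)"
      using cont[of "axis j 1"] by (intro tendsto_norm) (simp add: isCont_def tendsto_nhds_iff)
    then show "\<forall>\<^sub>F y in nhds x. norm (D y (axis j 1)) < norm (D x (axis j 1)) + 1"
      by (rule order_tendstoD(2)) simp
  qed
  moreover have "\<forall>\<^sub>F y in nhds x. y \<in> S" using S by (rule eventually_nhds_in_open)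
  ultimately have "\<forall>\<^sub>F y in nhds x. y \<in> S \<and> (\<forall>j. norm (D y (axis j 1)) < norm (D x (axis j 1)) + 1)"
    by eventually_elim auto
  then obtain e where e: "0 < e" "\<And>y. y \<in> ball x e \<Longrightarrow> y \<in> S \<and> (\<forall>j. norm (D y (axis j 1)) < norm (D x (axis j 1)) + 1)"
    unfolding eventually_nhds_metric by (metis dist_commute mem_ball)
  define K where "K = (\<Sum>j\<in>UNIV. norm (D x (axis j 1)) + 1)"
  have K0: "0 \<le> K" unfolding K_def by (intro sum_nonneg) auto
  have on: "onorm (D y) \<le> K" if y: "y \<in> ball x e" for y
  proof (rule onorm_le)
    fix v :: "real^'n"
    interpret linear "D y" using deriv e(2)[OF y] has_derivative_linear by blast
    have "D y v = D y (\<Sum>j\<in>UNIV. v $ j *\<^sub>R axis j 1)"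
      using basis_expansion[of v] by (simp add: scalar_mult_eq_scaleR)
    also have "\<dots> = (\<Sum>j\<in>UNIV. v $ j *\<^sub>R D y (axis j 1))" by (simp add: sum scale)
    also have "norm \<dots> \<le> (\<Sum>j\<in>UNIV. norm (v $ j *\<^sub>R D y (axis j 1)))" by (rule norm_sum)
    also have "\<dots> \<le> (\<Sum>j\<in>UNIV. norm v * (norm (D x (axis j 1)) + 1))"
    proof (rule sum_mono)
      fix j
      have "\<bar>v $ j\<bar> \<le> norm v" by (rule component_le_norm_cart)
      moreover have "norm (D y (axis j 1)) \<le> norm (D x (axis j 1)) + 1" using e(2)[OF y] less_imp_le by blast
      ultimately show "norm (v $ j *\<^sub>R D y (axis j 1)) \<le> norm v * (norm (D x (axis j 1)) + 1)"
        by (simp add: mult_mono)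
    qed
    also have "\<dots> = K * norm v" by (simp only: K_def sum_distrib_left mult.commute)
    finally show "norm (D y v) \<le> K * norm v" .
  qed
  have "K-lipschitz_on (ball x e) f"
  proof (rule lipschitz_onI[OF _ K0])
    fix y z assume yz: "y \<in> ball x e" "z \<in> ball x e"
    have "norm (f y - f z) \<le> K * norm (y - z)"
    proof (rule differentiable_bound[OF convex_ball _ on yz])
      show "(f has_derivative D y) (at y within ball x e)" if "y \<in> ball x e" for y
        using deriv e(2)[OF that] has_derivative_at_withinI by blast
    qed
    then show "dist (f y) (f z) \<le> K * dist y z" by (simp add: dist_norm)
  qed
  then show ?thesis unfolding lipschitz_near_def using e(1) by blast
qed

text \<open>Points closer than a Lebesgue number \<delta> of the cover share a ball with a Lipschitz
  bound. For all others the slope 1 / \<delta> is enough, since the values lie in [0, 1].\<close>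

lemma lipschitz_near_compact:
  fixes f :: "'a::metric_space \<Rightarrow> real"
  assumes S: "compact S" and f: "\<And>x. x \<in> S \<Longrightarrow> lipschitz_near f x" and bd: "\<And>x. x \<in> S \<Longrightarrow> 0 \<le> f x \<and> f x \<le> 1"
  shows "\<exists>K\<ge>0. \<forall>x\<in>S. \<forall>y\<in>S. \<bar>f x - f y\<bar> \<le> K * dist x y"
proof -
  have "\<exists>e K. \<forall>x\<in>S. 0 < e x \<and> (K x)-lipschitz_on (ball x (e x)) f"
    using f unfolding lipschitz_near_def by metis
  then obtain e K where eK: "\<And>x. x \<in> S \<Longrightarrow> 0 < e x" "\<And>x. x \<in> S \<Longrightarrow> (K x)-lipschitz_on (ball x (e x)) f" by blast
  have "S \<subseteq> (\<Union>x\<in>S. ball x (e x))" using eK(1) by auto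
  with S obtain T where T: "T \<subseteq> S" "finite T" "S \<subseteq> (\<Union>x\<in>T. ball x (e x))"
    using compactE_image[of S S "\<lambda>x. ball x (e x)"] by (metis open_ball)
  obtain \<delta> where \<delta>: "0 < \<delta>" "\<And>x. x \<in> S \<Longrightarrow> \<exists>G\<in>(\<lambda>x. ball x (e x)) ` T. ball x \<delta> \<subseteq> G"
    using Heine_Borel_lemma[OF S T(3)] by auto
  have Knn: "0 \<le> K x" if "x \<in> T" for x using lipschitz_on_nonneg[OF eK(2)] that T(1) by auto
  define K0 where "K0 = 1 / \<delta> + (\<Sum>x\<in>T. K x)"
  have K0: "1 / \<delta> \<le> K0" "0 \<le> K0" using \<delta>(1) Knn by (auto simp: K0_def sum_nonneg)
  have "\<bar>f x - f y\<bar> \<le> K0 * dist x y" if x: "x \<in> S" and y: "y \<in> S" for x y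
  proof (cases "dist x y < \<delta>")
    case True
    obtain t where t: "t \<in> T" "ball x \<delta> \<subseteq> ball t (e t)" using \<delta>(2)[OF x] by auto
    have "x \<in> ball x \<delta>" "y \<in> ball x \<delta>" using True \<delta>(1) by auto
    then have "x \<in> ball t (e t)" "y \<in> ball t (e t)" using t(2) by blast+
    then have "dist (f x) (f y) \<le> K t * dist x y" using lipschitz_onD[OF eK(2)] t(1) T(1) by blast
    also have "K t \<le> K0"
      using member_le_sum[of t T K] t(1) Knn T(2) \<delta>(1) by (simp add: K0_def add_increasing)
    finally show ?thesis by (simp add: dist_real_def mult_right_mono)
  next
    case False
    have "\<bar>f x - f y\<bar> \<le> 1" using bd[OF x] bd[OF y] by linarith
    also have "1 \<le> 1 / \<delta> * dist x y" using False \<delta>(1) by simp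
    also have "\<dots> \<le> K0 * dist x y" using K0 by (intro mult_right_mono) auto
    finally show ?thesis .
  qed
  then show ?thesis using K0(2) by blast
qed

lemma smooth_on_continuous: "smooth_on S f \<Longrightarrow> continuous_on S f"
  unfolding smooth_on_def by (metis Ck_on.simps(1))

lemma open_image_of_inverse:
  assumes V: "open V" "continuous_on V g" and S: "f ` S = V" "\<And>x. x \<in> S \<Longrightarrow> g (f x) = x"
    and W: "open W" "W \<subseteq> S"
  shows "open (f ` W)"
proof -
  have "f ` W = V \<inter> g -` W"
  proof
    show "f ` W \<subseteq> V \<inter> g -` W" using S W(2) by auto
    show "V \<inter> g -` W \<subseteq> f ` W"
    proof
      fix v assume v: "v \<in> V \<inter> g -` W"
      then obtain x where "x \<in> S" "v = f x" using S(1) by auto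
      then show "v \<in> f ` W" using v S(2) by auto
    qed
  qed
  then show ?thesis using continuous_on_open_vimage[OF V(1)] V(2) W(1) by (metis Int_commute)
qed

text \<open>Half-way between the two boxes lies a compact one, on which \<open>d\<close> attains
  positive bounds; \<open>a\<close> is the least difference between its half-sides and those of the
  inner box.\<close>

lemma centered_box_uniform_bounds:
  fixes d :: "real^'n::finite \<Rightarrow> real"
  assumes l: "\<And>j. 0 < l j" "\<And>j. l j < L j"
    and d: "continuous_on (centered_box L) d" "\<And>w. w \<in> centered_box L \<Longrightarrow> 0 < d w"
  shows "\<exists>\<Lambda> a. 1 \<le> \<Lambda> \<and> 0 < a \<and> (\<forall>w\<in>centered_box l. \<forall>j s. \<bar>s\<bar> \<le> a \<longrightarrow>
        w + axis j s \<in> centered_box L \<and> 1 / \<Lambda> \<le> d (w + axis j s) \<and> d (w + axis j s) \<le> \<Lambda>)"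
proof -
  define m where "m j = (l j + L j) / 2" for j
  define C where "C = cbox (\<chi> j. - m j) (\<chi> j. m j)"
  have C: "C = {w. \<forall>j. - m j \<le> w $ j \<and> w $ j \<le> m j}" by (auto simp: C_def mem_box_cart)
  have ml: "l j < m j" "m j < L j" "0 < m j" for j using l[of j] by (auto simp: m_def)
  have CL: "C \<subseteq> centered_box L"
  proof
    fix w assume w: "w \<in> C"
    have "- L j < w $ j \<and> w $ j < L j" for j using w ml[of j] unfolding C by (auto dest!: spec[of _ j])
    then show "w \<in> centered_box L" by (simp add: centered_box_def)
  qed
  define a where "a = Min (range (\<lambda>j. m j - l j))"
  have a: "0 < a" using ml by (simp add: a_def)
  have al: "a \<le> m j - l j" for j unfolding a_def by (rule Min_le) auto
  have inC: "w + axis j s \<in> C" if w: "w \<in> centered_box l" and s: "\<bar>s\<bar> \<le> a" for w j s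
  proof -
    have "- m i \<le> (w + axis j s) $ i \<and> (w + axis j s) $ i \<le> m i" for i
    proof -
      have "- l i < w $ i" "w $ i < l i" using w by (auto simp: centered_box_def)
      moreover have "\<bar>(axis j s :: real^'n) $ i\<bar> \<le> a" using s a by (simp add: axis_def)
      ultimately show ?thesis using al[of i] by (simp add: abs_le_iff)
    qed
    then show ?thesis by (simp add: C)
  qed
  have dC: "continuous_on C d" by (rule continuous_on_subset[OF d(1) CL])
  have ne: "C \<noteq> {}" using ml(3) by (auto simp: C less_imp_le intro!: exI[of _ 0])
  have cC: "compact C" by (simp add: C_def)
  obtain x y where x: "x \<in> C" "\<And>w. w \<in> C \<Longrightarrow> d x \<le> d w" and y: "y \<in> C" "\<And>w. w \<in> C \<Longrightarrow> d w \<le> d y"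
    using continuous_attains_inf[OF cC ne dC] continuous_attains_sup[OF cC ne dC] by metis
  have dx: "0 < d x" using x(1) CL d(2) by auto
  define \<Lambda> where "\<Lambda> = max 1 (max (1 / d x) (d y))"
  have \<Lambda>: "1 \<le> \<Lambda>" "1 / d x \<le> \<Lambda>" "d y \<le> \<Lambda>" by (auto simp: \<Lambda>_def)
  have "1 / \<Lambda> \<le> d x" using \<Lambda>(1,2) dx by (simp add: field_simps)
  then have "w + axis j s \<in> centered_box L \<and> 1 / \<Lambda> \<le> d (w + axis j s) \<and> d (w + axis j s) \<le> \<Lambda>"
    if "w \<in> centered_box l" "\<bar>s\<bar> \<le> a" for w j s
    using inC[OF that, of j] x(2) y(2) \<Lambda>(3) CL by (meson order_trans subsetD)
  then show ?thesis using \<Lambda>(1) a by blast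
qed

section \<open>The walk on subunit cubes\<close>

locale cube_setting =
  fixes atl :: "('m::{t2_space, second_countable_topology}, 'n::{finite, linorder}) chart set"
    and g :: "('m, 'n) metric_tensor"
    and \<epsilon> :: real
    and L :: nat and p :: "nat \<Rightarrow> 'm" and r :: "nat \<Rightarrow> real" and nc :: "nat \<Rightarrow> ('m, 'n) chart"
    and a :: "nat \<Rightarrow> 'n matrix_field"
    and cs K \<rho>0 \<rho> :: real
    and cube :: "real \<Rightarrow> 'm \<Rightarrow> 'n cube"
    and N :: nat and xs :: "nat \<Rightarrow> 'm" and q :: "nat \<Rightarrow> 'n cube"
    and \<psi> :: "nat \<Rightarrow> 'm \<Rightarrow> real"
    and \<mu> :: "'m measure"
    and dens :: "nat \<Rightarrow> (real, 'n) vec \<Rightarrow> real"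
    and \<tau> :: "nat \<Rightarrow> 'n \<Rightarrow> real"
  assumes manifold: "closed_connected_riemannian_manifold atl g"
    and ball_cover: "geodesic_ball_cover atl g L p r nc"
    and cubes: "cube_family atl g \<epsilon> L p r nc a cs K \<rho>0 cube"
    and rho: "0 < \<rho>" "\<rho> \<le> \<rho>0"
    and q_def: "\<And>i. q i = cube \<rho> (xs i)"
    and cubes_cover: "(\<Union>i<N. subunit_cube nc (q i) \<rho>) = UNIV"
    and partition: "partition_of_unity atl N (\<lambda>k. subunit_cube nc (q k) (cs * \<rho>)) \<psi>"
    and mu_def: "\<mu> = mu nc cs \<rho> N q \<psi>"
    and densities: "cube_densities nc cs \<rho> N q \<mu> dens"
    and rescaling: "\<And>i j. i < N \<Longrightarrow> 0 < \<tau> i j"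
begin

definition par :: "nat \<Rightarrow> (real, 'n) vec \<Rightarrow> 'm" where "par i = cube_param nc (q i)"

definition len :: "nat \<Rightarrow> 'n \<Rightarrow> real" where "len i j = cube_const (q i) j * \<rho> powr cube_exp (q i) j"

definition Len :: "nat \<Rightarrow> 'n \<Rightarrow> real" where "Len i j = cube_const (q i) j * (cs * \<rho>) powr cube_exp (q i) j"

definition rate :: "nat \<Rightarrow> 'n \<Rightarrow> real" where "rate i j = \<tau> i j * cube_const (q i) j * \<rho> powr cube_exp (q i) j"

lemma block_eq: "block (q i) \<rho> = centered_box (len i)" "block (q i) (cs * \<rho>) = centered_box (Len i)"
  by (auto simp: block_def centered_box_def len_def Len_def)

lemma subunit_cube_eq: "subunit_cube nc (q i) \<rho> = par i ` centered_box (len i)"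
  "subunit_cube nc (q i) (cs * \<rho>) = par i ` centered_box (Len i)"
  by (simp_all add: subunit_cube_def block_eq par_def)

lemma cs: "1 < cs" using cubes by (simp add: cube_family_def)

lemma is_cube: "is_cube_at atl g \<epsilon> L p r nc a cs K \<rho> (xs i) (q i)"
  using cubes rho by (simp add: cube_family_def q_def)

abbreviation "idx i \<equiv> cube_idx (q i)"
abbreviation "\<Phi> i \<equiv> cube_map (q i)"
abbreviation "B i \<equiv> centered_box (Len i)"

lemma cube_facts:
  "idx i < L" "0 < cube_const (q i) j" "1 \<le> cube_exp (q i) j"
  "smooth_on (B i) (\<Phi> i)" "inj_on (\<Phi> i) (B i)" "open (\<Phi> i ` B i)" "smooth_on (\<Phi> i ` B i) (inv_into (B i) (\<Phi> i))"
  "\<Phi> i ` B i \<subseteq> snd (nc (idx i)) ` riem_ball atl g (p (idx i)) (r (idx i))"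
proof -
  note * = is_cube[of i, unfolded is_cube_at_def Let_def block_eq]
  show "idx i < L" "0 < cube_const (q i) j"
    "smooth_on (B i) (\<Phi> i)" "inj_on (\<Phi> i) (B i)" "open (\<Phi> i ` B i)" "smooth_on (\<Phi> i ` B i) (inv_into (B i) (\<Phi> i))"
    "\<Phi> i ` B i \<subseteq> snd (nc (idx i)) ` riem_ball atl g (p (idx i)) (r (idx i))"
    using * by blast+
  have "mono (cube_exp (q i))" "cube_exp (q i) (Min UNIV) = 1" using * by blast+
  moreover have "Min UNIV \<le> j" by simp
  ultimately show "1 \<le> cube_exp (q i) j" by (metis monoD)
qed

lemma normal_charts:
  assumes "k < L"
  shows "nc k \<in> max_atlas atl" "open (fst (nc k))" "open (chart_img (nc k))"
    "homeomorphism (fst (nc k)) (chart_img (nc k)) (snd (nc k)) (chart_inv (nc k))"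
    "riem_ball atl g (p k) (r k) \<subseteq> fst (nc k)"
proof -
  have *: "normal_chart atl g (p k) (nc k)" "closure (riem_ball atl g (p k) (r k)) \<subseteq> fst (nc k)"
    using ball_cover assms by (auto simp: geodesic_ball_cover_def)
  then show m: "nc k \<in> max_atlas atl" by (simp add: normal_chart_def)
  then have "is_chart (nc k)" by (simp add: max_atlas_def)
  then show "open (fst (nc k))" "open (chart_img (nc k))"
    "homeomorphism (fst (nc k)) (chart_img (nc k)) (snd (nc k)) (chart_inv (nc k))"
    by (simp_all add: is_chart_def)
  show "riem_ball atl g (p k) (r k) \<subseteq> fst (nc k)" using *(2) closure_subset by blast
qed

lemma \<Phi>_img: "\<Phi> i ` B i \<subseteq> chart_img (nc (idx i))"
  using cube_facts(8)[of i] normal_charts(5)[OF cube_facts(1)[of i]] unfolding chart_img_def by blast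

lemma par_in_chart: "w \<in> B i \<Longrightarrow> par i w \<in> fst (nc (idx i))" "w \<in> B i \<Longrightarrow> snd (nc (idx i)) (par i w) = \<Phi> i w"
proof -
  assume w: "w \<in> B i"
  then have "\<Phi> i w \<in> chart_img (nc (idx i))" using \<Phi>_img by blast
  then show "par i w \<in> fst (nc (idx i))" "snd (nc (idx i)) (par i w) = \<Phi> i w"
    using normal_charts(4)[OF cube_facts(1)[of i]] unfolding par_def cube_param_def homeomorphism_def by auto
qed

lemma par_inj: "inj_on (par i) (B i)"
proof (rule inj_onI)
  fix v w assume "v \<in> B i" "w \<in> B i" "par i v = par i w"
  then show "v = w" using par_in_chart(2)[of _ i] inj_onD[OF cube_facts(5)[of i]] by metis
qed

lemma par_continuous: "continuous_on (B i) (par i)"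
  unfolding par_def cube_param_def
proof (rule continuous_on_compose)
  show "continuous_on (B i) (\<Phi> i)" by (rule smooth_on_continuous[OF cube_facts(4)])
  have "continuous_on (chart_img (nc (idx i))) (chart_inv (nc (idx i)))"
    using normal_charts(4)[OF cube_facts(1)[of i]] by (simp add: homeomorphism_def)
  then show "continuous_on (\<Phi> i ` B i) (chart_inv (nc (idx i)))"
    by (rule continuous_on_subset) (rule \<Phi>_img)
qed

lemma par_open:
  assumes W: "open W" "W \<subseteq> B i" shows "open (par i ` W)"
proof -
  have 1: "open (\<Phi> i ` W)"
    by (rule open_image_of_inverse[OF cube_facts(6) smooth_on_continuous[OF cube_facts(7)] refl _ W])
       (rule inv_into_f_f[OF cube_facts(5)])
  note h = normal_charts(4)[OF cube_facts(1)[of i]]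
  have "open (chart_inv (nc (idx i)) ` (\<Phi> i ` W))"
  proof (rule open_image_of_inverse[OF _ _ _ _ 1])
    show "open (fst (nc (idx i)))" by (rule normal_charts(2)[OF cube_facts(1)])
    show "continuous_on (fst (nc (idx i))) (snd (nc (idx i)))"
      "chart_inv (nc (idx i)) ` chart_img (nc (idx i)) = fst (nc (idx i))"
      using h by (auto simp: homeomorphism_def)
    show "snd (nc (idx i)) (chart_inv (nc (idx i)) x) = x" if "x \<in> chart_img (nc (idx i))" for x
      using h that by (auto simp: homeomorphism_def)
    show "\<Phi> i ` W \<subseteq> chart_img (nc (idx i))" using W(2) \<Phi>_img by blast
  qed
  then show ?thesis by (simp add: par_def cube_param_def image_comp)
qed

lemma lengths: "0 < len i j" "len i j < Len i j"
proof -
  show "0 < len i j" using cube_facts(2)[of i j] rho by (simp add: len_def)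
  have "\<rho> powr cube_exp (q i) j < (cs * \<rho>) powr cube_exp (q i) j"
    using rho cs cube_facts(3)[of i j] by (intro powr_less_mono2) auto
  then show "len i j < Len i j" using cube_facts(2)[of i j] by (simp add: len_def Len_def)
qed

lemma rate_pos: "i < N \<Longrightarrow> 0 < rate i j"
  using rescaling[of i j] cube_facts(2)[of i j] rho by (simp add: rate_def)

lemma N_pos: "0 < N"
  using cubes_cover by (cases N) auto

lemma dens_facts:
  assumes i: "i < N"
  shows "continuous_on (B i) (dens i)" "\<And>w. w \<in> B i \<Longrightarrow> 0 < dens i w"
    "\<And>X. X \<in> sets borel \<Longrightarrow> X \<subseteq> B i \<Longrightarrow> emeasure \<mu> (par i ` X) = (\<integral>\<^sup>+ w \<in> X. ennreal (dens i w) \<partial>lborel)"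
  using densities i smooth_on_continuous[of "B i" "dens i"] unfolding cube_densities_def block_eq par_def by auto

lemma sets_\<mu>: "sets \<mu> = sets borel"
proof -
  have "sigma_sets UNIV (sets (borel :: 'm measure)) = sets borel"
    using sets.sigma_sets_eq[of "borel :: 'm measure"] by simp
  then show ?thesis by (simp add: mu_def Defs.mu_def unnormalized_mu_def)
qed

lemma space_\<mu>: "space \<mu> = UNIV"
  using sets_eq_imp_space_eq[OF sets_\<mu>] by simp

text \<open>Total mass 0 or \<infinity> of the unnormalized measure would make the scaled one
  vanish. The positive density on a dilated cube excludes this, so \<open>prob_\<mu>\<close> gets
  both cases from this one fact.\<close>

lemma emeasure_\<mu>_pos: "emeasure \<mu> UNIV \<noteq> 0"
proof
  assume 0: "emeasure \<mu> UNIV = 0"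
  have "emeasure \<mu> (par 0 ` B 0) \<le> emeasure \<mu> UNIV" by (rule emeasure_mono) (auto simp: sets_\<mu>)
  then have "(\<integral>\<^sup>+ w \<in> B 0. ennreal (dens 0 w) \<partial>lborel) = 0"
    using 0 dens_facts(3)[OF N_pos, of "B 0"] by simp
  moreover have "(\<lambda>w. if w \<in> B 0 then dens 0 w else 0) \<in> borel_measurable borel"
    using dens_facts(1)[OF N_pos] by (intro borel_measurable_continuous_on_if) auto
  then have m: "(\<lambda>w. ennreal (if w \<in> B 0 then dens 0 w else 0)) \<in> borel_measurable lborel" by simp
  moreover have "(\<integral>\<^sup>+ w \<in> B 0. ennreal (dens 0 w) \<partial>lborel) = (\<integral>\<^sup>+ w. ennreal (if w \<in> B 0 then dens 0 w else 0) \<partial>lborel)"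
    by (intro nn_integral_cong) auto
  ultimately have "AE w in lborel. ennreal (if w \<in> B 0 then dens 0 w else 0) = 0"
    using nn_integral_0_iff_AE[OF m] by simp
  then have "AE w in lborel. w \<notin> B 0"
  proof (rule AE_mp, intro AE_I2 impI)
    fix w assume "ennreal (if w \<in> B 0 then dens 0 w else 0) = 0"
    then show "w \<notin> B 0" using dens_facts(2)[OF N_pos, of w] by (auto split: if_splits)
  qed
  then have "emeasure lborel (B 0) = 0"
    by (subst (asm) AE_iff_measurable[of "B 0"]) auto
  moreover have "0 \<in> B 0" using lengths[of 0] by (auto simp: centered_box_def intro: less_trans)
  ultimately show False using emeasure_lborel_open_pos[OF open_centered_box, of "Len 0"] by auto
qed

lemma prob_\<mu>: "prob_space \<mu>"
proof
  let ?e = "emeasure (unnormalized_mu nc cs \<rho> N q \<psi>) UNIV"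
  have e: "emeasure \<mu> UNIV = 1 / ?e * ?e" by (simp add: mu_def Defs.mu_def)
  have "?e \<noteq> 0" using e emeasure_\<mu>_pos by auto
  moreover have "?e \<noteq> \<top>" using e emeasure_\<mu>_pos by auto
  ultimately have "1 / ?e * ?e = 1" by (simp add: ennreal_divide_times ennreal_divide_self less_top zero_less_iff_neq_zero)
  then show "emeasure \<mu> (space \<mu>) = 1" using e by (simp add: space_\<mu>)
qed

text \<open>\<Lambda> and \<open>b\<close> come before h: the density bounds, half-sides and rates
  of N cubes are finitely many positive numbers and have a common bound.\<close>

lemma cube_walk_exists:
  "\<exists>\<Lambda> b. 1 \<le> \<Lambda> \<and> 0 < b \<and> (\<forall>h. 0 < h \<longrightarrow> h \<le> 1 \<longrightarrow> h \<le> 1 / \<Lambda> \<longrightarrow> h \<le> b / \<Lambda>\<^sup>2 \<longrightarrow>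
     cube_walk \<mu> N par len Len rate dens \<Lambda> b h)"
proof -
  let ?P = "\<lambda>i \<Lambda> a. 1 \<le> \<Lambda> \<and> 0 < a \<and> (\<forall>w\<in>centered_box (len i). \<forall>j s. \<bar>s\<bar> \<le> a \<longrightarrow>
        w + axis j s \<in> B i \<and> 1 / \<Lambda> \<le> dens i (w + axis j s) \<and> dens i (w + axis j s) \<le> \<Lambda>)"
  have "\<exists>\<Lambda> a. \<forall>i<N. ?P i (\<Lambda> i) (a i)"
    using centered_box_uniform_bounds[OF lengths dens_facts(1,2)] by metis
  then obtain \<Lambda>' a' where *: "\<And>i. i < N \<Longrightarrow> ?P i (\<Lambda>' i) (a' i)" by blast
  let ?S = "\<lambda>f. (\<lambda>(i, j). f i j) ` ({..<N} \<times> (UNIV :: 'n set))"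
  have "bdd_above (insert 1 (\<Lambda>' ` {..<N} \<union> ?S rate \<union> ?S (\<lambda>i j. 1 / rate i j) \<union> ?S len \<union> ?S (\<lambda>i j. 1 / len i j)))"
    by (rule bdd_above_finite) auto
  then obtain \<Lambda> where "\<forall>x\<in>insert 1 (\<Lambda>' ` {..<N} \<union> ?S rate \<union> ?S (\<lambda>i j. 1 / rate i j) \<union> ?S len \<union> ?S (\<lambda>i j. 1 / len i j)). x \<le> \<Lambda>"
    by (auto simp: bdd_above_def)
  then have \<Lambda>: "1 \<le> \<Lambda>" "\<And>i. i < N \<Longrightarrow> \<Lambda>' i \<le> \<Lambda>"
    and b: "\<And>i j. i < N \<Longrightarrow> rate i j \<le> \<Lambda> \<and> 1 / rate i j \<le> \<Lambda> \<and> len i j \<le> \<Lambda> \<and> 1 / len i j \<le> \<Lambda>"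
    by (auto simp: ball_Un)
  define b where "b = Min (a' ` {..<N})"
  have b0: "0 < b" "\<And>i. i < N \<Longrightarrow> b \<le> a' i"
    using * N_pos by (auto simp: b_def Min_gr_iff lessThan_empty_iff)
  have inv: "1 / \<Lambda> \<le> x" if "1 / x \<le> \<Lambda>" "0 < x" for x using that \<Lambda>(1) by (simp add: field_simps)
  have "cube_walk \<mu> N par len Len rate dens \<Lambda> b h"
    if h: "0 < h" "h \<le> 1" "h \<le> 1 / \<Lambda>" "h \<le> b / \<Lambda>\<^sup>2" for h
  proof -
    show ?thesis
    proof (intro cube_walk.intro cube_walk_axioms.intro prob_\<mu>)
      fix i assume i: "i < N"
      show "cube_chart (par i) (len i) (Len i) (dens i) \<mu> \<Lambda> b"
      proof unfold_locales
        fix w j s assume w: "w \<in> centered_box (len i)" "\<bar>s\<bar> \<le> b"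
        have "\<bar>s\<bar> \<le> a' i" using w(2) b0(2)[OF i] by linarith
        then have 1: "w + axis j s \<in> B i" "1 / \<Lambda>' i \<le> dens i (w + axis j s)" "dens i (w + axis j s) \<le> \<Lambda>' i" "1 \<le> \<Lambda>' i"
          using *[OF i] w(1) by blast+
        have "1 / \<Lambda> \<le> 1 / \<Lambda>' i" using 1(4) \<Lambda>(2)[OF i] by (intro divide_left_mono) auto
        then show "w + axis j s \<in> B i \<and> 1 / \<Lambda> \<le> dens i (w + axis j s) \<and> dens i (w + axis j s) \<le> \<Lambda>"
          using 1 \<Lambda>(2)[OF i] by linarith
      qed (use lengths par_inj par_continuous par_open sets_\<mu> dens_facts[OF i] \<Lambda>(1) b0(1) in auto)
      show "1 / \<Lambda> \<le> rate i j" "rate i j \<le> \<Lambda>" "1 / \<Lambda> \<le> len i j" "len i j \<le> \<Lambda>" for j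
        using b[OF i, of j] inv rate_pos[OF i, of j] lengths(1)[of i j] by auto
    qed (use h N_pos cubes_cover in \<open>auto simp: subunit_cube_eq\<close>)
  qed
  then show ?thesis using \<Lambda>(1) b0(1) by blast
qed

lemma flow_eq:
  assumes W: "cube_walk \<mu> N par len Len rate dens \<Lambda> b h" and i: "i < N"
    and x: "x \<in> par i ` centered_box (len i)" and t: "\<bar>t\<bar> < h"
  defines "w \<equiv> cube_chart.coord (par i) (Len i) x"
  shows "flow_rel nc cs \<rho> q dens \<tau> i j t x y \<longleftrightarrow> y = par i (w + axis j (cube_chart.pos (Len i) (dens i) b j (rate i j) w t))"
proof -
  interpret W: cube_walk \<mu> N par len Len rate dens \<Lambda> b h by (rule W)
  interpret C: cube_chart "par i" "len i" "Len i" "dens i" \<mu> \<Lambda> b by (rule W.chart[OF i])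
  have w: "w \<in> centered_box (len i)" "par i w = x" using C.coord_Q[OF x] by (simp_all add: w_def)
  have "\<bar>t\<bar> < b / (\<Lambda> * rate i j)" using t W.h_le(1)[OF i, of j] by linarith
  note C.flows_to_pos[OF w(1) W.c_pos[OF i] this]
  then show ?thesis
    unfolding flow_rel_def block_eq par_def[symmetric] X_coord_def[abs_def] rate_def[symmetric] w(2) .
qed

lemma flow_pos:
  assumes W: "cube_walk \<mu> N par len Len rate dens \<Lambda> b h" and i: "i < N"
    and x: "x \<in> par i ` centered_box (len i)" and t: "\<bar>t\<bar> < h"
  defines "w \<equiv> cube_chart.coord (par i) (Len i) x"
  shows "flow nc cs \<rho> q dens \<tau> i j t x = par i (w + axis j (cube_chart.pos (Len i) (dens i) b j (rate i j) w t))"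
  unfolding flow_def flow_eq[OF W i x t] w_def by (rule the_eq_trivial)

lemma flows_defined:
  assumes W: "cube_walk \<mu> N par len Len rate dens \<Lambda> b h"
  shows "flows_defined nc cs \<rho> N q dens \<tau> h"
  unfolding flows_defined_def subunit_cube_eq
proof (intro allI impI ballI)
  fix i j x t assume "i < N" "x \<in> par i ` centered_box (len i)" "\<bar>t\<bar> < h"
  from flow_eq[OF W this] show "\<exists>!y. flow_rel nc cs \<rho> q dens \<tau> i j t x y" by simp
qed

lemma S_op_eq_walk:
  fixes f :: "'m \<Rightarrow> 'b::{banach, second_countable_topology}"
  assumes W: "cube_walk \<mu> N par len Len rate dens \<Lambda> b h" and f: "f \<in> borel_measurable borel"
  shows "S_op nc cs \<rho> N q dens \<tau> h f = kernel_family.walk (cube_walk.ix N) (cube_walk.\<kappa> par len Len rate dens h) f"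
proof
  fix x
  interpret W: cube_walk \<mu> N par len Len rate dens \<Lambda> b h by (rule W)
  have "S_field (par i ` centered_box (len i)) (flow nc cs \<rho> q dens \<tau> i j) h f x = W.step (i, j) f x" if i: "i < N" for i j
  proof -
    interpret C: cube_chart "par i" "len i" "Len i" "dens i" \<mu> \<Lambda> b by (rule W.chart[OF i])
    have "S_field C.Q (flow nc cs \<rho> q dens \<tau> i j) h f x =
        (1 - measure (C.ker j (rate i j) h x) UNIV) *\<^sub>R f x + (LINT y|C.ker j (rate i j) h x. f y)"
      by (rule C.S_field_eq_ker[OF f W.c_pos[OF i] W.h(1) W.h_le(1)[OF i]]) (rule flow_pos[OF W i])
    then show ?thesis
      unfolding W.step_def W.mass_def unfolding W.\<kappa>_def prod.case .
  qed
  then have "(\<Sum>i<N. \<Sum>j\<in>UNIV. S_field (par i ` centered_box (len i)) (flow nc cs \<rho> q dens \<tau> i j) h f x)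
      = (\<Sum>i<N. \<Sum>j\<in>UNIV. W.step (i, j) f x)" by (intro sum.cong refl) auto
  also have "\<dots> = (\<Sum>p\<in>W.ix. W.step p f x)"
    by (simp add: W.ix_def sum.cartesian_product)
  finally show "S_op nc cs \<rho> N q dens \<tau> h f x = W.walk f x"
    by (simp add: S_op_def subunit_cube_eq W.walk_def W.card_ix mult.commute)
qed

lemma markov_kernel_bound:
  assumes W: "cube_walk \<mu> N par len Len rate dens \<Lambda> b h"
    and bound: "\<And>X. X \<in> sets \<mu> \<Longrightarrow>
      \<bar>(kernel_family.walk (cube_walk.ix N) (cube_walk.\<kappa> par len Len rate dens h) ^^ k) (indicat_real X) x - measure \<mu> X\<bar> \<le> D"
  shows "tv_dist (markov_kernel (S_op nc cs \<rho> N q dens \<tau> h ^^ k) x) \<mu> \<le> D"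
proof -
  interpret W: cube_walk \<mu> N par len Len rate dens \<Lambda> b h by (rule W)
  let ?S = "S_op nc cs \<rho> N q dens \<tau> h :: ('m \<Rightarrow> real) \<Rightarrow> 'm \<Rightarrow> real"
  have Sk: "(?S ^^ k) f = (W.walk ^^ k) f" if f: "bm \<mu> f" for f k
  proof (induction k)
    case (Suc k)
    have "bm \<mu> ((W.walk ^^ k) f)" by (rule submarkov_bm[OF submarkov_funpow[OF W.walk_submarkov] f])
    then show ?case using S_op_eq_walk[OF W W.bm_borel] Suc by simp
  qed simp
  have sg: "sigma_sets UNIV (sets (borel :: 'm measure)) = sets borel"
    using sets.sigma_sets_eq[of "borel :: 'm measure"] by simp
  have mk: "markov_kernel (?S ^^ k) x = measure_of UNIV (sets \<mu>) (\<lambda>X. ennreal ((W.walk ^^ k) (indicat_real X) x))"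
    unfolding markov_kernel_def sets_\<mu>
  proof (rule measure_of_eq)
    fix X assume "X \<in> sigma_sets UNIV (sets (borel :: 'm measure))"
    then have "bm \<mu> (indicat_real X)" unfolding sg by (intro bm_indicator) (simp add: sets_\<mu>)
    from Sk[OF this] show "ennreal ((?S ^^ k) (indicat_real X) x) = ennreal ((W.walk ^^ k) (indicat_real X) x)" by simp
  qed auto
  note m = submarkov_measure[OF submarkov_funpow[OF W.walk_submarkov, of k] space_\<mu>, where x=x, folded mk]
  show ?thesis
    unfolding tv_dist_def m(1)
  proof (rule cSUP_least)
    fix X assume X: "X \<in> sets \<mu>"
    have "0 \<le> (W.walk ^^ k) (indicat_real X) x"
      by (rule submarkov_nonneg[OF submarkov_funpow[OF W.walk_submarkov] bm_indicator[OF X]]) simp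
    then have "measure (markov_kernel (?S ^^ k) x) X = (W.walk ^^ k) (indicat_real X) x"
      using m(2)[OF X] by (simp add: measure_def)
    then show "\<bar>measure (markov_kernel (?S ^^ k) x) X - measure \<mu> X\<bar> \<le> D" using bound[OF X] by simp
  qed (use sets.sets_into_space in auto)
qed

lemma spectral_gap_eq:
  assumes W: "cube_walk \<mu> N par len Len rate dens \<Lambda> b h"
  shows "spectral_gap \<mu> (S_op nc cs \<rho> N q dens \<tau> h) =
    Sup (kernel_family.gap_bounds \<mu> (cube_walk.ix N) (cube_walk.\<kappa> par len Len rate dens h))"
proof -
  interpret W: cube_walk \<mu> N par len Len rate dens \<Lambda> b h by (rule W)
  have "S_op nc cs \<rho> N q dens \<tau> h u = W.walk u" if "u \<in> L2 \<mu>" for u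
  proof (rule S_op_eq_walk[OF W])
    have "u \<in> borel_measurable \<mu>" using that by (simp add: L2_def)
    then show "u \<in> borel_measurable borel" unfolding measurable_cong_sets[OF sets_\<mu> refl] .
  qed
  then show ?thesis unfolding spectral_gap_def W.gap_bounds_def by (simp cong: ball_cong)
qed

end

section \<open>A Lipschitz test function from the partition of unity\<close>

context cube_setting
begin

lemma atlas: "c \<in> atl \<Longrightarrow> is_chart c" "(\<Union>c\<in>atl. fst c) = UNIV"
  using manifold by (auto simp: closed_connected_riemannian_manifold_def smooth_atlas_def)

lemma is_chart_facts:
  assumes "is_chart c"
  shows "open (fst c)" "open (chart_img c)" "continuous_on (fst c) (snd c)" "continuous_on (chart_img c) (chart_inv c)"
    "\<And>x. x \<in> fst c \<Longrightarrow> snd c x \<in> chart_img c" "\<And>x. x \<in> fst c \<Longrightarrow> chart_inv c (snd c x) = x"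
    "\<And>v. v \<in> chart_img c \<Longrightarrow> chart_inv c v \<in> fst c" "\<And>v. v \<in> chart_img c \<Longrightarrow> snd c (chart_inv c v) = v"
  using assms by (auto simp: is_chart_def homeomorphism_def)

lemma partition_facts:
  assumes "k < N"
  shows "smooth_fun atl (\<psi> k)" "0 \<le> \<psi> k x" "\<psi> k x \<le> 1" "closure {x. \<psi> k x \<noteq> 0} \<subseteq> par k ` B k"
proof -
  have *: "\<And>k. k < N \<Longrightarrow> smooth_fun atl (\<psi> k) \<and> (\<forall>x. 0 \<le> \<psi> k x) \<and> closure {x. \<psi> k x \<noteq> 0} \<subseteq> par k ` B k"
    and s: "(\<Sum>k<N. \<psi> k x) = 1"
    using partition by (auto simp: partition_of_unity_def subunit_cube_eq)
  then show "smooth_fun atl (\<psi> k)" "0 \<le> \<psi> k x" "closure {x. \<psi> k x \<noteq> 0} \<subseteq> par k ` B k" using assms by auto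
  have "\<psi> k x \<le> (\<Sum>k<N. \<psi> k x)" using * assms by (intro member_le_sum) auto
  then show "\<psi> k x \<le> 1" using s by simp
qed

lemma smooth_fun_continuous:
  fixes u :: "'m \<Rightarrow> real"
  assumes u: "smooth_fun atl u" shows "continuous_on UNIV u"
proof -
  have "continuous_on (\<Union>c\<in>atl. fst c) u"
  proof (rule continuous_on_open_UN)
    fix c assume c: "c \<in> atl"
    note f = is_chart_facts[OF atlas(1)[OF c]]
    show "open (fst c)" by (rule f(1))
    have "continuous_on (chart_img c) (u \<circ> chart_inv c)"
      using u c by (intro smooth_on_continuous) (simp add: smooth_fun_def)
    then have "continuous_on (fst c) ((u \<circ> chart_inv c) \<circ> snd c)"
      by (rule continuous_on_compose[OF f(3) continuous_on_subset]) (use f(5) in auto)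
    then show "continuous_on (fst c) u"
      by (rule continuous_on_eq) (simp add: f(6))
  qed
  then show ?thesis by (simp add: atlas(2))
qed

text \<open>Near w the function is a composition of \<open>\<Phi> i\<close>, a change of charts and
  the expression of \<open>u\<close> in a chart of the atlas; each factor is smooth, hence locally
  Lipschitz.\<close>

lemma smooth_fun_lipschitz_near:
  fixes u :: "'m \<Rightarrow> real"
  assumes u: "smooth_fun atl u" and w: "w \<in> B i" shows "lipschitz_near (u \<circ> par i) w"
proof -
  obtain c where c: "c \<in> atl" "par i w \<in> fst c" using atlas(2) by blast
  note f = is_chart_facts[OF atlas(1)[OF c(1)]]
  define e where "e = nc (idx i)"
  have em: "e \<in> max_atlas atl" unfolding e_def by (rule normal_charts(1)[OF cube_facts(1)])
  then have "is_chart e" by (simp add: max_atlas_def)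
  note fe = is_chart_facts[OF this]
  have pe: "par i v \<in> fst e" "snd e (par i v) = \<Phi> i v" if "v \<in> B i" for v
    using par_in_chart[OF that] by (simp_all add: e_def)
  let ?S = "B i \<inter> par i -` fst c"
  have S: "open ?S" "w \<in> ?S"
    using continuous_on_open_vimage[OF open_centered_box, of "Len i" "par i"] par_continuous f(1) c(2) w
    by (auto simp: Int_commute)
  let ?T = "snd e ` (fst e \<inter> fst c)"
  have sm: "smooth_on ?T (snd c \<circ> chart_inv e)"
    using em c(1) by (simp add: max_atlas_def compatible_def)
  have "?T = chart_img e \<inter> chart_inv e -` fst c"
  proof
    show "?T \<subseteq> chart_img e \<inter> chart_inv e -` fst c" using fe(5,6) by auto
    show "chart_img e \<inter> chart_inv e -` fst c \<subseteq> ?T"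
    proof
      fix v assume "v \<in> chart_img e \<inter> chart_inv e -` fst c"
      then have "chart_inv e v \<in> fst e \<inter> fst c" "v = snd e (chart_inv e v)" using fe(7,8) by auto
      then show "v \<in> ?T" by blast
    qed
  qed
  then have T: "open ?T"
    using continuous_on_open_vimage[OF fe(2)] fe(4) f(1) by (metis Int_commute)
  have eq: "(u \<circ> par i) v = ((u \<circ> chart_inv c) \<circ> ((snd c \<circ> chart_inv e) \<circ> \<Phi> i)) v" if "v \<in> ?S" for v
  proof -
    have "chart_inv e (\<Phi> i v) = par i v" using pe[of v] fe(6)[of "par i v"] that by simp
    then show ?thesis using that f(6) by simp
  qed
  show ?thesis
  proof (rule lipschitz_near_cong[OF S eq])
    show "lipschitz_near ((u \<circ> chart_inv c) \<circ> ((snd c \<circ> chart_inv e) \<circ> \<Phi> i)) w"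
    proof (intro lipschitz_near_comp)
      show "lipschitz_near (\<Phi> i) w" by (rule lipschitz_near_smooth[OF cube_facts(4) open_centered_box w])
      have "\<Phi> i w \<in> ?T" using pe[OF w] c(2) by (metis IntI image_eqI)
      then show "lipschitz_near (snd c \<circ> chart_inv e) (\<Phi> i w)" by (rule lipschitz_near_smooth[OF sm T])
      have "chart_inv e (\<Phi> i w) = par i w" using pe[OF w] fe(6)[of "par i w"] by simp
      then have 1: "((snd c \<circ> chart_inv e) \<circ> \<Phi> i) w = snd c (par i w)" by simp
      have "smooth_on (chart_img c) (u \<circ> chart_inv c)" using u c(1) by (simp add: smooth_fun_def)
      then show "lipschitz_near (u \<circ> chart_inv c) (((snd c \<circ> chart_inv e) \<circ> \<Phi> i) w)"
        unfolding 1 by (rule lipschitz_near_smooth[OF _ f(2) f(5)[OF c(2)]])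
    qed
  qed
qed

text \<open>The manifold is compact and \<open>par i\<close> is a homeomorphism onto its image, so
  equality would make a nonempty open box compact.\<close>

lemma dilated_cube_not_UNIV: "par i ` B i \<noteq> UNIV"
proof
  assume eq: "par i ` B i = UNIV"
  have "continuous_on (par i ` B i) (inv_into (B i) (par i))"
  proof (rule continuous_on_inverse_open_map[OF par_continuous refl])
    show "inv_into (B i) (par i) (par i x) = x" if "x \<in> B i" for x using par_inj that by simp
    fix U assume "openin (top_of_set (B i)) U"
    then have "open U" "U \<subseteq> B i"
      using open_centered_box[of "Len i"] by (auto simp: openin_open_eq)
    then have "open (par i ` U)" by (rule par_open)
    then show "openin (top_of_set (par i ` B i)) (par i ` U)" by (simp add: eq)
  qed
  moreover have "compact (UNIV :: 'm set)" using manifold by (simp add: closed_connected_riemannian_manifold_def)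
  ultimately have "compact (inv_into (B i) (par i) ` (par i ` B i))"
    unfolding eq by (rule compact_continuous_image)
  then have "compact (B i)" using par_inj by (simp add: inv_into_image_cancel)
  then have "B i = {}" using compact_open[of "B i"] open_centered_box by blast
  moreover have "0 \<in> B i" using lengths[of i] by (auto simp: centered_box_def intro: less_trans)
  ultimately show False by simp
qed

text \<open>Some \<psi> k is nonzero at a point; if it were constant, its support would be the whole
  manifold and yet lie in a dilated cube. This function tests the gap from above.\<close>

lemma nonconstant_partition_function: "\<exists>k<N. \<exists>x y. \<psi> k x \<noteq> \<psi> k y"
proof (rule ccontr)
  assume "\<not> ?thesis"
  then have const: "\<psi> k x = \<psi> k y" if "k < N" for k x y using that by blast
  fix x0 :: 'm
  have s: "(\<Sum>k<N. \<psi> k x0) = 1" using partition by (simp add: partition_of_unity_def)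
  have "\<exists>k<N. \<psi> k x0 \<noteq> 0"
  proof (rule ccontr)
    assume "\<not> ?thesis"
    then have "(\<Sum>k<N. \<psi> k x0) = 0" by (intro sum.neutral) auto
    then show False using s by simp
  qed
  then obtain k where k: "k < N" "\<psi> k x0 \<noteq> 0" by blast
  then have "\<psi> k x \<noteq> 0" for x using const[OF k(1), of x x0] by simp
  then have "{x. \<psi> k x \<noteq> 0} = UNIV" by auto
  then have "UNIV \<subseteq> par k ` B k" using partition_facts(4)[OF k(1)] by simp
  then show False using dilated_cube_not_UNIV[of k] by blast
qed

lemma lipschitz_on_cubes:
  fixes u :: "'m \<Rightarrow> real"
  assumes u: "smooth_fun atl u" and bd: "\<And>x. 0 \<le> u x \<and> u x \<le> 1"
  shows "\<exists>K\<ge>0. \<forall>i<N. \<forall>j. \<forall>w\<in>centered_box (len i). \<forall>s. w + axis j s \<in> centered_box (len i) \<longrightarrow>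
     \<bar>u (par i (w + axis j s)) - u (par i w)\<bar> \<le> K * \<bar>s\<bar>"
proof -
  have one: "\<exists>K\<ge>0. \<forall>v\<in>centered_box (len i). \<forall>w\<in>centered_box (len i). \<bar>u (par i v) - u (par i w)\<bar> \<le> K * dist v w" for i
  proof -
    let ?C = "cbox (\<chi> j. - len i j) (\<chi> j. len i j)"
    have C: "centered_box (len i) \<subseteq> ?C" by (simp add: centered_box_eq_box box_subset_cbox)
    have CB: "?C \<subseteq> B i"
    proof
      fix w assume w: "w \<in> ?C"
      have "- Len i j < w $ j \<and> w $ j < Len i j" for j
      proof -
        have "- len i j \<le> w $ j" "w $ j \<le> len i j" using w by (auto simp: mem_box_cart)
        then show ?thesis using lengths(2)[of i j] by linarith
      qed
      then show "w \<in> B i" by (simp add: centered_box_def)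
    qed
    have "\<exists>K\<ge>0. \<forall>v\<in>?C. \<forall>w\<in>?C. \<bar>(u \<circ> par i) v - (u \<circ> par i) w\<bar> \<le> K * dist v w"
    proof (rule lipschitz_near_compact[OF compact_cbox])
      show "lipschitz_near (u \<circ> par i) w" if "w \<in> ?C" for w
        using smooth_fun_lipschitz_near[OF u] CB that by blast
    qed (simp add: bd)
    then show ?thesis using C unfolding comp_def by (meson subsetD)
  qed
  then obtain K where K: "\<And>i. 0 \<le> K i" "\<And>i v w. v \<in> centered_box (len i) \<Longrightarrow> w \<in> centered_box (len i) \<Longrightarrow>
      \<bar>u (par i v) - u (par i w)\<bar> \<le> K i * dist v w"
    by metis
  define K0 where "K0 = (\<Sum>i<N. K i)"
  have "\<bar>u (par i (w + axis j s)) - u (par i w)\<bar> \<le> K0 * \<bar>s\<bar>"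
    if i: "i < N" and w: "w \<in> centered_box (len i)" "w + axis j s \<in> centered_box (len i)" for i j w s
  proof -
    have "K i \<le> K0" unfolding K0_def using K(1) i by (intro member_le_sum) auto
    then have "K i * \<bar>s\<bar> \<le> K0 * \<bar>s\<bar>" by (rule mult_right_mono) simp
    moreover have "dist (w + axis j s) w = \<bar>s\<bar>" by (simp add: dist_norm norm_eq_sqrt_inner inner_axis_axis)
    ultimately show ?thesis using K(2)[OF w(2,1)] by simp
  qed
  moreover have "0 \<le> K0" unfolding K0_def using K(1) by (intro sum_nonneg) auto
  ultimately show ?thesis by blast
qed

lemma mixing:
  "\<exists>h0>0. flows_defined nc cs \<rho> N q dens \<tau> h0 \<and>
    (\<exists>C>0. \<forall>h\<in>{0<..h0}. \<forall>k.
       (SUP x. tv_dist (markov_kernel (S_op nc cs \<rho> N q dens \<tau> h ^^ k) x) \<mu>)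
         \<le> C * exp (- real k * spectral_gap \<mu> (S_op nc cs \<rho> N q dens \<tau> h)))"
proof -
  obtain \<Lambda> b where \<Lambda>: "1 \<le> \<Lambda>" "0 < b" and W: "\<And>h. 0 < h \<Longrightarrow> h \<le> 1 \<Longrightarrow> h \<le> 1 / \<Lambda> \<Longrightarrow> h \<le> b / \<Lambda>\<^sup>2 \<Longrightarrow>
      cube_walk \<mu> N par len Len rate dens \<Lambda> b h"
    using cube_walk_exists by blast
  obtain k0 y z where k0: "k0 < N" "\<psi> k0 y \<noteq> \<psi> k0 z" using nonconstant_partition_function by blast
  define u where "u = \<psi> k0"
  have u: "smooth_fun atl u" "\<And>x. 0 \<le> u x \<and> u x \<le> 1" "u y \<noteq> u z"
    using partition_facts[OF k0(1)] k0(2) by (auto simp: u_def)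
  obtain K where K: "0 \<le> K" "\<And>i j w s. i < N \<Longrightarrow> w \<in> centered_box (len i) \<Longrightarrow> w + axis j s \<in> centered_box (len i) \<Longrightarrow>
     \<bar>u (par i (w + axis j s)) - u (par i w)\<bar> \<le> K * \<bar>s\<bar>"
    using lipschitz_on_cubes[OF u(1,2)] by blast
  have conn: "connected (UNIV :: 'm set)" using manifold by (simp add: closed_connected_riemannian_manifold_def)
  have cont: "continuous_on UNIV u" by (rule smooth_fun_continuous[OF u(1)])
  have "u \<in> borel_measurable \<mu>"
    unfolding measurable_cong_sets[OF sets_\<mu> refl] by (rule borel_measurable_continuous_onI[OF cont])
  then have ub: "bm \<mu> u" using u(2) by (intro bmI[where B=1]) auto
  define V where "V = (LINT x|\<mu>. (u x)\<^sup>2) - (LINT x|\<mu>. u x)\<^sup>2"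
  let ?n = "CARD('n)"
  define h1 where "h1 = min 1 (min (1 / \<Lambda>) (b / \<Lambda>\<^sup>2))"
  have h1: "0 < h1" using \<Lambda> by (simp add: h1_def)
  have W1: "cube_walk \<mu> N par len Len rate dens \<Lambda> b h" if "0 < h" "h \<le> h1" for h
    using that by (intro W) (auto simp: h1_def)
  have V: "0 < V"
    unfolding V_def by (rule cube_walk.variance_pos[OF W1[OF h1 order_refl] ub cont u(3)])
  define \<delta>1 \<delta>2 where "\<delta>1 = 1 / (18 * \<Lambda> ^ 4 * (real N * real ?n))"
    and "\<delta>2 = 1 / real N * (1 / (real N * real ?n)) ^ ?n * (1 / (2 * \<Lambda>\<^sup>2)) ^ ?n"
  \<comment> \<open>1/2 secures \<delta> < 1; \<delta>1 is the distance of the spectrum from -1 and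
    \<delta>2 the mass of \<open>smoothing\<close>.\<close>
  define \<delta> where "\<delta> = min (1 / 2) (min \<delta>1 \<delta>2)"
  have n: "0 < real ?n" by simp
  have \<delta>p: "0 < \<delta>1" "0 < \<delta>2" using N_pos \<Lambda>(1) n unfolding \<delta>1_def \<delta>2_def by (auto intro!: mult_pos_pos divide_pos_pos)
  have \<delta>: "0 < \<delta>" "\<delta> < 1" "\<delta> \<le> \<delta>1" "\<delta> \<le> \<delta>2" using \<delta>p by (auto simp: \<delta>_def)
  define C1 where "C1 = real N * \<Lambda> * (4 ^ Suc ?n * real ?n * \<Lambda> ^ 5 * (real N * real ?n) + 2 * (2 * \<Lambda>\<^sup>2) ^ ?n * \<Lambda>\<^sup>2)"
  define C0 where "C0 = \<Lambda> * (\<Lambda>\<^sup>2 / 2) ^ ?n"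
  \<comment> \<open>The summand 1 makes \<open>Cg\<close> positive even if K = 0; the locale is
    entered again below with this larger constant.\<close>
  define Cg where "Cg = (K * \<Lambda>\<^sup>2)\<^sup>2 / V + 1"
  have C1: "0 < C1" unfolding C1_def using N_pos \<Lambda>(1) n by (intro mult_pos_pos add_pos_pos) auto
  have C0: "0 \<le> C0" using \<Lambda>(1) by (simp add: C0_def)
  have Cg: "0 < Cg" using V by (simp add: Cg_def add_nonneg_pos)
  obtain h2 C where h2: "0 < h2" and C: "0 < C" and mix: "\<And>h (M :: 'm measure) S U g k X x. h \<in> {0<..h2} \<Longrightarrow>
      regularizing_walk M S \<delta> U ?n ?n h C1 C0 Cg g \<Longrightarrow> X \<in> sets M \<Longrightarrow>
      \<bar>(S ^^ k) (indicat_real X) x - measure M X\<bar> \<le> C * exp (- real k * g)"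
    using regularizing_walk_mixing[OF \<delta>(1) C1 C0 Cg, of ?n ?n] by (metis zero_less_card_finite)
  define h0 where "h0 = min h1 h2"
  have h0: "0 < h0" using h1 h2 by (simp add: h0_def)
  have "(SUP x. tv_dist (markov_kernel (S_op nc cs \<rho> N q dens \<tau> h ^^ k) x) \<mu>)
         \<le> C * exp (- real k * spectral_gap \<mu> (S_op nc cs \<rho> N q dens \<tau> h))" if h: "h \<in> {0<..h0}" for h k
  proof -
    have Wh: "cube_walk \<mu> N par len Len rate dens \<Lambda> b h" using h by (intro W1) (auto simp: h0_def)
    then interpret W: cube_walk \<mu> N par len Len rate dens \<Lambda> b h .
    have "regularizing_walk \<mu> W.walk \<delta> W.smoothing ?n ?n h C1 C0 ((K * \<Lambda>\<^sup>2)\<^sup>2 / V) (Sup W.gap_bounds)"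
      unfolding C1_def C0_def V_def
      by (rule W.regularizing[OF conn ub V[unfolded V_def] K(1) K(2) \<delta>(1,2) \<delta>(3)[unfolded \<delta>1_def] \<delta>(4)[unfolded \<delta>2_def]])
    then interpret R: regularizing_walk \<mu> W.walk \<delta> W.smoothing ?n ?n h C1 C0 "(K * \<Lambda>\<^sup>2)\<^sup>2 / V" "Sup W.gap_bounds" .
    have "regularizing_walk \<mu> W.walk \<delta> W.smoothing ?n ?n h C1 C0 Cg (Sup W.gap_bounds)"
    proof (unfold_locales, fact R.h, fact R.h)
      show "Sup W.gap_bounds \<le> Cg * h\<^sup>2"
        using R.gap_le by (rule order_trans) (simp add: Cg_def distrib_right)
    qed (use R.n R.nash R.U R.U_one R.U_le R.U_dom R.gap_pos R.gap in auto)
    note bound = mix[OF _ this]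
    show ?thesis
    proof (rule cSUP_least)
      fix x
      show "tv_dist (markov_kernel (S_op nc cs \<rho> N q dens \<tau> h ^^ k) x) \<mu>
          \<le> C * exp (- real k * spectral_gap \<mu> (S_op nc cs \<rho> N q dens \<tau> h))"
        unfolding spectral_gap_eq[OF Wh]
        by (rule markov_kernel_bound[OF Wh]) (rule bound, use h in \<open>auto simp: h0_def\<close>)
    qed simp
  qed
  moreover have "flows_defined nc cs \<rho> N q dens \<tau> h0"
    using flows_defined[OF W1[of h0]] h0 by (simp add: h0_def)
  ultimately show ?thesis using h0 C by blast
qed

end

theorem theorem1p4:
  fixes atl :: "('m::{t2_space, second_countable_topology}, 'n::{finite, linorder}) chart set"
    and g :: "('m, 'n) metric_tensor"
    and A :: "('m \<Rightarrow> complex) \<Rightarrow> ('m \<Rightarrow> complex)"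
    and \<epsilon> :: real
    and L :: nat and p :: "nat \<Rightarrow> 'm" and r :: "nat \<Rightarrow> real" and nc :: "nat \<Rightarrow> ('m, 'n) chart"
    and a :: "nat \<Rightarrow> 'n matrix_field"
    and cs K \<rho>0 \<rho> :: real
    and cube :: "real \<Rightarrow> 'm \<Rightarrow> 'n cube"
    and N :: nat and xs :: "nat \<Rightarrow> 'm" and q :: "nat \<Rightarrow> 'n cube"
    and \<psi> :: "nat \<Rightarrow> 'm \<Rightarrow> real"
    and \<mu> :: "'m measure"
    and dens :: "nat \<Rightarrow> (real, 'n) vec \<Rightarrow> real"
    and \<tau> :: "nat \<Rightarrow> 'n \<Rightarrow> real"
  assumes manifold: "closed_connected_riemannian_manifold atl g"
    and operator: "standing_assumptions atl g A \<epsilon>"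
    and cover: "geodesic_ball_cover atl g L p r nc"
    and local_coefficients: "\<And>l. l < L \<Longrightarrow> \<exists>b d. local_expression atl A (nc l) (a l) b d"
    and cubes: "cube_family atl g \<epsilon> L p r nc a cs K \<rho>0 cube"
    and rho: "0 < \<rho>" "\<rho> \<le> \<rho>0"
    and q_def: "\<And>i. q i = cube \<rho> (xs i)"
    and cubes_cover: "(\<Union>i<N. subunit_cube nc (q i) \<rho>) = UNIV"
    and partition: "partition_of_unity atl N (\<lambda>k. subunit_cube nc (q k) (cs * \<rho>)) \<psi>"
    and mu_def: "\<mu> = mu nc cs \<rho> N q \<psi>"
    and densities: "cube_densities nc cs \<rho> N q \<mu> dens"
    and rescaling: "\<And>i j. i < N \<Longrightarrow> 0 < \<tau> i j"
  shows "\<exists>h0>0. flows_defined nc cs \<rho> N q dens \<tau> h0 \<and>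
    (\<exists>C>0. \<forall>h\<in>{0<..h0}. \<forall>k.
       (SUP x. tv_dist (markov_kernel (S_op nc cs \<rho> N q dens \<tau> h ^^ k) x) \<mu>)
         \<le> C * exp (- real k * spectral_gap \<mu> (S_op nc cs \<rho> N q dens \<tau> h)))"
proof -
  interpret cube_setting atl g \<epsilon> L p r nc a cs K \<rho>0 \<rho> cube N xs q \<psi> \<mu> dens \<tau>
    by (rule cube_setting.intro[OF manifold cover cubes rho q_def cubes_cover partition mu_def densities rescaling])
  show ?thesis by (rule mixing)
qed

end
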